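(* For $j\in\{1,2\}$ let $M_j$ be a smooth manifold, let $E_r^j\to M_j$, $E_{p_i}^j\to M_j$, $E_{p_e}^j\to M_j$ be smooth vector bundles, let $\mathcal{D}_j\leq \big(\mathcal{T}M_j\oplus E_r^j\oplus E_{p_i}^j\oplus E_{p_e}^j\big)\oplus\big(\mathcal{T}^*M_j\oplus (E_r^j)^*\oplus (E_{p_i}^j)^*\oplus (E_{p_e}^j)^*\big)$ be a Dirac structure, let $\mathcal{R}_j\leq E_r^j\oplus (E_r^j)^*$ be a non-negative Lagrangian subbundle and let $H_j\in\mathcal{C}^\infty(M_j)$. Let $\mathcal{D}_{\mathrm{int}}\leq \big(E_{p_e}^1\times E_{p_e}^2\big)\oplus\big((E_{p_e}^1)^*\times (E_{p_e}^2)^*\big)$ be a Dirac structure over $M_1\times M_2$ which is an admissible interconnection constraint for $(\mathcal{D}_1,\mathcal{D}_2)$. Let $\mathfrak{t}\in\{\mathrm{c},\mathrm{w}\}$. Then, for all real $t_0<t_1$, $$\big(\mathfrak{B}^{\mathfrak{t}}_{\mathcal{D}_1,\mathcal{R}_1,H_1}\Vert_{\mathcal{D}_{\mathrm{int}}}\mathfrak{B}^{\mathfrak{t}}_{\mathcal{D}_2,\mathcal{R}_2,H_2}\big)([t_0,t_1])\subseteq\mathfrak{B}^{\mathfrak{t}}_{\mathcal{D}_1\Vert_{\mathcal{D}_{\mathrm{int}}}\mathcal{D}_2,\ \mathcal{R}_1\boxplus\mathcal{R}_2,\ H_1+H_2}([t_0,t_1]).$$ Equality does not hold in general: for each $\mathfrak{t}\in\{\mathrm{c},\mathrm{w}\}$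 there exist, for $j\in\{1,2\}$, smooth manifolds $M_j$, smooth vector bundles $E_r^j\to M_j$, $E_{p_i}^j\to M_j$, $E_{p_e}^j\to M_j$, Dirac structures $\mathcal{D}_j\leq \big(\mathcal{T}M_j\oplus E_r^j\oplus E_{p_i}^j\oplus E_{p_e}^j\big)\oplus\big(\mathcal{T}^*M_j\oplus (E_r^j)^*\oplus (E_{p_i}^j)^*\oplus (E_{p_e}^j)^*\big)$, non-negative Lagrangian subbundles $\mathcal{R}_j\leq E_r^j\oplus (E_r^j)^*$ and functions $H_j\in\mathcal{C}^\infty(M_j)$, together with a Dirac structure $\mathcal{D}_{\mathrm{int}}\leq \big(E_{p_e}^1\times E_{p_e}^2\big)\oplus\big((E_{p_e}^1)^*\times (E_{p_e}^2)^*\big)$ over $M_1\times M_2$ which is an admissible interconnection constraint for $(\mathcal{D}_1,\mathcal{D}_2)$, and some real $t_0<t_1$, for which the inclusion $$\big(\mathfrak{B}^{\mathfrak{t}}_{\mathcal{D}_1,\mathcal{R}_1,H_1}\Vert_{\mathcal{D}_{\mathrm{int}}}\mathfrak{B}^{\mathfrak{t}}_{\mathcal{D}_2,\mathcal{R}_2,H_2}\big)([t_0,t_1])\subseteq\mathfrak{B}^{\mathfrak{t}}_{\mathcal{D}_1\Vert_{\mathcal{D}_{\mathrm{int}}}\mathcal{D}_2,\ \mathcal{R}_1\boxplus\mathcal{R}_2,\ H_1+H_2}([t_0,t_1])$$ is proper.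
   Context: All manifolds and vector bundles are smooth and of finite dimension/rank; rank-zero bundles are allowed. \textbf{Geometry.} For a vector bundle $E\to M$, $E\oplus E^*$ carries fibrewise the forms $\langle\langle (f,e),(f',e')\rangle\rangle=\langle e',f\rangle+\langle e,f'\rangle$ and $\Omega((f,e),(f',e'))=\langle e',f\rangle-\langle e,f'\rangle$. A Dirac structure (Lagrangian subbundle) is a smooth subvector bundle of $E\oplus E^*$ of rank $\mathrm{rk}\,E$ that is isotropic with respect to $\langle\langle\cdot,\cdot\rangle\rangle$ (respectively $\Omega$). A subbundle is non-negative if $\langle\langle\cdot,\cdot\rangle\rangle$ restricted to it is positive semidefinite. For bundles $A\to M_1$, $B\to M_2$, $A\times B\to M_1\times M_2$ is the product bundle, with fibre $A_{x_1}\oplus B_{x_2}$ at $(x_1,x_2)$; $\mathcal{R}_1\boxplus\mathcal{R}_2$ is the bundle over $M_1\times M_2$ of all $(f_1,f_2,e_1,e_2)$ with $(f_j,e_j)\in(\mathcal{R}_j)_{x_j}$. \textbf{Function spaces.} The shadow of a curve in (the total space of) a vector bundle is its composition with the bundle projection. For a compact interval $I=[t_0,t_1]$ and a manifold $N$, $\mathcal{C}^k(I,N)$ is the set of continuous curves $I\to N$ that extend to a $\mathcal{C}^k$ curve on an open interval containing $I$. For a vector bundle $E\to M$, $\mathcal{L}^1_c(I,E)$ is the set of measurable curves $\xi:I\to E$ with continuous shadow such that $\sqrt{g(\xi,\xi)}$ is integrable for some (equivalently every) vector bundle metric $g$. A continuous curve $x:I\to M$ is weakly differentiable with weak derivative $X:I\to\mathcal{T}M$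 (a curve over $x$) if for every chart $\varphi_U:U\to\mathbb{R}^n$ of an atlas, $\varphi_U\circ x$ is weakly differentiable on $x^{-1}(U)\cap(t_0,t_1)$ with weak derivative $\mathrm{d}\varphi_U X$; $(\mathcal{C}\cap W^{1,1})(I,M)$ is the set of such $x$ having a weak derivative in $\mathcal{L}^1_c(I,\mathcal{T}M)$; this weak derivative is denoted $\tfrac{\mathrm{d}}{\mathrm{d}t}x$. \textbf{Weak sense.} Let $(f,e)\in\mathcal{L}^1_c(I,E\oplus E^* )$ have shadow $x$. For a Dirac structure $\mathcal{D}\le E\oplus E^*$, $(f,e)\in\mathcal{D}$ in the weak sense means $\int_I\langle\varepsilon(t),f(t)\rangle+\langle e(t),\varphi(t)\rangle\,\mathrm{d}t=0$ for all continuous sections $(\varphi,\varepsilon)$ of $x^*\mathcal{D}$ with compact support in $(t_0,t_1)$. For a Lagrangian subbundle, the same with $+$ replaced by $-$. \textbf{Behaviours.} Let $E_r,E_p\to M$ be vector bundles, $\mathcal{D}\le(\mathcal{T}M\oplus E_r\oplus E_p)\oplus(\mathcal{T}^*M\oplus E_r^*\oplus E_p^* )$ a Dirac structure, $\mathcal{R}\le E_r\oplus E_r^*$ a non-negative Lagrangian subbundle, $H\in\mathcal{C}^\infty(M)$. The port-Hamiltonian system is $$\big(\tfrac{\mathrm{d}}{\mathrm{d}t}x,f,-y,\mathrm{d}H_x,e,u\big)\in\mathcal{D}_x,\qquad(f,e)\in\mathcal{R}_x.\qquad( * )$$ The classical behaviour $\mathfrak{B}^{\mathrm{c}}_{\mathcal{D},\mathcal{R},H}(I)$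 is the set of continuous curves $(f,y,e,u):I\to E_r\oplus E_p\oplus E_r^*\oplus E_p^*$ whose shadow $x$ is in $\mathcal{C}^1(I,M)$ and for which $( * )$ holds at every point of $I$. The weak behaviour $\mathfrak{B}^{\mathrm{w}}_{\mathcal{D},\mathcal{R},H}(I)$ is the set of $(f,y,e,u)\in\mathcal{L}^1_c(I,E_r\oplus E_p\oplus E_r^*\oplus E_p^* )$ whose shadow $x$ is in $(\mathcal{C}\cap W^{1,1})(I,M)$ and for which both relations in $( * )$ hold in the weak sense. \textbf{Interconnection.} $\mathcal{D}_1\Vert_{\mathcal{D}_{\mathrm{int}}}\mathcal{D}_2$ has as fibre over $(x_1,x_2)\in M_1\times M_2$ the set of all $(v_1,v_2,f_1,f_2,\eta_1,\eta_2,\alpha_1,\alpha_2,e_1,e_2,u_1,u_2)$ for which there is $(\zeta_1,\zeta_2,w_1,w_2)\in(\mathcal{D}_{\mathrm{int}})_{(x_1,x_2)}$ with $(v_j,f_j,\eta_j,\zeta_j,\alpha_j,e_j,u_j,w_j)\in(\mathcal{D}_j)_{x_j}$ for $j=1,2$. Each fibre is a (linear) Dirac structure; $\mathcal{D}_{\mathrm{int}}$ is an admissible interconnection constraint for $(\mathcal{D}_1,\mathcal{D}_2)$ if $\mathcal{D}_1\Vert_{\mathcal{D}_{\mathrm{int}}}\mathcal{D}_2$ is a smooth subvector bundle. $\mathfrak{B}^{\mathfrak{t}}_{\mathcal{D}_1\Vert_{\mathcal{D}_{\mathrm{int}}}\mathcal{D}_2,\mathcal{R}_1\boxplus\mathcal{R}_2,H_1+H_2}$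 is the behaviour over $M_1\times M_2$ with resistive bundle $E_r^1\times E_r^2$, external port bundle $E_{p_i}^1\times E_{p_i}^2$ and Hamiltonian $(x_1,x_2)\mapsto H_1(x_1)+H_2(x_2)$. In $\mathfrak{B}^{\mathfrak{t}}_{\mathcal{D}_j,\mathcal{R}_j,H_j}$ the external port bundle is $E_p=E_{p_i}^j\oplus E_{p_e}^j$. The behavioural interconnection $\big(\mathfrak{B}^{\mathfrak{t}}_{\mathcal{D}_1,\mathcal{R}_1,H_1}\Vert_{\mathcal{D}_{\mathrm{int}}}\mathfrak{B}^{\mathfrak{t}}_{\mathcal{D}_2,\mathcal{R}_2,H_2}\big)(I)$ is the set of curves $(f_1,f_2,y_1^1,y_2^1,e_1,e_2,u_1^1,u_2^1)$ on $I$ with values in $(E_r^1\times E_r^2)\oplus(E_{p_i}^1\times E_{p_i}^2)\oplus(E_r^1\times E_r^2)^*\oplus(E_{p_i}^1\times E_{p_i}^2)^*$ for which there exists a curve $(y_1^2,y_2^2,u_1^2,u_2^2):I\to\mathcal{D}_{\mathrm{int}}$ (over the same base curve) with $(f_j,y_j^1,-y_j^2,e_j,u_j^1,u_j^2)\in\mathfrak{B}^{\mathfrak{t}}_{\mathcal{D}_j,\mathcal{R}_j,H_j}(I)$ for $j=1,2$. *)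

theory Defs
  imports "HOL-Analysis.Analysis" "HOL-Library.Function_Algebras"
begin

section \<open>Real-valued functions as a vector space\<close>

text \<open>Tangent vectors are functionals on functions and covectors are functionals on a fibre; both
  are added and scaled pointwise.\<close>

instantiation "fun" :: (type, real_vector) real_vector
begin

definition scaleR_fun_def: "scaleR c f = (\<lambda>x. c *\<^sub>R f x)"

instance
  by standard (auto simp: scaleR_fun_def plus_fun_def fun_eq_iff scaleR_add_right scaleR_add_left)

end


section \<open>Smooth manifolds\<close>

text \<open>\<open>\<real>\<^sup>n\<close> is the library's \<^const>\<open>Euclidean_space\<close> \<open>n\<close>: the sequences that vanish from index
  \<open>n\<close> on, with the product topology. This keeps the dimension a number, which may be \<open>0\<close>.\<close>

definition partial :: "nat \<Rightarrow> ((nat \<Rightarrow> real) \<Rightarrow> real) \<Rightarrow> (nat \<Rightarrow> real) \<Rightarrow> real" where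
  "partial i f z = deriv (\<lambda>s. f (z(i := s))) (z i)"

text \<open>\<open>Ck k n W f\<close>: all partial derivatives of \<open>f\<close> of order up to \<open>k\<close> exist and are continuous on
  \<open>W\<close>. It is used for \<open>W\<close> open in \<open>\<real>\<^sup>n\<close> only, so values of \<open>f\<close> off \<open>W\<close> do not matter.\<close>

primrec Ck :: "nat \<Rightarrow> nat \<Rightarrow> (nat \<Rightarrow> real) set \<Rightarrow> ((nat \<Rightarrow> real) \<Rightarrow> real) \<Rightarrow> bool" where
  "Ck 0 n W f \<longleftrightarrow> continuous_map (subtopology (Euclidean_space n) W) euclideanreal f"
| "Ck (Suc k) n W f \<longleftrightarrow>
     continuous_map (subtopology (Euclidean_space n) W) euclideanreal f \<and>
     (\<forall>i<n. (\<forall>z\<in>W. (\<lambda>s. f (z(i := s))) field_differentiable at (z i)) \<and> Ck k n W (partial i f))"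

type_synonym 'm chart = "'m set \<times> ('m \<Rightarrow> nat \<Rightarrow> real)"

record 'm manifold =
  mtop :: "'m topology"
  mdim :: nat
  charts :: "'m chart set"

abbreviation points :: "'m manifold \<Rightarrow> 'm set" where
  "points M \<equiv> topspace (mtop M)"

definition smooth_fun :: "'m manifold \<Rightarrow> 'm set \<Rightarrow> ('m \<Rightarrow> real) \<Rightarrow> bool" where
  "smooth_fun M U h \<longleftrightarrow>
     (\<forall>(V, \<phi>) \<in> charts M. \<forall>k. Ck k (mdim M) (\<phi> ` (U \<inter> V)) (h \<circ> inv_into V \<phi>))"

definition smooth_near :: "'m manifold \<Rightarrow> 'm \<Rightarrow> ('m \<Rightarrow> real) \<Rightarrow> bool" where
  "smooth_near M p h \<longleftrightarrow> (\<exists>U. openin (mtop M) U \<and> p \<in> U \<and> smooth_fun M U h)"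

text \<open>The last conjunct says that the coordinate functions of every chart are smooth when expressed
  in every other chart, i.e. that the transition maps are smooth. The atlas need not be maximal.\<close>

definition smooth_manifold :: "'m manifold \<Rightarrow> bool" where
  "smooth_manifold M \<longleftrightarrow>
     Hausdorff_space (mtop M) \<and> second_countable (mtop M) \<and>
     \<Union> (fst ` charts M) = points M \<and>
     (\<forall>(U, \<phi>) \<in> charts M.
        openin (mtop M) U \<and> openin (Euclidean_space (mdim M)) (\<phi> ` U) \<and>
        homeomorphic_map (subtopology (mtop M) U) (subtopology (Euclidean_space (mdim M)) (\<phi> ` U)) \<phi> \<and>
        (\<forall>i<mdim M. smooth_fun M U (\<lambda>p. \<phi> p i)))"

definition prod_manifold :: "'m manifold \<Rightarrow> 'n manifold \<Rightarrow> ('m \<times> 'n) manifold" where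
  "prod_manifold M N =
     \<lparr> mtop = prod_topology (mtop M) (mtop N),
       mdim = mdim M + mdim N,
       charts = {(U \<times> V, \<lambda>(p, q) i. if i < mdim M then \<phi> p i else \<psi> q (i - mdim M)) | U \<phi> V \<psi>.
                   (U, \<phi>) \<in> charts M \<and> (V, \<psi>) \<in> charts N} \<rparr>"


section \<open>Vector bundles\<close>

text \<open>The smooth structure of a bundle over \<open>M\<close> is given by a family of local frames
  \<open>(U, b)\<close>: for \<open>p \<in> U\<close> the vectors \<open>b 0 p, \<dots>, b (rk E - 1) p\<close> form a basis of the fibre \<open>fib E p\<close>.
  Local frames and local trivialisations are the same thing. Fibres are linear subspaces of an
  ambient vector space, different fibres being unrelated.\<close>

record ('m, 'v) vbundle =
  fib :: "'m \<Rightarrow> 'v set"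
  rk :: nat
  frames :: "('m set \<times> (nat \<Rightarrow> 'm \<Rightarrow> 'v)) set"

definition basis_of :: "nat \<Rightarrow> (nat \<Rightarrow> 'v::real_vector) \<Rightarrow> 'v set \<Rightarrow> bool" where
  "basis_of k b V \<longleftrightarrow> inj_on b {..<k} \<and> independent (b ` {..<k}) \<and> span (b ` {..<k}) = V"

definition smooth_section ::
    "'m manifold \<Rightarrow> ('m, 'v::real_vector) vbundle \<Rightarrow> 'm set \<Rightarrow> ('m \<Rightarrow> 'v) \<Rightarrow> bool" where
  "smooth_section M E U s \<longleftrightarrow>
     (\<forall>(V, b) \<in> frames E. \<exists>c :: nat \<Rightarrow> 'm \<Rightarrow> real.
        (\<forall>i<rk E. smooth_fun M (U \<inter> V) (c i)) \<and>
        (\<forall>p \<in> U \<inter> V. s p = (\<Sum>i<rk E. c i p *\<^sub>R b i p)))"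

text \<open>The smoothness of the frames as sections says that frame changes are smooth.\<close>

definition vector_bundle :: "'m manifold \<Rightarrow> ('m, 'v::real_vector) vbundle \<Rightarrow> bool" where
  "vector_bundle M E \<longleftrightarrow>
     \<Union> (fst ` frames E) = points M \<and>
     (\<forall>(U, b) \<in> frames E.
        openin (mtop M) U \<and>
        (\<forall>p\<in>U. basis_of (rk E) (\<lambda>i. b i p) (fib E p)) \<and>
        (\<forall>i<rk E. smooth_section M E U (b i)))"

text \<open>Topology of the total space \<open>{(p, v). p \<in> M \<and> v \<in> fib E p}\<close>, generated by the images of the open
  sets of \<open>U \<times> \<real>\<^sup>r\<close> under the local trivialisations.\<close>

definition total_top :: "'m manifold \<Rightarrow> ('m, 'v::real_vector) vbundle \<Rightarrow> ('m \<times> 'v) topology" where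
  "total_top M E = topology_generated_by
     {(\<lambda>(p, c). (p, \<Sum>i<rk E. c i *\<^sub>R b i p)) ` W | U b W. (U, b) \<in> frames E \<and>
        openin (prod_topology (subtopology (mtop M) U) (Euclidean_space (rk E))) W}"

definition dsum_bundle ::
    "('m, 'v::real_vector) vbundle \<Rightarrow> ('m, 'w::real_vector) vbundle \<Rightarrow> ('m, 'v \<times> 'w) vbundle"
    (infixr "\<oplus>\<^sub>b" 65) where
  "E \<oplus>\<^sub>b F =
     \<lparr> fib = (\<lambda>p. fib E p \<times> fib F p),
       rk = rk E + rk F,
       frames = {(U \<inter> V, \<lambda>i p. if i < rk E then (b i p, 0) else (0, c (i - rk E) p)) | U b V c.
                   (U, b) \<in> frames E \<and> (V, c) \<in> frames F} \<rparr>"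

definition prod_bundle ::
    "('m, 'v::real_vector) vbundle \<Rightarrow> ('n, 'w::real_vector) vbundle \<Rightarrow> ('m \<times> 'n, 'v \<times> 'w) vbundle"
    (infixr "\<times>\<^sub>b" 65) where
  "E \<times>\<^sub>b F =
     \<lparr> fib = (\<lambda>(p, q). fib E p \<times> fib F q),
       rk = rk E + rk F,
       frames = {(U \<times> V, \<lambda>i (p, q). if i < rk E then (b i p, 0) else (0, c (i - rk E) q)) | U b V c.
                   (U, b) \<in> frames E \<and> (V, c) \<in> frames F} \<rparr>"

text \<open>A covector at \<open>p\<close> is a linear functional on the fibre, set to \<open>0\<close> off the fibre so that it is
  determined by its values on the fibre. The dual frame consists of the coordinate functionals;
  \<^const>\<open>representation\<close> is \<open>0\<close> off the span as well.\<close>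

definition dual_bundle :: "('m, 'v::real_vector) vbundle \<Rightarrow> ('m, 'v \<Rightarrow> real) vbundle" where
  "dual_bundle E =
     \<lparr> fib = (\<lambda>p. {e. (\<forall>v\<in>fib E p. \<forall>w\<in>fib E p. \<forall>a b. e (a *\<^sub>R v + b *\<^sub>R w) = a * e v + b * e w) \<and>
                       (\<forall>v. v \<notin> fib E p \<longrightarrow> e v = 0)}),
       rk = rk E,
       frames = {(U, \<lambda>i p v. representation ((\<lambda>j. b j p) ` {..<rk E}) v (b i p)) | U b.
                   (U, b) \<in> frames E} \<rparr>"

definition bundle_metric ::
    "'m manifold \<Rightarrow> ('m, 'v::real_vector) vbundle \<Rightarrow> ('m \<Rightarrow> 'v \<Rightarrow> 'v \<Rightarrow> real) \<Rightarrow> bool" where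
  "bundle_metric M E g \<longleftrightarrow>
     (\<forall>p\<in>points M. \<forall>u\<in>fib E p. \<forall>v\<in>fib E p.
        g p u v = g p v u \<and> (u \<noteq> 0 \<longrightarrow> g p u u > 0) \<and>
        (\<forall>w\<in>fib E p. \<forall>a b. g p (a *\<^sub>R u + b *\<^sub>R v) w = a * g p u w + b * g p v w)) \<and>
     (\<forall>(U, b) \<in> frames E. \<forall>i<rk E. \<forall>j<rk E. smooth_fun M U (\<lambda>p. g p (b i p) (b j p)))"

text \<open>\<open>D\<close> is given by its fibres.\<close>

definition smooth_subbundle ::
    "'m manifold \<Rightarrow> ('m, 'v::real_vector) vbundle \<Rightarrow> nat \<Rightarrow> ('m \<Rightarrow> 'v set) \<Rightarrow> bool" where
  "smooth_subbundle M E k D \<longleftrightarrow>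
     (\<forall>p\<in>points M. \<exists>U s. openin (mtop M) U \<and> p \<in> U \<and>
        (\<forall>i<k. smooth_section M E U (s i)) \<and>
        (\<forall>q\<in>U. basis_of k (\<lambda>i. s i q) (D q)))"

text \<open>A bundle \<open>E\<close> together with a model of \<open>E\<^sup>*\<close> and the evaluation pairing. For a single bundle the
  model is \<^const>\<open>dual_bundle\<close>; for direct sums and products it is \<open>E\<^sup>* \<oplus> F\<^sup>*\<close> and \<open>E\<^sup>* \<times> F\<^sup>*\<close>, with
  \<open>\<langle>(e, e'), (f, f')\<rangle> = \<langle>e, f\<rangle> + \<langle>e', f'\<rangle>\<close>. Only objects built by the three constructors below are
  used.\<close>

record ('m, 'v, 'w) dual_pair =
  primal :: "('m, 'v) vbundle"
  codual :: "('m, 'w) vbundle"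
  pairing :: "'w \<Rightarrow> 'v \<Rightarrow> real"

definition with_dual :: "('m, 'v::real_vector) vbundle \<Rightarrow> ('m, 'v, 'v \<Rightarrow> real) dual_pair" where
  "with_dual E = \<lparr> primal = E, codual = dual_bundle E, pairing = (\<lambda>e f. e f) \<rparr>"

definition dsum_pair (infixr "\<oplus>\<^sub>d" 65) where
  "P \<oplus>\<^sub>d Q = \<lparr> primal = primal P \<oplus>\<^sub>b primal Q, codual = codual P \<oplus>\<^sub>b codual Q,
               pairing = (\<lambda>(e, e') (f, f'). pairing P e f + pairing Q e' f') \<rparr>"

definition prod_pair (infixr "\<times>\<^sub>d" 65) where
  "P \<times>\<^sub>d Q = \<lparr> primal = primal P \<times>\<^sub>b primal Q, codual = codual P \<times>\<^sub>b codual Q,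
               pairing = (\<lambda>(e, e') (f, f'). pairing P e f + pairing Q e' f') \<rparr>"

abbreviation doubled where
  "doubled P \<equiv> primal P \<oplus>\<^sub>b codual P"


section \<open>Tangent bundle\<close>

text \<open>A tangent vector at \<open>p\<close> acts as a derivation on the functions that are smooth near \<open>p\<close>; it is
  set to \<open>0\<close> on all other functions. The tangent space is spanned by the coordinate derivations of
  any chart around \<open>p\<close>.\<close>

type_synonym 'm tvec = "('m \<Rightarrow> real) \<Rightarrow> real"

definition coord_deriv :: "'m manifold \<Rightarrow> 'm chart \<Rightarrow> nat \<Rightarrow> 'm \<Rightarrow> 'm tvec" where
  "coord_deriv M = (\<lambda>(U, \<phi>) i p h.
     if smooth_near M p h then partial i (h \<circ> inv_into U \<phi>) (\<phi> p) else 0)"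

definition tangent_bundle :: "'m manifold \<Rightarrow> ('m, 'm tvec) vbundle" where
  "tangent_bundle M =
     \<lparr> fib = (\<lambda>p. \<Union>\<kappa> \<in> {\<kappa> \<in> charts M. p \<in> fst \<kappa>}. span ((\<lambda>i. coord_deriv M \<kappa> i p) ` {..<mdim M})),
       rk = mdim M,
       frames = {(fst \<kappa>, coord_deriv M \<kappa>) | \<kappa>. \<kappa> \<in> charts M} \<rparr>"

abbreviation tangent_pair :: "'m manifold \<Rightarrow> ('m, 'm tvec, 'm tvec \<Rightarrow> real) dual_pair" where
  "tangent_pair M \<equiv> with_dual (tangent_bundle M)"

definition dfun :: "'m manifold \<Rightarrow> ('m \<Rightarrow> real) \<Rightarrow> 'm \<Rightarrow> 'm tvec \<Rightarrow> real" where
  "dfun M H p v = (if v \<in> fib (tangent_bundle M) p then v H else 0)"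

text \<open>Differential of \<open>F\<close>, where \<open>q\<close> is the image point in \<open>N\<close>.\<close>

definition push :: "'n manifold \<Rightarrow> 'n \<Rightarrow> ('m \<Rightarrow> 'n) \<Rightarrow> 'm tvec \<Rightarrow> 'n tvec" where
  "push N q F v h = (if smooth_near N q h then v (h \<circ> F) else 0)"

text \<open>The canonical isomorphisms \<open>T\<^bsub>(p,q)\<^esub>(M \<times> N) = T\<^bsub>p\<^esub>M \<oplus> T\<^bsub>q\<^esub>N\<close> and
  \<open>T\<^sup>*\<^bsub>(p,q)\<^esub>(M \<times> N) = T\<^sup>*\<^bsub>p\<^esub>M \<oplus> T\<^sup>*\<^bsub>q\<^esub>N\<close>: tangent vectors are pushed forward along the projections,
  covectors are pulled back along \<open>M \<rightarrow> M \<times> {q}\<close> and \<open>N \<rightarrow> {p} \<times> N\<close>.\<close>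

definition split_tangent ::
    "'m manifold \<Rightarrow> 'n manifold \<Rightarrow> 'm \<times> 'n \<Rightarrow> ('m \<times> 'n) tvec \<Rightarrow> 'm tvec \<times> 'n tvec" where
  "split_tangent M N = (\<lambda>(p, q) v. (push M p fst v, push N q snd v))"

definition split_cotangent ::
    "'m manifold \<Rightarrow> 'n manifold \<Rightarrow> 'm \<times> 'n \<Rightarrow> (('m \<times> 'n) tvec \<Rightarrow> real)
       \<Rightarrow> ('m tvec \<Rightarrow> real) \<times> ('n tvec \<Rightarrow> real)" where
  "split_cotangent M N = (\<lambda>(p, q) \<alpha>.
     (\<lambda>v. if v \<in> fib (tangent_bundle M) p
           then \<alpha> (push (prod_manifold M N) (p, q) (\<lambda>p'. (p', q)) v) else 0,
      \<lambda>w. if w \<in> fib (tangent_bundle N) q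
           then \<alpha> (push (prod_manifold M N) (p, q) (\<lambda>q'. (p, q')) w) else 0))"


section \<open>Dirac structures and Lagrangian subbundles\<close>

definition sym_form where
  "sym_form P = (\<lambda>(f, e) (f', e'). pairing P e' f + pairing P e f')"

definition alt_form where
  "alt_form P = (\<lambda>(f, e) (f', e'). pairing P e' f - pairing P e f')"

definition dirac_structure where
  "dirac_structure M P D \<longleftrightarrow>
     smooth_subbundle M (doubled P) (rk (primal P)) D \<and>
     (\<forall>p\<in>points M. \<forall>\<xi>\<in>D p. \<forall>\<xi>'\<in>D p. sym_form P \<xi> \<xi>' = 0)"

definition lagrangian_subbundle where
  "lagrangian_subbundle M P R \<longleftrightarrow>
     smooth_subbundle M (doubled P) (rk (primal P)) R \<and>
     (\<forall>p\<in>points M. \<forall>\<xi>\<in>R p. \<forall>\<xi>'\<in>R p. alt_form P \<xi> \<xi>' = 0)"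

definition nonnegative where
  "nonnegative M P R \<longleftrightarrow> (\<forall>p\<in>points M. \<forall>\<xi>\<in>R p. sym_form P \<xi> \<xi> \<ge> 0)"


section \<open>Curves\<close>

text \<open>Curves on \<open>I = [t0, t1]\<close> are functions on \<^typ>\<open>real\<close>; a curve in the total space of a bundle is
  a function \<open>t \<mapsto> (x t, v t)\<close>, with shadow \<open>x\<close>. Inside behaviours, curves are required to be
  \<^const>\<open>extensional\<close>, so that they are determined by their restriction to \<open>I\<close>.\<close>

definition C1_curve :: "'m manifold \<Rightarrow> real \<Rightarrow> real \<Rightarrow> (real \<Rightarrow> 'm) \<Rightarrow> bool" where
  "C1_curve M t0 t1 x \<longleftrightarrow>
     (\<exists>a b \<gamma>. a < t0 \<and> t1 < b \<and> continuous_map (top_of_set {a<..<b}) (mtop M) \<gamma> \<and>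
        (\<forall>(U, \<phi>) \<in> charts M. \<forall>i<mdim M.
           (\<lambda>t. \<phi> (\<gamma> t) i) C1_differentiable_on {t \<in> {a<..<b}. \<gamma> t \<in> U}) \<and>
        (\<forall>t\<in>{t0..t1}. \<gamma> t = x t))"

text \<open>One-sided at the end points, where it agrees with the velocity of any \<open>C\<^sup>1\<close> extension.\<close>

definition velocity :: "'m manifold \<Rightarrow> real \<Rightarrow> real \<Rightarrow> (real \<Rightarrow> 'm) \<Rightarrow> real \<Rightarrow> 'm tvec" where
  "velocity M t0 t1 x t h =
     (if smooth_near M (x t) h then vector_derivative (h \<circ> x) (at t within {t0..t1}) else 0)"

definition L1c ::
    "'m manifold \<Rightarrow> ('m, 'v::real_vector) vbundle \<Rightarrow> real \<Rightarrow> real \<Rightarrow> (real \<Rightarrow> 'm \<times> 'v) set" where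
  "L1c M E t0 t1 = {\<xi>.
     \<xi> \<in> measurable (lebesgue_on {t0..t1})
            (sigma (topspace (total_top M E)) {W. openin (total_top M E) W}) \<and>
     continuous_map (top_of_set {t0..t1}) (mtop M) (fst \<circ> \<xi>) \<and>
     (\<exists>g. bundle_metric M E g \<and>
        integrable (lebesgue_on {t0..t1}) (\<lambda>t. sqrt (g (fst (\<xi> t)) (snd (\<xi> t)) (snd (\<xi> t)))))}"

definition test_function :: "real set \<Rightarrow> (real \<Rightarrow> real) \<Rightarrow> bool" where
  "test_function S \<eta> \<longleftrightarrow>
     (\<forall>k t. (deriv ^^ k) \<eta> field_differentiable at t) \<and>
     (\<exists>K. compact K \<and> K \<subseteq> S \<and> (\<forall>t. t \<notin> K \<longrightarrow> \<eta> t = 0))"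

definition weak_derivative_on :: "real set \<Rightarrow> (real \<Rightarrow> real) \<Rightarrow> (real \<Rightarrow> real) \<Rightarrow> bool" where
  "weak_derivative_on S u w \<longleftrightarrow>
     (\<forall>K. compact K \<and> K \<subseteq> S \<longrightarrow> set_integrable lebesgue K u \<and> set_integrable lebesgue K w) \<and>
     (\<forall>\<eta>. test_function S \<eta> \<longrightarrow>
        (LINT t:S|lebesgue. u t * deriv \<eta> t) = - (LINT t:S|lebesgue. w t * \<eta> t))"

text \<open>The components of \<open>d\<phi> (X t)\<close> are the values of the tangent vector \<open>X t\<close> on the coordinate
  functions of the chart.\<close>

definition weak_derivative ::
    "'m manifold \<Rightarrow> real \<Rightarrow> real \<Rightarrow> (real \<Rightarrow> 'm) \<Rightarrow> (real \<Rightarrow> 'm tvec) \<Rightarrow> bool" where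
  "weak_derivative M t0 t1 x X \<longleftrightarrow>
     (\<forall>(U, \<phi>) \<in> charts M. \<forall>i<mdim M.
        weak_derivative_on {t \<in> {t0<..<t1}. x t \<in> U} (\<lambda>t. \<phi> (x t) i) (\<lambda>t. X t (\<lambda>p. \<phi> p i)))"

text \<open>\<open>(f, e) \<in> D\<close> in the weak sense, for \<open>\<xi> t = (f t, e t)\<close> over \<open>x\<close>. The form is \<^const>\<open>sym_form\<close>
  for Dirac structures and \<^const>\<open>alt_form\<close> for Lagrangian subbundles; \<open>\<sigma>\<close> ranges over
  the continuous compactly supported sections \<open>(\<phi>, \<epsilon>)\<close> of \<open>x\<^sup>*D\<close>.\<close>

definition weakly_in where
  "weakly_in M P form D t0 t1 x \<xi> \<longleftrightarrow>
     (\<forall>\<sigma>. (\<forall>t\<in>{t0..t1}. \<sigma> t \<in> D (x t)) \<and>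
          continuous_map (top_of_set {t0..t1}) (total_top M (doubled P)) (\<lambda>t. (x t, \<sigma> t)) \<and>
          (\<exists>a b. t0 < a \<and> b < t1 \<and> (\<forall>t\<in>{t0..t1}. t \<notin> {a..b} \<longrightarrow> \<sigma> t = 0)) \<longrightarrow>
          (LINT t|lebesgue_on {t0..t1}. form P (\<xi> t) (\<sigma> t)) = 0)"


section \<open>Port-Hamiltonian systems and their behaviours\<close>

text \<open>\<open>Er\<close> and \<open>Ep\<close> are the resistive and the external port bundle, each with its dual. A point of the
  total space of \<open>E\<^sub>r \<oplus> E\<^sub>p \<oplus> E\<^sub>r\<^sup>* \<oplus> E\<^sub>p\<^sup>*\<close> is \<open>(x, f, y, e, u)\<close>.\<close>

abbreviation flow_pair where
  "flow_pair M Er Ep \<equiv> tangent_pair M \<oplus>\<^sub>d Er \<oplus>\<^sub>d Ep"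

abbreviation signal_bundle where
  "signal_bundle Er Ep \<equiv> primal Er \<oplus>\<^sub>b primal Ep \<oplus>\<^sub>b codual Er \<oplus>\<^sub>b codual Ep"

definition classical_behaviour where
  "classical_behaviour M Er Ep D R H t0 t1 = {\<xi> \<in> extensional {t0..t1}.
     continuous_map (top_of_set {t0..t1}) (total_top M (signal_bundle Er Ep)) \<xi> \<and>
     C1_curve M t0 t1 (fst \<circ> \<xi>) \<and>
     (\<forall>t\<in>{t0..t1}. case \<xi> t of (x, f, y, e, u) \<Rightarrow>
        ((velocity M t0 t1 (fst \<circ> \<xi>) t, f, - y), (dfun M H x, e, u)) \<in> D x \<and> (f, e) \<in> R x)}"

definition weak_behaviour where
  "weak_behaviour M Er Ep D R H t0 t1 = {\<xi> \<in> extensional {t0..t1}.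
     \<xi> \<in> L1c M (signal_bundle Er Ep) t0 t1 \<and>
     (\<exists>X. (\<lambda>t. (fst (\<xi> t), X t)) \<in> L1c M (tangent_bundle M) t0 t1 \<and>
        weak_derivative M t0 t1 (fst \<circ> \<xi>) X \<and>
        weakly_in M (flow_pair M Er Ep) sym_form D t0 t1 (fst \<circ> \<xi>)
          (\<lambda>t. case \<xi> t of (x, f, y, e, u) \<Rightarrow> ((X t, f, - y), (dfun M H x, e, u))) \<and>
        weakly_in M Er alt_form R t0 t1 (fst \<circ> \<xi>)
          (\<lambda>t. case \<xi> t of (x, f, y, e, u) \<Rightarrow> (f, e)))}"

datatype regime = Classical | Weak

definition behaviour where
  "behaviour \<tau> M Er Ep D R H t0 t1 =
     (case \<tau> of Classical \<Rightarrow> classical_behaviour M Er Ep D R H t0 t1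
              | Weak \<Rightarrow> weak_behaviour M Er Ep D R H t0 t1)"


section \<open>Interconnection\<close>

definition ph_system ::
    "'m manifold \<Rightarrow> ('m, 'r::real_vector) vbundle \<Rightarrow> ('m, 'i::real_vector) vbundle
       \<Rightarrow> ('m, 'e::real_vector) vbundle \<Rightarrow> _ \<Rightarrow> _ \<Rightarrow> ('m \<Rightarrow> real) \<Rightarrow> bool" where
  "ph_system M Er Epi Epe D R H \<longleftrightarrow>
     smooth_manifold M \<and> vector_bundle M Er \<and> vector_bundle M Epi \<and> vector_bundle M Epe \<and>
     dirac_structure M (flow_pair M (with_dual Er) (with_dual Epi \<oplus>\<^sub>d with_dual Epe)) D \<and>
     lagrangian_subbundle M (with_dual Er) R \<and> nonnegative M (with_dual Er) R \<and>
     smooth_fun M (points M) H"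

text \<open>The fibre of \<open>D1 \<parallel>\<^bsub>Dint\<^esub> D2\<close>; \<open>(v1, v2)\<close> and \<open>(\<alpha>1, \<alpha>2)\<close> are the components of \<open>v\<close> and \<open>\<alpha>\<close>.\<close>

definition dirac_interconnection where
  "dirac_interconnection M1 M2 Dint D1 D2 = (\<lambda>(x1, x2).
     {((v, (f1, f2), (\<eta>1, \<eta>2)), (\<alpha>, (e1, e2), (u1, u2))) | v f1 f2 \<eta>1 \<eta>2 \<alpha> e1 e2 u1 u2.
        v \<in> fib (primal (tangent_pair (prod_manifold M1 M2))) (x1, x2) \<and>
        \<alpha> \<in> fib (codual (tangent_pair (prod_manifold M1 M2))) (x1, x2) \<and>
        (\<exists>v1 v2 \<alpha>1 \<alpha>2 \<zeta>1 \<zeta>2 w1 w2.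
           (v1, v2) = split_tangent M1 M2 (x1, x2) v \<and>
           (\<alpha>1, \<alpha>2) = split_cotangent M1 M2 (x1, x2) \<alpha> \<and>
           ((\<zeta>1, \<zeta>2), (w1, w2)) \<in> Dint (x1, x2) \<and>
           ((v1, f1, \<eta>1, \<zeta>1), (\<alpha>1, e1, u1, w1)) \<in> D1 x1 \<and>
           ((v2, f2, \<eta>2, \<zeta>2), (\<alpha>2, e2, u2, w2)) \<in> D2 x2)})"

definition box_sum where
  "box_sum R1 R2 = (\<lambda>(x1, x2).
     {((f1, f2), (e1, e2)) | f1 f2 e1 e2. (f1, e1) \<in> R1 x1 \<and> (f2, e2) \<in> R2 x2})"

definition admissible where
  "admissible M1 Er1 Epi1 M2 Er2 Epi2 D1 D2 Dint \<longleftrightarrow>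
     (\<exists>k. smooth_subbundle (prod_manifold M1 M2)
        (doubled (flow_pair (prod_manifold M1 M2)
           (with_dual Er1 \<times>\<^sub>d with_dual Er2) (with_dual Epi1 \<times>\<^sub>d with_dual Epi2)))
        k (dirac_interconnection M1 M2 Dint D1 D2))"

text \<open>\<open>y1, u1, \<dots>\<close> are the signals at the ports that stay external, \<open>y1', u1', \<dots>\<close> those at the
  interconnected ports.\<close>

definition behaviour_interconnection where
  "behaviour_interconnection Dint B1 B2 t0 t1 = {\<xi> \<in> extensional {t0..t1}.
     \<exists>y1' y2' u1' u2'.
       (\<forall>t\<in>{t0..t1}. ((y1' t, y2' t), (u1' t, u2' t)) \<in> Dint (fst (\<xi> t))) \<and>
       (\<lambda>t\<in>{t0..t1}. case \<xi> t of ((x1, x2), (f1, f2), (y1, y2), (e1, e2), (u1, u2)) \<Rightarrow>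
          (x1, f1, (y1, - y1' t), e1, (u1, u1' t))) \<in> B1 \<and>
       (\<lambda>t\<in>{t0..t1}. case \<xi> t of ((x1, x2), (f1, f2), (y1, y2), (e1, e2), (u1, u2)) \<Rightarrow>
          (x2, f2, (y2, - y2' t), e2, (u2, u2' t))) \<in> B2}"

definition interconnected_behaviours where
  "interconnected_behaviours \<tau> M1 Er1 Epi1 Epe1 D1 R1 H1 M2 Er2 Epi2 Epe2 D2 R2 H2 Dint t0 t1 =
     behaviour_interconnection Dint
       (behaviour \<tau> M1 (with_dual Er1) (with_dual Epi1 \<oplus>\<^sub>d with_dual Epe1) D1 R1 H1 t0 t1)
       (behaviour \<tau> M2 (with_dual Er2) (with_dual Epi2 \<oplus>\<^sub>d with_dual Epe2) D2 R2 H2 t0 t1) t0 t1"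

definition behaviour_of_interconnection where
  "behaviour_of_interconnection \<tau> M1 Er1 Epi1 D1 R1 H1 M2 Er2 Epi2 D2 R2 H2 Dint t0 t1 =
     behaviour \<tau> (prod_manifold M1 M2)
       (with_dual Er1 \<times>\<^sub>d with_dual Er2) (with_dual Epi1 \<times>\<^sub>d with_dual Epi2)
       (dirac_interconnection M1 M2 Dint D1 D2) (box_sum R1 R2) (\<lambda>(x1, x2). H1 x1 + H2 x2) t0 t1"

end

(* Since the fibres of a Dirac structure or Lagrangian subbundle are maximal isotropic and have local
   continuous frames, the fundamental lemma of the calculus of variations turns membership in the weak
   sense into membership almost everywhere; the interconnected relation then holds fibrewise.
   The inclusion can be proper because the composite forgets the flow at the eliminated port: in a smooth
   Dirac structure over the real line the remaining signals can force that flow to be - 1 / x, which is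
   not integrable along x(t) = t. *)
theory Submission imports Defs begin

section \<open>Bases and coordinates\<close>

text \<open>Fibres over different points are unrelated, so continuity, measurability and
  integrability of curves in a total space are expressed by coordinates in local frames, where sums,
  products and duals of bundles act entry by entry. Membership in \<open>L1c\<close> also asserts
  that a bundle metric exists; for the composite it is assembled from the metrics that come with the
  signals of the two parts. The counterexample is the graph of a skew-symmetric map from flows to
  efforts whose entries are polynomials in x. The rank of the condition that the effort at the
  eliminated port vanishes drops at x = 0, yet what it says about the surviving signals is the same
  for every x. A second structure, in which all efforts are 0, has the same composite, so the
  singular curve lies in that composite by the inclusion itself. One curve serves both regimes,
  because 1/t is neither continuous nor integrable near 0.\<close>

definition coords :: "nat => (nat => 'v::real_vector) => 'v => nat => real" where
  "coords k b v i = (if i < k then representation (b ` {..<k}) v (b i) else 0)"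

lemma span_image_lessThan:
  fixes b :: "nat => 'v::real_vector"
  shows "span (b ` {..<k}) = range (\<lambda>c. \<Sum>i<k. c i *\<^sub>R b i)"
proof (intro set_eqI iffI)
  fix v assume "v \<in> span (b ` {..<k})"
  then show "v \<in> range (\<lambda>c. \<Sum>i<k. c i *\<^sub>R b i)"
  proof (induction rule: span_induct_alt)
    case base
    show ?case by (rule range_eqI[of _ _ "\<lambda>_. 0"]) simp
  next
    case (step a x y)
    then obtain j c where j: "j < k" "x = b j" and c: "y = (\<Sum>i<k. c i *\<^sub>R b i)" by blast
    have "(\<Sum>i<k. (if i = j then a else 0) *\<^sub>R b i) = a *\<^sub>R b j"
      using j(1) by (simp add: if_distrib[of "\<lambda>r. r *\<^sub>R _"] cong: if_cong)
    then have "a *\<^sub>R x + y = (\<Sum>i<k. ((if i = j then a else 0) + c i) *\<^sub>R b i)"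
      by (simp add: scaleR_add_left sum.distrib j(2) c)
    then show ?case by (intro range_eqI)
  qed
next
  fix v assume "v \<in> range (\<lambda>c. \<Sum>i<k. c i *\<^sub>R b i)"
  then show "v \<in> span (b ` {..<k})"
    by (auto intro!: span_sum intro: span_scale span_base)
qed

text \<open>Sums over indices instead of over the image set turn the concatenation of frames into
  index arithmetic. Injectivity is absorbed by the second condition, because a repeated vector is
  itself a linear relation.\<close>

lemma basis_of_iff:
  "basis_of k b V \<longleftrightarrow>
     V = range (\<lambda>c. \<Sum>i<k. c i *\<^sub>R b i) \<and> (\<forall>c. (\<Sum>i<k. c i *\<^sub>R b i) = 0 \<longrightarrow> (\<forall>i<k. c i = 0))"
    (is "?L \<longleftrightarrow> _ \<and> ?Z")
proof -
  have "inj_on b {..<k} \<and> independent (b ` {..<k}) \<longleftrightarrow> ?Z"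
  proof (intro iffI conjI)
    assume L: "inj_on b {..<k} \<and> independent (b ` {..<k})"
    show ?Z
    proof (intro allI impI)
      fix c i assume *: "(\<Sum>i<k. c i *\<^sub>R b i) = 0" "i < k"
      have "(\<Sum>v\<in>b ` {..<k}. c (inv_into {..<k} b v) *\<^sub>R v) = (\<Sum>i<k. c i *\<^sub>R b i)"
        using L by (subst sum.reindex) (auto intro!: sum.cong)
      then have "c (inv_into {..<k} b (b i)) = 0"
        using L * independentD[of "b ` {..<k}" "b ` {..<k}" "\<lambda>v. c (inv_into {..<k} b v)" "b i"]
        by auto
      then show "c i = 0" using L * by simp
    qed
  next
    assume Z: ?Z
    show inj: "inj_on b {..<k}"
    proof (rule inj_onI, rule ccontr)
      fix i j assume ij: "i \<in> {..<k}" "j \<in> {..<k}" "b i = b j" "i \<noteq> j"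
      \<comment> \<open>The relation b i - b j = 0, which is nontrivial as soon as the two indices
        differ.\<close>
      define c :: "nat => real" where "c l = (if l = i then 1 else 0) - (if l = j then 1 else 0)" for l
      have "(\<Sum>l<k. c l *\<^sub>R b l) = 0"
        using ij by (simp add: c_def scaleR_diff_left sum_subtractf if_distrib[of "\<lambda>r. r *\<^sub>R _"] cong: if_cong)
      then have "c i = 0" using Z ij by blast
      then show False using ij by (simp add: c_def)
    qed
    show "independent (b ` {..<k})"
    proof (rule independent_if_scalars_zero)
      fix f x assume *: "(\<Sum>x\<in>b ` {..<k}. f x *\<^sub>R x) = 0" "x \<in> b ` {..<k}"
      then have "(\<Sum>i<k. f (b i) *\<^sub>R b i) = 0" using inj by (simp add: sum.reindex)
      then show "f x = 0" using Z[rule_format, of "\<lambda>i. f (b i)"] * by auto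
    qed simp
  qed
  then show ?thesis unfolding basis_of_def span_image_lessThan by blast
qed

lemma basis_of_cong: "(\<And>i. i < k ==> b i = b' i) ==> basis_of k b V = basis_of k b' V"
  unfolding basis_of_iff by simp

lemma coords_cong: "(\<And>i. i < k ==> b i = b' i) ==> coords k b v i = coords k b' v i"
proof -
  assume *: "\<And>i. i < k ==> b i = b' i"
  then have "b ` {..<k} = b' ` {..<k}" by simp
  then show ?thesis using * by (simp add: coords_def)
qed

text \<open>\<open>representation\<close> is a function of vectors rather than of indices.
  Injectivity of \<open>b\<close> moves each coefficient from its index to its vector, and
  uniqueness of finitely supported representations does the rest.\<close>

lemma coords_unique:
  assumes "basis_of k b V"
  shows "coords k b (\<Sum>i<k. c i *\<^sub>R b i) j = (if j < k then c j else 0)"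
proof (cases "j < k")
  case True
  have L: "inj_on b {..<k}" "independent (b ` {..<k})" using assms by (auto simp: basis_of_def)
  have *: "c i = (\<lambda>v. if v \<in> b ` {..<k} then c (inv_into {..<k} b v) else 0) (b i)" if "i < k" for i
    using that L by simp
  have "representation (b ` {..<k}) (\<Sum>i<k. c i *\<^sub>R b i) = (\<lambda>v. if v \<in> b ` {..<k} then c (inv_into {..<k} b v) else 0)"
    (is "_ = ?g")
  proof (rule representation_eqI[OF L(2)])
    show "(\<Sum>i<k. c i *\<^sub>R b i) \<in> span (b ` {..<k})" by (auto intro!: span_sum intro: span_scale span_base)
    show "finite {v. ?g v \<noteq> 0}"
      by (rule finite_subset[of _ "b ` {..<k}"]) (auto split: if_splits)
    show "(\<Sum>v | ?g v \<noteq> 0. ?g v *\<^sub>R v) = (\<Sum>i<k. c i *\<^sub>R b i)"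
    proof -
      have "(\<Sum>v | ?g v \<noteq> 0. ?g v *\<^sub>R v) = (\<Sum>v\<in>b ` {..<k}. ?g v *\<^sub>R v)"
        by (rule sum.mono_neutral_left) auto
      also have "\<dots> = (\<Sum>i<k. c i *\<^sub>R b i)"
        using L by (subst sum.reindex) (auto intro!: sum.cong)
      finally show ?thesis .
    qed
  qed (auto split: if_splits)
  then show ?thesis using True L by (simp add: coords_def)
qed (simp add: coords_def)

lemma coords_sum:
  assumes "basis_of k b V" "v \<in> V"
  shows "(\<Sum>i<k. coords k b v i *\<^sub>R b i) = v"
proof -
  obtain c where c: "v = (\<Sum>i<k. c i *\<^sub>R b i)" using assms by (auto simp: basis_of_iff)
  show ?thesis unfolding c using coords_unique[OF assms(1)] by simp
qed

text \<open>These zeros place coordinate vectors in \<open>Euclidean_space k\<close>, the model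
  fibre of the trivialisations in \<open>total_top\<close>.\<close>

lemma coords_ge: "\<not> i < k ==> coords k b v i = 0"
  by (simp add: coords_def)

lemma coords_outside:
  assumes "basis_of k b V" "v \<notin> V"
  shows "coords k b v i = 0"
  using assms by (auto simp: coords_def basis_of_def representation_def)

lemma basis_of_comb: "basis_of k b V ==> (\<Sum>i<k. c i *\<^sub>R b i) \<in> V"
  by (auto simp: basis_of_iff)

lemma coords_basis:
  assumes "basis_of k b V" "i < k"
  shows "coords k b (b i) j = (if i = j then 1 else 0)"
proof -
  have "b i = (\<Sum>l<k. (if l = i then 1 else 0) *\<^sub>R b l)"
    using assms(2) by (simp add: if_distrib[of "\<lambda>r. r *\<^sub>R _"] cong: if_cong)
  then have "coords k b (b i) j = coords k b (\<Sum>l<k. (if l = i then 1 else 0) *\<^sub>R b l) j" by simp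
  also have "\<dots> = (if i = j then 1 else 0)" unfolding coords_unique[OF assms(1)] using assms(2) by auto
  finally show ?thesis .
qed

lemma basis_of_subspace: "basis_of k b V ==> subspace V"
  by (auto simp: basis_of_def)

lemma basis_of_mem: "basis_of k b V ==> i < k ==> b i \<in> V"
  by (auto simp: basis_of_def intro: span_base)

lemma coords_linear:
  assumes "basis_of k b V" "v \<in> V" "w \<in> V"
  shows "coords k b (r *\<^sub>R v + s *\<^sub>R w) i = r * coords k b v i + s * coords k b w i"
proof (cases "i < k")
  case True
  have ind: "independent (b ` {..<k})" and sp: "span (b ` {..<k}) = V"
    using assms(1) by (auto simp: basis_of_def)
  show ?thesis using True assms(2,3)
    by (simp add: coords_def representation_add[OF ind] representation_scale[OF ind] sp span_scale
        subspace_scale[OF basis_of_subspace[OF assms(1)]])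
qed (simp add: coords_def)

lemma coords_zero: "basis_of k b V ==> coords k b 0 i = 0"
  using coords_unique[of k b V "\<lambda>_. 0" i] by simp

lemma coords_uminus: "basis_of k b V ==> v \<in> V ==> coords k b (- v) i = - coords k b v i"
  using coords_linear[of k b V v v "-1" 0 i] by simp

section \<open>Concatenation of bases\<close>

lemma sum_lessThan_add:
  fixes f :: "nat => 'a::comm_monoid_add"
  shows "(\<Sum>i<m + n. f i) = (\<Sum>i<m. f i) + (\<Sum>i<n. f (m + i))"
  by (induction n) (simp_all add: add.assoc)

text \<open>The frames of direct sums and of products are concatenations of this shape, so
  statements about them reduce to splitting a coefficient sequence at \<open>k\<close>.\<close>

lemma sum_append_frame:
  fixes b :: "nat => 'v::real_vector" and b' :: "nat => 'w::real_vector"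
  shows "(\<Sum>i<k + l. c i *\<^sub>R (if i < k then (b i, 0) else (0, b' (i - k)))) =
    (\<Sum>i<k. c i *\<^sub>R b i, \<Sum>i<l. c (k + i) *\<^sub>R b' i)"
proof -
  have "(\<Sum>i<k. c i *\<^sub>R (b i, 0::'w)) = (\<Sum>i<k. c i *\<^sub>R b i, 0)"
    by (simp add: prod_eq_iff fst_sum snd_sum)
  moreover have "(\<Sum>i<l. c (k + i) *\<^sub>R (0::'v, b' i)) = (0, \<Sum>i<l. c (k + i) *\<^sub>R b' i)"
    by (simp add: prod_eq_iff fst_sum snd_sum)
  ultimately show ?thesis unfolding sum_lessThan_add by simp
qed

lemma basis_of_append:
  fixes b :: "nat => 'v::real_vector" and b' :: "nat => 'w::real_vector"
  assumes "basis_of k b V" "basis_of l b' W"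
  shows "basis_of (k + l) (\<lambda>i. if i < k then (b i, 0) else (0, b' (i - k))) (V \<times> W)"
  unfolding basis_of_iff sum_append_frame
proof (intro conjI allI impI)
  show "V \<times> W = range (\<lambda>c. (\<Sum>i<k. c i *\<^sub>R b i, \<Sum>i<l. c (k + i) *\<^sub>R b' i))"
  proof (intro set_eqI iffI)
    fix x assume "x \<in> V \<times> W"
    then obtain c d where "x = (\<Sum>i<k. c i *\<^sub>R b i, \<Sum>i<l. d i *\<^sub>R b' i)"
      using assms by (auto simp: basis_of_iff)
    then show "x \<in> range (\<lambda>c. (\<Sum>i<k. c i *\<^sub>R b i, \<Sum>i<l. c (k + i) *\<^sub>R b' i))"
      by (intro range_eqI[of _ _ "\<lambda>i. if i < k then c i else d (i - k)"]) simp
  qed (auto intro!: basis_of_comb[OF assms(1)] basis_of_comb[OF assms(2)])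
next
  fix c i assume *: "(\<Sum>i<k. c i *\<^sub>R b i, \<Sum>i<l. c (k + i) *\<^sub>R b' i) = 0" "i < k + l"
  then have "\<forall>i<k. c i = 0" "\<forall>i<l. c (k + i) = 0"
    using assms unfolding basis_of_iff by (auto simp: zero_prod_def)
  then show "c i = 0" using *(2) by (metis add_diff_inverse_nat nat_add_left_cancel_less)
qed

lemma coords_append:
  fixes b :: "nat => 'v::real_vector" and b' :: "nat => 'w::real_vector"
  assumes "basis_of k b V" "basis_of l b' W" "v \<in> V" "w \<in> W"
  shows "coords (k + l) (\<lambda>i. if i < k then (b i, 0) else (0, b' (i - k))) (v, w) i =
    (if i < k then coords k b v i else coords l b' w (i - k))"
proof -
  let ?c = "\<lambda>i. if i < k then coords k b v i else coords l b' w (i - k)"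
  have "(v, w) = (\<Sum>i<k + l. ?c i *\<^sub>R (if i < k then (b i, 0) else (0, b' (i - k))))"
    by (rule trans[OF _ sum_append_frame[symmetric]])
      (simp add: coords_sum[OF assms(1,3)] coords_sum[OF assms(2,4)])
  then show ?thesis
    using coords_unique[OF basis_of_append[OF assms(1,2)], of ?c i] by (auto simp: coords_ge)
qed

section \<open>Functionals on a subspace and dual bases\<close>

definition dual_space :: "'v::real_vector set => ('v => real) set" where
  "dual_space V = {e. (\<forall>v\<in>V. \<forall>w\<in>V. \<forall>a b. e (a *\<^sub>R v + b *\<^sub>R w) = a * e v + b * e w) \<and>
     (\<forall>v. v \<notin> V \<longrightarrow> e v = 0)}"

text \<open>Membership in \<open>dual_space V\<close> serves as a general certificate of linearity
  on \<open>V\<close>: pairings, bilinear forms and metrics, cut off to 0 outside \<open>V\<close>,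
  are all expanded in a family of vectors through this one rule.\<close>

lemma dual_space_sum:
  assumes "e \<in> dual_space V" "subspace V" "\<And>i. i \<in> A ==> b i \<in> V"
  shows "e (\<Sum>i\<in>A. c i *\<^sub>R b i) = (\<Sum>i\<in>A. c i * e (b i))"
proof -
  have lin: "\<And>v w r s. v \<in> V ==> w \<in> V ==> e (r *\<^sub>R v + s *\<^sub>R w) = r * e v + s * e w"
    using assms(1) by (auto simp: dual_space_def)
  have e0: "e 0 = 0" using lin[OF subspace_0[OF assms(2)] subspace_0[OF assms(2)], of 0 0] by simp
  show ?thesis using assms(3)
  proof (induction A rule: infinite_finite_induct)
    case (insert x F)
    have "(\<Sum>i\<in>F. c i *\<^sub>R b i) \<in> V"
      using insert.prems assms(2) by (intro subspace_sum) (auto intro: subspace_scale)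
    then show ?case using insert lin[of "b x" "\<Sum>i\<in>F. c i *\<^sub>R b i" "c x" 1] by simp
  qed (simp_all add: e0)
qed

lemma dual_space_eqI:
  assumes "e \<in> dual_space V" "e' \<in> dual_space V" "basis_of k b V" "\<And>i. i < k ==> e (b i) = e' (b i)"
  shows "e = e'"
proof
  fix v
  show "e v = e' v"
  proof (cases "v \<in> V")
    case True
    have *: "f v = (\<Sum>i<k. coords k b v i * f (b i))" if "f \<in> dual_space V" for f
      using dual_space_sum[OF that basis_of_subspace[OF assms(3)], of "{..<k}" b "coords k b v"]
        coords_sum[OF assms(3) True] basis_of_mem[OF assms(3)] by simp
    show ?thesis unfolding *[OF assms(1)] *[OF assms(2)] using assms(4) by simp
  qed (use assms(1,2) in \<open>auto simp: dual_space_def\<close>)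
qed

lemma subspace_dual_space: "subspace (dual_space V)"
  by (auto simp: subspace_def dual_space_def scaleR_fun_def algebra_simps)

lemma sum_fun_apply: "(\<Sum>i\<in>A. f i) x = (\<Sum>i\<in>A. f i x)"
  by (induction A rule: infinite_finite_induct) auto

lemma coords_in_dual_space: "basis_of k b V ==> (\<lambda>v. coords k b v i) \<in> dual_space V"
  by (auto simp: dual_space_def coords_linear coords_outside)

text \<open>The coordinate functionals take the values 0 and 1 on \<open>b\<close>, so a combination
  of them has its coefficients as values on \<open>b\<close>, and a functional on \<open>V\<close>
  is determined by these values. Both claims follow from this evaluation.\<close>

lemma dual_basis:
  assumes "basis_of k b V"
  shows "basis_of k (\<lambda>i v. coords k b v i) (dual_space V)"
    and "e \<in> dual_space V ==> coords k (\<lambda>i v. coords k b v i) e i = (if i < k then e (b i) else 0)"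
proof -
  have mem: "(\<Sum>i<k. c i *\<^sub>R (\<lambda>v. coords k b v i)) \<in> dual_space V" for c
    using coords_in_dual_space[OF assms] subspace_dual_space
    by (intro subspace_sum) (auto intro: subspace_scale)
  have ev: "(\<Sum>i<k. c i *\<^sub>R (\<lambda>v. coords k b v i)) (b j) = c j" if "j < k" for c j
    using that by (simp add: sum_fun_apply scaleR_fun_def coords_basis[OF assms] if_distrib cong: if_cong)
  have rep: "e = (\<Sum>i<k. e (b i) *\<^sub>R (\<lambda>v. coords k b v i))" if "e \<in> dual_space V" for e
    by (rule dual_space_eqI[OF that mem[of "\<lambda>i. e (b i)"] assms])
      (rule ev[of _ "\<lambda>i. e (b i)", symmetric])
  show 1: "basis_of k (\<lambda>i v. coords k b v i) (dual_space V)"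
    unfolding basis_of_iff
  proof (intro conjI allI impI)
    show "dual_space V = range (\<lambda>c. \<Sum>i<k. c i *\<^sub>R (\<lambda>v. coords k b v i))"
    proof (intro subset_antisym subsetI)
      fix e assume "e \<in> dual_space V"
      then show "e \<in> range (\<lambda>c. \<Sum>i<k. c i *\<^sub>R (\<lambda>v. coords k b v i))"
        by (intro range_eqI[of _ _ "\<lambda>i. e (b i)"] rep)
    qed (use mem in blast)
    fix c i assume "(\<Sum>i<k. c i *\<^sub>R (\<lambda>v. coords k b v i)) = 0" "i < k"
    then show "c i = 0" using ev[of i c] by simp
  qed
  show "coords k (\<lambda>i v. coords k b v i) e i = (if i < k then e (b i) else 0)" if "e \<in> dual_space V"
    by (subst rep[OF that], rule coords_unique[OF 1])
qed

text \<open>A totally isotropic subspace of half the dimension is maximal: with one more vector orthogonal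
  to it, its \<open>n + 1\<close> dimensions would inject into the \<open>n\<close>-dimensional dual of a complement.\<close>

lemma half_dim_isotropic_maximal:
  fixes B :: "'v::real_vector => 'v => real"
  assumes V: "basis_of (n + n) b V" and D: "basis_of n d D" "D \<subseteq> V"
    and lin1: "\<And>w. w \<in> V ==> (\<lambda>v. if v \<in> V then B v w else 0) \<in> dual_space V"
    and lin2: "\<And>w. w \<in> V ==> (\<lambda>v. if v \<in> V then B w v else 0) \<in> dual_space V"
    and nondeg: "\<And>v. v \<in> V ==> \<forall>w\<in>V. B v w = 0 ==> v = 0"
    and iso: "\<And>v w. v \<in> D ==> w \<in> D ==> B v w = 0"
    and x: "x \<in> V" "\<And>v. v \<in> D ==> B x v = 0"
  shows "x \<in> D"
proof (rule ccontr)
  assume nx: "x \<notin> D"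
  have sV: "subspace V" and sD: "subspace D" using basis_of_subspace V D by blast+
  define S where "S = d ` {..<n}"
  have indS: "independent S" and spS: "span S = D" and cS: "card S = n"
    using D(1) by (auto simp: basis_of_def S_def card_image)
  have indT: "independent (insert x S)" using nx indS spS by (simp add: independent_insert)
  have xS: "x \<notin> S" using nx spS span_base by blast
  have TV: "insert x S \<subseteq> V" using x(1) D(2) spS span_base by blast
  obtain T where T: "insert x S \<subseteq> T" "T \<subseteq> V" "independent T" "V \<subseteq> span T"
    using maximal_independent_subset_extend[OF TV indT] by blast
  have spT: "span T = V" using T sV by (metis span_minimal subset_antisym)
  have cT: "card T = n + n" "finite T"
  proof -
    have "card (b ` {..<n+n}) = n + n" "independent (b ` {..<n+n})" "span (b ` {..<n+n}) = V"
      using V by (auto simp: basis_of_def card_image)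
    note b = this
    show "finite T" using T(3) b(3) T(2) independent_span_bound[of "b ` {..<n+n}" T] by auto
    have "dim T = card T" "dim (b ` {..<n+n}) = n + n"
      using dim_eq_card_independent[OF T(3)] dim_eq_card_independent[OF b(2)] b(1) by auto
    moreover have "dim T = dim (b ` {..<n+n})" using dim_span[of T] dim_span[of "b ` {..<n+n}"] spT b(3) by simp
    ultimately show "card T = n + n" by simp
  qed
  have fS: "finite S" using S_def by simp
  have "card (T - S) = n" using cT cS T(1) fS by (simp add: card_Diff_subset)
  \<comment> \<open>\<open>T\<close> extends a basis \<open>S\<close> of \<open>D\<close> and the
    vector \<open>x\<close> to a basis of \<open>V\<close>. The values of \<open>B v\<close> on
    \<open>T - S\<close> are the coordinates of the functional that \<open>v\<close> induces on a
    complement of \<open>D\<close>.\<close>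
  define f where "f v = (\<lambda>t. if t \<in> T - S then B v t else 0)" for v
  have lin: "B (\<Sum>v\<in>A. c v *\<^sub>R v) t = (\<Sum>v\<in>A. c v * B v t)" if "A \<subseteq> V" "t \<in> V" for A c t
  proof -
    have "(\<Sum>v\<in>A. c v *\<^sub>R v) \<in> V"
      using that sV by (intro subspace_sum) (auto intro: subspace_scale)
    then show ?thesis using dual_space_sum[OF lin1[OF that(2)] sV, of A "\<lambda>v. v" c] that
      by (auto simp: subset_iff cong: sum.cong)
  qed
  \<comment> \<open>A relation among the \<open>f v\<close> yields a vector that is orthogonal to
    \<open>T - S\<close> by the relation itself, and to \<open>S\<close> by isotropy and the
    assumption on \<open>x\<close>. Nondegeneracy makes it 0, and the independence of
    \<open>insert x S\<close> kills the coefficients.\<close>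
  have key: "c v = 0" if c: "(\<Sum>v\<in>insert x S. c v *\<^sub>R f v) = 0" and v: "v \<in> insert x S" for c v
  proof -
    let ?y = "\<Sum>v\<in>insert x S. c v *\<^sub>R v"
    have yV: "?y \<in> V" using TV sV by (intro subspace_sum) (auto intro: subspace_scale)
    have yt: "B ?y t = 0" if t: "t \<in> T" for t
    proof (cases "t \<in> S")
      case True
      then have "t \<in> D" using spS span_base by blast
      then have "\<forall>v\<in>insert x S. B v t = 0" using iso x(2) spS span_base by blast
      then show ?thesis using lin[OF TV subsetD[OF T(2) t], of c] by (simp add: sum.neutral)
    next
      case False
      then have "B ?y t = (\<Sum>v\<in>insert x S. c v *\<^sub>R f v) t"
        using lin[OF TV subsetD[OF T(2) t], of c] t by (simp add: sum_fun_apply scaleR_fun_def f_def del: sum.insert)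
      then show ?thesis using c by simp
    qed
    have "B ?y w = 0" if w: "w \<in> V" for w
    proof -
      obtain a where a: "w = (\<Sum>t\<in>T. a t *\<^sub>R t)" using w spT span_finite[OF cT(2)] by auto
      have "B ?y w = (\<Sum>t\<in>T. a t * B ?y t)"
        using dual_space_sum[OF lin2[OF yV] sV, of T "\<lambda>t. t" a] T(2) w a
        by (auto simp: subset_iff cong: sum.cong)
      then show ?thesis using yt by simp
    qed
    then have "?y = 0" using nondeg yV by blast
    then show "c v = 0" using indT v fS independentD[of "insert x S" "insert x S" c v] by auto
  qed
  have inj: "inj_on f (insert x S)"
  proof (rule inj_onI, rule ccontr)
    fix u v assume uv: "u \<in> insert x S" "v \<in> insert x S" "f u = f v" "u \<noteq> v"
    define c :: "'v => real" where "c w = (if w = u then 1 else 0) - (if w = v then 1 else 0)" for w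
    have "(\<Sum>w\<in>insert x S. c w *\<^sub>R f w) = 0"
      using uv fS unfolding c_def scaleR_diff_left sum_subtractf if_distrib[of "\<lambda>r. r *\<^sub>R _"]
      by (simp cong: if_cong del: insert_iff sum.insert)
    then show False using key[of c u] uv by (auto simp: c_def)
  qed
  have indf: "independent (f ` insert x S)"
  proof (rule independent_if_scalars_zero)
    fix g y assume g: "(\<Sum>y\<in>f ` insert x S. g y *\<^sub>R y) = 0" "y \<in> f ` insert x S"
    then have "(\<Sum>v\<in>insert x S. g (f v) *\<^sub>R f v) = 0" using inj by (subst (asm) sum.reindex) auto
    moreover obtain v where "v \<in> insert x S" "y = f v" using g(2) by blast
    ultimately show "g y = 0" using key[of "\<lambda>v. g (f v)" v] by simp
  qed (use fS in simp)
  \<comment> \<open>Functions supported on \<open>T - S\<close> are spanned by its \<open>n\<close>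
    point masses, too few for \<open>n + 1\<close> independent functions.\<close>
  have sub: "f ` insert x S \<subseteq> span ((\<lambda>t s. if s = t then 1 else 0 :: real) ` (T - S))"
  proof
    fix g assume "g \<in> f ` insert x S"
    then obtain v where v: "g = f v" by blast
    have "g = (\<Sum>t\<in>T - S. B v t *\<^sub>R (\<lambda>s. if s = t then 1 else 0))"
      using cT(2) by (auto simp: fun_eq_iff sum_fun_apply scaleR_fun_def v f_def if_distrib cong: if_cong)
    then show "g \<in> span ((\<lambda>t s. if s = t then 1 else 0 :: real) ` (T - S))"
      by (metis (no_types, lifting) imageI span_base span_scale span_sum)
  qed
  have "card (f ` insert x S) \<le> card ((\<lambda>t s. if s = t then 1 else 0 :: real) ` (T - S))"
    by (rule conjunct2[OF independent_span_bound[OF _ indf sub]]) (use cT(2) in simp)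
  also have "\<dots> \<le> n" using card_image_le[OF finite_Diff[OF cT(2)], of "\<lambda>t s. if s = t then 1 else 0 :: real" S]
    \<open>card (T - S) = n\<close> by simp
  finally show False using card_image[OF inj] cS xS fS by simp
qed

section \<open>Continuous frames\<close>

abbreviation curve_on :: "real set => 'm manifold => (real => 'm) => bool" where
  "curve_on I M \<equiv> continuous_map (top_of_set I) (mtop M)"

abbreviation mtop_on :: "'m manifold => 'm set => 'm topology" where
  "mtop_on M \<equiv> subtopology (mtop M)"

abbreviation model :: "'m manifold => (nat => real) topology" where
  "model M \<equiv> Euclidean_space (mdim M)"

abbreviation frame_coords :: "('m, 'v::real_vector) vbundle => (nat => 'm => 'v) => 'm => 'v => nat => real" where
  "frame_coords E b p \<equiv> coords (rk E) (\<lambda>j. b j p)"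

text \<open>The continuous part of the vector bundle axioms; sums, products and duals preserve it, and
  nothing more is needed to describe curves in the total space by coordinates.\<close>

definition framed :: "'m manifold => ('m, 'v::real_vector) vbundle => bool" where
  "framed M E \<longleftrightarrow>
     \<Union> (fst ` frames E) = points M \<and>
     (\<forall>(U, b) \<in> frames E. openin (mtop M) U \<and> (\<forall>p\<in>U. basis_of (rk E) (\<lambda>i. b i p) (fib E p))) \<and>
     (\<forall>(U, b) \<in> frames E. \<forall>(V, c) \<in> frames E. \<forall>i<rk E. \<forall>j<rk E.
        continuous_map (mtop_on M (U \<inter> V)) euclideanreal
          (\<lambda>p. frame_coords E c p (b i p) j))"

lemma framedI:
  assumes "\<Union> (fst ` frames E) = points M"
    and "\<And>X. X \<in> frames E ==> case X of (U, b) =>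
      openin (mtop M) U \<and> (\<forall>p\<in>U. basis_of (rk E) (\<lambda>i. b i p) (fib E p))"
    and "\<And>X X'. X \<in> frames E ==> X' \<in> frames E ==> case X of (U, b) => case X' of (V, c) =>
      \<forall>i<rk E. \<forall>j<rk E. continuous_map (mtop_on M (U \<inter> V)) euclideanreal
          (\<lambda>p. frame_coords E c p (b i p) j)"
  shows "framed M E"
  unfolding framed_def
proof (intro conjI)
  show "\<forall>(U, b) \<in> frames E. \<forall>(V, c) \<in> frames E. \<forall>i<rk E. \<forall>j<rk E.
        continuous_map (mtop_on M (U \<inter> V)) euclideanreal
          (\<lambda>p. frame_coords E c p (b i p) j)"
  proof (intro ballI)
    fix X assume X: "X \<in> frames E"
    show "case X of (U, b) => \<forall>(V, c) \<in> frames E. \<forall>i<rk E. \<forall>j<rk E.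
        continuous_map (mtop_on M (U \<inter> V)) euclideanreal
          (\<lambda>p. frame_coords E c p (b i p) j)"
    proof (cases X)
      case (Pair U b)
      show ?thesis unfolding Pair prod.case
      proof (rule ballI)
        fix Y assume Y: "Y \<in> frames E"
        show "case Y of (V, c) => \<forall>i<rk E. \<forall>j<rk E.
          continuous_map (mtop_on M (U \<inter> V)) euclideanreal
          (\<lambda>p. frame_coords E c p (b i p) j)"
          using assms(3)[OF X Y] unfolding Pair prod.case .
      qed
    qed
  qed
qed (use assms(1,2) in blast)+

lemma framedD:
  assumes "framed M E" "(U, b) \<in> frames E"
  shows "openin (mtop M) U" "\<And>p. p \<in> U ==> basis_of (rk E) (\<lambda>i. b i p) (fib E p)"
    "\<And>V c i j. (V, c) \<in> frames E ==> i < rk E ==> j < rk E ==>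
      continuous_map (mtop_on M (U \<inter> V)) euclideanreal
          (\<lambda>p. frame_coords E c p (b i p) j)"
proof -
  note A = assms(1)[unfolded framed_def]
  note B = bspec[OF conjunct1[OF conjunct2[OF A]] assms(2), unfolded prod.case]
  show "openin (mtop M) U" "\<And>p. p \<in> U ==> basis_of (rk E) (\<lambda>i. b i p) (fib E p)"
    using B by simp_all
  fix V c i j assume *: "(V, c) \<in> frames E" "i < rk E" "j < rk E"
  note bspec[OF bspec[OF conjunct2[OF conjunct2[OF A]] assms(2), unfolded prod.case] *(1), unfolded prod.case]
  then show "continuous_map (mtop_on M (U \<inter> V)) euclideanreal
          (\<lambda>p. frame_coords E c p (b i p) j)" using * by simp
qed

lemma framed_cover: "framed M E ==> p \<in> points M ==> \<exists>U b. (U, b) \<in> frames E \<and> p \<in> U"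
  using conjunct1[OF iffD1[OF framed_def]] by fastforce

lemma framed_subset: "framed M E ==> (U, b) \<in> frames E ==> U \<subseteq> points M"
  by (rule openin_subset[OF framedD(1)])

lemma framed_subspace: "framed M E ==> p \<in> points M ==> subspace (fib E p)"
  using framed_cover[of M E p] basis_of_subspace[OF framedD(2)[of M E]] by blast

section \<open>Frames of products, sums and duals\<close>

lemma dsum_bundle_sel [simp]:
  "fib (E \<oplus>\<^sub>b F) p = fib E p \<times> fib F p" "rk (E \<oplus>\<^sub>b F) = rk E + rk F"
  by (simp_all add: dsum_bundle_def)

lemma prod_bundle_sel [simp]:
  "fib (E \<times>\<^sub>b F) (p, q) = fib E p \<times> fib F q" "rk (E \<times>\<^sub>b F) = rk E + rk F"
  by (simp_all add: prod_bundle_def)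

lemma dual_bundle_sel [simp]:
  "fib (dual_bundle E) p = dual_space (fib E p)" "rk (dual_bundle E) = rk E"
  by (simp_all add: dual_bundle_def dual_space_def)

lemma dual_frame_eq:
  "i < rk E ==> (\<lambda>v. representation ((\<lambda>j. b j p) ` {..<rk E}) v (b i p)) =
     (\<lambda>v. frame_coords E b p v i)"
  by (simp add: coords_def)

text \<open>The transition matrix between two concatenated frames is block diagonal.\<close>

lemma coords_append_frame:
  fixes b b' :: "nat => 'v::real_vector" and c c' :: "nat => 'w::real_vector"
  assumes "basis_of k b V" "basis_of l c W" "basis_of k b' V" "basis_of l c' W" "i < k + l"
  shows "coords (k + l) (\<lambda>i. if i < k then (b' i, 0) else (0, c' (i - k)))
      (if i < k then (b i, 0) else (0, c (i - k))) j =
    (if i < k then (if j < k then coords k b' (b i) j else 0)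
     else (if j < k then 0 else coords l c' (c (i - k)) (j - k)))"
proof (cases "i < k")
  case True
  then show ?thesis
    using coords_append[OF assms(3,4) basis_of_mem[OF assms(1) True] subspace_0[OF basis_of_subspace[OF assms(2)]], of j]
      coords_zero[OF assms(4)] by simp
next
  case False
  then have "i - k < l" using assms(5) by simp
  then show ?thesis
    using False coords_append[OF assms(3,4) subspace_0[OF basis_of_subspace[OF assms(1)]] basis_of_mem[OF assms(2)], of "i - k" j]
      coords_zero[OF assms(3)] by simp
qed

abbreviation sum_frame where
  "sum_frame E b c \<equiv> \<lambda>i p. if i < rk E then (b i p, 0) else (0, c (i - rk E) p)"

abbreviation prod_frame where
  "prod_frame E b c \<equiv> \<lambda>i (p, q). if i < rk E then (b i p, 0) else (0, c (i - rk E) q)"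

lemma dsum_frameI:
  "(U, b) \<in> frames E ==> (V, c) \<in> frames F ==>
    (U \<inter> V, sum_frame E b c) \<in> frames (E \<oplus>\<^sub>b F)"
  by (auto simp: dsum_bundle_def)

lemma prod_frameI:
  "(U, b) \<in> frames E ==> (V, c) \<in> frames F ==>
    (U \<times> V, prod_frame E b c) \<in> frames (E \<times>\<^sub>b F)"
  by (auto simp: prod_bundle_def)

lemma prod_manifold_sel [simp]:
  "mtop (prod_manifold M N) = prod_topology (mtop M) (mtop N)"
  "mdim (prod_manifold M N) = mdim M + mdim N"
  by (simp_all add: prod_manifold_def)

text \<open>By block diagonality each entry of a transition matrix is either 0 or an entry for one
  of the factors composed with a projection, which keeps it continuous.\<close>

lemma framed_prod:
  assumes "framed M E" "framed N F"
  shows "framed (prod_manifold M N) (E \<times>\<^sub>b F)"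
proof (rule framedI)
  show "\<Union> (fst ` frames (E \<times>\<^sub>b F)) = points (prod_manifold M N)"
  proof (intro equalityI subsetI)
    fix x assume "x \<in> points (prod_manifold M N)"
    then obtain p q U b V c where "(U, b) \<in> frames E" "p \<in> U" "(V, c) \<in> frames F" "q \<in> V" "x = (p, q)"
      using framed_cover[OF assms(1)] framed_cover[OF assms(2)] by (auto; blast)
    then show "x \<in> \<Union> (fst ` frames (E \<times>\<^sub>b F))"
      using prod_frameI[of U b E V c F] by force
  qed (use framed_subset[OF assms(1)] framed_subset[OF assms(2)] in \<open>force simp: prod_bundle_def\<close>)
next
  fix X assume "X \<in> frames (E \<times>\<^sub>b F)"
  then obtain U b V c where X: "X = (U \<times> V, prod_frame E b c)"
    and fr: "(U, b) \<in> frames E" "(V, c) \<in> frames F"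
    by (auto simp: prod_bundle_def)
  note D = framedD[OF assms(1) fr(1)] framedD[OF assms(2) fr(2)]
  show "case X of (U, b) => openin (mtop (prod_manifold M N)) U \<and>
      (\<forall>p\<in>U. basis_of (rk (E \<times>\<^sub>b F)) (\<lambda>i. b i p) (fib (E \<times>\<^sub>b F) p))"
    unfolding X using D by (auto intro!: basis_of_append simp: openin_prod_Times_iff)
  fix X' assume "X' \<in> frames (E \<times>\<^sub>b F)"
  then obtain U' b' V' c' where X': "X' = (U' \<times> V', prod_frame E b' c')"
    and fr': "(U', b') \<in> frames E" "(V', c') \<in> frames F"
    by (auto simp: prod_bundle_def)
  note D' = framedD[OF assms(1) fr'(1)] framedD[OF assms(2) fr'(2)]
  let ?T = "subtopology (prod_topology (mtop M) (mtop N)) (U \<times> V \<inter> U' \<times> V')"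
  have T: "?T = prod_topology (mtop_on M (U \<inter> U')) (mtop_on N (V \<inter> V'))"
    by (simp only: Times_Int_Times subtopology_Times)
  have "continuous_map ?T euclideanreal
      (\<lambda>x. coords (rk E + rk F) (\<lambda>i. case x of (p, q) => if i < rk E then (b' i p, 0) else (0, c' (i - rk E) q))
         (case x of (p, q) => if i < rk E then (b i p, 0) else (0, c (i - rk E) q)) j)"
    (is "continuous_map _ _ (\<lambda>p. ?C p)")
    if ij: "i < rk E + rk F" "j < rk E + rk F" for i j
  proof -
    consider (1) "i < rk E" "j < rk E" | (2) "(i < rk E) \<noteq> (j < rk E)" | (4) "\<not> i < rk E" "\<not> j < rk E" by blast
    then obtain f where f: "continuous_map ?T euclideanreal f"
      "\<And>p q. p \<in> U \<inter> U' ==> q \<in> V \<inter> V' ==> ?C (p, q) = f (p, q)"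
    proof cases
      case 1
      show ?thesis
      proof (rule that[of "(\<lambda>p. frame_coords E b' p (b i p) j) \<circ> fst"])
        show "continuous_map ?T euclideanreal ((\<lambda>p. frame_coords E b' p (b i p) j) \<circ> fst)"
          unfolding T by (rule continuous_map_compose[OF continuous_map_fst D(3)[OF fr'(1) 1]])
        fix p q assume "p \<in> U \<inter> U'" "q \<in> V \<inter> V'"
        then show "?C (p, q) = ((\<lambda>p. frame_coords E b' p (b i p) j) \<circ> fst) (p, q)"
          using 1 coords_append_frame[OF D(2)[of p] D(5)[of q] D'(2)[of p] D'(5)[of q] ij(1), of j] by simp
      qed
    next
      case 2
      show ?thesis
      proof (rule that[of "\<lambda>_. 0"])
        fix p q assume "p \<in> U \<inter> U'" "q \<in> V \<inter> V'"
        then show "?C (p, q) = 0"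
          using 2 coords_append_frame[OF D(2)[of p] D(5)[of q] D'(2)[of p] D'(5)[of q] ij(1), of j] by auto
      qed simp
    next
      case 4
      then have ij': "i - rk E < rk F" "j - rk E < rk F" using ij by auto
      show ?thesis
      proof (rule that[of "(\<lambda>p. frame_coords F c' p (c (i - rk E) p) (j - rk E)) \<circ> snd"])
        show "continuous_map ?T euclideanreal
          ((\<lambda>p. frame_coords F c' p (c (i - rk E) p) (j - rk E)) \<circ> snd)"
          unfolding T by (rule continuous_map_compose[OF continuous_map_snd D(6)[OF fr'(2) ij']])
        fix p q assume "p \<in> U \<inter> U'" "q \<in> V \<inter> V'"
        then show "?C (p, q) = ((\<lambda>p. frame_coords F c' p (c (i - rk E) p) (j - rk E)) \<circ> snd) (p, q)"
          using 4 ij' coords_append_frame[OF D(2)[of p] D(5)[of q] D'(2)[of p] D'(5)[of q] ij(1), of j] by simp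
      qed
    qed
    show ?thesis by (rule continuous_map_eq[OF f(1)]) (use f(2) in auto)
  qed
  then show "case X of (U, b) => case X' of (V, c) => \<forall>i<rk (E \<times>\<^sub>b F). \<forall>j<rk (E \<times>\<^sub>b F).
        continuous_map (mtop_on (prod_manifold M N) (U \<inter> V)) euclideanreal
          (\<lambda>p. frame_coords (E \<times>\<^sub>b F) c p (b i p) j)"
    unfolding X X' by auto
qed

text \<open>The frames of the sum are those of the product, restricted to the diagonal.\<close>

lemma framed_dsum:
  assumes "framed M E" "framed M F"
  shows "framed M (E \<oplus>\<^sub>b F)"
proof (rule framedI)
  note P = framedD[OF framed_prod[OF assms] prod_frameI]
  show "\<Union> (fst ` frames (E \<oplus>\<^sub>b F)) = points M"
  proof (intro equalityI subsetI)
    fix p assume "p \<in> points M"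
    then obtain U b V c where "(U, b) \<in> frames E" "p \<in> U" "(V, c) \<in> frames F" "p \<in> V"
      using framed_cover[OF assms(1)] framed_cover[OF assms(2)] by blast
    then show "p \<in> \<Union> (fst ` frames (E \<oplus>\<^sub>b F))"
      using dsum_frameI[of U b E V c F] by force
  qed (use framed_subset[OF assms(1)] in \<open>force simp: dsum_bundle_def\<close>)
  fix X assume "X \<in> frames (E \<oplus>\<^sub>b F)"
  then obtain U b V c where X: "X = (U \<inter> V, sum_frame E b c)" and fr: "(U, b) \<in> frames E" "(V, c) \<in> frames F"
    by (auto simp: dsum_bundle_def)
  show "case X of (U, b) => openin (mtop M) U \<and>
      (\<forall>p\<in>U. basis_of (rk (E \<oplus>\<^sub>b F)) (\<lambda>i. b i p) (fib (E \<oplus>\<^sub>b F) p))"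
    unfolding X using framedD(1)[OF assms(1) fr(1)] framedD(1)[OF assms(2) fr(2)] P(2)[OF fr, of "(p, p)" for p] by auto
  fix X' assume "X' \<in> frames (E \<oplus>\<^sub>b F)"
  then obtain U' b' V' c' where X': "X' = (U' \<inter> V', sum_frame E b' c')"
    and fr': "(U', b') \<in> frames E" "(V', c') \<in> frames F"
    by (auto simp: dsum_bundle_def)
  have "continuous_map (mtop_on M (U \<inter> V \<inter> (U' \<inter> V'))) (mtop_on (prod_manifold M M) (U \<times> V \<inter> U' \<times> V')) (\<lambda>p. (p, p))"
    by (rule continuous_map_into_subtopology) (auto simp: continuous_map_pairwise o_def continuous_map_from_subtopology)
  from continuous_map_compose[OF this P(3)[OF fr prod_frameI[OF fr']]]
  show "case X of (U, b) => case X' of (V, c) => \<forall>i<rk (E \<oplus>\<^sub>b F). \<forall>j<rk (E \<oplus>\<^sub>b F).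
        continuous_map (mtop_on M (U \<inter> V)) euclideanreal (\<lambda>p. frame_coords (E \<oplus>\<^sub>b F) c p (b i p) j)"
    unfolding X X' by (simp add: o_def)
qed

text \<open>The transition matrix between dual frames is the transpose of the transition matrix in
  the opposite direction, so its continuity is that of \<open>framed\<close> with the two frames and
  the two indices exchanged, and no matrix is inverted.\<close>

lemma framed_dual:
  assumes "framed M E"
  shows "framed M (dual_bundle E)"
proof (rule framedI)
  have "fst ` frames (dual_bundle E) = fst ` frames E" by (force simp: dual_bundle_def)
  then show "\<Union> (fst ` frames (dual_bundle E)) = points M"
    using assms by (simp add: framed_def)
next
  fix X assume "X \<in> frames (dual_bundle E)"
  then obtain U b where X: "X = (U, \<lambda>i p v. representation ((\<lambda>j. b j p) ` {..<rk E}) v (b i p))"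
    and fr: "(U, b) \<in> frames E" by (auto simp: dual_bundle_def)
  note D = framedD[OF assms fr]
  show "case X of (U, b) => openin (mtop M) U \<and>
      (\<forall>p\<in>U. basis_of (rk (dual_bundle E)) (\<lambda>i. b i p) (fib (dual_bundle E) p))"
  proof -
    have "basis_of (rk E) (\<lambda>i v. representation ((\<lambda>j. b j p) ` {..<rk E}) v (b i p)) (dual_space (fib E p))"
      if "p \<in> U" for p
      by (rule basis_of_cong[THEN iffD1, OF _ dual_basis(1)[OF D(2)[OF that]]])
        (rule dual_frame_eq[symmetric])
    then show ?thesis unfolding X using D(1) by simp
  qed
  fix X' assume "X' \<in> frames (dual_bundle E)"
  then obtain U' b' where X': "X' = (U', \<lambda>i p v. representation ((\<lambda>j. b' j p) ` {..<rk E}) v (b' i p))"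
    and fr': "(U', b') \<in> frames E" by (auto simp: dual_bundle_def)
  note D' = framedD[OF assms fr']
  have "continuous_map (mtop_on M (U \<inter> U')) euclideanreal
     (\<lambda>p. coords (rk E) (\<lambda>k v. representation ((\<lambda>j. b' j p) ` {..<rk E}) v (b' k p))
        (\<lambda>v. representation ((\<lambda>j. b j p) ` {..<rk E}) v (b i p)) j)"
    if ij: "i < rk E" "j < rk E" for i j
  proof (rule continuous_map_eq)
    show "continuous_map (mtop_on M (U \<inter> U')) euclideanreal
       (\<lambda>p. frame_coords E b p (b' j p) i)"
      using D'(3)[OF fr ij(2,1)] by (simp add: Int_commute)
    fix p assume "p \<in> topspace (mtop_on M (U \<inter> U'))"
    then have p: "p \<in> U" "p \<in> U'" by auto
    have "coords (rk E) (\<lambda>k v. representation ((\<lambda>j. b' j p) ` {..<rk E}) v (b' k p))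
        (\<lambda>v. representation ((\<lambda>j. b j p) ` {..<rk E}) v (b i p)) j =
       coords (rk E) (\<lambda>k v. frame_coords E b' p v k) (\<lambda>v. frame_coords E b p v i) j"
      unfolding dual_frame_eq[OF ij(1)] by (rule coords_cong) (rule dual_frame_eq)
    also have "\<dots> = frame_coords E b p (b' j p) i"
      using dual_basis(2)[OF D'(2)[OF p(2)] coords_in_dual_space[OF D(2)[OF p(1)]]] ij by simp
    finally show "frame_coords E b p (b' j p) i = coords (rk E) (\<lambda>k v. representation ((\<lambda>j. b' j p) ` {..<rk E}) v (b' k p))
        (\<lambda>v. representation ((\<lambda>j. b j p) ` {..<rk E}) v (b i p)) j" ..
  qed
  then show "case X of (U, b) => case X' of (V, c) => \<forall>i<rk (dual_bundle E). \<forall>j<rk (dual_bundle E).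
        continuous_map (mtop_on M (U \<inter> V)) euclideanreal
          (\<lambda>p. frame_coords (dual_bundle E) c p (b i p) j)"
    unfolding X X' by auto
qed

lemma dual_frame_coords:
  assumes "framed M E" "(U, b) \<in> frames E" "p \<in> U" "e \<in> dual_space (fib E p)" "i < rk E"
  shows "coords (rk E) (\<lambda>k v. representation ((\<lambda>j. b j p) ` {..<rk E}) v (b k p)) e i = e (b i p)"
proof -
  have "coords (rk E) (\<lambda>k v. representation ((\<lambda>j. b j p) ` {..<rk E}) v (b k p)) e i =
      coords (rk E) (\<lambda>k v. frame_coords E b p v k) e i"
    by (rule coords_cong) (rule dual_frame_eq)
  then show ?thesis using dual_basis(2)[OF framedD(2)[OF assms(1-3)] assms(4)] assms(5) by simp
qed


section \<open>Curves in coordinates\<close>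

text \<open>A class of real functions on the open subsets of an interval that is closed under
  restriction and determined locally. Continuity and local integrability are the instances.\<close>

locale local_class =
  fixes I :: "real set" and Q :: "real set => (real => real) => bool"
  assumes mono: "Q S f ==> openin (top_of_set I) S ==> openin (top_of_set I) T ==> T \<subseteq> S ==> Q T f"
    and loc: "openin (top_of_set I) S ==>
      (\<And>t. t \<in> S ==> \<exists>T. openin (top_of_set I) T \<and> t \<in> T \<and> T \<subseteq> S \<and> Q T f) ==> Q S f"
    and cong: "(\<And>t. t \<in> S ==> f t = g t) ==> Q S f ==> Q S g"

text \<open>With continuity, measurability or local integrability in the role of \<open>Q\<close>,
  this is the coordinate form of the corresponding property of the curve \<open>(x, v)\<close> in
  the total space.\<close>

definition coords_in ::
    "(real set => (real => real) => bool) => real set => ('m, 'v::real_vector) vbundle =>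
      (real => 'm) => (real => 'v) => bool" where
  "coords_in Q I E x v \<longleftrightarrow>
     (\<forall>t\<in>I. v t \<in> fib E (x t)) \<and>
     (\<forall>(U, b) \<in> frames E. \<forall>i<rk E.
        Q {t \<in> I. x t \<in> U} (\<lambda>t. frame_coords E b (x t) (v t) i))"

lemma coords_inD:
  assumes "coords_in Q I E x v"
  shows "t \<in> I ==> v t \<in> fib E (x t)"
    and "(U, b) \<in> frames E ==> i < rk E ==>
      Q {t \<in> I. x t \<in> U} (\<lambda>t. frame_coords E b (x t) (v t) i)"
proof -
  note A = assms[unfolded coords_in_def]
  show "v t \<in> fib E (x t)" if "t \<in> I" using conjunct1[OF A] that by simp
  show "Q {t \<in> I. x t \<in> U} (\<lambda>t. frame_coords E b (x t) (v t) i)"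
    if "(U, b) \<in> frames E" "i < rk E"
    using bspec[OF conjunct2[OF A] that(1), unfolded prod.case] that(2) by simp
qed

lemma coords_inI:
  assumes "\<And>t. t \<in> I ==> v t \<in> fib E (x t)"
    and "\<And>U b i. (U, b) \<in> frames E ==> i < rk E ==> Q {t \<in> I. x t \<in> U} (\<lambda>t. frame_coords E b (x t) (v t) i)"
  shows "coords_in Q I E x v"
  unfolding coords_in_def
proof (intro conjI ballI)
  fix X assume "X \<in> frames E"
  then show "case X of (U, b) => \<forall>i<rk E. Q {t \<in> I. x t \<in> U} (\<lambda>t. frame_coords E b (x t) (v t) i)"
    using assms(2) by (cases X) simp
qed (rule assms(1))

lemma openin_curve_preimage:
  assumes "curve_on I M x" "openin (mtop M) U"
  shows "openin (top_of_set I) {t \<in> I. x t \<in> U}"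
  using openin_continuous_map_preimage[OF assms] by simp

lemma curve_in_points: "curve_on I M x ==> t \<in> I ==> x t \<in> points M"
  by (simp add: continuous_map_def Pi_iff)

lemma continuous_map_curve:
  assumes x: "curve_on I M x"
  shows "continuous_map (top_of_set {t \<in> I. x t \<in> U}) (mtop_on M U) x"
proof (rule continuous_map_into_subtopology)
  have "{t \<in> I. x t \<in> U} \<subseteq> I" by blast
  from continuous_map_from_subtopology[OF x, of "{t \<in> I. x t \<in> U}"]
  show "curve_on {t \<in> I. x t \<in> U} M x"
    unfolding subtopology_subtopology Int_absorb1[OF \<open>{t \<in> I. x t \<in> U} \<subseteq> I\<close>] .
qed auto

lemma continuous_on_curve:
  assumes "curve_on I M x" "continuous_map (mtop_on M U) euclideanreal f"
  shows "continuous_on {t \<in> I. x t \<in> U} (\<lambda>t. f (x t))"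
  using continuous_map_compose[OF continuous_map_curve[OF assms(1)] assms(2)] by (simp add: o_def)

lemma curve_frame:
  assumes "framed M E" "curve_on I M x" "t \<in> I"
  obtains U b where "(U, b) \<in> frames E" "x t \<in> U" "openin (top_of_set I) {t \<in> I. x t \<in> U}"
  using framed_cover[OF assms(1) curve_in_points[OF assms(2,3)]]
    openin_curve_preimage[OF assms(2) framedD(1)[OF assms(1)]] by blast

context local_class
begin

lemma coords_in_prod:
  assumes E: "framed M E" and F: "framed N F"
    and x: "curve_on I M x" and y: "curve_on I N y"
    and v: "coords_in Q I E x v" and w: "coords_in Q I F y w"
  shows "coords_in Q I (E \<times>\<^sub>b F) (\<lambda>t. (x t, y t)) (\<lambda>t. (v t, w t))"
proof -
  have mem: "\<And>t. t \<in> I ==> v t \<in> fib E (x t) \<and> w t \<in> fib F (y t)" using coords_inD(1)[OF v] coords_inD(1)[OF w] by simp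
  show ?thesis
  proof (rule coords_inI)
    fix W d i assume "(W, d) \<in> frames (E \<times>\<^sub>b F)" and i: "i < rk (E \<times>\<^sub>b F)"
    then obtain U b V c where W: "W = U \<times> V" "d = prod_frame E b c" and fr: "(U, b) \<in> frames E" "(V, c) \<in> frames F"
      by (auto simp: prod_bundle_def)
    have opE: "openin (top_of_set I) {t \<in> I. x t \<in> U}" by (rule openin_curve_preimage[OF x framedD(1)[OF E fr(1)]])
    have opF: "openin (top_of_set I) {t \<in> I. y t \<in> V}" by (rule openin_curve_preimage[OF y framedD(1)[OF F fr(2)]])
    have eq: "{t \<in> I. (x t, y t) \<in> W} = {t \<in> I. x t \<in> U} \<inter> {t \<in> I. y t \<in> V}" unfolding W by blast
    have op: "openin (top_of_set I) {t \<in> I. (x t, y t) \<in> W}" unfolding eq using opE opF by (rule openin_Int)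
    show "Q {t \<in> I. (x t, y t) \<in> W} (\<lambda>t. frame_coords (E \<times>\<^sub>b F) d (x t, y t) (v t, w t) i)"
    proof (rule cong)
      show "Q {t \<in> I. (x t, y t) \<in> W} (\<lambda>t. if i < rk E then frame_coords E b (x t) (v t) i
        else frame_coords F c (y t) (w t) (i - rk E))"
      proof (cases "i < rk E")
        case True
        then show ?thesis using mono[OF coords_inD(2)[OF v fr(1) True] opE op] by (simp add: eq)
      next
        case False
        then have "i - rk E < rk F" using i by auto
        then show ?thesis using False mono[OF coords_inD(2)[OF w fr(2)] opF op] by (simp add: eq)
      qed
      fix t assume "t \<in> {t \<in> I. (x t, y t) \<in> W}"
      then show "(if i < rk E then frame_coords E b (x t) (v t) i
        else frame_coords F c (y t) (w t) (i - rk E)) = frame_coords (E \<times>\<^sub>b F) d (x t, y t) (v t, w t) i"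
        using coords_append[OF framedD(2)[OF E fr(1), of "x t"] framedD(2)[OF F fr(2), of "y t"], of "v t" "w t"] mem
        by (auto simp: W)
    qed
  qed (use mem in auto)
qed

text \<open>From left to right, a coordinate of \<open>v\<close> is a coordinate of the pair only
  where a frame of \<open>F\<close> is defined as well; \<open>Q\<close> is therefore known on
  pieces of the preimage of \<open>U\<close> and is glued by \<open>loc\<close>. From right to left
  the pair is a curve in the product bundle over the diagonal.\<close>

lemma coords_in_dsum:
  assumes E: "framed M E" and F: "framed M F" and x: "curve_on I M x"
  shows "coords_in Q I (E \<oplus>\<^sub>b F) x (\<lambda>t. (v t, w t)) \<longleftrightarrow> coords_in Q I E x v \<and> coords_in Q I F x w"
    (is "?L \<longleftrightarrow> ?R1 \<and> ?R2")
proof -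
  have op: "openin (top_of_set I) {t \<in> I. x t \<in> U \<inter> V}"
    if "(U, b) \<in> frames E" "(V, c) \<in> frames F" for U b V c
    by (rule openin_curve_preimage[OF x openin_Int[OF framedD(1)[OF E that(1)] framedD(1)[OF F that(2)]]])
  have opE: "openin (top_of_set I) {t \<in> I. x t \<in> U}" if "(U, b) \<in> frames E" for U b
    by (rule openin_curve_preimage[OF x framedD(1)[OF E that]])
  have opF: "openin (top_of_set I) {t \<in> I. x t \<in> U}" if "(U, b) \<in> frames F" for U b
    by (rule openin_curve_preimage[OF x framedD(1)[OF F that]])
  have co: "coords (rk E + rk F) (\<lambda>i. if i < rk E then (b i (x t), 0) else (0, c (i - rk E) (x t))) (v t, w t) i =
     (if i < rk E then frame_coords E b (x t) (v t) i
      else frame_coords F c (x t) (w t) (i - rk E))"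
    if "(U, b) \<in> frames E" "(V, c) \<in> frames F" "x t \<in> U" "x t \<in> V" "v t \<in> fib E (x t)" "w t \<in> fib F (x t)"
    for U b V c t i
    using coords_append[OF framedD(2)[OF E that(1,3)] framedD(2)[OF F that(2,4)] that(5,6)] .
  show ?thesis
  proof (intro iffI)
    assume L: ?L
    have mem: "\<And>t. t \<in> I ==> v t \<in> fib E (x t) \<and> w t \<in> fib F (x t)" using coords_inD(1)[OF L] by auto
    have Qs: "Q {t \<in> I. x t \<in> U \<inter> V} (\<lambda>t. if i < rk E then frame_coords E b (x t) (v t) i
      else frame_coords F c (x t) (w t) (i - rk E))"
      if fr: "(U, b) \<in> frames E" "(V, c) \<in> frames F" and i: "i < rk E + rk F" for U b V c i
    proof -
      have "(U \<inter> V, sum_frame E b c) \<in> frames (E \<oplus>\<^sub>b F)"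
        using fr by (auto simp: dsum_bundle_def)
      from coords_inD(2)[OF L this, of i] i
      have "Q {t \<in> I. x t \<in> U \<inter> V} (\<lambda>t. coords (rk E + rk F)
         (\<lambda>i. if i < rk E then (b i (x t), 0) else (0, c (i - rk E) (x t))) (v t, w t) i)" by simp
      then show ?thesis by (rule cong[rotated]) (use co[OF fr] mem in auto)
    qed
    have ?R1
    proof (rule coords_inI)
      fix U b i assume fr: "(U, b) \<in> frames E" and i: "i < rk E"
      show "Q {t \<in> I. x t \<in> U} (\<lambda>t. frame_coords E b (x t) (v t) i)"
      proof (rule loc[OF opE[OF fr]])
        fix t assume t: "t \<in> {t \<in> I. x t \<in> U}"
        then obtain V c where V: "(V, c) \<in> frames F" "x t \<in> V"
          using framed_cover[OF F] curve_in_points[OF x] by blast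
        have "Q {t \<in> I. x t \<in> U \<inter> V} (\<lambda>t. frame_coords E b (x t) (v t) i)"
          using Qs[OF fr V(1), of i] i by simp
        then show "\<exists>T. openin (top_of_set I) T \<and> t \<in> T \<and> T \<subseteq> {t \<in> I. x t \<in> U} \<and>
            Q T (\<lambda>t. frame_coords E b (x t) (v t) i)"
          using op[OF fr V(1)] t V(2) by (intro exI[of _ "{t \<in> I. x t \<in> U \<inter> V}"]) auto
      qed
    qed (use mem in blast)
    moreover have ?R2
    proof (rule coords_inI)
      fix V c i assume fr: "(V, c) \<in> frames F" and i: "i < rk F"
      show "Q {t \<in> I. x t \<in> V} (\<lambda>t. frame_coords F c (x t) (w t) i)"
      proof (rule loc[OF opF[OF fr]])
        fix t assume t: "t \<in> {t \<in> I. x t \<in> V}"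
        then obtain U b where U: "(U, b) \<in> frames E" "x t \<in> U"
          using framed_cover[OF E] curve_in_points[OF x] by blast
        have "Q {t \<in> I. x t \<in> U \<inter> V} (\<lambda>t. frame_coords F c (x t) (w t) i)"
          using Qs[OF U(1) fr, of "rk E + i"] i by simp
        then show "\<exists>T. openin (top_of_set I) T \<and> t \<in> T \<and> T \<subseteq> {t \<in> I. x t \<in> V} \<and>
            Q T (\<lambda>t. frame_coords F c (x t) (w t) i)"
          using op[OF U(1) fr] t U(2) by (intro exI[of _ "{t \<in> I. x t \<in> U \<inter> V}"]) auto
      qed
    qed (use mem in blast)
    ultimately show "?R1 \<and> ?R2" ..
  next
    assume R: "?R1 \<and> ?R2"
    have mem: "\<And>t. t \<in> I ==> v t \<in> fib E (x t) \<and> w t \<in> fib F (x t)" using coords_inD(1)[OF conjunct1[OF R]] coords_inD(1)[OF conjunct2[OF R]] by simp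
    have "coords_in Q I (E \<times>\<^sub>b F) (\<lambda>t. (x t, x t)) (\<lambda>t. (v t, w t))"
      using coords_in_prod[OF E F x x] R by blast
    note c = coords_inD(2)[OF this prod_frameI]
    show ?L
    proof (rule coords_inI)
      fix W d i assume "(W, d) \<in> frames (E \<oplus>\<^sub>b F)" and i: "i < rk (E \<oplus>\<^sub>b F)"
      then obtain U b V c where W: "W = U \<inter> V" "d = sum_frame E b c" and fr: "(U, b) \<in> frames E" "(V, c) \<in> frames F"
        by (auto simp: dsum_bundle_def)
      show "Q {t \<in> I. x t \<in> W} (\<lambda>t. frame_coords (E \<oplus>\<^sub>b F) d (x t) (v t, w t) i)"
        using c[OF fr, of i] i unfolding W by simp
    qed (use mem in auto)
  qed
qed

end

section \<open>Calculus in coordinates\<close>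

lemma Euclidean_space_eq: "Euclidean_space n = top_of_set {x. \<forall>i\<ge>n. x i = 0}"
  by (simp add: Euclidean_space_def euclidean_product_topology)

text \<open>A basic open set of the product topology gives one radius per coordinate. Points of the
  space vanish from index \<open>n\<close> on, so only finitely many radii count and their minimum
  works.\<close>

lemma Euclidean_space_box:
  assumes W: "openin (Euclidean_space n) W" and z: "z \<in> W"
  obtains \<delta> where "\<delta> > 0" "\<And>w. (\<And>i. i < n ==> \<bar>w i - z i\<bar> < \<delta>) ==> (\<And>i. i \<ge> n ==> w i = 0) ==> w \<in> W"
proof -
  obtain O' where O': "open O'" "W = O' \<inter> {x. \<forall>i\<ge>n. x i = 0}"
    using W by (auto simp: Euclidean_space_eq openin_open)
  have "openin (product_topology (\<lambda>i. euclidean::real topology) UNIV) O'"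
    using O'(1) by (simp add: euclidean_product_topology)
  then obtain X where X: "z \<in> PiE UNIV X" "\<And>i. openin (euclidean::real topology) (X i)"
    "finite {i. X i \<noteq> topspace (euclidean::real topology)}" "PiE UNIV X \<subseteq> O'"
    using product_topology_open_contains_basis[of "\<lambda>i. euclidean" UNIV O' z] z O'(2) by auto
  have "\<exists>d>0. \<forall>y. \<bar>y - z i\<bar> < d \<longrightarrow> y \<in> X i" for i
  proof -
    have "open (X i)" "z i \<in> X i" using X(1,2) by (auto simp: PiE_def Pi_iff)
    then show ?thesis unfolding open_dist by (auto simp: dist_real_def)
  qed
  then obtain d where d: "\<And>i. d i > 0" "\<And>i y. \<bar>y - z i\<bar> < d i ==> y \<in> X i" by metis
  \<comment> \<open>The element 1 keeps the set nonempty in dimension 0.\<close>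
  define \<delta> where "\<delta> = Min (insert 1 (d ` {..<n}))"
  have "\<delta> > 0" using d(1) by (simp add: \<delta>_def)
  moreover have "w \<in> W" if w: "\<And>i. i < n ==> \<bar>w i - z i\<bar> < \<delta>" "\<And>i. i \<ge> n ==> w i = 0" for w
  proof -
    have "w i \<in> X i" for i
    proof (cases "i < n")
      case True
      then have "\<delta> \<le> d i" by (simp add: \<delta>_def)
      then show ?thesis using w(1)[OF True] d(2)[of "w i" i] by simp
    next
      case False
      then have "w i = z i" using w(2) z O'(2) by simp
      then show ?thesis using d[of i] d(2)[of "w i" i] by simp
    qed
    then have "w \<in> O'" using X(4) by (auto simp: PiE_def)
    then show ?thesis using w(2) O'(2) by simp
  qed
  ultimately show ?thesis using that by blast
qed

text \<open>A mean value theorem without an order on the end points: a coordinate of a curve may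
  move in either direction or not at all.\<close>

lemma mvt_symmetric:
  fixes f :: "real => real"
  assumes "\<And>r. \<bar>r - a\<bar> \<le> \<bar>b - a\<bar> ==> (f has_real_derivative f' r) (at r)"
  obtains r where "\<bar>r - a\<bar> \<le> \<bar>b - a\<bar>" "f b - f a = (b - a) * f' r"
proof -
  consider "a < b" | "a = b" | "b < a" by linarith
  then show ?thesis
  proof cases
    case 1
    then obtain r where "a < r" "r < b" "f b - f a = (b - a) * f' r" using MVT2[of a b f f'] assms by force
    then show ?thesis using that[of r] by auto
  next
    case 2
    then show ?thesis using that[of a] by simp
  next
    case 3
    then obtain r where "b < r" "r < a" "f a - f b = (a - b) * f' r" using MVT2[of b a f f'] assms by force
    then show ?thesis using that[of r] by (auto simp: algebra_simps)
  qed
qed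

text \<open>The increment is telescoped along a path that changes one coordinate at a time.\<close>

lemma chain_rule_partial:
  assumes W: "openin (Euclidean_space n) W" and f: "Ck (Suc 0) n W f"
    and \<gamma>: "\<And>i. i < n ==> ((\<lambda>s. \<gamma> s i) has_real_derivative v i) (at t within S)"
    and mem: "\<And>s. s \<in> S ==> \<gamma> s \<in> W" and t: "t \<in> S"
  shows "((\<lambda>s. f (\<gamma> s)) has_real_derivative (\<Sum>i<n. partial i f (\<gamma> t) * v i)) (at t within S)"
proof -
  let ?z = "\<gamma> t"
  have W0: "w i = 0" if "w \<in> W" "i \<ge> n" for w i
    using openin_subset[OF W] that by (auto simp: topspace_Euclidean_space)
  \<comment> \<open>The corner of the path from \<open>?z\<close> to the curve point at which the
    first \<open>k\<close> coordinates have been moved.\<close>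
  define zz where "zz k s = (\<lambda>i. if i < k then \<gamma> s i else ?z i)" for k :: nat and s
  have der: "((\<lambda>r. f (w(k := r))) has_real_derivative partial k f w) (at (w k))" if "w \<in> W" "k < n" for w k
    using f that unfolding partial_def by (simp add: field_differentiable_derivI)
  obtain \<delta> where \<delta>: "\<delta> > 0"
    "\<And>w. (\<And>i. i < n ==> \<bar>w i - ?z i\<bar> < \<delta>) ==> (\<And>i. i \<ge> n ==> w i = 0) ==> w \<in> W"
    using Euclidean_space_box[OF W mem[OF t]] by blast
  have \<gamma>lim: "((\<lambda>s. \<gamma> s i) \<longlongrightarrow> ?z i) (at t within S)" if "i < n" for i
    using has_field_derivative_imp_has_derivative[OF \<gamma>[OF that]] has_derivative_continuous
    by (metis continuous_within)
  have close: "\<forall>\<^sub>F s in at t within S. \<forall>i<n. \<bar>\<gamma> s i - ?z i\<bar> < e" if e: "e > 0" for e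
  proof -
    have "\<forall>\<^sub>F s in at t within S. \<forall>i\<in>{..<n}. \<bar>\<gamma> s i - ?z i\<bar> < e"
      using \<gamma>lim tendstoD[OF \<gamma>lim e] by (intro eventually_ball_finite) (auto simp: dist_real_def)
    then show ?thesis by (simp add: Ball_def)
  qed
  have step: "((\<lambda>s. (f (zz (Suc k) s) - f (zz k s)) / (s - t)) \<longlongrightarrow> partial k f ?z * v k) (at t within S)"
    if k: "k < n" for k
  proof -
    \<comment> \<open>\<open>r\<close> is a mean value point on the edge from \<open>zz k s\<close>
      to \<open>zz (Suc k) s\<close>. It is kept no farther from \<open>?z k\<close> than
      \<open>\<gamma> s k\<close>, so it converges to \<open>?z k\<close> and the continuity of the
      partial derivative at \<open>?z\<close> applies.\<close>
    define P where "P s r \<longleftrightarrow> \<bar>r - ?z k\<bar> \<le> \<bar>\<gamma> s k - ?z k\<bar> \<and>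
      f (zz (Suc k) s) - f (zz k s) = (\<gamma> s k - ?z k) * partial k f ((zz k s)(k := r))" for s r
    define \<theta> where "\<theta> s = (SOME r. P s r)" for s
    have box: "(zz k s)(k := r) \<in> W" if "s \<in> S" "\<forall>i<n. \<bar>\<gamma> s i - ?z i\<bar> < \<delta>" "\<bar>r - ?z k\<bar> \<le> \<bar>\<gamma> s k - ?z k\<bar>" for s r
      using that W0[OF mem[OF that(1)]] W0[OF mem[OF t]] k \<delta>(1)
      by (intro \<delta>(2)) (auto simp: zz_def intro: le_less_trans)
    have P: "P s (\<theta> s)" if s: "s \<in> S" "\<forall>i<n. \<bar>\<gamma> s i - ?z i\<bar> < \<delta>" for s
    proof -
      have "((\<lambda>r. f ((zz k s)(k := r))) has_real_derivative partial k f ((zz k s)(k := r))) (at r)"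
        if "\<bar>r - ?z k\<bar> \<le> \<bar>\<gamma> s k - ?z k\<bar>" for r
        using der[OF box[OF s that] k] by simp
      then obtain r where r: "\<bar>r - ?z k\<bar> \<le> \<bar>\<gamma> s k - ?z k\<bar>"
        "f ((zz k s)(k := \<gamma> s k)) - f ((zz k s)(k := ?z k)) = (\<gamma> s k - ?z k) * partial k f ((zz k s)(k := r))"
        using mvt_symmetric[of "?z k" "\<gamma> s k" "\<lambda>r. f ((zz k s)(k := r))"
            "\<lambda>r. partial k f ((zz k s)(k := r))"] by blast
      moreover have "(zz k s)(k := \<gamma> s k) = zz (Suc k) s" "(zz k s)(k := ?z k) = zz k s"
        by (auto simp: zz_def fun_eq_iff less_Suc_eq)
      ultimately have "P s r" unfolding P_def by simp
      then show ?thesis unfolding \<theta>_def by (rule someI)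
    qed
    have lim: "((\<lambda>s. partial k f ((zz k s)(k := \<theta> s))) \<longlongrightarrow> partial k f ?z) (at t within S)"
    proof (rule tendstoI)
      fix e :: real assume e: "e > 0"
      have "continuous_map (subtopology (Euclidean_space n) W) euclideanreal (partial k f)"
        using f k by simp
      from openin_continuous_map_preimage[OF this, of "ball (partial k f ?z) e"]
      have op: "openin (Euclidean_space n) {w \<in> W. partial k f w \<in> ball (partial k f ?z) e}"
        using W openin_subset[OF W] by (simp add: openin_open_subtopology Int_absorb1)
      then obtain \<delta>' where \<delta>': "\<delta>' > 0" "\<And>w. (\<And>i. i < n ==> \<bar>w i - ?z i\<bar> < \<delta>') ==> (\<And>i. i \<ge> n ==> w i = 0) ==>
          w \<in> {w \<in> W. partial k f w \<in> ball (partial k f ?z) e}"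
      proof -
        have "?z \<in> {w \<in> W. partial k f w \<in> ball (partial k f ?z) e}" using mem[OF t] e by simp
        from Euclidean_space_box[OF op this] show ?thesis using that by blast
      qed
      have "\<forall>\<^sub>F s in at t within S. s \<in> S \<and> (\<forall>i<n. \<bar>\<gamma> s i - ?z i\<bar> < \<delta>) \<and> (\<forall>i<n. \<bar>\<gamma> s i - ?z i\<bar> < \<delta>')"
        using close[OF \<delta>(1)] close[OF \<delta>'(1)] by (intro eventually_conj) (auto simp: eventually_at_filter)
      then show "\<forall>\<^sub>F s in at t within S. dist (partial k f ((zz k s)(k := \<theta> s))) (partial k f ?z) < e"
      proof (rule eventually_mono)
        fix s assume s: "s \<in> S \<and> (\<forall>i<n. \<bar>\<gamma> s i - ?z i\<bar> < \<delta>) \<and> (\<forall>i<n. \<bar>\<gamma> s i - ?z i\<bar> < \<delta>')"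
        then have "\<bar>\<theta> s - ?z k\<bar> \<le> \<bar>\<gamma> s k - ?z k\<bar>" using P[of s] unfolding P_def by blast
        moreover have "\<bar>\<gamma> s k - ?z k\<bar> < \<delta>'" using s k by blast
        ultimately have "(zz k s)(k := \<theta> s) \<in> {w \<in> W. partial k f w \<in> ball (partial k f ?z) e}"
          using s k W0[OF mem[of s]] W0[OF mem[OF t]] \<delta>'(1) by (intro \<delta>'(2)) (auto simp: zz_def)
        then show "dist (partial k f ((zz k s)(k := \<theta> s))) (partial k f ?z) < e" by (simp add: dist_commute)
      qed
    qed
    have "((\<lambda>s. (\<gamma> s k - ?z k) / (s - t)) \<longlongrightarrow> v k) (at t within S)"
      using \<gamma>[OF k] by (simp add: has_field_derivative_iff)
    from tendsto_mult[OF lim this]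
    show ?thesis
    proof (rule Lim_transform_eventually)
      have "\<forall>\<^sub>F s in at t within S. s \<in> S \<and> (\<forall>i<n. \<bar>\<gamma> s i - ?z i\<bar> < \<delta>)"
        using close[OF \<delta>(1)] by (intro eventually_conj) (auto simp: eventually_at_filter)
      then show "\<forall>\<^sub>F s in at t within S. partial k f ((zz k s)(k := \<theta> s)) * ((\<gamma> s k - ?z k) / (s - t)) =
          (f (zz (Suc k) s) - f (zz k s)) / (s - t)"
      proof (rule eventually_mono)
        fix s assume "s \<in> S \<and> (\<forall>i<n. \<bar>\<gamma> s i - ?z i\<bar> < \<delta>)"
        then have "f (zz (Suc k) s) - f (zz k s) = (\<gamma> s k - ?z k) * partial k f ((zz k s)(k := \<theta> s))"
          using P[of s] unfolding P_def by blast
        then show "partial k f ((zz k s)(k := \<theta> s)) * ((\<gamma> s k - ?z k) / (s - t)) =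
          (f (zz (Suc k) s) - f (zz k s)) / (s - t)" by simp
      qed
    qed
  qed
  have "((\<lambda>s. \<Sum>k<n. (f (zz (Suc k) s) - f (zz k s)) / (s - t)) \<longlongrightarrow> (\<Sum>k<n. partial k f ?z * v k)) (at t within S)"
    by (intro tendsto_sum step) simp
  then have "((\<lambda>s. (f (\<gamma> s) - f ?z) / (s - t)) \<longlongrightarrow> (\<Sum>k<n. partial k f ?z * v k)) (at t within S)"
  proof (rule Lim_transform_eventually)
    have "\<forall>\<^sub>F s in at t within S. s \<in> S" by (simp add: eventually_at_filter)
    then show "\<forall>\<^sub>F s in at t within S. (\<Sum>k<n. (f (zz (Suc k) s) - f (zz k s)) / (s - t)) = (f (\<gamma> s) - f ?z) / (s - t)"
    proof (rule eventually_mono)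
      fix s assume s: "s \<in> S"
      have "zz n s = \<gamma> s" "zz 0 s = ?z"
        using W0[OF mem[OF s]] W0[OF mem[OF t]] by (auto simp: zz_def fun_eq_iff)
      then show "(\<Sum>k<n. (f (zz (Suc k) s) - f (zz k s)) / (s - t)) = (f (\<gamma> s) - f ?z) / (s - t)"
        by (simp flip: sum_divide_distrib add: sum_lessThan_telescope[of "\<lambda>k. f (zz k s)"])
    qed
  qed
  then show ?thesis by (simp add: has_field_derivative_iff)
qed

section \<open>Functions of class \<open>C\<^sup>k\<close>\<close>

lemma open_slice:
  assumes W: "openin (Euclidean_space n) W" and z: "z \<in> W" and i: "i < n"
  shows "\<forall>\<^sub>F s in nhds (z i). z(i := s) \<in> W"
proof -
  obtain \<delta> where \<delta>: "\<delta> > 0"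
    "\<And>w. (\<And>i. i < n ==> \<bar>w i - z i\<bar> < \<delta>) ==> (\<And>i. i \<ge> n ==> w i = 0) ==> w \<in> W"
    using Euclidean_space_box[OF W z] by blast
  have z0: "z j = 0" if "j \<ge> n" for j
    using openin_subset[OF W] z that by (auto simp: topspace_Euclidean_space)
  show ?thesis unfolding eventually_nhds_metric
    using \<delta>(1) i z0 by (intro exI[of _ \<delta>]) (auto simp: dist_real_def intro!: \<delta>(2))
qed

text \<open>On an open set a coordinate line through a point stays inside for a while, so
  derivatives along it see only the values on the set. Functions may thus be replaced by any
  expression that equals them on a chart image.\<close>

lemma partial_cong:
  assumes W: "openin (Euclidean_space n) W" and eq: "\<And>z. z \<in> W ==> f z = g z" and z: "z \<in> W" and i: "i < n"
  shows "partial i f z = partial i g z"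
    and "(\<lambda>s. f (z(i := s))) field_differentiable at (z i) \<longleftrightarrow> (\<lambda>s. g (z(i := s))) field_differentiable at (z i)"
proof -
  have ev: "\<forall>\<^sub>F s in nhds (z i). f (z(i := s)) = g (z(i := s))"
    using open_slice[OF W z i] by (rule eventually_mono) (rule eq)
  show "partial i f z = partial i g z" unfolding partial_def by (rule deriv_cong_ev[OF ev refl])
  show "(\<lambda>s. f (z(i := s))) field_differentiable at (z i) \<longleftrightarrow> (\<lambda>s. g (z(i := s))) field_differentiable at (z i)"
    unfolding field_differentiable_def using DERIV_cong_ev[OF refl ev refl] by simp
qed

lemma Ck_cong:
  assumes W: "openin (Euclidean_space n) W" and "\<And>z. z \<in> W ==> f z = g z" "Ck k n W f"
  shows "Ck k n W g"
  using assms(2,3)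
proof (induction k arbitrary: f g)
  case 0
  then show ?case using continuous_map_eq[of "subtopology (Euclidean_space n) W" euclideanreal f g] by simp
next
  case (Suc k)
  have c: "continuous_map (subtopology (Euclidean_space n) W) euclideanreal g"
    using Suc.prems continuous_map_eq[of "subtopology (Euclidean_space n) W" euclideanreal f g] by simp
  have "Ck k n W (partial i g)" if "i < n" for i
  proof (rule Suc.IH[of "partial i f"])
    show "partial i f z = partial i g z" if "z \<in> W" for z
      by (rule partial_cong(1)[OF W Suc.prems(1) that \<open>i < n\<close>])
  qed (use Suc.prems(2) that in simp)
  moreover have "(\<lambda>s. g (z(i := s))) field_differentiable at (z i)" if "z \<in> W" "i < n" for z i
    using partial_cong(2)[where f=f and g=g, OF W Suc.prems(1) that] Suc.prems(2) that by simp
  ultimately show ?case using c by simp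
qed

lemma Ck_subset: "Ck k n W f ==> V \<subseteq> W ==> Ck k n V f"
proof (induction k arbitrary: f)
  case 0
  then show ?case using continuous_map_from_subtopology_mono by auto
next
  case (Suc k)
  then have "continuous_map (subtopology (Euclidean_space n) V) euclideanreal f"
    using continuous_map_from_subtopology_mono by fastforce
  then show ?case using Suc by auto
qed

lemma continuous_map_locally:
  assumes "\<And>a. a \<in> topspace X ==> \<exists>T. openin X T \<and> a \<in> T \<and> continuous_map (subtopology X T) Y f"
  shows "continuous_map X Y f"
  unfolding continuous_map_def
proof (intro conjI allI impI)
  show "f \<in> topspace X \<rightarrow> topspace Y"
  proof
    fix a assume a: "a \<in> topspace X"
    then obtain T where "a \<in> T" "continuous_map (subtopology X T) Y f" using assms by blast
    then show "f a \<in> topspace Y" using a by (auto simp: continuous_map_def Pi_iff)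
  qed
  fix U assume U: "openin Y U"
  show "openin X {x \<in> topspace X. f x \<in> U}"
    unfolding openin_subopen[of X "{x \<in> topspace X. f x \<in> U}"]
  proof
    fix a assume a: "a \<in> {x \<in> topspace X. f x \<in> U}"
    then obtain T where T: "openin X T" "a \<in> T" "continuous_map (subtopology X T) Y f" using assms by blast
    have "openin (subtopology X T) {x \<in> topspace (subtopology X T). f x \<in> U}"
      by (rule openin_continuous_map_preimage[OF T(3) U])
    then have "openin X {x \<in> topspace (subtopology X T). f x \<in> U}"
      using T(1) by (simp add: openin_open_subtopology)
    then show "\<exists>T. openin X T \<and> a \<in> T \<and> T \<subseteq> {x \<in> topspace X. f x \<in> U}"
      using a T(2) by (intro exI[of _ "{x \<in> topspace (subtopology X T). f x \<in> U}"]) auto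
  qed
qed

lemma Ck_local:
  assumes "W \<subseteq> topspace (Euclidean_space n)"
    and "\<And>z. z \<in> W ==> \<exists>V. openin (Euclidean_space n) V \<and> z \<in> V \<and> V \<subseteq> W \<and> Ck k n V f"
  shows "Ck k n W f"
proof -
  have c: "continuous_map (subtopology (Euclidean_space n) W) euclideanreal f"
    if *: "\<And>z. z \<in> W ==> \<exists>V. openin (Euclidean_space n) V \<and> z \<in> V \<and> V \<subseteq> W \<and>
      continuous_map (subtopology (Euclidean_space n) V) euclideanreal f" for f
  proof (rule continuous_map_locally)
    fix z assume "z \<in> topspace (subtopology (Euclidean_space n) W)"
    then have "z \<in> W" by simp
    from *[OF this] obtain V where V: "openin (Euclidean_space n) V" "z \<in> V" "V \<subseteq> W"
      "continuous_map (subtopology (Euclidean_space n) V) euclideanreal f" by blast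
    have "openin (subtopology (Euclidean_space n) W) V"
      unfolding openin_subtopology using V(1,3) by (intro exI[of _ V]) auto
    with V show "\<exists>T. openin (subtopology (Euclidean_space n) W) T \<and> z \<in> T \<and>
        continuous_map (subtopology (subtopology (Euclidean_space n) W) T) euclideanreal f"
      by (intro exI[of _ V]) (simp add: subtopology_subtopology Int_absorb1)
  qed
  show ?thesis using assms(2)
  proof (induction k arbitrary: f)
    case 0
    then show ?case using c[of f] by simp
  next
    case (Suc k)
    have "continuous_map (subtopology (Euclidean_space n) W) euclideanreal f"
    proof (rule c)
      fix z assume "z \<in> W"
      then show "\<exists>V. openin (Euclidean_space n) V \<and> z \<in> V \<and> V \<subseteq> W \<and>
          continuous_map (subtopology (Euclidean_space n) V) euclideanreal f"
        using Suc.prems[of z] by fastforce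
    qed
    moreover have "Ck k n W (partial i f)" if "i < n" for i
    proof (rule Suc.IH)
      fix z assume "z \<in> W"
      then show "\<exists>V. openin (Euclidean_space n) V \<and> z \<in> V \<and> V \<subseteq> W \<and> Ck k n V (partial i f)"
        using Suc.prems[of z] that by fastforce
    qed
    moreover have "(\<lambda>s. f (z(i := s))) field_differentiable at (z i)" if "z \<in> W" "i < n" for z i
      using Suc.prems[OF that(1)] that(2) by auto
    ultimately show ?case by simp
  qed
qed

lemma partial_const [simp]: "partial i (\<lambda>_. c) = (\<lambda>_. 0)"
  by (simp add: partial_def fun_eq_iff)

lemma Ck_const: "Ck k n W (\<lambda>_. c)"
  by (induction k arbitrary: c) auto

lemma Ck_add:
  assumes W: "openin (Euclidean_space n) W" and "Ck k n W f" "Ck k n W g"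
  shows "Ck k n W (\<lambda>z. f z + g z)"
  using assms(2,3)
proof (induction k arbitrary: f g)
  case 0
  then show ?case by (auto intro: continuous_map_add)
next
  case (Suc k)
  have "Ck k n W (partial i (\<lambda>z. f z + g z))" if i: "i < n" for i
  proof (rule Ck_cong[OF W _ Suc.IH[of "partial i f" "partial i g"]])
    fix z assume "z \<in> W"
    then show "partial i f z + partial i g z = partial i (\<lambda>z. f z + g z) z"
      using Suc.prems i unfolding partial_def by simp
  qed (use Suc.prems i in auto)
  moreover have "(\<lambda>s. f (z(i := s)) + g (z(i := s))) field_differentiable at (z i)" if "z \<in> W" "i < n" for z i
    using Suc.prems that by (intro field_differentiable_add) auto
  ultimately show ?case using Suc.prems by (auto intro: continuous_map_add)
qed

text \<open>Precomposition with a map that either ignores the coordinate \<open>i\<close> or passes it on as the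
  coordinate \<open>\<sigma> i\<close>; projections and slices of products are of this kind.\<close>

lemma Ck_reindex:
  assumes T: "continuous_map (subtopology (Euclidean_space n) V) (subtopology (Euclidean_space m) W) T"
    and pass: "\<And>i z s. i < n ==> i \<in> A ==> T (z(i := s)) = (T z)(\<sigma> i := s)"
    and pass': "\<And>i z. i < n ==> i \<in> A ==> \<sigma> i < m \<and> T z (\<sigma> i) = z i"
    and ign: "\<And>i z s. i < n ==> i \<notin> A ==> T (z(i := s)) = T z"
    and V: "V \<subseteq> topspace (Euclidean_space n)"
    and f: "Ck k m W f"
  shows "Ck k n V (\<lambda>z. f (T z))"
  using f
proof (induction k arbitrary: f)
  case 0
  then show ?case using continuous_map_compose[OF T, of euclideanreal f] by (simp add: o_def)
next
  case (Suc k)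
  have TW: "T z \<in> W" if "z \<in> V" for z
    using T that V by (auto simp: continuous_map_def Pi_iff)
  have c: "continuous_map (subtopology (Euclidean_space n) V) euclideanreal (\<lambda>z. f (T z))"
    using continuous_map_compose[OF T, of euclideanreal f] Suc.prems by (simp add: o_def)
  have p: "partial i (\<lambda>z. f (T z)) = (if i \<in> A then (\<lambda>z. partial (\<sigma> i) f (T z)) else (\<lambda>_. 0))" if "i < n" for i
  proof (rule ext)
    fix z
    show "partial i (\<lambda>z. f (T z)) z = (if i \<in> A then (\<lambda>z. partial (\<sigma> i) f (T z)) else (\<lambda>_. 0)) z"
      using pass[OF that] pass'[OF that] ign[OF that] by (cases "i \<in> A") (simp_all add: partial_def)
  qed
  have "Ck k n V (partial i (\<lambda>z. f (T z)))" if i: "i < n" for i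
    unfolding p[OF i] using Suc.IH[of "partial (\<sigma> i) f"] Suc.prems pass'[OF i] by (auto intro: Ck_const)
  moreover have "(\<lambda>s. f (T (z(i := s)))) field_differentiable at (z i)" if z: "z \<in> V" and i: "i < n" for z i
  proof (cases "i \<in> A")
    case True
    have "\<forall>w\<in>W. (\<lambda>s. f (w(\<sigma> i := s))) field_differentiable at (w (\<sigma> i))"
      using Suc.prems conjunct1[OF pass'[OF i True]] by simp
    from bspec[OF this TW[OF z]] show ?thesis
      by (simp only: pass[OF i True] conjunct2[OF pass'[OF i True]])
  qed (simp add: ign[OF i])
  ultimately show ?case using c by simp
qed

section \<open>Local integrability\<close>

lemma integrable_on_iff:
  fixes f :: "real => real"
  assumes "S \<in> sets lebesgue"
  shows "integrable (lebesgue_on S) f \<longleftrightarrow> set_integrable lebesgue S f"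
  using assms by (simp add: integrable_restrict_space set_integrable_def)

lemma openin_interval_lebesgue: "openin (top_of_set {a..b::real}) S ==> S \<in> sets lebesgue"
  by (auto simp: openin_open intro!: sets.Int)

text \<open>Closed balls, because a small one around a point of a relatively open \<open>S\<close>
  meets \<open>S\<close> in a compact interval, on which a continuous factor is bounded.\<close>

definition loc_integrable :: "real set => (real => real) => bool" where
  "loc_integrable S f \<longleftrightarrow> (\<forall>t\<in>S. \<exists>d>0. set_integrable lebesgue (S \<inter> cball t d) f)"

lemma loc_integrable_common:
  assumes S: "S \<in> sets lebesgue" and t: "t \<in> S" and fin: "finite F"
    and f: "\<And>f. f \<in> F ==> loc_integrable S f"
  obtains d where "d > 0" "\<And>f. f \<in> F ==> set_integrable lebesgue (S \<inter> cball t d) f"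
proof -
  have "\<exists>d>0. \<forall>f\<in>F. set_integrable lebesgue (S \<inter> cball t d) f"
    using fin f
  proof (induction F)
    case empty
    show ?case by (intro exI[of _ 1]) simp
  next
    case (insert g F)
    then obtain d where d: "d > 0" "\<forall>f\<in>F. set_integrable lebesgue (S \<inter> cball t d) f" by auto
    obtain e where e: "e > 0" "set_integrable lebesgue (S \<inter> cball t e) g"
      using insert.prems[of g] t unfolding loc_integrable_def by auto
    have sub: "S \<inter> cball t (min d e) \<in> sets lebesgue" "S \<inter> cball t (min d e) \<subseteq> S \<inter> cball t d"
      "S \<inter> cball t (min d e) \<subseteq> S \<inter> cball t e"
      using S by auto
    show ?case
    proof (intro exI[of _ "min d e"] conjI ballI)
      fix f assume "f \<in> insert g F"
      then show "set_integrable lebesgue (S \<inter> cball t (min d e)) f"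
        using set_integrable_subset[OF _ sub(1,2)] set_integrable_subset[OF e(2) sub(1,3)] d(2) by auto
    qed (use d e in auto)
  qed
  then show ?thesis using that by blast
qed

interpretation continuous_class: local_class I "\<lambda>S f. continuous_on S f"
proof
  fix S T :: "real set" and f :: "real => real"
  assume "continuous_on S f" "T \<subseteq> S"
  then show "continuous_on T f" by (rule continuous_on_subset)
next
  fix S and f :: "real => real"
  assume S: "openin (top_of_set I) S"
    and *: "\<And>t. t \<in> S ==> \<exists>T. openin (top_of_set I) T \<and> t \<in> T \<and> T \<subseteq> S \<and> continuous_on T f"
  show "continuous_on S f" unfolding continuous_on_eq_continuous_within
  proof
    fix t assume "t \<in> S"
    from *[OF this] obtain T where T: "openin (top_of_set I) T" "t \<in> T" "T \<subseteq> S" "continuous_on T f" by blast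
    obtain O' where O': "open O'" "T = I \<inter> O'" using T(1) by (auto simp: openin_open)
    have SI: "S \<subseteq> I" using S openin_imp_subset by blast
    have eq: "S \<inter> O' = T" using T(3) O'(2) SI by blast
    have "at t within T = at t within S"
      by (rule at_within_nhd[of t O']) (use O' T eq in auto)
    moreover have "continuous (at t within T) f" using T(2,4) by (simp add: continuous_on_eq_continuous_within)
    ultimately show "continuous (at t within S) f" by (simp add: continuous_within)
  qed
next
  fix S and f g :: "real => real"
  assume "\<And>t. t \<in> S ==> f t = g t" "continuous_on S f"
  then show "continuous_on S g" using continuous_on_cong by metis
qed

interpretation loc_integrable_class: local_class "{t0..t1}" loc_integrable for t0 t1
proof
  fix S T :: "real set" and f :: "real => real"
  assume *: "loc_integrable S f" "openin (top_of_set {t0..t1}) T" "T \<subseteq> S"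
  show "loc_integrable T f" unfolding loc_integrable_def
  proof
    fix t assume "t \<in> T"
    then obtain d where d: "d > 0" "set_integrable lebesgue (S \<inter> cball t d) f"
      using * unfolding loc_integrable_def by blast
    have "set_integrable lebesgue (T \<inter> cball t d) f"
      by (rule set_integrable_subset[OF d(2)]) (use openin_interval_lebesgue[OF *(2)] *(3) in auto)
    then show "\<exists>d>0. set_integrable lebesgue (T \<inter> cball t d) f" using d(1) by blast
  qed
next
  fix S and f :: "real => real"
  assume S: "openin (top_of_set {t0..t1}) S"
    and *: "\<And>t. t \<in> S ==> \<exists>T. openin (top_of_set {t0..t1}) T \<and> t \<in> T \<and> T \<subseteq> S \<and> loc_integrable T f"
  show "loc_integrable S f" unfolding loc_integrable_def
  proof
    fix t assume "t \<in> S"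
    from *[OF this] obtain T where T: "openin (top_of_set {t0..t1}) T" "t \<in> T" "T \<subseteq> S" "loc_integrable T f" by blast
    obtain d where d: "d > 0" "set_integrable lebesgue (T \<inter> cball t d) f"
      using T(2,4) unfolding loc_integrable_def by blast
    obtain e where e: "e > 0" "cball t e \<inter> {t0..t1} \<subseteq> T"
      using T(1,2) unfolding openin_contains_cball by blast
    have "S \<subseteq> {t0..t1}" using S openin_imp_subset by blast
    then have "set_integrable lebesgue (S \<inter> cball t (min d e)) f"
      by (intro set_integrable_subset[OF d(2)]) (use openin_interval_lebesgue[OF S] e(2) in auto)
    then show "\<exists>d>0. set_integrable lebesgue (S \<inter> cball t d) f" using d(1) e(1) by (intro exI[of _ "min d e"]) auto
  qed
next
  fix S and f g :: "real => real"
  assume fg: "\<And>t. t \<in> S ==> f t = g t" and f: "loc_integrable S f"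
  show "loc_integrable S g" unfolding loc_integrable_def
  proof
    fix t assume "t \<in> S"
    then obtain d where d: "d > 0" "set_integrable lebesgue (S \<inter> cball t d) f"
      using f unfolding loc_integrable_def by blast
    have "set_integrable lebesgue (S \<inter> cball t d) g"
      using d(2) unfolding set_integrable_def
      by (rule Bochner_Integration.integrable_cong[THEN iffD1, rotated 2]) (auto simp: fg indicator_def)
    then show "\<exists>d>0. set_integrable lebesgue (S \<inter> cball t d) g" using d(1) by blast
  qed
qed

section \<open>Calculus of local integrability\<close>

lemma interval_Int_cball: "{t0..t1} \<inter> cball t d = {max t0 (t - d)..min t1 (t + d)}" for t0 :: real
  by (auto simp: dist_real_def)

lemma openin_interval_cball:
  assumes "openin (top_of_set {t0..t1::real}) S" "t \<in> S"
  obtains d where "d > 0" "{t0..t1} \<inter> cball t d \<subseteq> S" "\<And>e. e \<le> d ==> S \<inter> cball t e = {t0..t1} \<inter> cball t e"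
proof -
  obtain d where d: "d > 0" "cball t d \<inter> {t0..t1} \<subseteq> S"
    using assms unfolding openin_contains_cball by blast
  have "S \<inter> cball t e = {t0..t1} \<inter> cball t e" if "e \<le> d" for e
    using d(2) openin_imp_subset[OF assms(1)] subset_cball[OF that, of t] by blast
  then show ?thesis using that[OF d(1)] d(2) by blast
qed

lemma set_integrable_mult_continuous:
  fixes f g :: "real => real"
  assumes "set_integrable lebesgue {a..b} f" "continuous_on {a..b} g"
  shows "set_integrable lebesgue {a..b} (\<lambda>t. g t * f t)"
proof -
  have "bounded (g ` {a..b})" using compact_continuous_image[OF assms(2)] compact_imp_bounded by blast
  then obtain B where "\<forall>y\<in>g ` {a..b}. norm y \<le> B" unfolding bounded_iff by blast
  then have B: "\<bar>g t\<bar> \<le> B" if "t \<in> {a..b}" for t using that by simp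
  have f: "integrable (lebesgue_on {a..b}) f" using assms(1) by (simp add: integrable_on_iff)
  have "integrable (lebesgue_on {a..b}) (\<lambda>t. g t * f t)"
  proof (rule Bochner_Integration.integrable_bound)
    show "integrable (lebesgue_on {a..b}) (\<lambda>t. B * f t)" using f by simp
    show "(\<lambda>t. g t * f t) \<in> borel_measurable (lebesgue_on {a..b})"
      using continuous_imp_measurable_on_sets_lebesgue[OF assms(2)] f by (intro borel_measurable_times) auto
    show "AE t in lebesgue_on {a..b}. norm (g t * f t) \<le> norm (B * f t)"
      using B by (intro AE_I2) (auto simp: abs_mult intro!: mult_right_mono order_trans[OF B abs_ge_self])
  qed
  then show ?thesis by (simp add: integrable_on_iff)
qed

lemma loc_integrable_mult:
  assumes S: "openin (top_of_set {t0..t1}) S" and f: "loc_integrable S f" and g: "continuous_on S g"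
  shows "loc_integrable S (\<lambda>t. g t * f t)"
  unfolding loc_integrable_def
proof
  fix t assume t: "t \<in> S"
  obtain d where d: "d > 0" "set_integrable lebesgue (S \<inter> cball t d) f"
    using f t unfolding loc_integrable_def by blast
  obtain e where e: "e > 0" "{t0..t1} \<inter> cball t e \<subseteq> S" "\<And>e'. e' \<le> e ==> S \<inter> cball t e' = {t0..t1} \<inter> cball t e'"
    using openin_interval_cball[OF S t] by blast
  have eq: "S \<inter> cball t (min d e) = {max t0 (t - min d e)..min t1 (t + min d e)}"
    using e(3)[of "min d e"] interval_Int_cball[of t0 t1 t "min d e"] by simp
  have "set_integrable lebesgue (S \<inter> cball t (min d e)) f"
    by (rule set_integrable_subset[OF d(2)]) (use openin_interval_lebesgue[OF S] in auto)
  then have "set_integrable lebesgue (S \<inter> cball t (min d e)) (\<lambda>t. g t * f t)"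
    unfolding eq by (rule set_integrable_mult_continuous)
      (use continuous_on_subset[OF g, of "S \<inter> cball t (min d e)"] eq in auto)
  then show "\<exists>d>0. set_integrable lebesgue (S \<inter> cball t d) (\<lambda>t. g t * f t)"
    using d(1) e(1) by (intro exI[of _ "min d e"]) auto
qed

lemma loc_integrable_continuous:
  assumes S: "openin (top_of_set {t0..t1}) S" and g: "continuous_on S g"
  shows "loc_integrable S g"
proof -
  have "loc_integrable S (\<lambda>_. 1)"
    unfolding loc_integrable_def
  proof
    fix t assume t: "t \<in> S"
    have "set_integrable lebesgue {t - 1..t + 1} (\<lambda>_. 1::real)"
      using continuous_imp_integrable_real[of "t - 1" "t + 1" "\<lambda>_. 1::real"] by (simp add: integrable_on_iff)
    then have "set_integrable lebesgue (S \<inter> cball t 1) (\<lambda>_. 1::real)"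
      by (rule set_integrable_subset) (use openin_interval_lebesgue[OF S] in \<open>auto simp: dist_real_def\<close>)
    then show "\<exists>d>0. set_integrable lebesgue (S \<inter> cball t d) (\<lambda>_. 1::real)" by (intro exI[of _ 1]) auto
  qed
  from loc_integrable_mult[OF S this g] show ?thesis by simp
qed

lemma loc_integrable_sum:
  assumes S: "openin (top_of_set {t0..t1}) S" and "finite A" "\<And>i. i \<in> A ==> loc_integrable S (f i)"
  shows "loc_integrable S (\<lambda>t. \<Sum>i\<in>A. f i t)"
  unfolding loc_integrable_def
proof
  fix t assume t: "t \<in> S"
  have "finite (f ` A)" using assms(2) by simp
  then obtain d where d: "d > 0" "\<And>g. g \<in> f ` A ==> set_integrable lebesgue (S \<inter> cball t d) g"
    using loc_integrable_common[OF openin_interval_lebesgue[OF S] t, of "f ` A"] assms(3) by blast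
  have "set_integrable lebesgue (S \<inter> cball t d) (\<lambda>t. \<Sum>i\<in>A. f i t)"
    using d(2) unfolding set_integrable_def scaleR_sum_right by (intro Bochner_Integration.integrable_sum) auto
  then show "\<exists>d>0. set_integrable lebesgue (S \<inter> cball t d) (\<lambda>t. \<Sum>i\<in>A. f i t)" using d(1) by blast
qed

text \<open>Finitely many of the balls provided by local integrability cover the compact
  set.\<close>

lemma loc_integrable_compact:
  assumes S: "S \<in> sets lebesgue" and f: "loc_integrable S f" and K: "compact K" "K \<subseteq> S"
  shows "set_integrable lebesgue K f"
proof -
  have "\<forall>t\<in>S. \<exists>d. d > 0 \<and> set_integrable lebesgue (S \<inter> cball t d) f"
    using f unfolding loc_integrable_def by blast
  from bchoice[OF this] obtain d
    where d: "\<forall>t\<in>S. d t > 0 \<and> set_integrable lebesgue (S \<inter> cball t (d t)) f" ..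
  have cov: "K \<subseteq> (\<Union>t\<in>K. ball t (d t))"
  proof
    fix t assume "t \<in> K"
    moreover from this have "t \<in> ball t (d t)" using d K(2) by auto
    ultimately show "t \<in> (\<Union>t\<in>K. ball t (d t))" by blast
  qed
  obtain C where C: "C \<subseteq> K" "finite C" "K \<subseteq> (\<Union>t\<in>C. ball t (d t))"
    by (rule compactE_image[OF K(1) open_ball cov])
  have "set_integrable lebesgue (\<Union>t\<in>C. S \<inter> cball t (d t)) f"
    using C(2,1)
  proof (induction C)
    case (insert t C)
    have "t \<in> S" using insert.prems K(2) by blast
    then have 1: "set_integrable lebesgue (S \<inter> cball t (d t)) f" using d by simp
    have 2: "set_integrable lebesgue (\<Union>t\<in>C. S \<inter> cball t (d t)) f" using insert by simp
    have 3: "S \<inter> cball t (d t) \<in> sets lebesgue" for t using S by auto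
    show ?case unfolding UN_insert
      by (rule set_integrable_Un[OF 1 2 3]) (use insert.hyps(1) 3 in \<open>intro sets.finite_UN, auto\<close>)
  qed (simp add: set_integrable_def)
  then show ?thesis
  proof (rule set_integrable_subset)
    show "K \<in> sets lebesgue" by (rule fmeasurableD[OF lmeasurable_compact[OF K(1)]])
    show "K \<subseteq> (\<Union>t\<in>C. S \<inter> cball t (d t))" 
    proof
      fix x assume x: "x \<in> K"
      then obtain t where "t \<in> C" "x \<in> ball t (d t)" using C(3) by blast
      then show "x \<in> (\<Union>t\<in>C. S \<inter> cball t (d t))" using x K(2) by (auto intro!: bexI[of _ t])
    qed
  qed
qed


section \<open>The fundamental lemma of the calculus of variations\<close>

text \<open>By inner regularity it suffices that every compact subset \<open>K\<close> of the
  positivity set is null. Continuous functions that tend pointwise to the indicator of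
  \<open>K\<close> are admissible tests, and dominated convergence gives a vanishing integral of
  \<open>h\<close> over \<open>K\<close>, where \<open>h\<close> is positive.\<close>

lemma negligible_pos_if_test_integrals_zero:
  fixes h :: "real => real"
  assumes h: "set_integrable lebesgue {a..b} h"
    and test: "\<And>\<eta> c d. continuous_on UNIV \<eta> ==> a < c ==> d < b ==> (\<And>t. t \<notin> {c..d} ==> \<eta> t = 0) ==>
      (LINT t:{a..b}|lebesgue. \<eta> t * h t) = 0"
  shows "negligible {t \<in> {a<..<b}. h t > 0}"
proof -
  define A where "A = {t \<in> {a<..<b}. h t > 0}"
  have hm: "(\<lambda>t. indicator {a..b} t * h t) \<in> borel_measurable lebesgue"
    using h unfolding set_integrable_def by (auto dest: borel_measurable_integrable)
  have A_eq: "A = {t \<in> space lebesgue. 0 < indicator {a..b} t * h t} \<inter> {a<..<b}"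
    by (auto simp: A_def indicator_def)
  have "{t \<in> space lebesgue. 0 < indicator {a..b} t * h t} \<in> sets lebesgue"
    using borel_measurable_less[OF _ hm, of "\<lambda>_. 0"] by simp
  then have A: "A \<in> sets lebesgue" unfolding A_eq by (intro sets.Int) auto
  \<comment> \<open>Up to a null set \<open>A\<close> is a countable union of closed sets, each of
    them compact because it lies in \<open>{a..b}\<close>.\<close>
  obtain C T where CT: "fsigma C" "T \<in> null_sets lebesgue" "C \<union> T = A" "disjnt C T"
    using lebesgue_set_almost_fsigma[OF A] by blast
  obtain F :: "nat => real set" where F: "\<And>n. closed (F n)" "C = (\<Union>n. F n)"
    using CT(1) by (auto elim!: fsigma.cases)
  have null: "K \<in> null_sets lebesgue" if K: "compact K" "K \<subseteq> A" for K
  proof (cases "K = {}")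
    case False
    obtain c d where cd: "K \<subseteq> {c..d}" "a < c" "d < b"
    proof -
      obtain c where c: "c \<in> K" "\<forall>t\<in>K. c \<le> t" using compact_attains_inf[OF K(1) False] by blast
      obtain d where d: "d \<in> K" "\<forall>t\<in>K. t \<le> d" using compact_attains_sup[OF K(1) False] by blast
      have "c \<in> A" "d \<in> A" using c(1) d(1) K(2) by blast+
      then have "a < c" "d < b" by (simp_all add: A_def)
      moreover have "K \<subseteq> {c..d}" using c(2) d(2) by auto
      ultimately show ?thesis using that by blast
    qed
    \<comment> \<open>A tent over \<open>K\<close>: equal to 1 on \<open>K\<close>, and 0 at
      distance 1/m or more.\<close>
    define \<eta> where "\<eta> m t = max 0 (1 - real m * infdist t K)" for m t
    obtain \<delta> where \<delta>: "\<delta> > 0" "a < c - \<delta>" "d + \<delta> < b"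
      using cd by (intro that[of "min (c - a) (b - d) / 2"]) (auto simp: min_def field_simps)
    \<comment> \<open>From \<open>m0\<close> on the tents vanish farther than
      \<open>\<delta>\<close> from \<open>K\<close>, so their support stays inside the open
      interval.\<close>
    obtain m0 :: nat where m0: "real m0 * \<delta> > 1" using reals_Archimedean3[OF \<delta>(1)] by blast
    have van: "\<eta> m t = 0" if t: "t \<notin> {c - \<delta>..d + \<delta>}" and m: "m \<ge> m0" for m t
    proof -
      have "dist t k \<ge> \<delta>" if "k \<in> K" for k using t cd(1) that by (force simp: dist_real_def)
      then have "infdist t K \<ge> \<delta>" using False by (auto simp: infdist_def intro!: cINF_greatest)
      then have "real m * infdist t K \<ge> real m0 * \<delta>" using m \<delta>(1) by (intro mult_mono) auto
      then show ?thesis using m0 by (simp add: \<eta>_def)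
    qed
    have cont: "continuous_on UNIV (\<eta> m)" for m
      unfolding \<eta>_def by (intro continuous_intros)
    have lim: "(\<lambda>m. LINT t:{a..b}|lebesgue. \<eta> m t * h t) \<longlonglongrightarrow> (LINT t:{a..b}|lebesgue. indicator K t * h t)"
      unfolding set_lebesgue_integral_def
    proof (rule integral_dominated_convergence[where w="\<lambda>t. \<bar>indicator {a..b} t * h t\<bar>"])
      have Km: "K \<in> sets lebesgue" by (rule fmeasurableD[OF lmeasurable_compact[OF K(1)]])
      have e: "(\<lambda>t. indicator {a..b} t *\<^sub>R (f t * h t)) = (\<lambda>t. f t * (indicator {a..b} t * h t))" for f :: "real => real"
        by (auto simp: fun_eq_iff)
      show "(\<lambda>t. indicator {a..b} t *\<^sub>R (indicator K t * h t)) \<in> borel_measurable lebesgue"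
        unfolding e by (rule borel_measurable_times[OF _ hm]) (use Km in auto)
      show "(\<lambda>t. indicator {a..b} t *\<^sub>R (\<eta> m t * h t)) \<in> borel_measurable lebesgue" for m
        unfolding e by (rule borel_measurable_times[OF _ hm])
          (use continuous_imp_measurable_on_sets_lebesgue[OF cont[of m]] in \<open>simp add: lebesgue_on_UNIV_eq\<close>)
      show "integrable lebesgue (\<lambda>t. \<bar>indicator {a..b} t * h t\<bar>)"
        using h unfolding set_integrable_def by (intro integrable_abs) simp
      show "AE t in lebesgue. (\<lambda>m. indicator {a..b} t *\<^sub>R (\<eta> m t * h t)) \<longlonglongrightarrow> indicator {a..b} t *\<^sub>R (indicator K t * h t)"
      proof (intro AE_I2 tendsto_scaleR tendsto_const tendsto_mult)
        fix t
        show "(\<lambda>m. \<eta> m t) \<longlonglongrightarrow> indicator K t"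
        proof (cases "t \<in> K")
          case True
          then show ?thesis by (simp add: \<eta>_def)
        next
          case nt: False
          then have pos: "infdist t K > 0"
            using in_closed_iff_infdist_zero[OF compact_imp_closed[OF K(1)] False] infdist_nonneg[of t K] by force
          obtain m1 :: nat where m1: "real m1 * infdist t K > 1" using reals_Archimedean3[OF pos] by blast
          have "\<eta> m t = 0" if "m \<ge> m1" for m
          proof -
            have "real m * infdist t K \<ge> real m1 * infdist t K" using that pos by (intro mult_right_mono) auto
            then show ?thesis using m1 by (simp add: \<eta>_def)
          qed
          then have "\<forall>\<^sub>F m in sequentially. \<eta> m t = indicator K t"
            using nt by (auto simp: eventually_sequentially)
          then show ?thesis by (rule tendsto_eventually)
        qed
      qed
      show "AE t in lebesgue. norm (indicator {a..b} t *\<^sub>R (\<eta> m t * h t)) \<le> \<bar>indicator {a..b} t * h t\<bar>" for m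
      proof (intro AE_I2)
        fix t
        have "0 \<le> \<eta> m t" "\<eta> m t \<le> 1" using infdist_nonneg[of t K] by (auto simp: \<eta>_def)
        then show "norm (indicator {a..b} t *\<^sub>R (\<eta> m t * h t)) \<le> \<bar>indicator {a..b} t * h t\<bar>"
          by (auto simp: abs_mult indicator_def intro: mult_left_le_one_le)
      qed
    qed
    moreover have "\<forall>\<^sub>F m in sequentially. (LINT t:{a..b}|lebesgue. \<eta> m t * h t) = 0"
      unfolding eventually_sequentially
      using test[OF cont, of "c - \<delta>" "d + \<delta>"] van \<delta> by (intro exI[of _ m0]) auto
    ultimately have "(LINT t:{a..b}|lebesgue. indicator K t * h t) = 0"
      using LIMSEQ_unique[OF _ tendsto_eventually] by blast
    moreover have "(LINT t:{a..b}|lebesgue. indicator K t * h t) = (LINT t:K|lebesgue. indicator {a..b} t * h t)"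
      unfolding set_lebesgue_integral_def by (intro Bochner_Integration.integral_cong) (auto simp: indicator_def)
    moreover have "K \<in> sets lebesgue" by (rule fmeasurableD[OF lmeasurable_compact[OF K(1)]])
    ultimately show ?thesis
      using h K(2) unfolding set_integrable_def
      by (intro null_if_pos_func_has_zero_int[of lebesgue "\<lambda>t. indicator {a..b} t * h t"] AE_I2)
        (auto simp: A_def subset_iff)
  qed simp
  have "F n \<in> null_sets lebesgue" for n
  proof -
    have sub: "F n \<subseteq> A" using F(2) CT(3) by blast
    then have "F n \<inter> {a..b} = F n" by (auto simp: A_def)
    then have "compact (F n)" using closed_Int_compact[OF F(1)[of n] compact_Icc[of a b]] by simp
    then show ?thesis using sub by (rule null)
  qed
  then have "C \<in> null_sets lebesgue" unfolding F(2) by auto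
  then have "A \<in> null_sets lebesgue" using CT(2,3) null_sets.Un by blast
  then show ?thesis by (simp add: A_def negligible_iff_null_sets)
qed

lemma negligible_if_test_integrals_zero:
  fixes h :: "real => real"
  assumes h: "set_integrable lebesgue {a..b} h"
    and test: "\<And>\<eta> c d. continuous_on UNIV \<eta> ==> a < c ==> d < b ==> (\<And>t. t \<notin> {c..d} ==> \<eta> t = 0) ==>
      (LINT t:{a..b}|lebesgue. \<eta> t * h t) = 0"
  shows "negligible {t \<in> {a<..<b}. h t \<noteq> 0}"
proof -
  have "negligible {t \<in> {a<..<b}. - h t > 0}"
  proof (rule negligible_pos_if_test_integrals_zero)
    show "set_integrable lebesgue {a..b} (\<lambda>t. - h t)"
      using h unfolding set_integrable_def by simp
    fix \<eta> :: "real => real" and c d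
    assume "continuous_on UNIV \<eta>" "a < c" "d < b" "\<And>t. t \<notin> {c..d} ==> \<eta> t = 0"
    then have "(LINT t:{a..b}|lebesgue. \<eta> t * h t) = 0" by (rule test)
    then show "(LINT t:{a..b}|lebesgue. \<eta> t * - h t) = 0"
      by (simp add: set_lebesgue_integral_def)
  qed
  moreover have "negligible {t \<in> {a<..<b}. h t > 0}"
    by (rule negligible_pos_if_test_integrals_zero[OF h]) (rule test)
  ultimately have "negligible ({t \<in> {a<..<b}. h t > 0} \<union> {t \<in> {a<..<b}. - h t > 0})"
    by (intro negligible_Un)
  then show ?thesis by (rule negligible_subset) auto
qed

section \<open>Curves in the total space\<close>

lemma continuous_map_Euclidean_coord: "continuous_map (Euclidean_space n) euclideanreal (\<lambda>c. c i)"
  unfolding Euclidean_space_eq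
  using continuous_on_subset[OF continuous_on_product_coordinates subset_UNIV] by simp

lemma sets_lebesgue_onI: "S \<in> sets lebesgue ==> A \<in> sets lebesgue ==> A \<subseteq> S ==> A \<in> sets (lebesgue_on S)"
  by (simp add: sets_restrict_space_iff)

lemma sets_lebesgue_onD: "S \<in> sets lebesgue ==> A \<in> sets (lebesgue_on S) ==> A \<in> sets lebesgue"
  by (simp add: sets_restrict_space_iff)

lemma space_lebesgue_on: "space (lebesgue_on S) = S"
  by (simp add: space_restrict_space)

lemma openin_subtopology_self_open: "openin X U ==> openin (subtopology X U) U"
  unfolding openin_subtopology by blast

abbreviation frame_map where
  "frame_map E b \<equiv> (\<lambda>(p, c). (p, \<Sum>i<rk E. c i *\<^sub>R b i p))"

abbreviation triv_top where
  "triv_top M E U \<equiv> prod_topology (mtop_on M U) (Euclidean_space (rk E))"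

lemma topspace_total_top:
  assumes "framed M E"
  shows "topspace (total_top M E) = {(p, v). p \<in> points M \<and> v \<in> fib E p}"
proof (intro equalityI subsetI)
  fix z assume "z \<in> topspace (total_top M E)"
  then obtain G where G: "z \<in> G" "G \<in> {frame_map E b ` W | U b W. (U, b) \<in> frames E \<and>
        openin (triv_top M E U) W}"
    unfolding total_top_def topology_generated_by_topspace by (rule UnionE)
  from G(2) obtain U b W where fr: "(U, b) \<in> frames E"
    and W: "openin (triv_top M E U) W"
    and GW: "G = (frame_map E b) ` W" by (elim CollectE exE conjE)
  obtain p c where z: "(p, c) \<in> W" "z = (p, \<Sum>i<rk E. c i *\<^sub>R b i p)"
    using G(1) unfolding GW by (elim imageE) (auto simp: split_beta)
  have "p \<in> U" "p \<in> points M" using openin_subset[OF W] z(1) by auto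
  then show "z \<in> {(p, v). p \<in> points M \<and> v \<in> fib E p}"
    using basis_of_comb[OF framedD(2)[OF assms fr]] z(2) by simp
next
  fix z assume "z \<in> {(p, v). p \<in> points M \<and> v \<in> fib E p}"
  then obtain p v where z: "z = (p, v)" "p \<in> points M" "v \<in> fib E p" by blast
  obtain U b where fr: "(U, b) \<in> frames E" "p \<in> U" using framed_cover[OF assms z(2)] by blast
  let ?W = "U \<times> topspace (Euclidean_space (rk E))"
  have W: "openin (triv_top M E U) ?W"
    using openin_subtopology_self_open[OF framedD(1)[OF assms fr(1)]] by (simp add: openin_prod_Times_iff)
  have "z = (frame_map E b) (p, frame_coords E b p v)"
    using coords_sum[OF framedD(2)[OF assms fr] z(3)] z(1) by simp
  moreover have "(p, frame_coords E b p v) \<in> ?W"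
    using fr(2) by (auto simp: topspace_Euclidean_space coords_ge)
  ultimately have "z \<in> (frame_map E b) ` ?W" by (rule image_eqI)
  then show "z \<in> topspace (total_top M E)"
    using openin_subset[OF topology_generated_by_Basis] fr(1) W unfolding total_top_def
    by (intro subsetD[OF openin_subset[OF topology_generated_by_Basis]] CollectI exI conjI)
      (rule refl | assumption)+
qed

lemma openin_triv_image:
  assumes "(U, b) \<in> frames E" "openin (triv_top M E U) W"
  shows "openin (total_top M E) (frame_map E b ` W)"
  unfolding total_top_def using assms by (intro topology_generated_by_Basis) blast

lemma mem_triv_image:
  assumes "framed M E" "(U, b) \<in> frames E" "W \<subseteq> U \<times> topspace (Euclidean_space (rk E))" "p \<in> U" "v \<in> fib E p"
  shows "(p, v) \<in> (frame_map E b) ` W \<longleftrightarrow> (p, frame_coords E b p v) \<in> W"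
proof -
  note B = framedD(2)[OF assms(1,2,4)]
  show ?thesis
  proof
    assume "(p, v) \<in> (frame_map E b) ` W"
    then obtain c where c: "(p, c) \<in> W" "v = (\<Sum>i<rk E. c i *\<^sub>R b i p)" by auto
    have c0: "c i = 0" if "i \<ge> rk E" for i using c(1) assms(3) that by (auto simp: topspace_Euclidean_space)
    have "frame_coords E b p v = c"
    proof
      fix j
      show "frame_coords E b p v j = c j"
        unfolding c(2) coords_unique[OF B] using c0 by simp
    qed
    then show "(p, frame_coords E b p v) \<in> W" using c(1) by simp
  next
    assume "(p, frame_coords E b p v) \<in> W"
    moreover have "(p, v) = (frame_map E b) (p, frame_coords E b p v)"
      using coords_sum[OF B assms(5)] by simp
    ultimately show "(p, v) \<in> (frame_map E b) ` W" by (rule rev_image_eqI)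
  qed
qed

text \<open>Continuity is tested on the generating sets of the topology, which are images under
  other trivialisations. Over the overlap of the two domains such an image pulls back along the
  transition map, whose entries are continuous.\<close>

lemma continuous_map_triv:
  assumes E: "framed M E" and fr: "(U, b) \<in> frames E"
  shows "continuous_map (triv_top M E U) (total_top M E)
    (frame_map E b)"
  (is "continuous_map ?P _ ?t")
  unfolding total_top_def
proof (rule continuous_on_generated_topo)
  have "?t ` topspace ?P \<subseteq> topspace (total_top M E)"
    unfolding topspace_total_top[OF E]
    using basis_of_comb[OF framedD(2)[OF E fr]] by auto
  then show "?t ` topspace ?P \<subseteq> \<Union> {frame_map E b ` W | U b W. (U, b) \<in> frames E \<and>
        openin (triv_top M E U) W}"
    unfolding total_top_def topology_generated_by_topspace .
  fix G assume "G \<in> {frame_map E b ` W | U b W. (U, b) \<in> frames E \<and>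
        openin (triv_top M E U) W}"
  then obtain V d W where G: "G = (\<lambda>(p, c). (p, \<Sum>i<rk E. c i *\<^sub>R d i p)) ` W" and fr': "(V, d) \<in> frames E"
    and W: "openin (triv_top M E V) W" by blast
  have Wsub: "W \<subseteq> V \<times> topspace (Euclidean_space (rk E))" using openin_subset[OF W] by auto
  \<comment> \<open>The transition map: coefficients in the frame \<open>b\<close> are turned into
    coefficients in the frame \<open>d\<close> over the same point.\<close>
  define A where "A = (\<lambda>(p, c :: nat => real). (p, \<lambda>j. if j < rk E then \<Sum>i<rk E. c i * frame_coords E d p (b i p) j else 0))"
  let ?P' = "triv_top M E (U \<inter> V)"
  have "continuous_map ?P' (triv_top M E V) A"
    unfolding A_def case_prod_unfold continuous_map_pairwise o_def fst_conv snd_conv continuous_map_componentwise_Euclidean_space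
  proof (intro conjI allI impI)
    show "continuous_map ?P' (mtop_on M V) (\<lambda>x. fst x)"
    proof -
      have "continuous_map (mtop_on M (U \<inter> V)) (mtop_on M V) id"
        by (simp add: continuous_map_from_subtopology continuous_map_in_subtopology Pi_iff)
      from continuous_map_compose[OF continuous_map_fst this] show ?thesis by (simp add: o_def id_def)
    qed
    fix j assume j: "j < rk E"
    show "continuous_map ?P' euclideanreal (\<lambda>x. \<Sum>i<rk E. snd x i * frame_coords E d (fst x) (b i (fst x)) j)"
    proof (intro continuous_map_sum continuous_map_real_mult)
      fix i assume i: "i \<in> {..<rk E}"
      have "continuous_map (Euclidean_space (rk E)) euclideanreal (\<lambda>c. c i)"
        by (rule continuous_map_Euclidean_coord)
      from continuous_map_compose[OF continuous_map_snd this]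
      show "continuous_map ?P' euclideanreal (\<lambda>x. snd x i)" by (simp add: o_def)
      have "continuous_map (mtop_on M (U \<inter> V)) euclideanreal (\<lambda>p. frame_coords E d p (b i p) j)"
        using framedD(3)[OF E fr fr'] i j by simp
      from continuous_map_compose[OF continuous_map_fst this]
      show "continuous_map ?P' euclideanreal (\<lambda>x. frame_coords E d (fst x) (b i (fst x)) j)" by (simp add: o_def)
    qed simp
  qed
  from openin_continuous_map_preimage[OF this W]
  have 1: "openin ?P' {z \<in> topspace ?P'. A z \<in> W}" .
  have key: "?t (p, c) \<in> G \<longleftrightarrow> A (p, c) \<in> W" if pc: "p \<in> U" "p \<in> V" for p c
  proof -
    note B = framedD(2)[OF E fr pc(1)] and B' = framedD(2)[OF E fr' pc(2)]
    have mem: "(\<Sum>i<rk E. c i *\<^sub>R b i p) \<in> fib E p" by (rule basis_of_comb[OF B])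
    have "frame_coords E d p (\<Sum>i<rk E. c i *\<^sub>R b i p) j =
        (if j < rk E then \<Sum>i<rk E. c i * frame_coords E d p (b i p) j else 0)" for j
      using dual_space_sum[OF coords_in_dual_space[OF B'] basis_of_subspace[OF B'], where A="{..<rk E}" and b="\<lambda>i. b i p" and c=c]
        basis_of_mem[OF B] by (simp add: coords_ge)
    then have "frame_coords E d p (\<Sum>i<rk E. c i *\<^sub>R b i p) =
       (\<lambda>j. if j < rk E then \<Sum>i<rk E. c i * frame_coords E d p (b i p) j else 0)" by blast
    then show ?thesis
      unfolding G A_def using mem_triv_image[OF E fr' Wsub pc(2) mem] by simp
  qed
  \<comment> \<open>The part over the overlap is open in the domain of the trivialisation, so
    openness there is openness in the whole domain.\<close>
  have 2: "?P' = subtopology ?P (V \<times> UNIV)"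
    by (simp only: subtopology_Times subtopology_subtopology subtopology_UNIV)
  have 3: "subtopology ?P (V \<times> UNIV) = subtopology ?P (topspace ?P \<inter> V \<times> UNIV)"
    by (simp only: subtopology_restrict)
  have op: "openin ?P (topspace ?P \<inter> V \<times> UNIV)"
  proof -
    have "topspace ?P \<inter> V \<times> UNIV = (U \<inter> V) \<times> topspace (Euclidean_space (rk E))"
      using framed_subset[OF E fr] by auto
    moreover have "openin (mtop_on M U) (U \<inter> V)"
      unfolding openin_subtopology using framedD(1)[OF E fr'] by blast
    ultimately show ?thesis by (simp add: openin_prod_Times_iff)
  qed
  have "openin ?P {z \<in> topspace ?P'. A z \<in> W}"
    using 1 unfolding 2 3 openin_open_subtopology[OF op] by (rule conjunct1)
  moreover have "?t -` G \<inter> topspace ?P = {z \<in> topspace ?P'. A z \<in> W}"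
  proof (intro equalityI subsetI)
    fix z assume z: "z \<in> ?t -` G \<inter> topspace ?P"
    then have "fst z \<in> U" "fst z \<in> points M" "snd z \<in> topspace (Euclidean_space (rk E))" by auto
    moreover have "fst z \<in> V" using z Wsub by (auto simp: G)
    ultimately show "z \<in> {z \<in> topspace ?P'. A z \<in> W}"
      using z key[of "fst z" "snd z"] by (auto simp: mem_Times_iff)
  next
    fix z assume z: "z \<in> {z \<in> topspace ?P'. A z \<in> W}"
    then show "z \<in> ?t -` G \<inter> topspace ?P"
      using key[of "fst z" "snd z"] by (auto simp: mem_Times_iff)
  qed
  ultimately show "openin ?P (?t -` G \<inter> topspace ?P)" by simp
qed

lemma openin_total_over:
  assumes E: "framed M E" and V: "openin (mtop M) V"
  shows "openin (total_top M E) {z \<in> topspace (total_top M E). fst z \<in> V}"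
proof (subst openin_subopen, rule ballI)
  fix z assume z: "z \<in> {z \<in> topspace (total_top M E). fst z \<in> V}"
  then obtain p v where pv: "z = (p, v)" "p \<in> points M" "v \<in> fib E p" "p \<in> V"
    unfolding topspace_total_top[OF E] by auto
  obtain U b where fr: "(U, b) \<in> frames E" "p \<in> U" using framed_cover[OF E pv(2)] by blast
  let ?W = "(U \<inter> V) \<times> topspace (Euclidean_space (rk E))"
  let ?G = "(frame_map E b) ` ?W"
  have "openin (mtop_on M U) (U \<inter> V)" unfolding openin_subtopology using V by blast
  then have W: "openin (triv_top M E U) ?W"
    by (simp add: openin_prod_Times_iff)
  have "openin (total_top M E) ?G" by (rule openin_triv_image[OF fr(1) W])
  moreover have "z \<in> ?G"
  proof -
    have "(p, v) \<in> ?G \<longleftrightarrow> (p, frame_coords E b p v) \<in> ?W"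
      by (rule mem_triv_image[OF E fr(1) _ fr(2) pv(3)]) auto
    then show ?thesis using fr(2) pv(4) unfolding pv(1) by (simp add: topspace_Euclidean_space coords_ge)
  qed
  moreover have "?G \<subseteq> {z \<in> topspace (total_top M E). fst z \<in> V}"
    using openin_subset[OF \<open>openin (total_top M E) ?G\<close>] by auto
  ultimately show "\<exists>T. openin (total_top M E) T \<and> z \<in> T \<and> T \<subseteq> {z \<in> topspace (total_top M E). fst z \<in> V}" by blast
qed

lemma openin_total_coord:
  assumes E: "framed M E" and fr: "(U, b) \<in> frames E" and i: "i < rk E" and S: "open S"
  shows "openin (total_top M E)
    {z \<in> topspace (total_top M E). fst z \<in> U \<and> frame_coords E b (fst z) (snd z) i \<in> S}"
proof -
  let ?W = "U \<times> {c \<in> topspace (Euclidean_space (rk E)). c i \<in> S}"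
  let ?G = "(frame_map E b) ` ?W"
  have "continuous_map (Euclidean_space (rk E)) euclideanreal (\<lambda>c. c i)"
    by (rule continuous_map_Euclidean_coord)
  from openin_continuous_map_preimage[OF this, of S] S
  have "openin (Euclidean_space (rk E)) {c \<in> topspace (Euclidean_space (rk E)). c i \<in> S}" by simp
  moreover have "openin (mtop_on M U) U"
    unfolding openin_subtopology using framedD(1)[OF E fr] by blast
  ultimately have W: "openin (triv_top M E U) ?W"
    by (simp add: openin_prod_Times_iff)
  have op: "openin (total_top M E) ?G" by (rule openin_triv_image[OF fr W])
  have mem: "(p, v) \<in> ?G \<longleftrightarrow> frame_coords E b p v i \<in> S" if "p \<in> U" "v \<in> fib E p" for p v
  proof -
    have "(p, v) \<in> ?G \<longleftrightarrow> (p, frame_coords E b p v) \<in> ?W"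
      by (rule mem_triv_image[OF E fr _ that]) auto
    then show ?thesis using that(1) by (simp add: topspace_Euclidean_space coords_ge)
  qed
  have "?G = {z \<in> topspace (total_top M E). fst z \<in> U \<and> frame_coords E b (fst z) (snd z) i \<in> S}"
  proof (intro equalityI subsetI)
    fix z assume z: "z \<in> ?G"
    then have "z \<in> topspace (total_top M E)" using openin_subset[OF op] by blast
    moreover have "fst z \<in> U" using z by auto
    ultimately show "z \<in> {z \<in> topspace (total_top M E). fst z \<in> U \<and> frame_coords E b (fst z) (snd z) i \<in> S}"
      using z mem[of "fst z" "snd z"] unfolding topspace_total_top[OF E] by auto
  next
    fix z assume "z \<in> {z \<in> topspace (total_top M E). fst z \<in> U \<and> frame_coords E b (fst z) (snd z) i \<in> S}"
    then show "z \<in> ?G" using mem[of "fst z" "snd z"] unfolding topspace_total_top[OF E] by auto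
  qed
  then show ?thesis using op by simp
qed

text \<open>Coordinates are continuous because the points of the total space whose i-th coordinate
  lies in an open set form an open set. Conversely, the curve is locally the image of its continuous
  coordinate curve under a trivialisation, and continuity is local.\<close>

lemma curve_continuous_iff:
  assumes E: "framed M E"
  shows "continuous_map (top_of_set I) (total_top M E) (\<lambda>t. (x t, v t)) \<longleftrightarrow>
    curve_on I M x \<and> coords_in continuous_on I E x v"
proof (intro iffI conjI)
  assume L: "continuous_map (top_of_set I) (total_top M E) (\<lambda>t. (x t, v t))"
  have mem: "x t \<in> points M \<and> v t \<in> fib E (x t)" if "t \<in> I" for t
    using L that unfolding continuous_map_def topspace_total_top[OF E] by auto
  show x: "curve_on I M x"
    unfolding continuous_map_def
  proof (intro conjI allI impI)
    fix V assume V: "openin (mtop M) V"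
    have "{t \<in> topspace (top_of_set I). x t \<in> V} =
        {t \<in> topspace (top_of_set I). (x t, v t) \<in> {z \<in> topspace (total_top M E). fst z \<in> V}}"
      unfolding topspace_total_top[OF E] using mem by auto
    then show "openin (top_of_set I) {t \<in> topspace (top_of_set I). x t \<in> V}"
      using openin_continuous_map_preimage[OF L openin_total_over[OF E V]] by simp
  qed (use mem in auto)
  show "coords_in continuous_on I E x v"
  proof (rule coords_inI)
    fix U b i assume fr: "(U, b) \<in> frames E" and i: "i < rk E"
    show "continuous_on {t \<in> I. x t \<in> U} (\<lambda>t. frame_coords E b (x t) (v t) i)"
    proof (intro continuous_on_open_gen[THEN iffD2, of _ _ UNIV] allI impI)
      fix S :: "real set" assume "openin (top_of_set UNIV) S"
      then have S: "open S" by simp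
      let ?G = "{z \<in> topspace (total_top M E). fst z \<in> U \<and> frame_coords E b (fst z) (snd z) i \<in> S}"
      have "openin (top_of_set I) {t \<in> topspace (top_of_set I). (x t, v t) \<in> ?G}"
        by (rule openin_continuous_map_preimage[OF L openin_total_coord[OF E fr i S]])
      moreover have "{t \<in> topspace (top_of_set I). (x t, v t) \<in> ?G} =
          {t \<in> I. x t \<in> U} \<inter> (\<lambda>t. frame_coords E b (x t) (v t) i) -` S"
        unfolding topspace_total_top[OF E] using mem by auto
      ultimately show "openin (top_of_set {t \<in> I. x t \<in> U})
          ({t \<in> I. x t \<in> U} \<inter> (\<lambda>t. frame_coords E b (x t) (v t) i) -` S)"
        by (intro openin_subset_trans[of I _ "{t \<in> I. x t \<in> U}"]) auto
    qed auto
  qed (use mem in blast)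
next
  assume R: "curve_on I M x \<and> coords_in continuous_on I E x v"
  note x = conjunct1[OF R] and co = conjunct2[OF R]
  show "continuous_map (top_of_set I) (total_top M E) (\<lambda>t. (x t, v t))"
  proof (rule continuous_map_locally)
    fix t assume "t \<in> topspace (top_of_set I)"
    then have t: "t \<in> I" by simp
    obtain U b where fr: "(U, b) \<in> frames E" "x t \<in> U" "openin (top_of_set I) {t \<in> I. x t \<in> U}"
      by (rule curve_frame[OF E x t])
    let ?T = "{t \<in> I. x t \<in> U}"
    have eqT: "subtopology (top_of_set I) ?T = top_of_set ?T"
      by (simp add: subtopology_subtopology Int_absorb1 Collect_restrict)
    have "continuous_map (top_of_set ?T) (triv_top M E U)
        (\<lambda>t. (x t, \<lambda>i. if i < rk E then frame_coords E b (x t) (v t) i else 0))"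
      unfolding continuous_map_pairwise o_def fst_conv snd_conv continuous_map_componentwise_Euclidean_space
    proof (intro conjI allI impI)
      show "continuous_map (top_of_set ?T) (mtop_on M U) x" by (rule continuous_map_curve[OF x])
      fix i assume "i < rk E"
      then show "continuous_map (top_of_set ?T) euclideanreal (\<lambda>t. frame_coords E b (x t) (v t) i)"
        using coords_inD(2)[OF co fr(1)] by simp
    qed
    from continuous_map_compose[OF this continuous_map_triv[OF E fr(1)]]
    have "continuous_map (top_of_set ?T) (total_top M E)
      (\<lambda>t. (x t, \<Sum>i<rk E. frame_coords E b (x t) (v t) i *\<^sub>R b i (x t)))"
      by (simp add: o_def)
    then have "continuous_map (top_of_set ?T) (total_top M E) (\<lambda>t. (x t, v t))"
      by (rule continuous_map_eq) (use coords_sum[OF framedD(2)[OF E fr(1)] coords_inD(1)[OF co]] in auto)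
    then show "\<exists>T. openin (top_of_set I) T \<and> t \<in> T \<and>
        continuous_map (subtopology (top_of_set I) T) (total_top M E) (\<lambda>t. (x t, v t))"
      using fr t eqT by (intro exI[of _ ?T]) auto
  qed
qed

text \<open>Measurability of a continuous-shadow curve is tested in each of countably many trivialisations,
  where the curve factors through \<open>\<real> \<times> \<real>\<^sup>\<nat>\<close>, a second countable type.\<close>

lemma curve_measurable_iff:
  assumes E: "framed M E" and x: "curve_on {t0..t1::real} M x"
  shows "(\<lambda>t. (x t, v t)) \<in> measurable (lebesgue_on {t0..t1})
            (sigma (topspace (total_top M E)) {W. openin (total_top M E) W}) \<longleftrightarrow>
    coords_in (\<lambda>S f. f \<in> borel_measurable (lebesgue_on S)) {t0..t1} E x v"
    (is "?L \<longleftrightarrow> ?R")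
proof -
  let ?I = "{t0..t1}"
  let ?Tt = "total_top M E"
  have pow: "{W. openin ?Tt W} \<subseteq> Pow (topspace ?Tt)" using openin_subset by blast
  have mS: "{t \<in> ?I. x t \<in> U} \<in> sets lebesgue" if "(U, b) \<in> frames E" for U b
    by (rule openin_interval_lebesgue[OF openin_curve_preimage[OF x framedD(1)[OF E that]]])
  show ?thesis
  proof
    assume L: ?L
    have mem: "x t \<in> points M \<and> v t \<in> fib E (x t)" if "t \<in> ?I" for t
      using measurable_space[OF L, of t] that pow by (auto simp: space_measure_of topspace_total_top[OF E])
    show ?R
    proof (rule coords_inI)
      fix U b i assume fr: "(U, b) \<in> frames E" and i: "i < rk E"
      let ?S = "{t \<in> ?I. x t \<in> U}"
      show "(\<lambda>t. frame_coords E b (x t) (v t) i) \<in> borel_measurable (lebesgue_on ?S)"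
      proof (rule borel_measurableI)
        fix S :: "real set" assume S: "open S"
        let ?G = "{z \<in> topspace ?Tt. fst z \<in> U \<and> frame_coords E b (fst z) (snd z) i \<in> S}"
        have "?G \<in> sets (sigma (topspace ?Tt) {W. openin ?Tt W})"
          using openin_total_coord[OF E fr i S] pow by (simp add: sets_measure_of)
        from measurable_sets[OF L this]
        have "(\<lambda>t. (x t, v t)) -` ?G \<inter> ?I \<in> sets (lebesgue_on ?I)" by simp
        then have 1: "(\<lambda>t. (x t, v t)) -` ?G \<inter> ?I \<in> sets lebesgue"
          by (rule sets_lebesgue_onD[rotated]) simp
        have eq: "(\<lambda>t. frame_coords E b (x t) (v t) i) -` S \<inter> ?S = (\<lambda>t. (x t, v t)) -` ?G \<inter> ?I"
          unfolding topspace_total_top[OF E] using mem by auto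
        show "(\<lambda>t. frame_coords E b (x t) (v t) i) -` S \<inter> space (lebesgue_on ?S) \<in> sets (lebesgue_on ?S)"
          unfolding space_lebesgue_on
        proof (rule sets_lebesgue_onI[OF mS[OF fr]])
          show "(\<lambda>t. frame_coords E b (x t) (v t) i) -` S \<inter> ?S \<in> sets lebesgue"
            unfolding eq by (rule 1)
        qed blast
      qed
    qed (use mem in blast)
  next
    assume R: ?R
    show ?L
    proof (rule measurable_measure_of[OF pow])
      show "(\<lambda>t. (x t, v t)) \<in> space (lebesgue_on ?I) \<rightarrow> topspace ?Tt"
        using curve_in_points[OF x] coords_inD(1)[OF R] by (auto simp: topspace_total_top[OF E])
      fix W assume "W \<in> {W. openin ?Tt W}"
      then have W: "openin ?Tt W" by simp
      have loc: "{t \<in> ?I. x t \<in> U \<and> (x t, v t) \<in> W} \<in> sets lebesgue" if fr: "(U, b) \<in> frames E" for U b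
      proof -
        let ?S = "{t \<in> ?I. x t \<in> U}"
        let ?E = "{c :: nat => real. \<forall>i\<ge>rk E. c i = 0}"
        note xS = continuous_map_curve[OF x, of U]
        have "continuous_map (prod_topology (top_of_set ?S) (Euclidean_space (rk E)))
            (triv_top M E U) (\<lambda>(t, c). (x t, c))"
          using continuous_map_prod_top[of "top_of_set ?S" "Euclidean_space (rk E)" "mtop_on M U"
            "Euclidean_space (rk E)" x "\<lambda>c. c"] xS by simp
        from continuous_map_compose[OF this continuous_map_triv[OF E fr]]
        have "continuous_map (prod_topology (top_of_set ?S) (Euclidean_space (rk E))) ?Tt
            (\<lambda>(t, c). (x t, \<Sum>i<rk E. c i *\<^sub>R b i (x t)))" (is "continuous_map _ _ ?f")
          by (simp add: o_def case_prod_unfold)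
        from openin_continuous_map_preimage[OF this W]
        have "openin (prod_topology (top_of_set ?S) (Euclidean_space (rk E))) {z \<in> ?S \<times> ?E. ?f z \<in> W}"
          by (simp add: topspace_Euclidean_space)
        moreover have "prod_topology (top_of_set ?S) (Euclidean_space (rk E)) = top_of_set (?S \<times> ?E)"
          unfolding Euclidean_space_eq by (simp flip: subtopology_Times)
        \<comment> \<open>Extending the relatively open set to an open one reduces the claim to
          measurability of the map from \<open>t\<close> to the pair of \<open>t\<close> and the
          coordinates.\<close>
        ultimately obtain O' where O': "open O'" "{z \<in> ?S \<times> ?E. ?f z \<in> W} = (?S \<times> ?E) \<inter> O'"
          by (auto simp: openin_open)
        let ?c = "\<lambda>t. frame_coords E b (x t) (v t)"
        have cm: "?c \<in> borel_measurable (lebesgue_on ?S)"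
        proof (rule measurable_coordinatewise_then_product)
          fix i
          show "(\<lambda>t. ?c t i) \<in> borel_measurable (lebesgue_on ?S)"
          proof (cases "i < rk E")
            case True
            then show ?thesis using coords_inD(2)[OF R fr] by simp
          qed (simp add: coords_ge)
        qed
        have "(\<lambda>t. t) \<in> borel_measurable (lebesgue_on ?S)"
          by (rule continuous_imp_measurable_on_sets_lebesgue[OF continuous_on_id mS[OF fr]])
        from borel_measurable_Pair[OF this cm]
        have "(\<lambda>t. (t, ?c t)) -` O' \<inter> ?S \<in> sets (lebesgue_on ?S)"
          using measurable_sets[of "\<lambda>t. (t, ?c t)" "lebesgue_on ?S" borel O'] O'(1)
          unfolding space_lebesgue_on by simp
        then have "(\<lambda>t. (t, ?c t)) -` O' \<inter> ?S \<in> sets lebesgue"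
          by (rule sets_lebesgue_onD[OF mS[OF fr]])
        moreover have "(\<lambda>t. (t, ?c t)) -` O' \<inter> ?S = {t \<in> ?I. x t \<in> U \<and> (x t, v t) \<in> W}"
        proof -
          have "(t, ?c t) \<in> O' \<longleftrightarrow> (x t, v t) \<in> W" if "t \<in> ?S" for t
          proof -
            have "(t, ?c t) \<in> ?S \<times> ?E" using that by (auto simp: coords_ge)
            then have "(t, ?c t) \<in> O' \<longleftrightarrow> ?f (t, ?c t) \<in> W" using O'(2) by blast
            moreover have "?f (t, ?c t) = (x t, v t)"
              using coords_sum[OF framedD(2)[OF E fr] coords_inD(1)[OF R]] that by simp
            ultimately show ?thesis by simp
          qed
          then show ?thesis by auto
        qed
        ultimately show ?thesis by simp
      qed
      \<comment> \<open>There may be uncountably many frames; the Lindelof property of the interval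
        leaves a countable subfamily of preimages that still covers it.\<close>
      let ?F = "(\<lambda>U. {t \<in> ?I. x t \<in> U}) ` fst ` frames E"
      have op: "openin (top_of_set ?I) S" if "S \<in> ?F" for S
        using that openin_curve_preimage[OF x framedD(1)[OF E]] by auto
      obtain F where F: "F \<subseteq> ?F" "countable F" "\<Union> F = \<Union> ?F"
        by (rule Lindelof_openin[OF op])
      have cov: "\<Union> ?F = ?I"
      proof (intro equalityI subsetI)
        fix t assume t: "t \<in> ?I"
        then obtain U b where "(U, b) \<in> frames E" "x t \<in> U"
          using framed_cover[OF E curve_in_points[OF x t]] by blast
        then show "t \<in> \<Union> ?F" using t by force
      qed auto
      have FI: "\<Union> F = ?I" unfolding F(3) by (rule cov)
      have U: "(\<lambda>t. (x t, v t)) -` W \<inter> ?I = (\<Union>S\<in>F. {t \<in> S. (x t, v t) \<in> W})"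
        unfolding FI[symmetric] by blast
      have mS: "{t \<in> S. (x t, v t) \<in> W} \<in> sets lebesgue" if "S \<in> F" for S
      proof -
        obtain U b where "(U, b) \<in> frames E" "S = {t \<in> ?I. x t \<in> U}" using \<open>S \<in> F\<close> F(1) by auto
        then show ?thesis using loc[of U b] by (simp add: conj_assoc)
      qed
      have "(\<lambda>t. (x t, v t)) -` W \<inter> ?I \<in> sets lebesgue"
        unfolding U by (rule sets.countable_UN'[OF F(2)]) (rule image_subsetI, rule mS)
      then show "(\<lambda>t. (x t, v t)) -` W \<inter> space (lebesgue_on ?I) \<in> sets (lebesgue_on ?I)"
        unfolding space_lebesgue_on by (intro sets_lebesgue_onI) auto
    qed
  qed
qed

section \<open>Integrable curves in coordinates\<close>

text \<open>What the coordinate form of integrability takes from the smooth structure: it makes the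
  Gram matrices of bundle metrics continuous along curves.\<close>

definition smooth_implies_continuous :: "'m manifold => bool" where
  "smooth_implies_continuous M \<longleftrightarrow> (\<forall>U h. openin (mtop M) U \<longrightarrow> smooth_fun M U h \<longrightarrow>
     continuous_map (mtop_on M U) euclideanreal h)"

section \<open>Gram matrices of bundle metrics\<close>

lemma bundle_metric_expand:
  assumes g: "bundle_metric M E g" and p: "p \<in> points M" and s: "subspace (fib E p)"
    and b: "\<And>i. i \<in> A ==> b i \<in> fib E p"
  shows "g p (\<Sum>i\<in>A. c i *\<^sub>R b i) (\<Sum>i\<in>A. c i *\<^sub>R b i) = (\<Sum>i\<in>A. \<Sum>j\<in>A. c i * c j * g p (b i) (b j))"
proof -
  have sym: "g p u v = g p v u" if "u \<in> fib E p" "v \<in> fib E p" for u v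
    using g p that unfolding bundle_metric_def by blast
  have lin: "g p (a *\<^sub>R u + a' *\<^sub>R v) w = a * g p u w + a' * g p v w"
    if "u \<in> fib E p" "v \<in> fib E p" "w \<in> fib E p" for u v w a a'
    using g p that unfolding bundle_metric_def by blast
  have dual: "(\<lambda>u. if u \<in> fib E p then g p u w else 0) \<in> dual_space (fib E p)" if "w \<in> fib E p" for w
    using lin[OF _ _ that] s by (auto simp: dual_space_def subspace_add subspace_scale)
  have comb: "(\<Sum>i\<in>A. c i *\<^sub>R b i) \<in> fib E p"
    using s b by (intro subspace_sum) (auto intro: subspace_scale)
  have e: "g p (\<Sum>i\<in>A. c i *\<^sub>R b i) w = (\<Sum>i\<in>A. c i * g p (b i) w)" if w: "w \<in> fib E p" for w
    using dual_space_sum[where A=A and b=b and c=c, OF dual[OF w] s b] comb b by simp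
  have "g p (b i) (\<Sum>j\<in>A. c j *\<^sub>R b j) = (\<Sum>j\<in>A. c j * g p (b i) (b j))" if "i \<in> A" for i
    using e[OF b[OF that]] sym[OF comb b[OF that]] sym[OF b b[OF that]] by simp
  then show ?thesis unfolding e[OF comb]
    by (simp add: sum_distrib_left mult.assoc)
qed

text \<open>The unit sphere of the \<ell>1 norm is a closed subset of the infinite cube with sides
  \<open>{-1..1}\<close>, which is compact by Tychonoff.\<close>

lemma compact_coordinate_sphere:
  "compact {c :: nat => real. (\<forall>i. \<bar>c i\<bar> \<le> 1) \<and> (\<forall>i\<ge>r. c i = 0) \<and> (\<Sum>i<r. \<bar>c i\<bar>) = 1}" (is "compact ?Z")
proof -
  have "compactin (product_topology (\<lambda>_. euclideanreal) (UNIV :: nat set)) (PiE UNIV (\<lambda>_. {-1..1}))"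
    by (subst compactin_PiE) auto
  then have K: "compact (PiE (UNIV :: nat set) (\<lambda>_. {-1..1::real}))"
    by (simp add: euclidean_product_topology)
  have co: "continuous_on UNIV (\<lambda>c :: nat => real. c i)" for i by (rule continuous_on_product_coordinates)
  have "closed (\<Inter>i\<in>{r..}. {c :: nat => real. c i = 0})"
    by (intro closed_INT ballI closed_Collect_eq co continuous_on_const)
  moreover have "closed {c :: nat => real. (\<Sum>i<r. \<bar>c i\<bar>) = 1}"
    by (intro closed_Collect_eq continuous_on_sum continuous_on_rabs co continuous_on_const)
  ultimately have "compact (PiE (UNIV :: nat set) (\<lambda>_. {-1..1::real}) \<inter>
      ((\<Inter>i\<in>{r..}. {c. c i = 0}) \<inter> {c. (\<Sum>i<r. \<bar>c i\<bar>) = 1}))"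
    by (intro compact_Int_closed[OF K] closed_Int)
  moreover have "PiE (UNIV :: nat set) (\<lambda>_. {-1..1::real}) \<inter>
      ((\<Inter>i\<in>{r..}. {c. c i = 0}) \<inter> {c. (\<Sum>i<r. \<bar>c i\<bar>) = 1}) = ?Z"
    by (auto simp: PiE_def Pi_iff abs_le_iff; metis minus_le_iff)
  ultimately show ?thesis by simp
qed

text \<open>A continuous family of positive definite forms over a compact set is uniformly equivalent to the
  square of the \<open>\<ell>\<^sup>1\<close> norm of the coordinates.\<close>

lemma uniform_positive_definite:
  fixes G :: "nat => nat => real => real"
  assumes K: "compact K" and G: "\<And>i j. i < r ==> j < r ==> continuous_on K (G i j)"
    and pos: "\<And>s c. s \<in> K ==> (\<exists>i<r. c i \<noteq> 0) ==> (\<Sum>i<r. \<Sum>j<r. c i * c j * G i j s) > 0"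
  obtains m where "m > 0"
    "\<And>s c. s \<in> K ==> m * (\<Sum>i<r. \<bar>c i\<bar>)\<^sup>2 \<le> (\<Sum>i<r. \<Sum>j<r. c i * c j * G i j s)"
proof -
  let ?Z = "{c :: nat => real. (\<forall>i. \<bar>c i\<bar> \<le> 1) \<and> (\<forall>i\<ge>r. c i = 0) \<and> (\<Sum>i<r. \<bar>c i\<bar>) = 1}"
  let ?q = "\<lambda>(s, c). \<Sum>i<r. \<Sum>j<r. c i * c j * G i j s"
  have comp: "compact (K \<times> ?Z)" by (intro compact_Times K compact_coordinate_sphere)
  have co: "continuous_on (K \<times> ?Z) (\<lambda>z. snd z i)" for i
  proof -
    have "continuous_on (K \<times> ?Z) ((\<lambda>c. c i) \<circ> snd)"
      by (intro continuous_on_compose continuous_on_snd continuous_on_id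
          continuous_on_subset[OF continuous_on_product_coordinates]) auto
    then show ?thesis by (simp add: o_def)
  qed
  have cG: "continuous_on (K \<times> ?Z) (\<lambda>z. G i j (fst z))" if "i < r" "j < r" for i j
    by (rule continuous_on_compose2[OF G[OF that] continuous_on_fst[OF continuous_on_id]]) auto
  have q: "continuous_on (K \<times> ?Z) ?q"
    unfolding case_prod_unfold
    by (intro continuous_on_sum continuous_on_mult co cG) auto
  have ex: "\<exists>m>0. \<forall>z\<in>K \<times> ?Z. m \<le> ?q z"
  proof (cases "K \<times> ?Z = {}")
    \<comment> \<open>Empty if \<open>K\<close> is empty or the rank is 0; any positive constant
      serves.\<close>
    case True
    then show ?thesis by (intro exI[of _ 1]) auto
  next
    case False
    obtain z where z: "z \<in> K \<times> ?Z" "\<forall>y\<in>K \<times> ?Z. ?q z \<le> ?q y"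
      using continuous_attains_inf[OF comp False q] by blast
    have "\<exists>i<r. snd z i \<noteq> 0"
    proof (rule ccontr)
      assume "\<not> (\<exists>i<r. snd z i \<noteq> 0)"
      then have "(\<Sum>i<r. \<bar>snd z i\<bar>) = 0" by simp
      then show False using z(1) by auto
    qed
    then have "?q z > 0" using pos[of "fst z" "snd z"] z(1) by (auto simp: case_prod_unfold)
    then show ?thesis using z(2) by blast
  qed
  then obtain m where m: "m > 0" "\<And>z. z \<in> K \<times> ?Z ==> m \<le> ?q z" by blast
  have "m * (\<Sum>i<r. \<bar>c i\<bar>)\<^sup>2 \<le> (\<Sum>i<r. \<Sum>j<r. c i * c j * G i j s)" if s: "s \<in> K" for s c
  proof (cases "(\<Sum>i<r. \<bar>c i\<bar>) = 0")
    case True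
    then have "\<forall>i<r. c i = 0" by (simp add: sum_nonneg_eq_0_iff)
    then show ?thesis using True by simp
  next
    case False
    \<comment> \<open>The form is homogeneous of degree 2, so the bound on the sphere scales to
      every nonzero coefficient vector.\<close>
    define N where "N = (\<Sum>i<r. \<bar>c i\<bar>)"
    have N: "N > 0" using False by (simp add: N_def order.strict_iff_order sum_nonneg)
    define d where "d i = (if i < r then c i / N else 0)" for i
    have "(\<Sum>i<r. \<bar>d i\<bar>) = 1"
      using N by (simp add: d_def N_def[symmetric] flip: sum_divide_distrib)
    moreover have "\<bar>d i\<bar> \<le> 1" for i
      using member_le_sum[of i "{..<r}" "\<lambda>i. \<bar>c i\<bar>"] N by (auto simp: d_def N_def[symmetric])
    ultimately have "(s, d) \<in> K \<times> ?Z" using s by (simp add: d_def)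
    then have "m \<le> (\<Sum>i<r. \<Sum>j<r. d i * d j * G i j s)" using m(2) by fastforce
    also have "\<dots> = (\<Sum>i<r. \<Sum>j<r. c i * c j * G i j s) / N\<^sup>2"
      by (simp add: d_def sum_divide_distrib power2_eq_square)
    finally show ?thesis using N by (simp add: N_def[symmetric] pos_le_divide_eq)
  qed
  then show ?thesis using that m(1) by blast
qed

text \<open>Countably many of the balls from the definition cover \<open>S\<close>, and on each of
  them the function is integrable, hence measurable.\<close>

lemma loc_integrable_measurable:
  assumes S: "openin (top_of_set {t0..t1}) S" and f: "loc_integrable S f"
  shows "f \<in> borel_measurable (lebesgue_on S)"
proof -
  have mS: "S \<in> sets lebesgue" by (rule openin_interval_lebesgue[OF S])
  have "\<forall>t\<in>S. \<exists>d. d > 0 \<and> set_integrable lebesgue (S \<inter> cball t d) f"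
    using f unfolding loc_integrable_def by blast
  from bchoice[OF this] obtain d where d: "\<forall>t\<in>S. d t > 0 \<and> set_integrable lebesgue (S \<inter> cball t (d t)) f" ..
  let ?F = "(\<lambda>t. S \<inter> ball t (d t)) ` S"
  have op: "openin (top_of_set S) T" if "T \<in> ?F" for T using that by (auto intro: openin_open_Int)
  obtain F where F: "F \<subseteq> ?F" "countable F" "\<Union> F = \<Union> ?F" by (rule Lindelof_openin[OF op])
  have cov: "\<Union> ?F = S"
  proof (intro equalityI subsetI)
    fix t assume t: "t \<in> S"
    then have "t \<in> S \<inter> ball t (d t)" using d by simp
    then show "t \<in> \<Union> ?F" using t by blast
  qed auto
  show ?thesis
  proof (rule borel_measurableI)
    fix G :: "real set" assume G: "open G"
    have FS: "\<Union> F = S" unfolding F(3) by (rule cov)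
    have U: "f -` G \<inter> S = (\<Union>T\<in>F. f -` G \<inter> T)" by (subst FS[symmetric]) blast
    have mT: "f -` G \<inter> T \<in> sets lebesgue" if "T \<in> F" for T
    proof -
      obtain t where t: "t \<in> S" "T = S \<inter> ball t (d t)" using \<open>T \<in> F\<close> F(1) by blast
      have mT: "T \<in> sets lebesgue" using mS t(2) by auto
      have "set_integrable lebesgue T f"
        by (rule set_integrable_subset[of _ "S \<inter> cball t (d t)"]) (use d t mT in auto)
      then have "integrable (lebesgue_on T) f" using integrable_on_iff[OF mT] by simp
      then have "f -` G \<inter> space (lebesgue_on T) \<in> sets (lebesgue_on T)"
        using G by (intro measurable_sets[OF borel_measurable_integrable]) auto
      then show ?thesis unfolding space_lebesgue_on by (rule sets_lebesgue_onD[OF mT])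
    qed
    have "f -` G \<inter> S \<in> sets lebesgue"
      unfolding U by (rule sets.countable_UN'[OF F(2)]) (rule image_subsetI, rule mT)
    then show "f -` G \<inter> space (lebesgue_on S) \<in> sets (lebesgue_on S)"
      unfolding space_lebesgue_on by (intro sets_lebesgue_onI[OF mS]) auto
  qed
qed

text \<open>On a compact piece of the interval that the shadow maps into one frame domain, the Gram
  matrix is continuous and positive definite, so the metric norm and the \<ell>1 norm of the
  coordinates bound each other. Compactness of the interval passes from local to global
  integrability. The existence of a metric stays on the right-hand side because the coordinates do
  not provide one.\<close>

lemma L1c_iff:
  assumes E: "framed M E" and sc: "smooth_implies_continuous M"
  shows "(\<lambda>t. (x t, v t)) \<in> L1c M E t0 t1 \<longleftrightarrow>
    curve_on {t0..t1} M x \<and> coords_in loc_integrable {t0..t1} E x v \<and>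
    (\<exists>g. bundle_metric M E g)"
proof -
  let ?I = "{t0..t1}"
  have G: "continuous_on {t \<in> ?I. x t \<in> U} (\<lambda>t. g (x t) (b i (x t)) (b j (x t)))"
    if g: "bundle_metric M E g" and fr: "(U, b) \<in> frames E" and ij: "i < rk E" "j < rk E"
      and x: "curve_on ?I M x" for g U b i j
  proof -
    have "smooth_fun M U (\<lambda>p. g p (b i p) (b j p))"
      using g fr ij unfolding bundle_metric_def by auto
    then have "continuous_map (mtop_on M U) euclideanreal (\<lambda>p. g p (b i p) (b j p))"
      using sc framedD(1)[OF E fr] unfolding smooth_implies_continuous_def by blast
    from continuous_on_curve[OF x this] show ?thesis .
  qed
  show ?thesis
  proof
    assume L: "(\<lambda>t. (x t, v t)) \<in> L1c M E t0 t1"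
    then have x: "curve_on ?I M x" by (simp add: L1c_def o_def)
    have "coords_in (\<lambda>S f. f \<in> borel_measurable (lebesgue_on S)) ?I E x v"
      using L curve_measurable_iff[OF E x] by (simp add: L1c_def)
    note meas = coords_inD(2)[OF this] and mem = coords_inD(1)[OF this]
    obtain g where g: "bundle_metric M E g"
      and int: "integrable (lebesgue_on ?I) (\<lambda>t. sqrt (g (x t) (v t) (v t)))"
      using L by (auto simp: L1c_def)
    have int': "set_integrable lebesgue ?I (\<lambda>t. sqrt (g (x t) (v t) (v t)))"
      using int by (simp add: integrable_on_iff)
    have "coords_in loc_integrable ?I E x v"
    proof (rule coords_inI)
      fix U b i assume fr: "(U, b) \<in> frames E" and i: "i < rk E"
      let ?S = "{t \<in> ?I. x t \<in> U}"
      have opS: "openin (top_of_set ?I) ?S" by (rule openin_curve_preimage[OF x framedD(1)[OF E fr]])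
      show "loc_integrable ?S (\<lambda>t. frame_coords E b (x t) (v t) i)"
        unfolding loc_integrable_def
      proof
        fix t assume t: "t \<in> ?S"
        obtain d where d: "d > 0" "?I \<inter> cball t d \<subseteq> ?S" "\<And>e. e \<le> d ==> ?S \<inter> cball t e = ?I \<inter> cball t e"
          using openin_interval_cball[OF opS t] by blast
        let ?K = "?I \<inter> cball t d"
        have K: "compact ?K" by (intro compact_Int) auto
        have mK: "?K \<in> sets lebesgue" by auto
        let ?G = "\<lambda>i j s. g (x s) (b i (x s)) (b j (x s))"
        let ?c = "\<lambda>s. frame_coords E b (x s) (v s)"
        have ex: "g (x s) (\<Sum>i<rk E. c i *\<^sub>R b i (x s)) (\<Sum>i<rk E. c i *\<^sub>R b i (x s)) =
            (\<Sum>i<rk E. \<Sum>j<rk E. c i * c j * ?G i j s)" if "s \<in> ?S" for s c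
        proof -
          have B: "basis_of (rk E) (\<lambda>i. b i (x s)) (fib E (x s))" using framedD(2)[OF E fr] that by simp
          show ?thesis
            by (rule bundle_metric_expand[OF g curve_in_points[OF x] basis_of_subspace[OF B]])
              (use that basis_of_mem[OF B] in auto)
        qed
        \<comment> \<open>A uniform lower bound for the metric, which lets its integrable norm
          dominate each coordinate.\<close>
        obtain m where m: "m > 0" "\<And>s c. s \<in> ?K ==> m * (\<Sum>i<rk E. \<bar>c i\<bar>)\<^sup>2 \<le> (\<Sum>i<rk E. \<Sum>j<rk E. c i * c j * ?G i j s)"
        proof (rule uniform_positive_definite[OF K, of "rk E" ?G])
          show "continuous_on ?K (?G i j)" if "i < rk E" "j < rk E" for i j
            by (rule continuous_on_subset[OF G[OF g fr that x] d(2)])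
          fix s and c :: "nat => real" assume s: "s \<in> ?K" and c: "\<exists>i<rk E. c i \<noteq> 0"
          have sS: "s \<in> ?S" using s d(2) by blast
          then have B: "basis_of (rk E) (\<lambda>i. b i (x s)) (fib E (x s))" using framedD(2)[OF E fr] by simp
          have "(\<Sum>i<rk E. c i *\<^sub>R b i (x s)) \<noteq> 0" using c B unfolding basis_of_iff by blast
          moreover have "x s \<in> points M" using curve_in_points[OF x] sS by blast
          ultimately have "g (x s) (\<Sum>i<rk E. c i *\<^sub>R b i (x s)) (\<Sum>i<rk E. c i *\<^sub>R b i (x s)) > 0"
            using g basis_of_comb[OF B, of c] unfolding bundle_metric_def by blast
          then show "(\<Sum>i<rk E. \<Sum>j<rk E. c i * c j * ?G i j s) > 0" unfolding ex[OF sS] .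
        qed blast
        have bound: "norm (?c s i) \<le> norm (sqrt (g (x s) (v s) (v s)) / sqrt m)" if s: "s \<in> ?K" for s
        proof -
          have sS: "s \<in> ?S" using s d(2) by blast
          then have B: "basis_of (rk E) (\<lambda>i. b i (x s)) (fib E (x s))" using framedD(2)[OF E fr] by simp
          have v: "v s = (\<Sum>i<rk E. ?c s i *\<^sub>R b i (x s))" using coords_sum[OF B mem] sS by simp
          have "m * (\<Sum>i<rk E. \<bar>?c s i\<bar>)\<^sup>2 \<le> g (x s) (v s) (v s)"
            using m(2)[OF s, of "?c s"] ex[OF sS, of "?c s"] v by simp
          then have "sqrt m * (\<Sum>i<rk E. \<bar>?c s i\<bar>) \<le> sqrt (g (x s) (v s) (v s))"
            using m(1) by (intro real_le_rsqrt) (simp add: power_mult_distrib)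
          moreover have "\<bar>?c s i\<bar> \<le> (\<Sum>i<rk E. \<bar>?c s i\<bar>)" using i by (intro member_le_sum) auto
          ultimately have "sqrt m * \<bar>?c s i\<bar> \<le> sqrt (g (x s) (v s) (v s))"
            using m(1) by (meson mult_left_mono order_trans real_sqrt_ge_zero less_imp_le)
          then have "\<bar>?c s i\<bar> \<le> sqrt (g (x s) (v s) (v s)) / sqrt m"
            using m(1) by (simp add: pos_le_divide_eq mult.commute)
          also have "\<dots> \<le> \<bar>sqrt (g (x s) (v s) (v s)) / sqrt m\<bar>" by (rule abs_ge_self)
          finally show ?thesis unfolding real_norm_def .
        qed
        have "integrable (lebesgue_on ?K) (\<lambda>s. ?c s i)"
        proof (rule Bochner_Integration.integrable_bound)
          have "set_integrable lebesgue ?K (\<lambda>t. sqrt (g (x t) (v t) (v t)))"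
            by (rule set_integrable_subset[OF int' mK]) blast
          then show "integrable (lebesgue_on ?K) (\<lambda>t. sqrt (g (x t) (v t) (v t)) / sqrt m)"
            using integrable_on_iff[OF mK] by simp
          show "(\<lambda>s. ?c s i) \<in> borel_measurable (lebesgue_on ?K)"
            by (rule measurable_restrict_mono[OF meas[OF fr i] d(2)])
          show "AE s in lebesgue_on ?K. norm (?c s i) \<le> norm (sqrt (g (x s) (v s) (v s)) / sqrt m)"
            by (rule AE_I2) (simp only: space_lebesgue_on bound)
        qed
        then have "set_integrable lebesgue (?S \<inter> cball t d) (\<lambda>s. ?c s i)"
          using integrable_on_iff[OF mK] d(3)[OF order_refl] by simp
        then show "\<exists>d>0. set_integrable lebesgue (?S \<inter> cball t d) (\<lambda>s. ?c s i)" using d(1) by blast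
      qed
    qed (use mem in blast)
    then show "curve_on ?I M x \<and> coords_in loc_integrable ?I E x v \<and>
        (\<exists>g. bundle_metric M E g)" using x g by blast
  next
    assume R: "curve_on ?I M x \<and> coords_in loc_integrable ?I E x v \<and>
        (\<exists>g. bundle_metric M E g)"
    then obtain g where x: "curve_on ?I M x"
      and co: "coords_in loc_integrable ?I E x v" and g: "bundle_metric M E g" by blast
    have cm: "coords_in (\<lambda>S f. f \<in> borel_measurable (lebesgue_on S)) ?I E x v"
      by (intro coords_inI coords_inD(1)[OF co]
          loc_integrable_measurable[OF openin_curve_preimage[OF x framedD(1)[OF E]] coords_inD(2)[OF co]])
    have "loc_integrable ?I (\<lambda>t. sqrt (g (x t) (v t) (v t)))"
      unfolding loc_integrable_def
    proof
      fix t assume t: "t \<in> ?I"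
      obtain U b where fr: "(U, b) \<in> frames E" and xt: "x t \<in> U" and opS: "openin (top_of_set ?I) {t \<in> ?I. x t \<in> U}"
        by (rule curve_frame[OF E x t])
      let ?S = "{t \<in> ?I. x t \<in> U}"
      have tS: "t \<in> ?S" using t xt by simp
      let ?c = "\<lambda>s. frame_coords E b (x s) (v s)"
      let ?G = "\<lambda>i j s. g (x s) (b i (x s)) (b j (x s))"
      have "finite ((\<lambda>i t. ?c t i) ` {..<rk E})" by simp
      then obtain d where d: "d > 0" "\<And>f. f \<in> (\<lambda>i t. ?c t i) ` {..<rk E} ==> set_integrable lebesgue (?S \<inter> cball t d) f"
        using loc_integrable_common[OF openin_interval_lebesgue[OF opS] tS, of "(\<lambda>i t. ?c t i) ` {..<rk E}"]
          coords_inD(2)[OF co fr] by blast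
      obtain e where e: "e > 0" "?I \<inter> cball t e \<subseteq> ?S" "\<And>e'. e' \<le> e ==> ?S \<inter> cball t e' = ?I \<inter> cball t e'"
        using openin_interval_cball[OF opS tS] by blast
      let ?K = "?I \<inter> cball t (min d e)"
      have mK: "?K \<in> sets lebesgue" by auto
      have KS: "?K \<subseteq> ?S" using e(2) by auto
      have K: "compact ?K" by (intro compact_Int) auto
      have ci: "integrable (lebesgue_on ?K) (\<lambda>s. ?c s i)" if "i < rk E" for i
      proof -
        have "set_integrable lebesgue ?K (\<lambda>s. ?c s i)"
          by (rule set_integrable_subset[OF d(2) mK]) (use that KS in auto)
        then show ?thesis using integrable_on_iff[OF mK] by simp
      qed
      have Gc: "continuous_on ?K (?G i j)" if "i < rk E" "j < rk E" for i j
        by (rule continuous_on_subset[OF G[OF g fr that x] KS])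
      have ex: "g (x s) (v s) (v s) = (\<Sum>i<rk E. \<Sum>j<rk E. ?c s i * ?c s j * ?G i j s)" if "s \<in> ?K" for s
      proof -
        have sS: "s \<in> ?S" using that KS by blast
        then have B: "basis_of (rk E) (\<lambda>i. b i (x s)) (fib E (x s))" using framedD(2)[OF E fr] by simp
        have v: "v s = (\<Sum>i<rk E. ?c s i *\<^sub>R b i (x s))" using coords_sum[OF B coords_inD(1)[OF co]] sS by simp
        have "g (x s) (\<Sum>i<rk E. ?c s i *\<^sub>R b i (x s)) (\<Sum>i<rk E. ?c s i *\<^sub>R b i (x s)) =
            (\<Sum>i<rk E. \<Sum>j<rk E. ?c s i * ?c s j * ?G i j s)"
          by (rule bundle_metric_expand[OF g curve_in_points[OF x] basis_of_subspace[OF B]])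
            (use sS basis_of_mem[OF B] in auto)
        then show ?thesis using v by simp
      qed
      have "\<forall>p\<in>{..<rk E} \<times> {..<rk E}. \<exists>B. \<forall>s\<in>?K. \<bar>?G (fst p) (snd p) s\<bar> \<le> B"
      proof
        fix p assume "p \<in> {..<rk E} \<times> {..<rk E}"
        then have "bounded (?G (fst p) (snd p) ` ?K)"
          using compact_imp_bounded[OF compact_continuous_image[OF Gc K]] by (auto simp: mem_Times_iff)
        then show "\<exists>B. \<forall>s\<in>?K. \<bar>?G (fst p) (snd p) s\<bar> \<le> B" unfolding bounded_iff by auto
      qed
      from bchoice[OF this] obtain B where B: "\<forall>p\<in>{..<rk E} \<times> {..<rk E}. \<forall>s\<in>?K. \<bar>?G (fst p) (snd p) s\<bar> \<le> B p" ..
      \<comment> \<open>A common bound for all Gram entries on the piece, which lets the coordinates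
        dominate the metric norm.\<close>
      define B' where "B' = (\<Sum>p\<in>{..<rk E} \<times> {..<rk E}. \<bar>B p\<bar>)"
      have B': "\<bar>?G i j s\<bar> \<le> B'" if "i < rk E" "j < rk E" "s \<in> ?K" for i j s
      proof -
        have "\<bar>?G i j s\<bar> \<le> B (i, j)" using B that by auto
        also have "\<dots> \<le> \<bar>B (i, j)\<bar>" by simp
        also have "\<dots> \<le> B'" unfolding B'_def by (rule member_le_sum) (use that in auto)
        finally show ?thesis .
      qed
      have B0: "B' \<ge> 0" unfolding B'_def by (intro sum_nonneg) simp
      have "integrable (lebesgue_on ?K) (\<lambda>s. sqrt (g (x s) (v s) (v s)))"
      proof (rule Bochner_Integration.integrable_bound)
        show "integrable (lebesgue_on ?K) (\<lambda>s. sqrt B' * (\<Sum>i<rk E. \<bar>?c s i\<bar>))"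
          by (intro integrable_mult_right Bochner_Integration.integrable_sum integrable_abs ci) auto
        have "(\<lambda>s. \<Sum>i<rk E. \<Sum>j<rk E. ?c s i * ?c s j * ?G i j s) \<in> borel_measurable (lebesgue_on ?K)"
          by (intro borel_measurable_sum borel_measurable_times
              borel_measurable_integrable[OF ci] continuous_imp_measurable_on_sets_lebesgue[OF Gc mK]) auto
        moreover have "(sqrt :: real => real) \<in> borel_measurable borel"
          by (intro borel_measurable_continuous_onI continuous_intros)
        ultimately have "(\<lambda>s. sqrt (\<Sum>i<rk E. \<Sum>j<rk E. ?c s i * ?c s j * ?G i j s)) \<in> borel_measurable (lebesgue_on ?K)"
          by (rule measurable_compose)
        then show "(\<lambda>s. sqrt (g (x s) (v s) (v s))) \<in> borel_measurable (lebesgue_on ?K)"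
          by (rule measurable_cong[THEN iffD1, rotated]) (simp only: space_lebesgue_on ex)
        show "AE s in lebesgue_on ?K. norm (sqrt (g (x s) (v s) (v s))) \<le> norm (sqrt B' * (\<Sum>i<rk E. \<bar>?c s i\<bar>))"
        proof (rule AE_I2, unfold space_lebesgue_on)
          fix s assume s: "s \<in> ?K"
          have "\<bar>g (x s) (v s) (v s)\<bar> \<le> (\<Sum>i<rk E. \<Sum>j<rk E. \<bar>?c s i * ?c s j * ?G i j s\<bar>)"
            unfolding ex[OF s] by (rule order_trans[OF sum_abs sum_mono[OF sum_abs]])
          also have "\<dots> \<le> (\<Sum>i<rk E. \<Sum>j<rk E. \<bar>?c s i\<bar> * \<bar>?c s j\<bar> * B')"
            unfolding abs_mult by (intro sum_mono mult_left_mono B' s) auto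
          also have "\<dots> = B' * (\<Sum>i<rk E. \<bar>?c s i\<bar>)\<^sup>2"
            by (simp add: power2_eq_square sum_product sum_distrib_left mult_ac)
          finally have "sqrt \<bar>g (x s) (v s) (v s)\<bar> \<le> sqrt (B' * (\<Sum>i<rk E. \<bar>?c s i\<bar>)\<^sup>2)"
            by (rule real_sqrt_le_mono)
          moreover have "\<bar>sqrt y\<bar> = sqrt \<bar>y\<bar>" for y by (simp add: abs_if real_sqrt_minus)
          moreover have "sqrt (B' * (\<Sum>i<rk E. \<bar>?c s i\<bar>)\<^sup>2) = sqrt B' * (\<Sum>i<rk E. \<bar>?c s i\<bar>)"
            by (simp add: real_sqrt_mult sum_nonneg)
          ultimately show "norm (sqrt (g (x s) (v s) (v s))) \<le> norm (sqrt B' * (\<Sum>i<rk E. \<bar>?c s i\<bar>))"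
            unfolding real_norm_def by (metis abs_ge_self order_trans)
        qed
      qed
      then have "set_integrable lebesgue ?K (\<lambda>s. sqrt (g (x s) (v s) (v s)))"
        using integrable_on_iff[OF mK] by simp
      then show "\<exists>d>0. set_integrable lebesgue (?I \<inter> cball t d) (\<lambda>t. sqrt (g (x t) (v t) (v t)))"
        using d(1) e(1) by (intro exI[of _ "min d e"]) auto
    qed
    from loc_integrable_compact[OF _ this, of ?I]
    have "integrable (lebesgue_on ?I) (\<lambda>t. sqrt (g (x t) (v t) (v t)))"
      by (simp add: integrable_on_iff)
    then show "(\<lambda>t. (x t, v t)) \<in> L1c M E t0 t1"
      unfolding L1c_def using curve_measurable_iff[OF E x, of v] cm x g
      by (auto simp: o_def)
  qed
qed

section \<open>Products of manifolds\<close>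

text \<open>The part of the manifold axioms that concerns charts; unlike the separation axioms it is all
  that the tangent bundle needs.\<close>

definition atlas :: "'m manifold => bool" where
  "atlas M \<longleftrightarrow>
     \<Union> (fst ` charts M) = points M \<and>
     (\<forall>(U, \<phi>) \<in> charts M.
        openin (mtop M) U \<and> openin (model M) (\<phi> ` U) \<and>
        homeomorphic_map (mtop_on M U) (subtopology (model M) (\<phi> ` U)) \<phi> \<and>
        (\<forall>i<mdim M. smooth_fun M U (\<lambda>p. \<phi> p i)))"

lemma smooth_manifold_atlas: "smooth_manifold M ==> atlas M"
  unfolding smooth_manifold_def atlas_def by (elim conjE, intro conjI)

lemma atlasD:
  assumes "atlas M" "(U, \<phi>) \<in> charts M"
  shows "openin (mtop M) U" "openin (model M) (\<phi> ` U)"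
    "homeomorphic_map (mtop_on M U) (subtopology (model M) (\<phi> ` U)) \<phi>"
    "\<And>i. i < mdim M ==> smooth_fun M U (\<lambda>p. \<phi> p i)"
  using bspec[OF conjunct2[OF assms(1)[unfolded atlas_def]] assms(2), unfolded prod.case] by simp_all

lemma atlas_cover: "atlas M ==> p \<in> points M ==> \<exists>U \<phi>. (U, \<phi>) \<in> charts M \<and> p \<in> U"
  using conjunct1[OF iffD1[OF atlas_def]] by fastforce

lemma chart_inj:
  assumes "atlas M" "(U, \<phi>) \<in> charts M"
  shows "inj_on \<phi> U"
  using homeomorphic_imp_injective_map[OF atlasD(3)[OF assms]] openin_subset[OF atlasD(1)[OF assms]]
  by (simp add: Int_absorb1)

lemma chart_inv: "atlas M ==> (U, \<phi>) \<in> charts M ==> p \<in> U ==> inv_into U \<phi> (\<phi> p) = p"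
  by (rule inv_into_f_f[OF chart_inj])

lemma chart_Euclidean:
  assumes "atlas M" "(U, \<phi>) \<in> charts M" "p \<in> U" "i \<ge> mdim M"
  shows "\<phi> p i = 0"
  using subsetD[OF openin_subset[OF atlasD(2)[OF assms(1,2)]] imageI[OF assms(3)]] assms(4)
  by (simp add: topspace_Euclidean_space)

lemma chart_continuous:
  assumes "atlas M" "(U, \<phi>) \<in> charts M"
  shows "continuous_map (mtop_on M U) (model M) \<phi>"
  using homeomorphic_imp_continuous_map[OF atlasD(3)[OF assms]] by (simp add: continuous_map_in_subtopology)

lemma chart_open_image:
  assumes "atlas M" "(U, \<phi>) \<in> charts M" "openin (mtop M) V"
  shows "openin (model M) (\<phi> ` (V \<inter> U))"
proof -
  have "openin (mtop_on M U) (V \<inter> U)" unfolding openin_subtopology using assms(3) by blast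
  then have "openin (subtopology (model M) (\<phi> ` U)) (\<phi> ` (V \<inter> U))"
    using homeomorphic_imp_open_map[OF atlasD(3)[OF assms(1,2)]] unfolding open_map_def by blast
  then show ?thesis using openin_open_subtopology[OF atlasD(2)[OF assms(1,2)]] by blast
qed

lemma smooth_funD:
  "smooth_fun M U h ==> (V, \<phi>) \<in> charts M ==> Ck k (mdim M) (\<phi> ` (U \<inter> V)) (\<lambda>z. h (inv_into V \<phi> z))"
  unfolding smooth_fun_def by (auto simp: o_def)

lemma smooth_funI:
  "(\<And>V \<phi> k. (V, \<phi>) \<in> charts M ==> Ck k (mdim M) (\<phi> ` (U \<inter> V)) (\<lambda>z. h (inv_into V \<phi> z))) ==> smooth_fun M U h"
  unfolding smooth_fun_def by (auto simp: o_def)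

lemma atlas_smooth_continuous:
  assumes M: "atlas M"
  shows "smooth_implies_continuous M"
  unfolding smooth_implies_continuous_def
proof (intro allI impI)
  fix U h assume U: "openin (mtop M) U" and h: "smooth_fun M U h"
  show "continuous_map (mtop_on M U) euclideanreal h"
  proof (rule continuous_map_locally)
    fix p assume "p \<in> topspace (mtop_on M U)"
    then have p: "p \<in> U" "p \<in> points M" by auto
    obtain V \<phi> where ch: "(V, \<phi>) \<in> charts M" "p \<in> V" using atlas_cover[OF M p(2)] by blast
    have sub: "subtopology (mtop_on M U) (U \<inter> V) = subtopology (mtop_on M V) (U \<inter> V)"
      unfolding subtopology_subtopology by (rule arg_cong[of _ _ "mtop_on M"]) blast
    have "continuous_map (subtopology (mtop_on M V) (U \<inter> V))
        (subtopology (model M) (\<phi> ` (U \<inter> V))) \<phi>"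
      using continuous_map_from_subtopology[OF chart_continuous[OF M ch(1)], of "U \<inter> V"]
      by (auto simp: continuous_map_in_subtopology)
    moreover have "continuous_map (subtopology (model M) (\<phi> ` (U \<inter> V))) euclideanreal
        (\<lambda>z. h (inv_into V \<phi> z))"
      using smooth_funD[OF h ch(1), of 0] by simp
    ultimately have "continuous_map (subtopology (mtop_on M V) (U \<inter> V)) euclideanreal
        ((\<lambda>z. h (inv_into V \<phi> z)) \<circ> \<phi>)" by (rule continuous_map_compose)
    then have "continuous_map (subtopology (mtop_on M V) (U \<inter> V)) euclideanreal h"
      by (rule continuous_map_eq) (use chart_inv[OF M ch(1)] in auto)
    moreover have "openin (mtop_on M U) (U \<inter> V)"
      unfolding openin_subtopology using atlasD(1)[OF M ch(1)] by blast
    ultimately show "\<exists>T. openin (mtop_on M U) T \<and> p \<in> T \<and>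
        continuous_map (subtopology (mtop_on M U) T) euclideanreal h"
      using p ch(2) by (intro exI[of _ "U \<inter> V"]) (simp add: sub)
  qed
qed

lemma smooth_fun_subset: "smooth_fun M U h ==> V \<subseteq> U ==> smooth_fun M V h"
  by (rule smooth_funI, rule Ck_subset[OF smooth_funD]) auto

lemma smooth_fun_local:
  assumes M: "atlas M" and "\<And>p. p \<in> U ==> \<exists>V. openin (mtop M) V \<and> p \<in> V \<and> V \<subseteq> U \<and> smooth_fun M V h"
  shows "smooth_fun M U h"
proof (rule smooth_funI)
  fix V \<phi> k assume ch: "(V, \<phi>) \<in> charts M"
  show "Ck k (mdim M) (\<phi> ` (U \<inter> V)) (\<lambda>z. h (inv_into V \<phi> z))"
  proof (rule Ck_local)
    show "\<phi> ` (U \<inter> V) \<subseteq> topspace (model M)"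
      using openin_subset[OF atlasD(2)[OF M ch]] by blast
    fix z assume "z \<in> \<phi> ` (U \<inter> V)"
    then obtain p where p: "p \<in> U" "p \<in> V" "z = \<phi> p" by blast
    from assms(2)[OF p(1)] obtain W where W: "openin (mtop M) W" "p \<in> W" "W \<subseteq> U" "smooth_fun M W h" by blast
    show "\<exists>Va. openin (model M) Va \<and> z \<in> Va \<and> Va \<subseteq> \<phi> ` (U \<inter> V) \<and>
        Ck k (mdim M) Va (\<lambda>z. h (inv_into V \<phi> z))"
    proof (intro exI conjI)
      show "openin (model M) (\<phi> ` (W \<inter> V))" by (rule chart_open_image[OF M ch W(1)])
      show "Ck k (mdim M) (\<phi> ` (W \<inter> V)) (\<lambda>z. h (inv_into V \<phi> z))" by (rule smooth_funD[OF W(4) ch])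
    qed (use p W in auto)
  qed
qed

lemma smooth_fun_const: "smooth_fun M U (\<lambda>_. c)"
  by (rule smooth_funI) (rule Ck_const)

lemma smooth_fun_add:
  assumes M: "atlas M" and U: "openin (mtop M) U" and "smooth_fun M U f" "smooth_fun M U g"
  shows "smooth_fun M U (\<lambda>p. f p + g p)"
  by (rule smooth_funI, rule Ck_add[OF chart_open_image[OF M _ U]]) (auto intro: smooth_funD assms)

section \<open>Charts of a product as blocks of coordinates\<close>

lemma prod_manifold_chart:
  assumes "X \<in> charts (prod_manifold M N)"
  obtains U \<phi> V \<psi> where "(U, \<phi>) \<in> charts M" "(V, \<psi>) \<in> charts N"
    "X = (U \<times> V, \<lambda>(p, q) i. if i < mdim M then \<phi> p i else \<psi> q (i - mdim M))"
  using assms by (auto simp: prod_manifold_def)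

lemma prod_manifold_chartI:
  "(U, \<phi>) \<in> charts M ==> (V, \<psi>) \<in> charts N ==>
    (U \<times> V, \<lambda>(p, q) i. if i < mdim M then \<phi> p i else \<psi> q (i - mdim M)) \<in> charts (prod_manifold M N)"
  by (auto simp: prod_manifold_def)

text \<open>\<open>left_part\<close>, \<open>right_part\<close> and \<open>join\<close> identify
  \<open>R^(m+n)\<close> with \<open>R^m x R^n\<close>. The left part has to be truncated, as points
  of \<open>R^m\<close> vanish from index \<open>m\<close> on; the right part inherits its zeros
  through the shift.\<close>

definition left_part :: "nat => (nat => real) => nat => real" where
  "left_part m z = (\<lambda>i. if i < m then z i else 0)"

definition right_part :: "nat => (nat => real) => nat => real" where
  "right_part m z = (\<lambda>i. z (m + i))"

definition join :: "nat => (nat => real) => (nat => real) => nat => real" where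
  "join m z w = (\<lambda>i. if i < m then z i else w (i - m))"

abbreviation prod_map where
  "prod_map M \<phi> \<psi> \<equiv> (\<lambda>(p, q). join (mdim M) (\<phi> p) (\<psi> q))"

lemma left_part_join: "(\<And>i. i \<ge> m ==> z i = 0) ==> left_part m (join m z w) = z"
  by (auto simp: left_part_def join_def fun_eq_iff)

lemma right_part_join: "right_part m (join m z w) = w"
  by (auto simp: right_part_def join_def fun_eq_iff)

lemma join_parts: "join m (left_part m z) (right_part m z) = z"
  by (auto simp: right_part_def left_part_def join_def fun_eq_iff)

lemma continuous_map_into_Euclidean:
  assumes "\<And>i. i < n ==> continuous_map X euclideanreal (\<lambda>x. f x i)"
    and "\<And>x i. x \<in> topspace X ==> i \<ge> n ==> f x i = 0"
  shows "continuous_map X (Euclidean_space n) f"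
proof -
  have "continuous_map X (Euclidean_space n) (\<lambda>x i. if i < n then f x i else 0)"
    using assms(1) by (simp add: continuous_map_componentwise_Euclidean_space)
  then show ?thesis by (rule continuous_map_eq) (use assms(2) in \<open>auto simp: fun_eq_iff not_less\<close>)
qed

lemma continuous_map_left_part: "continuous_map (Euclidean_space (m + n)) (Euclidean_space m) (left_part m)"
  by (rule continuous_map_into_Euclidean) (auto simp: left_part_def continuous_map_Euclidean_coord)

lemma continuous_map_right_part: "continuous_map (Euclidean_space (m + n)) (Euclidean_space n) (right_part m)"
  by (rule continuous_map_into_Euclidean)
    (auto simp: right_part_def continuous_map_Euclidean_coord topspace_Euclidean_space)

lemma continuous_map_coord_compose:
  "continuous_map X (Euclidean_space n) f ==> continuous_map X euclideanreal (\<lambda>x. f x i)"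
  using continuous_map_compose[OF _ continuous_map_Euclidean_coord] by (simp add: o_def)

context
  fixes M :: "'m manifold" and N :: "'n manifold"
  assumes M: "atlas M" and N: "atlas N"
begin

abbreviation prod_model where
  "prod_model \<equiv> Euclidean_space (mdim M + mdim N)"

lemma prod_chart_join:
  "(\<lambda>(p, q) i. if i < mdim M then \<phi> p i else \<psi> q (i - mdim M)) = (prod_map M \<phi> \<psi>)"
  by (auto simp: join_def fun_eq_iff)

lemma prod_chart_inj:
  assumes "(U, \<phi>) \<in> charts M" "(V, \<psi>) \<in> charts N"
  shows "inj_on (prod_map M \<phi> \<psi>) (U \<times> V)"
proof (rule inj_onI, clarify)
  fix p q p' q' assume *: "p \<in> U" "q \<in> V" "p' \<in> U" "q' \<in> V" "join (mdim M) (\<phi> p) (\<psi> q) = join (mdim M) (\<phi> p') (\<psi> q')"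
  have "\<phi> p = \<phi> p'"
    using left_part_join[of "mdim M" "\<phi> p" "\<psi> q"] left_part_join[of "mdim M" "\<phi> p'" "\<psi> q'"] *
      chart_Euclidean[OF M assms(1)] by simp
  moreover have "\<psi> q = \<psi> q'"
    using right_part_join[of "mdim M" "\<phi> p" "\<psi> q"] right_part_join[of "mdim M" "\<phi> p'" "\<psi> q'"] * by simp
  ultimately show "p = p' \<and> q = q'"
    using * chart_inj[OF M assms(1)] chart_inj[OF N assms(2)] by (auto dest: inj_onD)
qed

lemma prod_chart_image:
  assumes "(U, \<phi>) \<in> charts M" "(V, \<psi>) \<in> charts N" "A \<subseteq> U" "B \<subseteq> V"
  shows "(prod_map M \<phi> \<psi>) ` (A \<times> B) =
    {z \<in> topspace prod_model. left_part (mdim M) z \<in> \<phi> ` A \<and> right_part (mdim M) z \<in> \<psi> ` B}"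
proof (intro equalityI subsetI)
  fix z assume "z \<in> (prod_map M \<phi> \<psi>) ` (A \<times> B)"
  then obtain p q where pq: "p \<in> A" "q \<in> B" "z = join (mdim M) (\<phi> p) (\<psi> q)" by auto
  then have "left_part (mdim M) z = \<phi> p" "right_part (mdim M) z = \<psi> q"
    using left_part_join[of "mdim M" "\<phi> p" "\<psi> q"] right_part_join chart_Euclidean[OF M assms(1)] assms(3) by auto
  moreover have "z i = 0" if "i \<ge> mdim M + mdim N" for i
    using chart_Euclidean[OF N assms(2), of q "i - mdim M"] that pq assms(4) by (auto simp: join_def)
  ultimately show "z \<in> {z \<in> topspace prod_model. left_part (mdim M) z \<in> \<phi> ` A \<and> right_part (mdim M) z \<in> \<psi> ` B}"
    using pq by (simp add: topspace_Euclidean_space)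
next
  fix z assume "z \<in> {z \<in> topspace prod_model. left_part (mdim M) z \<in> \<phi> ` A \<and> right_part (mdim M) z \<in> \<psi> ` B}"
  then obtain p q where pq: "p \<in> A" "q \<in> B" "left_part (mdim M) z = \<phi> p" "right_part (mdim M) z = \<psi> q" by blast
  then have "z = (prod_map M \<phi> \<psi>) (p, q)" using join_parts[of "mdim M" z] by simp
  then show "z \<in> (prod_map M \<phi> \<psi>) ` (A \<times> B)" using pq by blast
qed

lemma prod_chart_open_image:
  assumes "(U, \<phi>) \<in> charts M" "(V, \<psi>) \<in> charts N" "openin (mtop M) A" "openin (mtop N) B"
  shows "openin prod_model
    ((prod_map M \<phi> \<psi>) ` ((A \<inter> U) \<times> (B \<inter> V)))"
proof -
  have "openin prod_model {z \<in> topspace prod_model. left_part (mdim M) z \<in> \<phi> ` (A \<inter> U)}"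
    by (rule openin_continuous_map_preimage[OF continuous_map_left_part chart_open_image[OF M assms(1,3)]])
  moreover have "openin prod_model {z \<in> topspace prod_model. right_part (mdim M) z \<in> \<psi> ` (B \<inter> V)}"
    by (rule openin_continuous_map_preimage[OF continuous_map_right_part chart_open_image[OF N assms(2,4)]])
  ultimately have "openin prod_model
     ({z \<in> topspace prod_model. left_part (mdim M) z \<in> \<phi> ` (A \<inter> U)} \<inter>
      {z \<in> topspace prod_model. right_part (mdim M) z \<in> \<psi> ` (B \<inter> V)})"
    by (rule openin_Int)
  moreover have "\<dots> = (prod_map M \<phi> \<psi>) ` ((A \<inter> U) \<times> (B \<inter> V))"
    by (subst prod_chart_image[OF assms(1,2)]) auto
  ultimately show ?thesis by simp
qed

lemma prod_chart_inv:
  assumes "(U, \<phi>) \<in> charts M" "(V, \<psi>) \<in> charts N" "p \<in> U" "q \<in> V"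
  shows "inv_into (U \<times> V) (prod_map M \<phi> \<psi>) (join (mdim M) (\<phi> p) (\<psi> q)) = (p, q)"
  using inv_into_f_f[OF prod_chart_inj[OF assms(1,2)], of "(p, q)"] assms(3,4) by simp

text \<open>The coordinate representation may be any \<open>F\<close> with the right values at the
  points \<open>join (mdim M) (\<phi> p) (\<psi> q)\<close>. It can thus be written with
  \<open>left_part\<close> and \<open>right_part\<close>, and the inverse of the product chart does
  not appear.\<close>

lemma smooth_fun_prodI:
  assumes A: "openin (mtop M) A" and B: "openin (mtop N) B"
    and *: "\<And>U \<phi> V \<psi> k. (U, \<phi>) \<in> charts M ==> (V, \<psi>) \<in> charts N ==>
      \<exists>F. Ck k (mdim M + mdim N) ((prod_map M \<phi> \<psi>) ` ((A \<inter> U) \<times> (B \<inter> V))) F \<and>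
        (\<forall>p\<in>A \<inter> U. \<forall>q\<in>B \<inter> V. F (join (mdim M) (\<phi> p) (\<psi> q)) = h (p, q))"
  shows "smooth_fun (prod_manifold M N) (A \<times> B) h"
proof (rule smooth_funI)
  fix W k and \<kappa> :: "'m \<times> 'n => nat => real" assume "(W, \<kappa>) \<in> charts (prod_manifold M N)"
  then obtain U \<phi> V \<psi> where ch: "(U, \<phi>) \<in> charts M" "(V, \<psi>) \<in> charts N"
    and W: "W = U \<times> V" "\<kappa> = (prod_map M \<phi> \<psi>)"
    unfolding prod_chart_join[symmetric] by (blast elim: prod_manifold_chart)
  let ?D = "\<kappa> ` ((A \<inter> U) \<times> (B \<inter> V))"
  from *[OF ch, of k] obtain F where F: "Ck k (mdim M + mdim N) ?D F"
    "\<And>p q. p \<in> A \<inter> U ==> q \<in> B \<inter> V ==> F (join (mdim M) (\<phi> p) (\<psi> q)) = h (p, q)"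
    unfolding W(2) by blast
  have D: "openin prod_model ?D" unfolding W(2) by (rule prod_chart_open_image[OF ch A B])
  have "Ck k (mdim M + mdim N) ?D (\<lambda>z. h (inv_into W \<kappa> z))"
  proof (rule Ck_cong[OF D _ F(1)])
    fix z assume "z \<in> ?D"
    then obtain p q where pq: "p \<in> A \<inter> U" "q \<in> B \<inter> V" "z = join (mdim M) (\<phi> p) (\<psi> q)"
      unfolding W(2) by auto
    then show "F z = h (inv_into W \<kappa> z)"
      unfolding W using F(2)[OF pq(1,2)] prod_chart_inv[OF ch, of p q] by simp
  qed
  moreover have "A \<times> B \<inter> W = (A \<inter> U) \<times> (B \<inter> V)" unfolding W(1) by blast
  ultimately show "Ck k (mdim (prod_manifold M N)) (\<kappa> ` (A \<times> B \<inter> W)) (\<lambda>z. h (inv_into W \<kappa> z))" by simp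
qed

section \<open>Smooth functions on a product: projections and slices\<close>

lemma smooth_fun_fst:
  assumes A: "openin (mtop M) A" and B: "openin (mtop N) B" and h: "smooth_fun M A h"
  shows "smooth_fun (prod_manifold M N) (A \<times> B) (\<lambda>x. h (fst x))"
proof (rule smooth_fun_prodI[OF A B])
  fix U \<phi> V \<psi> k assume ch: "(U, \<phi>) \<in> charts M" "(V, \<psi>) \<in> charts N"
  let ?D = "(prod_map M \<phi> \<psi>) ` ((A \<inter> U) \<times> (B \<inter> V))"
  show "\<exists>F. Ck k (mdim M + mdim N) ?D F \<and> (\<forall>p\<in>A \<inter> U. \<forall>q\<in>B \<inter> V. F (join (mdim M) (\<phi> p) (\<psi> q)) = h (fst (p, q)))"
  proof (intro exI[of _ "\<lambda>z. h (inv_into U \<phi> (left_part (mdim M) z))"] conjI ballI)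
    show "Ck k (mdim M + mdim N) ?D (\<lambda>z. h (inv_into U \<phi> (left_part (mdim M) z)))"
    proof (rule Ck_reindex[where A="{..<mdim M}" and \<sigma>="\<lambda>i. i" and T="left_part (mdim M)"
          and W="\<phi> ` (A \<inter> U)" and f="\<lambda>z. h (inv_into U \<phi> z)"])
      have "?D = {z \<in> topspace prod_model. left_part (mdim M) z \<in> \<phi> ` (A \<inter> U) \<and> right_part (mdim M) z \<in> \<psi> ` (B \<inter> V)}"
        by (rule prod_chart_image[OF ch]) auto
      then show "continuous_map (subtopology prod_model ?D)
         (subtopology (model M) (\<phi> ` (A \<inter> U))) (left_part (mdim M))"
        using continuous_map_from_subtopology[OF continuous_map_left_part]
        by (auto simp: continuous_map_in_subtopology)
      show "?D \<subseteq> topspace prod_model"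
        by (rule openin_subset[OF prod_chart_open_image[OF ch A B]])
      show "Ck k (mdim M) (\<phi> ` (A \<inter> U)) (\<lambda>z. h (inv_into U \<phi> z))" by (rule smooth_funD[OF h ch(1)])
    qed (auto simp: left_part_def fun_eq_iff)
    fix p q assume pq: "p \<in> A \<inter> U" "q \<in> B \<inter> V"
    then show "h (inv_into U \<phi> (left_part (mdim M) (join (mdim M) (\<phi> p) (\<psi> q)))) = h (fst (p, q))"
      using left_part_join[of "mdim M" "\<phi> p" "\<psi> q"] chart_Euclidean[OF M ch(1)] chart_inv[OF M ch(1)] by simp
  qed
qed

lemma smooth_fun_snd:
  assumes A: "openin (mtop M) A" and B: "openin (mtop N) B" and h: "smooth_fun N B h"
  shows "smooth_fun (prod_manifold M N) (A \<times> B) (\<lambda>x. h (snd x))"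
proof (rule smooth_fun_prodI[OF A B])
  fix U \<phi> V \<psi> k assume ch: "(U, \<phi>) \<in> charts M" "(V, \<psi>) \<in> charts N"
  let ?D = "(prod_map M \<phi> \<psi>) ` ((A \<inter> U) \<times> (B \<inter> V))"
  show "\<exists>F. Ck k (mdim M + mdim N) ?D F \<and> (\<forall>p\<in>A \<inter> U. \<forall>q\<in>B \<inter> V. F (join (mdim M) (\<phi> p) (\<psi> q)) = h (snd (p, q)))"
  proof (intro exI[of _ "\<lambda>z. h (inv_into V \<psi> (right_part (mdim M) z))"] conjI ballI)
    show "Ck k (mdim M + mdim N) ?D (\<lambda>z. h (inv_into V \<psi> (right_part (mdim M) z)))"
    proof (rule Ck_reindex[where A="{mdim M..}" and \<sigma>="\<lambda>i. i - mdim M" and T="right_part (mdim M)"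
          and W="\<psi> ` (B \<inter> V)" and f="\<lambda>z. h (inv_into V \<psi> z)"])
      have "?D = {z \<in> topspace prod_model. left_part (mdim M) z \<in> \<phi> ` (A \<inter> U) \<and> right_part (mdim M) z \<in> \<psi> ` (B \<inter> V)}"
        by (rule prod_chart_image[OF ch]) auto
      then show "continuous_map (subtopology prod_model ?D)
         (subtopology (model N) (\<psi> ` (B \<inter> V))) (right_part (mdim M))"
        using continuous_map_from_subtopology[OF continuous_map_right_part]
        by (auto simp: continuous_map_in_subtopology)
      show "?D \<subseteq> topspace prod_model"
        by (rule openin_subset[OF prod_chart_open_image[OF ch A B]])
      show "Ck k (mdim N) (\<psi> ` (B \<inter> V)) (\<lambda>z. h (inv_into V \<psi> z))" by (rule smooth_funD[OF h ch(2)])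
    qed (auto simp: right_part_def fun_eq_iff)
    fix p q assume pq: "p \<in> A \<inter> U" "q \<in> B \<inter> V"
    then show "h (inv_into V \<psi> (right_part (mdim M) (join (mdim M) (\<phi> p) (\<psi> q)))) = h (snd (p, q))"
      using chart_inv[OF N ch(2)] by (simp add: right_part_join)
  qed
qed

text \<open>In a product chart, built with any chart around \<open>q\<close>, the slice is
  \<open>join\<close> with a fixed second block. This map passes each coordinate on unchanged, so
  \<open>Ck_reindex\<close> applies.\<close>

lemma smooth_fun_slice_fst:
  assumes W: "smooth_fun (prod_manifold M N) W h" and q: "q \<in> points N"
    and A: "openin (mtop M) A" "\<And>p. p \<in> A ==> (p, q) \<in> W"
  shows "smooth_fun M A (\<lambda>p. h (p, q))"
proof (rule smooth_funI)
  fix U \<phi> k assume ch: "(U, \<phi>) \<in> charts M"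
  obtain V \<psi> where ch': "(V, \<psi>) \<in> charts N" "q \<in> V" using atlas_cover[OF N q] by blast
  let ?\<kappa> = "\<lambda>(p, q). join (mdim M) (\<phi> p) (\<psi> q)"
  have F: "Ck k (mdim M + mdim N) (?\<kappa> ` (W \<inter> U \<times> V)) (\<lambda>z. h (inv_into (U \<times> V) ?\<kappa> z))"
    using smooth_funD[OF W prod_manifold_chartI[OF ch ch'(1)], of k] unfolding prod_chart_join by simp
  have op: "openin (model M) (\<phi> ` (A \<inter> U))" by (rule chart_open_image[OF M ch A(1)])
  have "continuous_map (model M) prod_model (\<lambda>z. join (mdim M) z (\<psi> q))"
  proof (rule continuous_map_into_Euclidean)
    show "continuous_map (model M) euclideanreal (\<lambda>z. join (mdim M) z (\<psi> q) i)" for i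
      by (cases "i < mdim M") (simp_all add: join_def continuous_map_Euclidean_coord)
    show "join (mdim M) z (\<psi> q) i = 0" if "mdim M + mdim N \<le> i" for z i
      using chart_Euclidean[OF N ch', of "i - mdim M"] that by (simp add: join_def)
  qed
  from continuous_map_from_subtopology[OF this, of "\<phi> ` (A \<inter> U)"]
  have c: "continuous_map (subtopology (model M) (\<phi> ` (A \<inter> U)))
     (subtopology prod_model (?\<kappa> ` (W \<inter> U \<times> V))) (\<lambda>z. join (mdim M) z (\<psi> q))"
  proof (rule continuous_map_into_subtopology)
    show "(\<lambda>z. join (mdim M) z (\<psi> q)) \<in> topspace (subtopology (model M) (\<phi> ` (A \<inter> U))) \<rightarrow> ?\<kappa> ` (W \<inter> U \<times> V)"
    proof
      fix z assume "z \<in> topspace (subtopology (model M) (\<phi> ` (A \<inter> U)))"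
      then obtain p where "p \<in> A" "p \<in> U" "z = \<phi> p" by auto
      then show "join (mdim M) z (\<psi> q) \<in> ?\<kappa> ` (W \<inter> U \<times> V)"
        using A(2) ch'(2) by (intro rev_image_eqI[of "(p, q)"]) auto
    qed
  qed
  have "Ck k (mdim M) (\<phi> ` (A \<inter> U)) (\<lambda>z. h (inv_into (U \<times> V) ?\<kappa> (join (mdim M) z (\<psi> q))))"
    by (rule Ck_reindex[where A=UNIV and \<sigma>="\<lambda>i. i", OF c _ _ _ openin_subset[OF op] F])
      (auto simp: join_def fun_eq_iff)
  then show "Ck k (mdim M) (\<phi> ` (A \<inter> U)) (\<lambda>z. h (inv_into U \<phi> z, q))"
  proof (rule Ck_cong[OF op, rotated])
    fix z assume "z \<in> \<phi> ` (A \<inter> U)"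
    then obtain p where "p \<in> U" "z = \<phi> p" by blast
    then show "h (inv_into (U \<times> V) ?\<kappa> (join (mdim M) z (\<psi> q))) = h (inv_into U \<phi> z, q)"
      using prod_chart_inv[OF ch ch'(1) _ ch'(2)] chart_inv[OF M ch] by simp
  qed
qed

lemma smooth_fun_slice_snd:
  assumes W: "smooth_fun (prod_manifold M N) W h" and p: "p \<in> points M"
    and B: "openin (mtop N) B" "\<And>q. q \<in> B ==> (p, q) \<in> W"
  shows "smooth_fun N B (\<lambda>q. h (p, q))"
proof (rule smooth_funI)
  fix V \<psi> k assume ch': "(V, \<psi>) \<in> charts N"
  obtain U \<phi> where ch: "(U, \<phi>) \<in> charts M" "p \<in> U" using atlas_cover[OF M p] by blast
  let ?\<kappa> = "\<lambda>(p, q). join (mdim M) (\<phi> p) (\<psi> q)"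
  have F: "Ck k (mdim M + mdim N) (?\<kappa> ` (W \<inter> U \<times> V)) (\<lambda>z. h (inv_into (U \<times> V) ?\<kappa> z))"
    using smooth_funD[OF W prod_manifold_chartI[OF ch(1) ch'], of k] unfolding prod_chart_join by simp
  have op: "openin (model N) (\<psi> ` (B \<inter> V))" by (rule chart_open_image[OF N ch' B(1)])
  have "continuous_map (model N) prod_model (\<lambda>z. join (mdim M) (\<phi> p) z)"
  proof (rule continuous_map_into_Euclidean)
    show "continuous_map (model N) euclideanreal (\<lambda>z. join (mdim M) (\<phi> p) z i)" for i
      by (cases "i < mdim M") (simp_all add: join_def continuous_map_Euclidean_coord)
    show "join (mdim M) (\<phi> p) z i = 0" if "z \<in> topspace (model N)" "mdim M + mdim N \<le> i" for z i
      using that by (simp add: join_def topspace_Euclidean_space)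
  qed
  from continuous_map_from_subtopology[OF this, of "\<psi> ` (B \<inter> V)"]
  have c: "continuous_map (subtopology (model N) (\<psi> ` (B \<inter> V)))
     (subtopology prod_model (?\<kappa> ` (W \<inter> U \<times> V))) (\<lambda>z. join (mdim M) (\<phi> p) z)"
  proof (rule continuous_map_into_subtopology)
    show "(\<lambda>z. join (mdim M) (\<phi> p) z) \<in> topspace (subtopology (model N) (\<psi> ` (B \<inter> V))) \<rightarrow> ?\<kappa> ` (W \<inter> U \<times> V)"
    proof
      fix z assume "z \<in> topspace (subtopology (model N) (\<psi> ` (B \<inter> V)))"
      then obtain q where "q \<in> B" "q \<in> V" "z = \<psi> q" by auto
      then show "join (mdim M) (\<phi> p) z \<in> ?\<kappa> ` (W \<inter> U \<times> V)"
        using B(2) ch(2) by (intro rev_image_eqI[of "(p, q)"]) auto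
    qed
  qed
  have "Ck k (mdim N) (\<psi> ` (B \<inter> V)) (\<lambda>z. h (inv_into (U \<times> V) ?\<kappa> (join (mdim M) (\<phi> p) z)))"
    by (rule Ck_reindex[where A=UNIV and \<sigma>="\<lambda>i. mdim M + i", OF c _ _ _ openin_subset[OF op] F])
      (auto simp: join_def fun_eq_iff)
  then show "Ck k (mdim N) (\<psi> ` (B \<inter> V)) (\<lambda>z. h (p, inv_into V \<psi> z))"
  proof (rule Ck_cong[OF op, rotated])
    fix z assume "z \<in> \<psi> ` (B \<inter> V)"
    then obtain q where "q \<in> V" "z = \<psi> q" by blast
    then show "h (inv_into (U \<times> V) ?\<kappa> (join (mdim M) (\<phi> p) z)) = h (p, inv_into V \<psi> z)"
      using prod_chart_inv[OF ch(1) ch' ch(2)] chart_inv[OF N ch'] by simp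
  qed
qed

lemma atlas_prod: "atlas (prod_manifold M N)"
  unfolding atlas_def
proof (intro conjI ballI)
  show "\<Union> (fst ` charts (prod_manifold M N)) = points (prod_manifold M N)"
  proof (intro equalityI subsetI)
    fix x assume "x \<in> points (prod_manifold M N)"
    then obtain p q where x: "x = (p, q)" "p \<in> points M" "q \<in> points N" by auto
    obtain U \<phi> where U: "(U, \<phi>) \<in> charts M" "p \<in> U" using atlas_cover[OF M x(2)] by blast
    obtain V \<psi> where V: "(V, \<psi>) \<in> charts N" "q \<in> V" using atlas_cover[OF N x(3)] by blast
    show "x \<in> \<Union> (fst ` charts (prod_manifold M N))"
      using prod_manifold_chartI[OF U(1) V(1)] U(2) V(2) x(1) by force
  next
    fix x assume "x \<in> \<Union> (fst ` charts (prod_manifold M N))"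
    then obtain X where X: "X \<in> charts (prod_manifold M N)" "x \<in> fst X" by blast
    obtain U \<phi> V \<psi> where ch: "(U, \<phi>) \<in> charts M" "(V, \<psi>) \<in> charts N"
      and eq: "X = (U \<times> V, \<lambda>(p, q) i. if i < mdim M then \<phi> p i else \<psi> q (i - mdim M))"
      by (rule prod_manifold_chart[OF X(1)])
    have "x \<in> U \<times> V" using X(2) unfolding eq by simp
    then show "x \<in> points (prod_manifold M N)"
      using openin_subset[OF atlasD(1)[OF M ch(1)]] openin_subset[OF atlasD(1)[OF N ch(2)]] by auto
  qed
next
  fix X assume "X \<in> charts (prod_manifold M N)"
  then obtain U \<phi> V \<psi> where ch: "(U, \<phi>) \<in> charts M" "(V, \<psi>) \<in> charts N"
    and X: "X = (U \<times> V, \<lambda>(p, q). join (mdim M) (\<phi> p) (\<psi> q))"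
    unfolding prod_chart_join[symmetric] by (blast elim: prod_manifold_chart)
  let ?\<kappa> = "\<lambda>(p, q). join (mdim M) (\<phi> p) (\<psi> q)"
  let ?E = prod_model
  have U: "openin (mtop M) U" and V: "openin (mtop N) V" using atlasD(1)[OF M ch(1)] atlasD(1)[OF N ch(2)] by auto
  have im: "?\<kappa> ` (U \<times> V) = {z \<in> topspace ?E. left_part (mdim M) z \<in> \<phi> ` U \<and> right_part (mdim M) z \<in> \<psi> ` V}"
    by (rule prod_chart_image[OF ch]) auto
  obtain f where f: "homeomorphic_maps (mtop_on M U) (subtopology (model M) (\<phi> ` U)) \<phi> f"
    using atlasD(3)[OF M ch(1)] unfolding homeomorphic_map_maps by blast
  obtain g where g: "homeomorphic_maps (mtop_on N V) (subtopology (model N) (\<psi> ` V)) \<psi> g"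
    using atlasD(3)[OF N ch(2)] unfolding homeomorphic_map_maps by blast
  have Utop: "topspace (mtop_on M U) = U" "topspace (mtop_on N V) = V"
    using openin_subset[OF U] openin_subset[OF V] by auto
  have sub: "subtopology (prod_topology (mtop M) (mtop N)) (U \<times> V) = prod_topology (mtop_on M U) (mtop_on N V)"
    by (simp only: subtopology_Times)
  have fv: "f (\<phi> p) = p" if "p \<in> U" for p using f that Utop unfolding homeomorphic_maps_def by simp
  have gv: "g (\<psi> q) = q" if "q \<in> V" for q using g that Utop unfolding homeomorphic_maps_def by simp
  have inv: "(f (left_part (mdim M) (?\<kappa> x)), g (right_part (mdim M) (?\<kappa> x))) = x" if "x \<in> U \<times> V" for x
    using that fv gv left_part_join[of "mdim M" "\<phi> (fst x)"] chart_Euclidean[OF M ch(1), of "fst x"]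
    by (auto simp: right_part_join)
  \<comment> \<open>The inverse consists of the inverses of the factor charts applied to the two
    blocks of coordinates.\<close>
  have "homeomorphic_maps (subtopology (prod_topology (mtop M) (mtop N)) (U \<times> V)) (subtopology ?E (?\<kappa> ` (U \<times> V))) ?\<kappa>
      (\<lambda>z. (f (left_part (mdim M) z), g (right_part (mdim M) z)))"
    unfolding homeomorphic_maps_def
  proof (intro conjI ballI)
    show "continuous_map (subtopology (prod_topology (mtop M) (mtop N)) (U \<times> V)) (subtopology ?E (?\<kappa> ` (U \<times> V))) ?\<kappa>"
    proof (rule continuous_map_into_subtopology)
      show "continuous_map (subtopology (prod_topology (mtop M) (mtop N)) (U \<times> V)) ?E ?\<kappa>"
        unfolding sub
      proof (rule continuous_map_into_Euclidean)
        fix i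
        have 1: "continuous_map (prod_topology (mtop_on M U) (mtop_on N V)) euclideanreal ((\<lambda>p. \<phi> p i) \<circ> fst)"
          by (rule continuous_map_compose[OF continuous_map_fst continuous_map_coord_compose[OF chart_continuous[OF M ch(1)]]])
        have 2: "continuous_map (prod_topology (mtop_on M U) (mtop_on N V)) euclideanreal ((\<lambda>q. \<psi> q (i - mdim M)) \<circ> snd)"
          by (rule continuous_map_compose[OF continuous_map_snd continuous_map_coord_compose[OF chart_continuous[OF N ch(2)]]])
        have "(\<lambda>x. ?\<kappa> x i) = (if i < mdim M then (\<lambda>p. \<phi> p i) \<circ> fst else (\<lambda>q. \<psi> q (i - mdim M)) \<circ> snd)"
          by (auto simp: join_def fun_eq_iff)
        then show "continuous_map (prod_topology (mtop_on M U) (mtop_on N V)) euclideanreal (\<lambda>x. ?\<kappa> x i)"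
          using 1 2 by (simp split: if_splits)
      next
        fix x i assume "x \<in> topspace (prod_topology (mtop_on M U) (mtop_on N V))" "mdim M + mdim N \<le> i"
        then show "?\<kappa> x i = 0"
          using chart_Euclidean[OF N ch(2), of "snd x" "i - mdim M"] by (auto simp: join_def)
      qed
    qed (auto simp: Utop)
    show "continuous_map (subtopology ?E (?\<kappa> ` (U \<times> V))) (subtopology (prod_topology (mtop M) (mtop N)) (U \<times> V))
        (\<lambda>z. (f (left_part (mdim M) z), g (right_part (mdim M) z)))"
      unfolding sub continuous_map_pairwise o_def fst_conv snd_conv
    proof
      have "continuous_map (subtopology ?E (?\<kappa> ` (U \<times> V))) (subtopology (model M) (\<phi> ` U)) (left_part (mdim M))"
        by (rule continuous_map_into_subtopology[OF continuous_map_from_subtopology[OF continuous_map_left_part]])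
          (auto simp: im)
      then show "continuous_map (subtopology ?E (?\<kappa> ` (U \<times> V))) (mtop_on M U) (\<lambda>z. f (left_part (mdim M) z))"
        using continuous_map_compose[of _ _ "left_part (mdim M)" _ f] f unfolding homeomorphic_maps_def o_def by blast
      have "continuous_map (subtopology ?E (?\<kappa> ` (U \<times> V))) (subtopology (model N) (\<psi> ` V)) (right_part (mdim M))"
        by (rule continuous_map_into_subtopology[OF continuous_map_from_subtopology[OF continuous_map_right_part]])
          (auto simp: im)
      then show "continuous_map (subtopology ?E (?\<kappa> ` (U \<times> V))) (mtop_on N V) (\<lambda>z. g (right_part (mdim M) z))"
        using continuous_map_compose[of _ _ "right_part (mdim M)" _ g] g unfolding homeomorphic_maps_def o_def by blast
    qed
    fix x assume "x \<in> topspace (subtopology (prod_topology (mtop M) (mtop N)) (U \<times> V))"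
    then show "(f (left_part (mdim M) (?\<kappa> x)), g (right_part (mdim M) (?\<kappa> x))) = x" using inv by simp
  next
    fix z assume "z \<in> topspace (subtopology ?E (?\<kappa> ` (U \<times> V)))"
    then obtain x where x: "x \<in> U \<times> V" "z = ?\<kappa> x" by auto
    show "?\<kappa> (f (left_part (mdim M) z), g (right_part (mdim M) z)) = z"
      unfolding x(2) inv[OF x(1)] ..
  qed
  then have hom: "homeomorphic_map (subtopology (prod_topology (mtop M) (mtop N)) (U \<times> V)) (subtopology ?E (?\<kappa> ` (U \<times> V))) ?\<kappa>"
    unfolding homeomorphic_map_maps by blast
  have op: "openin ?E (?\<kappa> ` (U \<times> V))" using prod_chart_open_image[OF ch U V] by simp
  have sm: "smooth_fun (prod_manifold M N) (U \<times> V) (\<lambda>x. ?\<kappa> x i)" if i: "i < mdim M + mdim N" for i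
  proof (cases "i < mdim M")
    case True
    have "(\<lambda>x. ?\<kappa> x i) = (\<lambda>x. \<phi> (fst x) i)" using True by (auto simp: join_def fun_eq_iff)
    then show ?thesis using smooth_fun_fst[OF U V atlasD(4)[OF M ch(1) True]] by simp
  next
    case False
    have "(\<lambda>x. ?\<kappa> x i) = (\<lambda>x. \<psi> (snd x) (i - mdim M))" using False by (auto simp: join_def fun_eq_iff)
    moreover have "i - mdim M < mdim N" using False i by simp
    ultimately show ?thesis using smooth_fun_snd[OF U V atlasD(4)[OF N ch(2)]] by simp
  qed
  show "case X of (U, \<phi>) => openin (mtop (prod_manifold M N)) U \<and>
      openin (model (prod_manifold M N)) (\<phi> ` U) \<and>
      homeomorphic_map (mtop_on (prod_manifold M N) U)
        (subtopology (model (prod_manifold M N)) (\<phi> ` U)) \<phi> \<and>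
      (\<forall>i<mdim (prod_manifold M N). smooth_fun (prod_manifold M N) U (\<lambda>p. \<phi> p i))"
    unfolding X prod.case prod_manifold_sel
    using hom op sm U V by (simp add: openin_prod_Times_iff)
qed

lemma smooth_near_fst:
  assumes h: "smooth_near M p h" and q: "q \<in> points N"
  shows "smooth_near (prod_manifold M N) (p, q) (\<lambda>x. h (fst x))"
proof -
  obtain U where U: "openin (mtop M) U" "p \<in> U" "smooth_fun M U h" using h unfolding smooth_near_def by blast
  show ?thesis unfolding smooth_near_def
    using smooth_fun_fst[OF U(1) openin_topspace U(3)] U q
    by (intro exI[of _ "U \<times> points N"]) (simp add: openin_prod_Times_iff)
qed

lemma smooth_near_snd:
  assumes h: "smooth_near N q h" and p: "p \<in> points M"
  shows "smooth_near (prod_manifold M N) (p, q) (\<lambda>x. h (snd x))"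
proof -
  obtain U where U: "openin (mtop N) U" "q \<in> U" "smooth_fun N U h" using h unfolding smooth_near_def by blast
  show ?thesis unfolding smooth_near_def
    using smooth_fun_snd[OF openin_topspace U(1) U(3)] U p
    by (intro exI[of _ "points M \<times> U"]) (simp add: openin_prod_Times_iff)
qed

lemma smooth_near_slice:
  assumes h: "smooth_near (prod_manifold M N) (p, q) h"
  shows "smooth_near M p (\<lambda>p'. h (p', q))" "smooth_near N q (\<lambda>q'. h (p, q'))"
proof -
  obtain W where W: "openin (prod_topology (mtop M) (mtop N)) W" "(p, q) \<in> W" "smooth_fun (prod_manifold M N) W h"
    using h unfolding smooth_near_def by auto
  from W(1)[unfolded openin_prod_topology_alt, rule_format, OF W(2)]
  obtain A B where AB: "openin (mtop M) A" "openin (mtop N) B" "p \<in> A" "q \<in> B" "A \<times> B \<subseteq> W" by blast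
  have "smooth_fun M A (\<lambda>p'. h (p', q))"
    by (rule smooth_fun_slice_fst[OF W(3) _ AB(1)]) (use AB openin_subset[OF AB(2)] in auto)
  then show "smooth_near M p (\<lambda>p'. h (p', q))" unfolding smooth_near_def using AB by blast
  have "smooth_fun N B (\<lambda>q'. h (p, q'))"
    by (rule smooth_fun_slice_snd[OF W(3) _ AB(2)]) (use AB openin_subset[OF AB(1)] in auto)
  then show "smooth_near N q (\<lambda>q'. h (p, q'))" unfolding smooth_near_def using AB by blast
qed

end

section \<open>The tangent bundle\<close>

abbreviation tangent_at :: "'m manifold => 'm => 'm tvec set" where
  "tangent_at M \<equiv> fib (tangent_bundle M)"

lemma smooth_near_chart:
  assumes "atlas M" "(U, \<phi>) \<in> charts M" "p \<in> U" "i < mdim M"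
  shows "smooth_near M p (\<lambda>p. \<phi> p i)"
  unfolding smooth_near_def using atlasD[OF assms(1,2)] assms(3,4) by blast

text \<open>The shape in which smoothness near a point enters the chain rule: a neighbourhood inside
  a prescribed chart domain, with first order differentiability in that chart.\<close>

lemma smooth_near_on:
  assumes "atlas M" "smooth_near M p h" "(V, \<psi>) \<in> charts M" "p \<in> V"
  obtains W where "openin (mtop M) W" "p \<in> W" "W \<subseteq> V" "smooth_fun M W h"
    "openin (model M) (\<psi> ` W)" "Ck (Suc 0) (mdim M) (\<psi> ` W) (\<lambda>z. h (inv_into V \<psi> z))"
proof -
  obtain U where U: "openin (mtop M) U" "p \<in> U" "smooth_fun M U h" using assms(2) unfolding smooth_near_def by blast
  show ?thesis
  proof (rule that[of "U \<inter> V"])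
    show "openin (mtop M) (U \<inter> V)" using U(1) atlasD(1)[OF assms(1,3)] by (rule openin_Int)
    show "smooth_fun M (U \<inter> V) h" by (rule smooth_fun_subset[OF U(3)]) blast
    show "openin (model M) (\<psi> ` (U \<inter> V))" by (rule chart_open_image[OF assms(1,3) U(1)])
    show "Ck (Suc 0) (mdim M) (\<psi> ` (U \<inter> V)) (\<lambda>z. h (inv_into V \<psi> z))" by (rule smooth_funD[OF U(3) assms(3)])
  qed (use U assms in auto)
qed

lemma coord_deriv_apply:
  "coord_deriv M (U, \<phi>) i p h = (if smooth_near M p h then partial i (\<lambda>z. h (inv_into U \<phi> z)) (\<phi> p) else 0)"
  by (simp add: coord_deriv_def o_def)

text \<open>The chain rule for a curve of charts coordinates; both the change of charts and the velocity
  of a curve are instances.\<close>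

lemma derivative_along_curve:
  assumes M: "atlas M" and ch: "(V, \<psi>) \<in> charts M" and h: "smooth_near M (x t) h" and xt: "x t \<in> V" and t: "t \<in> S"
    and S: "\<And>W. openin (mtop M) W ==> x t \<in> W ==> \<forall>\<^sub>F s in at t within S. x s \<in> W"
    and d: "\<And>j. j < mdim M ==> ((\<lambda>s. \<psi> (x s) j) has_real_derivative v j) (at t within S)"
  shows "((\<lambda>s. h (x s)) has_real_derivative (\<Sum>j<mdim M. v j * coord_deriv M (V, \<psi>) j (x t) h)) (at t within S)"
proof -
  obtain W where W: "openin (mtop M) W" "x t \<in> W" "W \<subseteq> V" "openin (model M) (\<psi> ` W)"
    "Ck (Suc 0) (mdim M) (\<psi> ` W) (\<lambda>z. h (inv_into V \<psi> z))"
    by (rule smooth_near_on[OF M h ch xt]) (rule that)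
  have ev: "\<forall>\<^sub>F s in at t within S. x s \<in> W" by (rule S[OF W(1,2)])
  \<comment> \<open>The chain rule wants the whole curve inside \<open>W\<close>. Since the curve is
    in \<open>W\<close> near \<open>t\<close>, restricting the parameters to \<open>S'\<close> does
    not change the limit at \<open>t\<close>.\<close>
  define S' where "S' = {s \<in> S. x s \<in> W}"
  have at: "at t within S' = at t within S"
  proof (rule filter_eq_iff[THEN iffD2], rule allI)
    fix P
    show "eventually P (at t within S') = eventually P (at t within S)"
    proof
      assume "eventually P (at t within S')"
      then have "\<forall>\<^sub>F s in at t within S. x s \<in> W \<longrightarrow> P s"
        unfolding eventually_at_filter S'_def by (rule eventually_mono) blast
      from eventually_elim2[OF this ev] show "eventually P (at t within S)" by blast
    next
      assume "eventually P (at t within S)"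
      then show "eventually P (at t within S')"
        unfolding eventually_at_filter S'_def by (rule eventually_mono) blast
    qed
  qed
  have "((\<lambda>s. (\<lambda>z. h (inv_into V \<psi> z)) (\<psi> (x s))) has_real_derivative
      (\<Sum>i<mdim M. partial i (\<lambda>z. h (inv_into V \<psi> z)) (\<psi> (x t)) * v i)) (at t within S')"
  proof (rule chain_rule_partial[OF W(4,5)])
    show "((\<lambda>s. \<psi> (x s) i) has_real_derivative v i) (at t within S')" if "i < mdim M" for i
      unfolding at by (rule d[OF that])
  qed (use W(2) t in \<open>auto simp: S'_def\<close>)
  then have "((\<lambda>s. h (x s)) has_real_derivative
      (\<Sum>i<mdim M. partial i (\<lambda>z. h (inv_into V \<psi> z)) (\<psi> (x t)) * v i)) (at t within S')"
    by (rule has_field_derivative_transform_within[OF _ zero_less_one])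
      (use W(2,3) t chart_inv[OF M ch] in \<open>auto simp: S'_def\<close>)
  moreover have "(\<Sum>i<mdim M. partial i (\<lambda>z. h (inv_into V \<psi> z)) (\<psi> (x t)) * v i) =
      (\<Sum>j<mdim M. v j * coord_deriv M (V, \<psi>) j (x t) h)"
    using h by (simp add: coord_deriv_apply mult.commute)
  ultimately show ?thesis unfolding at by simp
qed

lemma chart_line:
  assumes M: "atlas M" and ch: "(U, \<phi>) \<in> charts M" and p: "p \<in> U" and i: "i < mdim M"
    and W: "openin (mtop M) W" "p \<in> W"
  shows "\<forall>\<^sub>F s in nhds (\<phi> p i). inv_into U \<phi> ((\<phi> p)(i := s)) \<in> W \<and> (\<phi> p)(i := s) \<in> \<phi> ` U"
proof -
  have "\<forall>\<^sub>F s in nhds (\<phi> p i). (\<phi> p)(i := s) \<in> \<phi> ` (W \<inter> U)"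
    by (rule open_slice[OF chart_open_image[OF M ch W(1)] _ i]) (use p W in blast)
  then show ?thesis
  proof (rule eventually_mono)
    fix s assume "(\<phi> p)(i := s) \<in> \<phi> ` (W \<inter> U)"
    then obtain q where "q \<in> W" "q \<in> U" "(\<phi> p)(i := s) = \<phi> q" by blast
    then show "inv_into U \<phi> ((\<phi> p)(i := s)) \<in> W \<and> (\<phi> p)(i := s) \<in> \<phi> ` U"
      using chart_inv[OF M ch] by simp
  qed
qed

lemma smooth_near_coord_line:
  assumes M: "atlas M" and ch: "(U, \<phi>) \<in> charts M" and p: "p \<in> U" and i: "i < mdim M" and h: "smooth_near M p h"
  shows "((\<lambda>s. h (inv_into U \<phi> ((\<phi> p)(i := s)))) has_real_derivative coord_deriv M (U, \<phi>) i p h) (at (\<phi> p i))"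
proof -
  obtain W where W: "p \<in> W" "W \<subseteq> U" "Ck (Suc 0) (mdim M) (\<phi> ` W) (\<lambda>z. h (inv_into U \<phi> z))"
    by (rule smooth_near_on[OF M h ch p]) (rule that)
  have "(\<lambda>s. h (inv_into U \<phi> ((\<phi> p)(i := s)))) field_differentiable at (\<phi> p i)"
    using W(1,3) i by auto
  then show ?thesis using h unfolding coord_deriv_apply partial_def by (simp add: field_differentiable_derivI)
qed

text \<open>The i-th coordinate line of the first chart is a curve through \<open>p\<close>; the
  chain rule along it in the second chart produces a row of the Jacobian. On functions that are not
  smooth near \<open>p\<close> both sides are 0 by definition.\<close>

lemma coord_deriv_change:
  assumes M: "atlas M" and ch: "(U, \<phi>) \<in> charts M" "(V, \<psi>) \<in> charts M" and p: "p \<in> U" "p \<in> V" and i: "i < mdim M"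
  shows "coord_deriv M (U, \<phi>) i p =
    (\<Sum>j<mdim M. coord_deriv M (U, \<phi>) i p (\<lambda>p. \<psi> p j) *\<^sub>R coord_deriv M (V, \<psi>) j p)"
proof
  fix h
  show "coord_deriv M (U, \<phi>) i p h =
    (\<Sum>j<mdim M. coord_deriv M (U, \<phi>) i p (\<lambda>p. \<psi> p j) *\<^sub>R coord_deriv M (V, \<psi>) j p) h"
  proof (cases "smooth_near M p h")
    case True
    let ?x = "\<lambda>s. inv_into U \<phi> ((\<phi> p)(i := s))"
    have x: "?x (\<phi> p i) = p" using chart_inv[OF M ch(1) p(1)] by simp
    have "((\<lambda>s. h (?x s)) has_real_derivative
        (\<Sum>j<mdim M. coord_deriv M (U, \<phi>) i p (\<lambda>p. \<psi> p j) * coord_deriv M (V, \<psi>) j (?x (\<phi> p i)) h)) (at (\<phi> p i) within UNIV)"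
    proof (rule derivative_along_curve[OF M ch(2)])
      show "smooth_near M (?x (\<phi> p i)) h" "?x (\<phi> p i) \<in> V" unfolding x using True p(2) by auto
      show "\<forall>\<^sub>F s in at (\<phi> p i) within UNIV. ?x s \<in> W" if "openin (mtop M) W" "?x (\<phi> p i) \<in> W" for W
        using chart_line[OF M ch(1) p(1) i that(1)] that(2) unfolding x eventually_at_filter
        by (auto elim: eventually_mono)
      show "((\<lambda>s. \<psi> (?x s) j) has_real_derivative coord_deriv M (U, \<phi>) i p (\<lambda>p. \<psi> p j)) (at (\<phi> p i) within UNIV)"
        if "j < mdim M" for j
        using smooth_near_coord_line[OF M ch(1) p(1) i smooth_near_chart[OF M ch(2) p(2) that]] by simp
    qed simp
    moreover have "((\<lambda>s. h (?x s)) has_real_derivative coord_deriv M (U, \<phi>) i p h) (at (\<phi> p i))"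
      by (rule smooth_near_coord_line[OF M ch(1) p(1) i True])
    ultimately show ?thesis
      unfolding x by (simp add: DERIV_unique sum_fun_apply scaleR_fun_def)
  qed (simp add: coord_deriv_apply sum_fun_apply scaleR_fun_def)
qed

lemma coord_deriv_coord:
  assumes M: "atlas M" and ch: "(U, \<phi>) \<in> charts M" and p: "p \<in> U" and ij: "i < mdim M" "j < mdim M"
  shows "coord_deriv M (U, \<phi>) i p (\<lambda>p. \<phi> p j) = (if i = j then 1 else 0)"
proof -
  have ev: "\<forall>\<^sub>F s in nhds (\<phi> p i). \<phi> (inv_into U \<phi> ((\<phi> p)(i := s))) j = (if i = j then s else \<phi> p j)"
    using chart_line[OF M ch p ij(1) atlasD(1)[OF M ch] p]
  proof (rule eventually_mono)
    fix s assume "inv_into U \<phi> ((\<phi> p)(i := s)) \<in> U \<and> (\<phi> p)(i := s) \<in> \<phi> ` U"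
    then have "\<phi> (inv_into U \<phi> ((\<phi> p)(i := s))) = (\<phi> p)(i := s)" by (intro f_inv_into_f) blast
    then show "\<phi> (inv_into U \<phi> ((\<phi> p)(i := s))) j = (if i = j then s else \<phi> p j)" by auto
  qed
  have "partial i (\<lambda>z. \<phi> (inv_into U \<phi> z) j) (\<phi> p) = deriv (\<lambda>s. if i = j then s else \<phi> p j) (\<phi> p i)"
    unfolding partial_def by (rule deriv_cong_ev[OF ev refl])
  then show ?thesis using smooth_near_chart[OF M ch p ij(2)] by (auto simp: coord_deriv_apply)
qed

lemma tangent_bundle_sel [simp]: "rk (tangent_bundle M) = mdim M"
  "frames (tangent_bundle M) = {(fst \<kappa>, coord_deriv M \<kappa>) | \<kappa>. \<kappa> \<in> charts M}"
  by (simp_all add: tangent_bundle_def)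

lemma sum_times_delta:
  fixes c f :: "nat => real"
  assumes "j < n" "\<And>i. i < n ==> f i = (if i = j then 1 else 0)"
  shows "(\<Sum>i<n. c i * f i) = c j"
proof -
  have "(\<Sum>i<n. c i * f i) = (\<Sum>i<n. if i = j then c i else 0)"
    by (rule sum.cong) (use assms(2) in auto)
  then show ?thesis using assms(1) by simp
qed

lemma coord_deriv_span_le:
  assumes M: "atlas M" and ch: "(U, \<phi>) \<in> charts M" "(V, \<psi>) \<in> charts M" and p: "p \<in> U" "p \<in> V"
  shows "span ((\<lambda>i. coord_deriv M (U, \<phi>) i p) ` {..<mdim M}) \<subseteq> span ((\<lambda>i. coord_deriv M (V, \<psi>) i p) ` {..<mdim M})"
proof (rule span_minimal)
  show "(\<lambda>i. coord_deriv M (U, \<phi>) i p) ` {..<mdim M} \<subseteq> span ((\<lambda>i. coord_deriv M (V, \<psi>) i p) ` {..<mdim M})"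
  proof (rule image_subsetI)
    fix i assume "i \<in> {..<mdim M}"
    then have i: "i < mdim M" by simp
    show "coord_deriv M (U, \<phi>) i p \<in> span ((\<lambda>i. coord_deriv M (V, \<psi>) i p) ` {..<mdim M})"
      by (subst coord_deriv_change[OF M ch p i]) (auto intro!: span_sum intro: span_scale span_base)
  qed
qed simp

text \<open>The charts around \<open>p\<close> all span the same space, so the union in
  \<open>tangent_bundle\<close> collapses to the span for any one of them.\<close>

lemma tangent_fib:
  assumes M: "atlas M" and ch: "(U, \<phi>) \<in> charts M" and p: "p \<in> U"
  shows "tangent_at M p = span ((\<lambda>i. coord_deriv M (U, \<phi>) i p) ` {..<mdim M})"
proof
  show "tangent_at M p \<subseteq> span ((\<lambda>i. coord_deriv M (U, \<phi>) i p) ` {..<mdim M})"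
  proof
    fix v assume "v \<in> tangent_at M p"
    then obtain \<kappa> where k: "\<kappa> \<in> charts M" "p \<in> fst \<kappa>" "v \<in> span ((\<lambda>i. coord_deriv M \<kappa> i p) ` {..<mdim M})"
      unfolding tangent_bundle_def by auto
    then show "v \<in> span ((\<lambda>i. coord_deriv M (U, \<phi>) i p) ` {..<mdim M})"
      using coord_deriv_span_le[OF M _ ch _ p, of "fst \<kappa>" "snd \<kappa>"] by auto
  qed
  show "span ((\<lambda>i. coord_deriv M (U, \<phi>) i p) ` {..<mdim M}) \<subseteq> tangent_at M p"
    unfolding tangent_bundle_def using ch p by force
qed

lemma coord_basis:
  assumes M: "atlas M" and ch: "(U, \<phi>) \<in> charts M" and p: "p \<in> U"
  shows "basis_of (mdim M) (\<lambda>i. coord_deriv M (U, \<phi>) i p) (tangent_at M p)"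
  unfolding basis_of_iff
proof (intro conjI allI impI)
  show "tangent_at M p = range (\<lambda>c. \<Sum>i<mdim M. c i *\<^sub>R coord_deriv M (U, \<phi>) i p)"
    unfolding tangent_fib[OF assms] span_image_lessThan ..
  fix c j assume c: "(\<Sum>i<mdim M. c i *\<^sub>R coord_deriv M (U, \<phi>) i p) = 0" "j < mdim M"
  have "(\<Sum>i<mdim M. c i *\<^sub>R coord_deriv M (U, \<phi>) i p) (\<lambda>p. \<phi> p j) = c j"
    unfolding sum_fun_apply scaleR_fun_def real_scaleR_def
    by (rule sum_times_delta[OF c(2)]) (rule coord_deriv_coord[OF assms _ c(2)])
  then show "c j = 0" using c(1) by simp
qed

text \<open>Coordinate derivations and coordinate functions are dual to each other, so evaluating a
  tangent vector on the latter reads off its coefficients.\<close>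

lemma tangent_coords:
  assumes M: "atlas M" and ch: "(U, \<phi>) \<in> charts M" and p: "p \<in> U" and v: "v \<in> tangent_at M p" and j: "j < mdim M"
  shows "coords (mdim M) (\<lambda>i. coord_deriv M (U, \<phi>) i p) v j = v (\<lambda>p. \<phi> p j)"
proof -
  let ?c = "coords (mdim M) (\<lambda>i. coord_deriv M (U, \<phi>) i p) v"
  have "v (\<lambda>p. \<phi> p j) = (\<Sum>i<mdim M. ?c i *\<^sub>R coord_deriv M (U, \<phi>) i p) (\<lambda>p. \<phi> p j)"
    using coords_sum[OF coord_basis[OF M ch p] v] by simp
  also have "\<dots> = ?c j"
    unfolding sum_fun_apply scaleR_fun_def real_scaleR_def
    by (rule sum_times_delta[OF j]) (rule coord_deriv_coord[OF M ch p _ j])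
  finally show ?thesis ..
qed

text \<open>The transition matrix consists of the first partial derivatives of the change of charts,
  which are continuous since transition maps are smooth.\<close>

lemma framed_tangent:
  assumes M: "atlas M"
  shows "framed M (tangent_bundle M)"
proof (rule framedI)
  have "fst ` frames (tangent_bundle M) = fst ` charts M" by (auto simp: image_iff) (metis fst_conv)+
  then show "\<Union> (fst ` frames (tangent_bundle M)) = points M"
    using conjunct1[OF iffD1[OF atlas_def M]] by simp
next
  fix X assume "X \<in> frames (tangent_bundle M)"
  then obtain U \<phi> where X: "X = (U, coord_deriv M (U, \<phi>))" and ch: "(U, \<phi>) \<in> charts M" by auto
  show "case X of (U, b) => openin (mtop M) U \<and>
      (\<forall>p\<in>U. basis_of (rk (tangent_bundle M)) (\<lambda>i. b i p) (tangent_at M p))"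
    unfolding X using atlasD(1)[OF M ch] coord_basis[OF M ch] by simp
  fix X' assume "X' \<in> frames (tangent_bundle M)"
  then obtain V \<psi> where X': "X' = (V, coord_deriv M (V, \<psi>))" and ch': "(V, \<psi>) \<in> charts M" by auto
  have "continuous_map (mtop_on M (U \<inter> V)) euclideanreal
      (\<lambda>p. coords (mdim M) (\<lambda>k. coord_deriv M (V, \<psi>) k p) (coord_deriv M (U, \<phi>) i p) j)"
    if i: "i < mdim M" and j: "j < mdim M" for i j
  proof (rule continuous_map_eq)
    let ?f = "\<lambda>z. \<psi> (inv_into U \<phi> z) j"
    have "Ck (Suc 0) (mdim M) (\<phi> ` (V \<inter> U)) ?f" by (rule smooth_funD[OF atlasD(4)[OF M ch' j] ch])
    then have c: "continuous_map (subtopology (model M) (\<phi> ` (V \<inter> U))) euclideanreal (partial i ?f)"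
      using i by simp
    have "continuous_map (subtopology (mtop_on M U) (U \<inter> V)) (subtopology (model M) (\<phi> ` (V \<inter> U))) \<phi>"
      by (rule continuous_map_into_subtopology[OF continuous_map_from_subtopology[OF chart_continuous[OF M ch]]]) auto
    moreover have "subtopology (mtop_on M U) (U \<inter> V) = mtop_on M (U \<inter> V)"
      unfolding subtopology_subtopology by (rule arg_cong[of _ _ "mtop_on M"]) blast
    ultimately show "continuous_map (mtop_on M (U \<inter> V)) euclideanreal (partial i ?f \<circ> \<phi>)"
      using continuous_map_compose[OF _ c] by simp
    fix p assume "p \<in> topspace (mtop_on M (U \<inter> V))"
    then have p: "p \<in> U" "p \<in> V" by auto
    show "(partial i ?f \<circ> \<phi>) p = coords (mdim M) (\<lambda>k. coord_deriv M (V, \<psi>) k p) (coord_deriv M (U, \<phi>) i p) j"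
      using tangent_coords[OF M ch' p(2) basis_of_mem[OF coord_basis[OF M ch p(1)] i] j]
        smooth_near_chart[OF M ch' p(2) j] by (simp add: coord_deriv_apply)
  qed
  then show "case X of (U, b) => case X' of (V, c) =>
      \<forall>i<rk (tangent_bundle M). \<forall>j<rk (tangent_bundle M).
        continuous_map (mtop_on M (U \<inter> V)) euclideanreal
          (\<lambda>p. frame_coords (tangent_bundle M) c p (b i p) j)"
    unfolding X X' by simp
qed

text \<open>The coordinates are differentiable within the interval because those of a C1 extension
  are differentiable around it. As \<open>t0 < t1\<close> every parameter is a limit point of the
  interval, so one-sided derivatives are unique and the chain rule identifies them.\<close>

lemma velocity_in_tangent:
  assumes M: "atlas M" and x: "C1_curve M t0 t1 x" and t: "t \<in> {t0..t1}" and t01: "t0 < t1"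
    and ch: "(U, \<phi>) \<in> charts M" "x t \<in> U"
  shows "velocity M t0 t1 x t =
    (\<Sum>j<mdim M. vector_derivative (\<lambda>s. \<phi> (x s) j) (at t within {t0..t1}) *\<^sub>R coord_deriv M (U, \<phi>) j (x t))"
proof
  obtain a b \<gamma> where g: "a < t0" "t1 < b" "curve_on {a<..<b} M \<gamma>"
    "\<forall>(U, \<phi>) \<in> charts M. \<forall>i<mdim M. (\<lambda>t. \<phi> (\<gamma> t) i) C1_differentiable_on {t \<in> {a<..<b}. \<gamma> t \<in> U}"
    "\<forall>t\<in>{t0..t1}. \<gamma> t = x t"
    using x unfolding C1_curve_def by blast
  have tab: "t \<in> {a<..<b}" using g t by auto
  have ntriv: "at t within {t0..t1} \<noteq> bot"
    using t t01 by (simp add: trivial_limit_within islimpt_Icc)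
  have ev: "\<forall>\<^sub>F s in at t within {t0..t1}. x s \<in> W" if "openin (mtop M) W" "x t \<in> W" for W
  proof -
    have "openin (top_of_set {a<..<b}) {s \<in> {a<..<b}. \<gamma> s \<in> W}"
      using openin_continuous_map_preimage[OF g(3) that(1)] by simp
    then have "open {s \<in> {a<..<b}. \<gamma> s \<in> W}" by (rule openin_open_trans) simp
    moreover have "t \<in> {s \<in> {a<..<b}. \<gamma> s \<in> W}" using tab that(2) g(5) t by simp
    ultimately have "\<forall>\<^sub>F s in nhds t. s \<in> {s \<in> {a<..<b}. \<gamma> s \<in> W}" by (rule eventually_nhds_in_open)
    then show ?thesis unfolding eventually_at_filter
      by (rule eventually_mono) (use g(5) in auto)
  qed
  have der: "((\<lambda>s. \<phi> (x s) j) has_real_derivative vector_derivative (\<lambda>s. \<phi> (x s) j) (at t within {t0..t1})) (at t within {t0..t1})"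
    if "j < mdim M" for j
  proof -
    have "(\<lambda>t. \<phi> (\<gamma> t) j) C1_differentiable_on {t \<in> {a<..<b}. \<gamma> t \<in> U}" using g(4) ch(1) that by blast
    moreover have "t \<in> {t \<in> {a<..<b}. \<gamma> t \<in> U}" using tab ch(2) g(5) t by simp
    ultimately obtain D where "((\<lambda>t. \<phi> (\<gamma> t) j) has_vector_derivative D) (at t)"
      unfolding C1_differentiable_on_def by blast
    then have "((\<lambda>t. \<phi> (\<gamma> t) j) has_vector_derivative D) (at t within {t0..t1})"
      by (rule has_vector_derivative_at_within)
    then have *: "((\<lambda>s. \<phi> (x s) j) has_vector_derivative D) (at t within {t0..t1})"
      by (rule has_vector_derivative_transform_within[OF _ zero_less_one t]) (use g(5) in auto)
    have "vector_derivative (\<lambda>s. \<phi> (x s) j) (at t within {t0..t1}) = D"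
      by (rule vector_derivative_within[OF ntriv *])
    then show ?thesis using * by (simp add: has_real_derivative_iff_has_vector_derivative)
  qed
  fix h
  show "velocity M t0 t1 x t h =
    (\<Sum>j<mdim M. vector_derivative (\<lambda>s. \<phi> (x s) j) (at t within {t0..t1}) *\<^sub>R coord_deriv M (U, \<phi>) j (x t)) h"
  proof (cases "smooth_near M (x t) h")
    case True
    have "((\<lambda>s. h (x s)) has_real_derivative (\<Sum>j<mdim M. vector_derivative (\<lambda>s. \<phi> (x s) j) (at t within {t0..t1}) *
        coord_deriv M (U, \<phi>) j (x t) h)) (at t within {t0..t1})"
      by (rule derivative_along_curve[OF M ch(1) True ch(2) t ev der])
    then have "vector_derivative (\<lambda>s. h (x s)) (at t within {t0..t1}) =
      (\<Sum>j<mdim M. vector_derivative (\<lambda>s. \<phi> (x s) j) (at t within {t0..t1}) * coord_deriv M (U, \<phi>) j (x t) h)"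
      by (intro vector_derivative_within[OF ntriv]) (simp add: has_real_derivative_iff_has_vector_derivative)
    then show ?thesis using True by (simp add: velocity_def o_def sum_fun_apply scaleR_fun_def)
  qed (simp add: velocity_def coord_deriv_apply sum_fun_apply scaleR_fun_def)
qed

section \<open>Tangent vectors of a product\<close>

lemma push_sum: "push N q F (\<Sum>i\<in>A. c i *\<^sub>R v i) = (\<Sum>i\<in>A. c i *\<^sub>R push N q F (v i))"
  by (rule ext) (simp add: push_def sum_fun_apply scaleR_fun_def)

context
  fixes M :: "'m manifold" and N :: "'n manifold"
  assumes M: "atlas M" and N: "atlas N"
begin

text \<open>Moving one of the first coordinates of a product chart moves only the first component,
  so the partial derivative is that of the slice through \<open>q\<close>.\<close>

lemma partial_prod_left:
  assumes ch: "(U, \<phi>) \<in> charts M" "(V, \<psi>) \<in> charts N" and pq: "p \<in> U" "q \<in> V" and i: "i < mdim M"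
  shows "partial i (\<lambda>z. h (inv_into (U \<times> V) (prod_map M \<phi> \<psi>) z)) (join (mdim M) (\<phi> p) (\<psi> q)) =
    partial i (\<lambda>z. h (inv_into U \<phi> z, q)) (\<phi> p)"
proof -
  have at: "join (mdim M) (\<phi> p) (\<psi> q) i = \<phi> p i" using i by (simp add: join_def)
  have "\<forall>\<^sub>F s in nhds (\<phi> p i). h (inv_into (U \<times> V) (prod_map M \<phi> \<psi>) ((join (mdim M) (\<phi> p) (\<psi> q))(i := s))) =
      h (inv_into U \<phi> ((\<phi> p)(i := s)), q)"
    using chart_line[OF M ch(1) pq(1) i atlasD(1)[OF M ch(1)] pq(1)]
  proof (rule eventually_mono)
    fix s assume "inv_into U \<phi> ((\<phi> p)(i := s)) \<in> U \<and> (\<phi> p)(i := s) \<in> \<phi> ` U"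
    then obtain p' where p': "p' \<in> U" "(\<phi> p)(i := s) = \<phi> p'" by blast
    have "(join (mdim M) (\<phi> p) (\<psi> q))(i := s) = join (mdim M) ((\<phi> p)(i := s)) (\<psi> q)"
      using i by (auto simp: join_def fun_eq_iff)
    then show "h (inv_into (U \<times> V) (prod_map M \<phi> \<psi>) ((join (mdim M) (\<phi> p) (\<psi> q))(i := s))) =
      h (inv_into U \<phi> ((\<phi> p)(i := s)), q)"
      using prod_chart_inv[OF M N ch p'(1) pq(2)] chart_inv[OF M ch(1) p'(1)] p'(2) by simp
  qed
  then show ?thesis unfolding partial_def at by (rule deriv_cong_ev) simp
qed

lemma partial_prod_right:
  assumes ch: "(U, \<phi>) \<in> charts M" "(V, \<psi>) \<in> charts N" and pq: "p \<in> U" "q \<in> V" and i: "i < mdim N"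
  shows "partial (mdim M + i) (\<lambda>z. h (inv_into (U \<times> V) (prod_map M \<phi> \<psi>) z)) (join (mdim M) (\<phi> p) (\<psi> q)) =
    partial i (\<lambda>z. h (p, inv_into V \<psi> z)) (\<psi> q)"
proof -
  have at: "join (mdim M) (\<phi> p) (\<psi> q) (mdim M + i) = \<psi> q i" by (simp add: join_def)
  have "\<forall>\<^sub>F s in nhds (\<psi> q i). h (inv_into (U \<times> V) (prod_map M \<phi> \<psi>) ((join (mdim M) (\<phi> p) (\<psi> q))(mdim M + i := s))) =
      h (p, inv_into V \<psi> ((\<psi> q)(i := s)))"
    using chart_line[OF N ch(2) pq(2) i atlasD(1)[OF N ch(2)] pq(2)]
  proof (rule eventually_mono)
    fix s assume "inv_into V \<psi> ((\<psi> q)(i := s)) \<in> V \<and> (\<psi> q)(i := s) \<in> \<psi> ` V"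
    then obtain q' where q': "q' \<in> V" "(\<psi> q)(i := s) = \<psi> q'" by blast
    have "(join (mdim M) (\<phi> p) (\<psi> q))(mdim M + i := s) = join (mdim M) (\<phi> p) ((\<psi> q)(i := s))"
      by (auto simp: join_def fun_eq_iff)
    then show "h (inv_into (U \<times> V) (prod_map M \<phi> \<psi>) ((join (mdim M) (\<phi> p) (\<psi> q))(mdim M + i := s))) =
      h (p, inv_into V \<psi> ((\<psi> q)(i := s)))"
      using prod_chart_inv[OF M N ch pq(1) q'(1)] chart_inv[OF N ch(2) q'(1)] q'(2) by simp
  qed
  then show ?thesis unfolding partial_def at by (rule deriv_cong_ev) simp
qed

abbreviation "prod_chart U \<phi> V \<psi> \<equiv> (U \<times> V, \<lambda>(p, q). join (mdim M) (\<phi> p) (\<psi> q))"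

abbreviation incl_fst where "incl_fst p q \<equiv> push (prod_manifold M N) (p, q) (\<lambda>p'. (p', q))"

abbreviation incl_snd where "incl_snd p q \<equiv> push (prod_manifold M N) (p, q) (\<lambda>q'. (p, q'))"

lemma push_incl_left:
  assumes ch: "(U, \<phi>) \<in> charts M" "(V, \<psi>) \<in> charts N" and pq: "p \<in> U" "q \<in> V" and i: "i < mdim M"
  shows "push (prod_manifold M N) (p, q) (\<lambda>p'. (p', q)) (coord_deriv M (U, \<phi>) i p) =
    coord_deriv (prod_manifold M N) (prod_chart U \<phi> V \<psi>) i (p, q)"
  using smooth_near_slice(1)[OF M N] partial_prod_left[OF assms]
  by (auto simp: fun_eq_iff push_def coord_deriv_apply o_def)

lemma push_incl_right:
  assumes ch: "(U, \<phi>) \<in> charts M" "(V, \<psi>) \<in> charts N" and pq: "p \<in> U" "q \<in> V" and i: "i < mdim N"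
  shows "push (prod_manifold M N) (p, q) (\<lambda>q'. (p, q')) (coord_deriv N (V, \<psi>) i q) =
    coord_deriv (prod_manifold M N) (prod_chart U \<phi> V \<psi>) (mdim M + i) (p, q)"
  using smooth_near_slice(2)[OF M N] partial_prod_right[OF assms]
  by (auto simp: fun_eq_iff push_def coord_deriv_apply o_def)

lemma push_proj:
  assumes ch: "(U, \<phi>) \<in> charts M" "(V, \<psi>) \<in> charts N" and pq: "p \<in> U" "q \<in> V"
  shows "i < mdim M ==> push M p fst (coord_deriv (prod_manifold M N) (prod_chart U \<phi> V \<psi>) i (p, q)) = coord_deriv M (U, \<phi>) i p"
    and "i < mdim N ==> push M p fst (coord_deriv (prod_manifold M N) (prod_chart U \<phi> V \<psi>) (mdim M + i) (p, q)) = 0"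
    and "i < mdim M ==> push N q snd (coord_deriv (prod_manifold M N) (prod_chart U \<phi> V \<psi>) i (p, q)) = 0"
    and "i < mdim N ==> push N q snd (coord_deriv (prod_manifold M N) (prod_chart U \<phi> V \<psi>) (mdim M + i) (p, q)) = coord_deriv N (V, \<psi>) i q"
proof -
  have P: "p \<in> points M" "q \<in> points N"
    using openin_subset[OF atlasD(1)[OF M ch(1)]] openin_subset[OF atlasD(1)[OF N ch(2)]] pq by auto
  show "i < mdim M ==> push M p fst (coord_deriv (prod_manifold M N) (prod_chart U \<phi> V \<psi>) i (p, q)) = coord_deriv M (U, \<phi>) i p"
    using smooth_near_fst[OF M N _ P(2)] partial_prod_left[OF ch pq, of i "\<lambda>x. _ (fst x)"]
    by (auto simp: fun_eq_iff push_def coord_deriv_apply o_def)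
  show "i < mdim N ==> push M p fst (coord_deriv (prod_manifold M N) (prod_chart U \<phi> V \<psi>) (mdim M + i) (p, q)) = 0"
    using partial_prod_right[OF ch pq, of i "\<lambda>x. _ (fst x)"]
    by (auto simp: fun_eq_iff push_def coord_deriv_apply o_def)
  show "i < mdim M ==> push N q snd (coord_deriv (prod_manifold M N) (prod_chart U \<phi> V \<psi>) i (p, q)) = 0"
    using partial_prod_left[OF ch pq, of i "\<lambda>x. _ (snd x)"]
    by (auto simp: fun_eq_iff push_def coord_deriv_apply o_def)
  show "i < mdim N ==> push N q snd (coord_deriv (prod_manifold M N) (prod_chart U \<phi> V \<psi>) (mdim M + i) (p, q)) = coord_deriv N (V, \<psi>) i q"
    using smooth_near_snd[OF M N _ P(1)] partial_prod_right[OF ch pq, of i "\<lambda>x. _ (snd x)"]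
    by (auto simp: fun_eq_iff push_def coord_deriv_apply o_def)
qed

lemma prod_chart_in:
  "(U, \<phi>) \<in> charts M ==> (V, \<psi>) \<in> charts N ==> prod_chart U \<phi> V \<psi> \<in> charts (prod_manifold M N)"
  using prod_manifold_chartI[of U \<phi> M V \<psi> N] unfolding prod_chart_join[OF M N] .

text \<open>In the frames of a product chart the pushforwards along slices insert a block of zero
  coefficients and those along projections delete a block. The facts together say that the tangent
  space of the product is the direct sum, with the sum of the two insertions inverse to the pair of
  projections.\<close>

lemma push_tangent:
  assumes p: "p \<in> points M" and q: "q \<in> points N"
  shows "v \<in> tangent_at M p ==>
      incl_fst p q v \<in> tangent_at (prod_manifold M N) (p, q)"
    and "w \<in> tangent_at N q ==>
      incl_snd p q w \<in> tangent_at (prod_manifold M N) (p, q)"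
    and "u \<in> tangent_at (prod_manifold M N) (p, q) ==> push M p fst u \<in> tangent_at M p"
    and "u \<in> tangent_at (prod_manifold M N) (p, q) ==> push N q snd u \<in> tangent_at N q"
    and "u \<in> tangent_at (prod_manifold M N) (p, q) ==>
      incl_fst p q (push M p fst u) +
      incl_snd p q (push N q snd u) = u"
    and "v \<in> tangent_at M p ==> w \<in> tangent_at N q ==>
      push M p fst (incl_fst p q v + incl_snd p q w) = v"
    and "v \<in> tangent_at M p ==> w \<in> tangent_at N q ==>
      push N q snd (incl_fst p q v + incl_snd p q w) = w"
proof -
  let ?P = "prod_manifold M N"
  obtain U \<phi> where ch: "(U, \<phi>) \<in> charts M" "p \<in> U" using atlas_cover[OF M p] by blast
  obtain V \<psi> where ch': "(V, \<psi>) \<in> charts N" "q \<in> V" using atlas_cover[OF N q] by blast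
  let ?b = "\<lambda>i. coord_deriv M (U, \<phi>) i p" and ?c = "\<lambda>i. coord_deriv N (V, \<psi>) i q"
  let ?d = "\<lambda>i. coord_deriv ?P (prod_chart U \<phi> V \<psi>) i (p, q)"
  note B = coord_basis[OF M ch] and C = coord_basis[OF N ch']
  have D: "basis_of (mdim M + mdim N) ?d (tangent_at ?P (p, q))"
    using coord_basis[OF atlas_prod[OF M N] prod_chart_in[OF ch(1) ch'(1)], of "(p, q)"] ch(2) ch'(2) by simp
  have il: "incl_fst p q (\<Sum>i<mdim M. a i *\<^sub>R ?b i) = (\<Sum>i<mdim M. a i *\<^sub>R ?d i)" for a
    unfolding push_sum by (intro sum.cong refl) (simp add: push_incl_left[OF ch(1) ch'(1) ch(2) ch'(2)])
  have ir: "incl_snd p q (\<Sum>i<mdim N. a i *\<^sub>R ?c i) = (\<Sum>i<mdim N. a i *\<^sub>R ?d (mdim M + i))" for a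
    unfolding push_sum by (intro sum.cong refl) (simp add: push_incl_right[OF ch(1) ch'(1) ch(2) ch'(2)])
  have pl: "push M p fst (\<Sum>i<mdim M + mdim N. a i *\<^sub>R ?d i) = (\<Sum>i<mdim M. a i *\<^sub>R ?b i)" for a
    by (subst push_sum, subst sum_lessThan_add) (simp add: push_proj(1,2)[OF ch(1) ch'(1) ch(2) ch'(2)])
  have pr: "push N q snd (\<Sum>i<mdim M + mdim N. a i *\<^sub>R ?d i) = (\<Sum>i<mdim N. a (mdim M + i) *\<^sub>R ?c i)" for a
    by (subst push_sum, subst sum_lessThan_add) (simp add: push_proj(3,4)[OF ch(1) ch'(1) ch(2) ch'(2)])
  have ev: "\<exists>a. v = (\<Sum>i<mdim M. a i *\<^sub>R ?b i)" if "v \<in> tangent_at M p" for v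
    by (intro exI[of _ "coords (mdim M) ?b v"]) (rule coords_sum[OF B that, symmetric])
  have ew: "\<exists>a. w = (\<Sum>i<mdim N. a i *\<^sub>R ?c i)" if "w \<in> tangent_at N q" for w
    by (intro exI[of _ "coords (mdim N) ?c w"]) (rule coords_sum[OF C that, symmetric])
  have eu: "\<exists>a. u = (\<Sum>i<mdim M + mdim N. a i *\<^sub>R ?d i)" if "u \<in> tangent_at ?P (p, q)" for u
    by (intro exI[of _ "coords (mdim M + mdim N) ?d u"]) (rule coords_sum[OF D that, symmetric])
  have join_sum: "(\<Sum>i<mdim M. a i *\<^sub>R ?d i) + (\<Sum>i<mdim N. a' i *\<^sub>R ?d (mdim M + i)) =
      (\<Sum>i<mdim M + mdim N. (if i < mdim M then a i else a' (i - mdim M)) *\<^sub>R ?d i)" for a a'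
    unfolding sum_lessThan_add by simp
  have mem: "(\<Sum>i<mdim M + mdim N. a i *\<^sub>R ?d i) \<in> tangent_at ?P (p, q)" for a by (rule basis_of_comb[OF D])
  show "incl_fst p q v \<in> tangent_at ?P (p, q)" if v: "v \<in> tangent_at M p"
  proof -
    obtain a where a: "v = (\<Sum>i<mdim M. a i *\<^sub>R ?b i)" using ev[OF v] ..
    show ?thesis using mem[of "\<lambda>i. if i < mdim M then a i else 0"] unfolding a il sum_lessThan_add by simp
  qed
  show "incl_snd p q w \<in> tangent_at ?P (p, q)" if w: "w \<in> tangent_at N q"
  proof -
    obtain a where a: "w = (\<Sum>i<mdim N. a i *\<^sub>R ?c i)" using ew[OF w] ..
    show ?thesis using mem[of "\<lambda>i. if i < mdim M then 0 else a (i - mdim M)"] unfolding a ir sum_lessThan_add by simp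
  qed
  show "push M p fst u \<in> tangent_at M p" if u: "u \<in> tangent_at ?P (p, q)"
  proof -
    obtain a where a: "u = (\<Sum>i<mdim M + mdim N. a i *\<^sub>R ?d i)" using eu[OF u] ..
    show ?thesis unfolding a pl by (rule basis_of_comb[OF B])
  qed
  show "push N q snd u \<in> tangent_at N q" if u: "u \<in> tangent_at ?P (p, q)"
  proof -
    obtain a where a: "u = (\<Sum>i<mdim M + mdim N. a i *\<^sub>R ?d i)" using eu[OF u] ..
    show ?thesis unfolding a pr by (rule basis_of_comb[OF C])
  qed
  show "incl_fst p q (push M p fst u) + incl_snd p q (push N q snd u) = u"
    if u: "u \<in> tangent_at ?P (p, q)"
  proof -
    obtain a where a: "u = (\<Sum>i<mdim M + mdim N. a i *\<^sub>R ?d i)" using eu[OF u] ..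
    show ?thesis unfolding a pl pr il ir by (simp add: sum_lessThan_add)
  qed
  show "push M p fst (incl_fst p q v + incl_snd p q w) = v"
    "push N q snd (incl_fst p q v + incl_snd p q w) = w"
    if v: "v \<in> tangent_at M p" and w: "w \<in> tangent_at N q"
  proof -
    obtain a where a: "v = (\<Sum>i<mdim M. a i *\<^sub>R ?b i)" using ev[OF v] ..
    obtain a' where a': "w = (\<Sum>i<mdim N. a' i *\<^sub>R ?c i)" using ew[OF w] ..
    show "push M p fst (incl_fst p q v + incl_snd p q w) = v"
      "push N q snd (incl_fst p q v + incl_snd p q w) = w"
      unfolding a a' il ir join_sum pl pr by simp_all
  qed
qed

end

text \<open>The coefficients of one frame in another are unique, hence equal to its coordinates, and
  smooth coefficients are continuous.\<close>

lemma vector_bundle_framed: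
  assumes M: "atlas M" and E: "vector_bundle M E"
  shows "framed M E"
proof (rule framedI)
  note A = E[unfolded vector_bundle_def]
  show "\<Union> (fst ` frames E) = points M" using conjunct1[OF A] .
  fix X assume X: "X \<in> frames E"
  obtain U b where Ub: "X = (U, b)" by (cases X)
  note B = bspec[OF conjunct2[OF A] X, unfolded Ub prod.case]
  show "case X of (U, b) => openin (mtop M) U \<and> (\<forall>p\<in>U. basis_of (rk E) (\<lambda>i. b i p) (fib E p))"
    unfolding Ub prod.case using B by simp
  fix X' assume X': "X' \<in> frames E"
  obtain V c where Vc: "X' = (V, c)" by (cases X')
  note C = bspec[OF conjunct2[OF A] X', unfolded Vc prod.case]
  have "continuous_map (mtop_on M (U \<inter> V)) euclideanreal (\<lambda>p. frame_coords E c p (b i p) j)"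
    if i: "i < rk E" and j: "j < rk E" for i j
  proof -
    have "smooth_section M E U (b i)" using B i by simp
    then obtain a where a: "\<forall>i<rk E. smooth_fun M (U \<inter> V) (a i)"
      "\<forall>p\<in>U \<inter> V. b i p = (\<Sum>i<rk E. a i p *\<^sub>R c i p)"
      using X' unfolding smooth_section_def Vc by blast
    have "openin (mtop M) (U \<inter> V)" using B C by (simp add: openin_Int)
    then have "continuous_map (mtop_on M (U \<inter> V)) euclideanreal (a j)"
      using atlas_smooth_continuous[OF M] a(1) j unfolding smooth_implies_continuous_def by blast
    then show ?thesis
    proof (rule continuous_map_eq)
      fix p assume "p \<in> topspace (mtop_on M (U \<inter> V))"
      then have p: "p \<in> U \<inter> V" by simp
      have "basis_of (rk E) (\<lambda>i. c i p) (fib E p)" using C p by simp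
      from coords_unique[OF this, of "\<lambda>i. a i p" j]
      show "a j p = frame_coords E c p (b i p) j" using a(2) p j by simp
    qed
  qed
  then show "case X of (U, b) => case X' of (V, c) => \<forall>i<rk E. \<forall>j<rk E.
      continuous_map (mtop_on M (U \<inter> V)) euclideanreal (\<lambda>p. frame_coords E c p (b i p) j)"
    unfolding Ub Vc by simp
qed


section \<open>Bundle metrics\<close>

text \<open>The fibrewise half of \<open>bundle_metric\<close>, separated so that restriction,
  orthogonal sum and pullback of metrics become linear algebra in one fibre.\<close>

definition inner_on :: "'v::real_vector set => ('v => 'v => real) => bool" where
  "inner_on V B \<longleftrightarrow> (\<forall>u\<in>V. \<forall>v\<in>V.
        B u v = B v u \<and> (u \<noteq> 0 \<longrightarrow> B u u > 0) \<and>
        (\<forall>w\<in>V. \<forall>a b. B (a *\<^sub>R u + b *\<^sub>R v) w = a * B u w + b * B v w))"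

lemma inner_onD:
  assumes "inner_on V B" "u \<in> V" "v \<in> V"
  shows "B u v = B v u" "u \<noteq> 0 ==> B u u > 0"
    "w \<in> V ==> B (a *\<^sub>R u + b *\<^sub>R v) w = a * B u w + b * B v w"
  using bspec[OF bspec[OF assms(1)[unfolded inner_on_def] assms(2)] assms(3)] by simp_all

lemma inner_on_zero:
  assumes "inner_on V B" "v \<in> V" "0 \<in> V"
  shows "B 0 v = 0" "B v 0 = 0"
proof -
  show "B 0 v = 0" using inner_onD(3)[OF assms(1,2,2,2), of 0 0] by simp
  then show "B v 0 = 0" using inner_onD(1)[OF assms(1,2,3)] by simp
qed

lemma bundle_metric_iff:
  "bundle_metric M E g \<longleftrightarrow> (\<forall>p\<in>points M. inner_on (fib E p) (g p)) \<and>
     (\<forall>(U, b) \<in> frames E. \<forall>i<rk E. \<forall>j<rk E. smooth_fun M U (\<lambda>p. g p (b i p) (b j p)))"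
  unfolding bundle_metric_def inner_on_def ..

lemma bundle_metricD:
  assumes "bundle_metric M E g"
  shows "p \<in> points M ==> inner_on (fib E p) (g p)"
    "(U, b) \<in> frames E ==> i < rk E ==> j < rk E ==> smooth_fun M U (\<lambda>p. g p (b i p) (b j p))"
proof -
  note A = assms[unfolded bundle_metric_iff]
  show "p \<in> points M ==> inner_on (fib E p) (g p)" using conjunct1[OF A] by simp
  show "(U, b) \<in> frames E ==> i < rk E ==> j < rk E ==> smooth_fun M U (\<lambda>p. g p (b i p) (b j p))"
    using bspec[OF conjunct2[OF A], of "(U, b)"] by simp
qed

lemma bundle_metricI:
  assumes "\<And>p. p \<in> points M ==> inner_on (fib E p) (g p)"
    "\<And>U b i j. (U, b) \<in> frames E ==> i < rk E ==> j < rk E ==> smooth_fun M U (\<lambda>p. g p (b i p) (b j p))"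
  shows "bundle_metric M E g"
  unfolding bundle_metric_iff
proof (intro conjI ballI)
  fix X assume "X \<in> frames E"
  then show "case X of (U, b) => \<forall>i<rk E. \<forall>j<rk E. smooth_fun M U (\<lambda>p. g p (b i p) (b j p))"
    by (cases X) (auto intro: assms(2))
qed (rule assms(1))

lemma inner_on_fst:
  assumes "inner_on (V \<times> W) B" "0 \<in> W"
  shows "inner_on V (\<lambda>u v. B (u, 0) (v, 0))"
  unfolding inner_on_def
proof (intro ballI conjI impI allI)
  fix u v assume u: "u \<in> V" and v: "v \<in> V"
  then have uv: "(u, 0) \<in> V \<times> W" "(v, 0) \<in> V \<times> W" using assms(2) by auto
  show "B (u, 0) (v, 0) = B (v, 0) (u, 0)" by (rule inner_onD(1)[OF assms(1) uv])
  show "u \<noteq> 0 ==> B (u, 0) (u, 0) > 0" using inner_onD(2)[OF assms(1) uv] by (simp add: zero_prod_def)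
  fix w a b assume "w \<in> V"
  then have "(w, 0) \<in> V \<times> W" using assms(2) by auto
  from inner_onD(3)[OF assms(1) uv this, of a b]
  show "B (a *\<^sub>R u + b *\<^sub>R v, 0) (w, 0) = a * B (u, 0) (w, 0) + b * B (v, 0) (w, 0)" by simp
qed

lemma inner_on_snd:
  assumes "inner_on (V \<times> W) B" "0 \<in> V"
  shows "inner_on W (\<lambda>u v. B (0, u) (0, v))"
  unfolding inner_on_def
proof (intro ballI conjI impI allI)
  fix u v assume u: "u \<in> W" and v: "v \<in> W"
  then have uv: "(0, u) \<in> V \<times> W" "(0, v) \<in> V \<times> W" using assms(2) by auto
  show "B (0, u) (0, v) = B (0, v) (0, u)" by (rule inner_onD(1)[OF assms(1) uv])
  show "u \<noteq> 0 ==> B (0, u) (0, u) > 0" using inner_onD(2)[OF assms(1) uv] by (simp add: zero_prod_def)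
  fix w a b assume "w \<in> W"
  then have "(0, w) \<in> V \<times> W" using assms(2) by auto
  from inner_onD(3)[OF assms(1) uv this, of a b]
  show "B (0, a *\<^sub>R u + b *\<^sub>R v) (0, w) = a * B (0, u) (0, w) + b * B (0, v) (0, w)" by simp
qed

lemma inner_on_Times:
  assumes B: "inner_on V B" "subspace V" and C: "inner_on W C" "subspace W"
  shows "inner_on (V \<times> W) (\<lambda>(u, u') (v, v'). B u v + C u' v')"
  unfolding inner_on_def
proof (intro ballI conjI impI allI)
  fix x y assume "x \<in> V \<times> W" "y \<in> V \<times> W"
  then obtain u u' v v' where x: "x = (u, u')" and y: "y = (v, v')"
    and m: "u \<in> V" "u' \<in> W" "v \<in> V" "v' \<in> W" by auto
  show "(case x of (u, u') => \<lambda>(v, v'). B u v + C u' v') y = (case y of (u, u') => \<lambda>(v, v'). B u v + C u' v') x"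
    using inner_onD(1)[OF B(1) m(1,3)] inner_onD(1)[OF C(1) m(2,4)] by (simp add: x y)
  show "(case x of (u, u') => \<lambda>(v, v'). B u v + C u' v') x > 0" if "x \<noteq> 0"
    using inner_onD(2)[OF B(1) m(1,1)] inner_onD(2)[OF C(1) m(2,2)] that
      inner_on_zero(1)[OF B(1) subspace_0 subspace_0, OF B(2) B(2)] inner_on_zero(1)[OF C(1) subspace_0 subspace_0, OF C(2) C(2)]
    by (cases "u = 0"; cases "u' = 0") (simp_all add: x zero_prod_def)
  fix z a b assume "z \<in> V \<times> W"
  then obtain w w' where z: "z = (w, w')" "w \<in> V" "w' \<in> W" by auto
  show "(case a *\<^sub>R x + b *\<^sub>R y of (u, u') => \<lambda>(v, v'). B u v + C u' v') z =
     a * (case x of (u, u') => \<lambda>(v, v'). B u v + C u' v') z + b * (case y of (u, u') => \<lambda>(v, v'). B u v + C u' v') z"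
    using inner_onD(3)[OF B(1) m(1,3) z(2)] inner_onD(3)[OF C(1) m(2,4) z(3)] by (simp add: x y z algebra_simps)
qed

lemma inner_on_pullback:
  assumes B: "inner_on V B" and T: "\<And>u. u \<in> U ==> T u \<in> V"
    and lin: "\<And>a b u v. T (a *\<^sub>R u + b *\<^sub>R v) = a *\<^sub>R T u + b *\<^sub>R T v"
    and inj: "\<And>u. u \<in> U ==> T u = 0 ==> u = 0"
  shows "inner_on U (\<lambda>u v. B (T u) (T v))"
  unfolding inner_on_def
proof (intro ballI conjI impI allI)
  fix u v assume u: "u \<in> U" and v: "v \<in> U"
  show "B (T u) (T v) = B (T v) (T u)" by (rule inner_onD(1)[OF B T[OF u] T[OF v]])
  show "u \<noteq> 0 ==> B (T u) (T u) > 0" using inner_onD(2)[OF B T[OF u] T[OF u]] inj[OF u] by blast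
  fix w a b assume w: "w \<in> U"
  show "B (T (a *\<^sub>R u + b *\<^sub>R v)) (T w) = a * B (T u) (T w) + b * B (T v) (T w)"
    unfolding lin by (rule inner_onD(3)[OF B T[OF u] T[OF v] T[OF w]])
qed

lemma smooth_fun_cong:
  assumes M: "atlas M" and U: "openin (mtop M) U" and eq: "\<And>p. p \<in> U ==> f p = g p" and f: "smooth_fun M U f"
  shows "smooth_fun M U g"
proof (rule smooth_funI)
  fix V \<phi> k assume ch: "(V, \<phi>) \<in> charts M"
  show "Ck k (mdim M) (\<phi> ` (U \<inter> V)) (\<lambda>z. g (inv_into V \<phi> z))"
  proof (rule Ck_cong[OF chart_open_image[OF M ch U] _ smooth_funD[OF f ch]])
    fix z assume "z \<in> \<phi> ` (U \<inter> V)"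
    then obtain p where "p \<in> U" "p \<in> V" "z = \<phi> p" by blast
    then show "f (inv_into V \<phi> z) = g (inv_into V \<phi> z)" using chart_inv[OF M ch] eq by simp
  qed
qed

lemma bundle_metric_zero:
  assumes g: "bundle_metric M E g" and E: "framed M E" and p: "p \<in> points M" and v: "v \<in> fib E p"
  shows "g p 0 v = 0" "g p v 0 = 0"
  using inner_on_zero[OF bundle_metricD(1)[OF g p] v subspace_0[OF framed_subspace[OF E p]]] by auto

lemma bundle_metric_zero_frame:
  assumes g: "bundle_metric M E g" and E: "framed M E" and fr: "(U, b) \<in> frames E" "p \<in> U"
  shows "i < rk E ==> g p 0 (b i p) = 0" "i < rk E ==> g p (b i p) 0 = 0" "g p 0 0 = 0"
proof -
  have p: "p \<in> points M" using fr framed_subset[OF E fr(1)] by blast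
  note Z = bundle_metric_zero[OF g E p]
  show "i < rk E ==> g p 0 (b i p) = 0" "i < rk E ==> g p (b i p) 0 = 0" "g p 0 0 = 0"
    using Z[OF basis_of_mem[OF framedD(2)[OF E fr]]] Z[OF subspace_0[OF framed_subspace[OF E p]]] by auto
qed

text \<open>The frames of the sum live on intersections of frame domains, so smoothness of the
  restricted Gram matrix is first known there and is then glued by
  \<open>smooth_fun_local\<close>.\<close>

lemma bundle_metric_fst:
  assumes M: "atlas M" and E: "framed M E" and F: "framed M F" and g: "bundle_metric M (E \<oplus>\<^sub>b F) g"
  shows "bundle_metric M E (\<lambda>p u v. g p (u, 0) (v, 0))"
proof (rule bundle_metricI)
  show "inner_on (fib E p) (\<lambda>u v. g p (u, 0) (v, 0))" if "p \<in> points M" for p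
    using bundle_metricD(1)[OF g that] subspace_0[OF framed_subspace[OF F that]]
    by (intro inner_on_fst) simp_all
  fix U b i j assume fr: "(U, b) \<in> frames E" and ij: "i < rk E" "j < rk E"
  show "smooth_fun M U (\<lambda>p. g p (b i p, 0) (b j p, 0))"
  proof (rule smooth_fun_local[OF M])
    fix p assume p: "p \<in> U"
    then obtain V c where V: "(V, c) \<in> frames F" "p \<in> V"
      using framed_cover[OF F] framed_subset[OF E fr] by blast
    have "smooth_fun M (U \<inter> V) (\<lambda>p. g p (b i p, 0) (b j p, 0))"
      using bundle_metricD(2)[OF g dsum_frameI[OF fr V(1)], of i j] ij by simp
    then show "\<exists>V. openin (mtop M) V \<and> p \<in> V \<and> V \<subseteq> U \<and> smooth_fun M V (\<lambda>p. g p (b i p, 0) (b j p, 0))"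
      using p V framedD(1)[OF E fr] framedD(1)[OF F V(1)] by (intro exI[of _ "U \<inter> V"]) (simp add: openin_Int)
  qed
qed

lemma bundle_metric_snd:
  assumes M: "atlas M" and E: "framed M E" and F: "framed M F" and g: "bundle_metric M (E \<oplus>\<^sub>b F) g"
  shows "bundle_metric M F (\<lambda>p u v. g p (0, u) (0, v))"
proof (rule bundle_metricI)
  show "inner_on (fib F p) (\<lambda>u v. g p (0, u) (0, v))" if "p \<in> points M" for p
    using bundle_metricD(1)[OF g that] subspace_0[OF framed_subspace[OF E that]]
    by (intro inner_on_snd) simp_all
  fix V c i j assume fr: "(V, c) \<in> frames F" and ij: "i < rk F" "j < rk F"
  show "smooth_fun M V (\<lambda>p. g p (0, c i p) (0, c j p))"
  proof (rule smooth_fun_local[OF M])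
    fix p assume p: "p \<in> V"
    then obtain U b where U: "(U, b) \<in> frames E" "p \<in> U"
      using framed_cover[OF E] framed_subset[OF F fr] by blast
    have "smooth_fun M (U \<inter> V) (\<lambda>p. g p (0, c i p) (0, c j p))"
      using bundle_metricD(2)[OF g dsum_frameI[OF U(1) fr], of "rk E + i" "rk E + j"] ij by simp
    then show "\<exists>W. openin (mtop M) W \<and> p \<in> W \<and> W \<subseteq> V \<and> smooth_fun M W (\<lambda>p. g p (0, c i p) (0, c j p))"
      using p U framedD(1)[OF F fr] framedD(1)[OF E U(1)] by (intro exI[of _ "U \<inter> V"]) (simp add: openin_Int)
  qed
qed

text \<open>The orthogonal sum: its Gram matrix in a concatenated frame has the two given Gram
  matrices as diagonal blocks and zeros elsewhere.\<close>

lemma bundle_metric_dsum: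
  assumes M: "atlas M" and E: "framed M E" and F: "framed M F"
    and g: "bundle_metric M E g" and h: "bundle_metric M F h"
  shows "bundle_metric M (E \<oplus>\<^sub>b F) (\<lambda>p (u, u') (v, v'). g p u v + h p u' v')"
proof (rule bundle_metricI)
  show "inner_on (fib (E \<oplus>\<^sub>b F) p) (\<lambda>(u, u') (v, v'). g p u v + h p u' v')" if "p \<in> points M" for p
    using inner_on_Times[OF bundle_metricD(1)[OF g that] framed_subspace[OF E that]
        bundle_metricD(1)[OF h that] framed_subspace[OF F that]] by simp
  fix W d i j assume "(W, d) \<in> frames (E \<oplus>\<^sub>b F)" and ij: "i < rk (E \<oplus>\<^sub>b F)" "j < rk (E \<oplus>\<^sub>b F)"
  then obtain U b V c where W: "W = U \<inter> V" and d: "d = (sum_frame E b c)"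
    and fr: "(U, b) \<in> frames E" "(V, c) \<in> frames F"
    by (auto simp: dsum_bundle_def)
  have op: "openin (mtop M) (U \<inter> V)" using framedD(1)[OF E fr(1)] framedD(1)[OF F fr(2)] by (rule openin_Int)
  note g0 = bundle_metric_zero_frame[OF g E fr(1)] and h0 = bundle_metric_zero_frame[OF h F fr(2)]
  consider (1) "i < rk E" "j < rk E" | (2) "(i < rk E) \<noteq> (j < rk E)" | (3) "\<not> i < rk E" "\<not> j < rk E" by blast
  then show "smooth_fun M W (\<lambda>p. (case d i p of (u, u') => \<lambda>(v, v'). g p u v + h p u' v') (d j p))"
  proof cases
    case 1
    show ?thesis unfolding W
    proof (rule smooth_fun_cong[OF M op])
      show "smooth_fun M (U \<inter> V) (\<lambda>p. g p (b i p) (b j p))"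
        by (rule smooth_fun_subset[OF bundle_metricD(2)[OF g fr(1) 1]]) blast
    qed (use 1 h0(3) in \<open>simp add: d\<close>)
  next
    case 2
    then have ij': "i - rk E < rk F \<or> i < rk E" "j - rk E < rk F \<or> j < rk E" using ij by auto
    show ?thesis unfolding W
    proof (rule smooth_fun_cong[OF M op _ smooth_fun_const[of M _ 0]])
      fix p assume p: "p \<in> U \<inter> V"
      show "0 = (case d i p of (u, u') => \<lambda>(v, v'). g p u v + h p u' v') (d j p)"
      proof (cases "i < rk E")
        case True
        then show ?thesis using 2 p ij g0(2)[of p i] h0(1)[of p "j - rk E"] by (simp add: d)
      next
        case False
        then show ?thesis using 2 p ij g0(1)[of p j] h0(2)[of p "i - rk E"] by (simp add: d)
      qed
    qed
  next
    case 3
    then have ij': "i - rk E < rk F" "j - rk E < rk F" using ij by auto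
    show ?thesis unfolding W
    proof (rule smooth_fun_cong[OF M op])
      show "smooth_fun M (U \<inter> V) (\<lambda>p. h p (c (i - rk E) p) (c (j - rk E) p))"
        by (rule smooth_fun_subset[OF bundle_metricD(2)[OF h fr(2) ij']]) blast
    qed (use 3 g0(3) in \<open>simp add: d\<close>)
  qed
qed

lemma bundle_metric_prod:
  assumes M: "atlas M" and N: "atlas N" and E: "framed M E" and F: "framed N F"
    and g: "bundle_metric M E g" and h: "bundle_metric N F h"
  shows "bundle_metric (prod_manifold M N) (E \<times>\<^sub>b F) (\<lambda>(p, q) (u, u') (v, v'). g p u v + h q u' v')"
proof (rule bundle_metricI)
  fix x assume "x \<in> points (prod_manifold M N)"
  then obtain p q where x: "x = (p, q)" "p \<in> points M" "q \<in> points N" by auto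
  show "inner_on (fib (E \<times>\<^sub>b F) x) ((\<lambda>(p, q) (u, u') (v, v'). g p u v + h q u' v') x)"
    using inner_on_Times[OF bundle_metricD(1)[OF g x(2)] framed_subspace[OF E x(2)]
        bundle_metricD(1)[OF h x(3)] framed_subspace[OF F x(3)]] by (simp add: x(1))
next
  fix W d i j assume "(W, d) \<in> frames (E \<times>\<^sub>b F)" and ij: "i < rk (E \<times>\<^sub>b F)" "j < rk (E \<times>\<^sub>b F)"
  then obtain U b V c where W: "W = U \<times> V" and d: "d = (prod_frame E b c)"
    and fr: "(U, b) \<in> frames E" "(V, c) \<in> frames F"
    by (auto simp: prod_bundle_def)
  have oU: "openin (mtop M) U" and oV: "openin (mtop N) V" using framedD(1)[OF E fr(1)] framedD(1)[OF F fr(2)] by auto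
  have op: "openin (mtop (prod_manifold M N)) (U \<times> V)" using oU oV by (simp add: openin_prod_Times_iff)
  note g0 = bundle_metric_zero_frame[OF g E fr(1)] and h0 = bundle_metric_zero_frame[OF h F fr(2)]
  note P = atlas_prod[OF M N]
  let ?G = "\<lambda>x. ((\<lambda>(p, q) (u, u') (v, v'). g p u v + h q u' v') x) (d i x) (d j x)"
  consider (1) "i < rk E" "j < rk E" | (2) "(i < rk E) \<noteq> (j < rk E)" | (3) "\<not> i < rk E" "\<not> j < rk E" by blast
  then show "smooth_fun (prod_manifold M N) W ?G"
  proof cases
    case 1
    show ?thesis unfolding W
      by (rule smooth_fun_cong[OF P op _ smooth_fun_fst[OF M N oU oV bundle_metricD(2)[OF g fr(1) 1]]])
        (use 1 h0(3) in \<open>auto simp: d\<close>)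
  next
    case 2
    show ?thesis unfolding W
    proof (rule smooth_fun_cong[OF P op _ smooth_fun_const[of _ _ 0]])
      fix x assume "x \<in> U \<times> V"
      then obtain p q where x: "x = (p, q)" "p \<in> U" "q \<in> V" by auto
      show "0 = ?G x"
      proof (cases "i < rk E")
        case True
        then show ?thesis using 2 x ij g0(2)[of p i] h0(1)[of q "j - rk E"] by (simp add: d)
      next
        case False
        then show ?thesis using 2 x ij g0(1)[of p j] h0(2)[of q "i - rk E"] by (simp add: d)
      qed
    qed
  next
    case 3
    then have ij': "i - rk E < rk F" "j - rk E < rk F" using ij by auto
    show ?thesis unfolding W
      by (rule smooth_fun_cong[OF P op _ smooth_fun_snd[OF M N oU oV bundle_metricD(2)[OF h fr(2) ij']]])
        (use 3 g0(3) in \<open>auto simp: d\<close>)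
  qed
qed

text \<open>Bundle isomorphisms over the identity that carry given frames to given frames.
  Coordinates are then literally equal on both sides, so metrics and properties of curves pull back
  without any computation.\<close>

definition frame_preserving ::
    "('m, 'v::real_vector) vbundle => ('m, 'w::real_vector) vbundle => ('m => 'v => 'w) => bool" where
  "frame_preserving E F T \<longleftrightarrow> rk F = rk E \<and> (\<forall>p. linear (T p)) \<and>
     (\<forall>(U, b) \<in> frames E. \<exists>c. (U, c) \<in> frames F \<and> (\<forall>p\<in>U. \<forall>i<rk E. T p (b i p) = c i p))"

lemma frame_preserving_coords:
  assumes E: "framed M E" and F: "framed M F" and T: "frame_preserving E F T" and fr: "(U, b) \<in> frames E"
  obtains c where "(U, c) \<in> frames F" "\<And>p i. p \<in> U ==> i < rk E ==> T p (b i p) = c i p"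
    "\<And>p u. p \<in> U ==> u \<in> fib E p ==> T p u \<in> fib F p \<and> frame_coords F c p (T p u) = frame_coords E b p u"
proof -
  note T' = T[unfolded frame_preserving_def]
  have rk: "rk F = rk E" and lin: "linear (T p)" for p using T' by blast+
  obtain c where c: "(U, c) \<in> frames F" "\<forall>p\<in>U. \<forall>i<rk E. T p (b i p) = c i p"
    using bspec[OF conjunct2[OF conjunct2[OF T']] fr] by auto
  have "T p u \<in> fib F p \<and> frame_coords F c p (T p u) = frame_coords E b p u" if p: "p \<in> U" and u: "u \<in> fib E p" for p u
  proof -
    note B = framedD(2)[OF E fr p] and C = framedD(2)[OF F c(1) p, unfolded rk]
    let ?a = "frame_coords E b p u"
    have "T p u = T p (\<Sum>i<rk E. ?a i *\<^sub>R b i p)" using coords_sum[OF B u] by simp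
    also have "\<dots> = (\<Sum>i<rk E. ?a i *\<^sub>R c i p)" using c(2) p by (simp add: linear_sum[OF lin] linear_scale[OF lin])
    finally have "T p u = (\<Sum>i<rk E. ?a i *\<^sub>R c i p)" .
    then show ?thesis
      using basis_of_comb[OF C] coords_unique[OF C] coords_ge[of _ "rk E"] by (auto simp: rk fun_eq_iff)
  qed
  then show ?thesis using that c by blast
qed

lemma bundle_metric_pullback:
  assumes M: "atlas M" and E: "framed M E" and F: "framed M F" and T: "frame_preserving E F T" and g: "bundle_metric M F g"
  shows "bundle_metric M E (\<lambda>p u v. g p (T p u) (T p v))"
proof (rule bundle_metricI)
  have lin: "linear (T p)" and rk: "rk F = rk E" for p using T unfolding frame_preserving_def by blast+
  fix p assume p: "p \<in> points M"
  obtain U b where fr: "(U, b) \<in> frames E" "p \<in> U" using framed_cover[OF E p] by blast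
  note B = framedD(2)[OF E fr]
  obtain c where c: "(U, c) \<in> frames F"
    "\<And>p u. p \<in> U ==> u \<in> fib E p ==> T p u \<in> fib F p \<and> frame_coords F c p (T p u) = frame_coords E b p u"
    by (rule frame_preserving_coords[OF E F T fr(1)]) (rule that)
  show "inner_on (fib E p) (\<lambda>u v. g p (T p u) (T p v))"
  proof (rule inner_on_pullback[OF bundle_metricD(1)[OF g p]])
    fix u assume u: "u \<in> fib E p"
    show "T p u \<in> fib F p" using c(2)[OF fr(2) u] by blast
    assume "T p u = 0"
    then have "frame_coords E b p u i = 0" for i
      using c(2)[OF fr(2) u] coords_zero[OF framedD(2)[OF F c(1) fr(2)]] by metis
    then show "u = 0" using coords_sum[OF B u] by simp
  qed (simp add: linear_add[OF lin] linear_scale[OF lin])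
next
  have rk: "rk F = rk E" using T unfolding frame_preserving_def by blast
  fix U b i j assume fr: "(U, b) \<in> frames E" and ij: "i < rk E" "j < rk E"
  obtain c where c: "(U, c) \<in> frames F" "\<And>p i. p \<in> U ==> i < rk E ==> T p (b i p) = c i p"
    by (rule frame_preserving_coords[OF E F T fr]) (rule that)
  show "smooth_fun M U (\<lambda>p. g p (T p (b i p)) (T p (b j p)))"
    by (rule smooth_fun_cong[OF M framedD(1)[OF E fr] _ bundle_metricD(2)[OF g c(1) ij[folded rk]]]) (simp add: c(2) ij)
qed

lemma coords_in_pullback:
  assumes Q: "local_class I Q" and E: "framed M E" and F: "framed M F" and T: "frame_preserving E F T"
    and mem: "\<And>t. t \<in> I ==> v t \<in> fib E (x t)" and c: "coords_in Q I F x (\<lambda>t. T (x t) (v t))"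
  shows "coords_in Q I E x v"
proof (rule coords_inI)
  have rk: "rk F = rk E" using T unfolding frame_preserving_def by blast
  fix U b i assume fr: "(U, b) \<in> frames E" and i: "i < rk E"
  obtain d where d: "(U, d) \<in> frames F"
    "\<And>p u. p \<in> U ==> u \<in> fib E p ==> T p u \<in> fib F p \<and> frame_coords F d p (T p u) = frame_coords E b p u"
    by (rule frame_preserving_coords[OF E F T fr]) (rule that)
  show "Q {t \<in> I. x t \<in> U} (\<lambda>t. frame_coords E b (x t) (v t) i)"
  proof (rule local_class.cong[OF Q])
    show "Q {t \<in> I. x t \<in> U} (\<lambda>t. frame_coords F d (x t) (T (x t) (v t)) i)"
      by (rule coords_inD(2)[OF c d(1)]) (simp add: rk i)
    fix t assume "t \<in> {t \<in> I. x t \<in> U}"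
    then have "t \<in> I" "x t \<in> U" by auto
    then show "frame_coords F d (x t) (T (x t) (v t)) i = frame_coords E b (x t) (v t) i"
      by (intro fun_cong[OF conjunct2[OF d(2)]] mem)
  qed
qed (rule mem)

text \<open>Splitting the tangent bundle of a product sends the coordinate frame of a product chart
  to the concatenation of the two coordinate frames.\<close>

lemma frame_preserving_split:
  assumes M: "atlas M" and N: "atlas N"
  shows "frame_preserving (tangent_bundle (prod_manifold M N)) (tangent_bundle M \<times>\<^sub>b tangent_bundle N) (split_tangent M N)"
  unfolding frame_preserving_def
proof (intro conjI allI ballI)
  show "linear (split_tangent M N p)" for p
    by (cases p, rule linearI) (auto simp: split_tangent_def push_def fun_eq_iff scaleR_fun_def)
  fix X assume "X \<in> frames (tangent_bundle (prod_manifold M N))"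
  then obtain \<kappa> where k: "\<kappa> \<in> charts (prod_manifold M N)" "X = (fst \<kappa>, coord_deriv (prod_manifold M N) \<kappa>)" by auto
  obtain U \<phi> V \<psi> where ch: "(U, \<phi>) \<in> charts M" "(V, \<psi>) \<in> charts N" and eq: "\<kappa> = prod_chart M U \<phi> V \<psi>"
    using prod_manifold_chart[OF k(1)] unfolding prod_chart_join[OF M N] by metis
  let ?c = "\<lambda>i (p, q). if i < rk (tangent_bundle M) then (coord_deriv M (U, \<phi>) i p, 0)
      else (0, coord_deriv N (V, \<psi>) (i - rk (tangent_bundle M)) q)"
  have "(U, coord_deriv M (U, \<phi>)) \<in> frames (tangent_bundle M)" "(V, coord_deriv N (V, \<psi>)) \<in> frames (tangent_bundle N)"
    using ch by force+
  then have "(U \<times> V, ?c) \<in> frames (tangent_bundle M \<times>\<^sub>b tangent_bundle N)" by (rule prod_frameI)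
  moreover have "split_tangent M N (p, q) (coord_deriv (prod_manifold M N) \<kappa> i (p, q)) = ?c i (p, q)"
    if "p \<in> U" "q \<in> V" "i < mdim M + mdim N" for p q i
    using that push_proj[OF M N ch that(1,2), of i] push_proj[OF M N ch that(1,2), of "i - mdim M"]
    unfolding eq by (cases "i < mdim M") (simp_all add: split_tangent_def)
  ultimately show "case X of (U, b) => \<exists>c. (U, c) \<in> frames (tangent_bundle M \<times>\<^sub>b tangent_bundle N) \<and>
      (\<forall>p\<in>U. \<forall>i<rk (tangent_bundle (prod_manifold M N)). split_tangent M N p (b i p) = c i p)"
    unfolding k(2) eq by auto
qed simp

lemma bundle_metric_tangent_prod:
  assumes M: "atlas M" and N: "atlas N"
    and g: "bundle_metric M (tangent_bundle M) g" and h: "bundle_metric N (tangent_bundle N) h"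
  shows "\<exists>k. bundle_metric (prod_manifold M N) (tangent_bundle (prod_manifold M N)) k"
proof -
  note T = framed_tangent[OF M] framed_tangent[OF N] and P = atlas_prod[OF M N]
  show ?thesis
    by (rule exI, rule bundle_metric_pullback[OF P framed_tangent[OF P] framed_prod[OF T] frame_preserving_split[OF M N]
      bundle_metric_prod[OF M N T g h]])
qed

section \<open>The interconnected Dirac structure\<close>

abbreviation system_pair where
  "system_pair M Er Ei Ee \<equiv> flow_pair M (with_dual Er) (with_dual Ei \<oplus>\<^sub>d with_dual Ee)"

abbreviation system_signals where
  "system_signals Er Ei Ee \<equiv> signal_bundle (with_dual Er) (with_dual Ei \<oplus>\<^sub>d with_dual Ee)"

abbreviation composite_pair where
  "composite_pair M1 Er1 Ei1 M2 Er2 Ei2 \<equiv>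
     flow_pair (prod_manifold M1 M2) (with_dual Er1 \<times>\<^sub>d with_dual Er2) (with_dual Ei1 \<times>\<^sub>d with_dual Ei2)"

abbreviation composite_signals where
  "composite_signals Er1 Ei1 Er2 Ei2 \<equiv>
     signal_bundle (with_dual Er1 \<times>\<^sub>d with_dual Er2) (with_dual Ei1 \<times>\<^sub>d with_dual Ei2)"

lemma dsum_pair_sel [simp]:
  "primal (P \<oplus>\<^sub>d Q) = primal P \<oplus>\<^sub>b primal Q" "codual (P \<oplus>\<^sub>d Q) = codual P \<oplus>\<^sub>b codual Q"
  "pairing (P \<oplus>\<^sub>d Q) (e, e') (f, f') = pairing P e f + pairing Q e' f'"
  by (simp_all add: dsum_pair_def)

lemma prod_pair_sel [simp]:
  "primal (P \<times>\<^sub>d Q) = primal P \<times>\<^sub>b primal Q" "codual (P \<times>\<^sub>d Q) = codual P \<times>\<^sub>b codual Q"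
  "pairing (P \<times>\<^sub>d Q) (e, e') (f, f') = pairing P e f + pairing Q e' f'"
  by (simp_all add: prod_pair_def)

lemma with_dual_sel [simp]:
  "primal (with_dual E) = E" "codual (with_dual E) = dual_bundle E" "pairing (with_dual E) e f = e f"
  by (simp_all add: with_dual_def)

lemma sym_form_apply: "sym_form P (f, e) (f', e') = pairing P e' f + pairing P e f'"
  by (simp add: sym_form_def)

lemma alt_form_apply: "alt_form P (f, e) (f', e') = pairing P e' f - pairing P e f'"
  by (simp add: alt_form_def)

lemma dfun_in_dual:
  assumes M: "atlas M" and p: "p \<in> points M"
  shows "dfun M H p \<in> dual_space (tangent_at M p)"
  unfolding dual_space_def
proof (intro CollectI conjI ballI allI impI)
  fix v w a b assume "v \<in> tangent_at M p" "w \<in> tangent_at M p"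
  moreover from this have "a *\<^sub>R v + b *\<^sub>R w \<in> tangent_at M p"
    using framed_subspace[OF framed_tangent[OF M] p] by (intro subspace_add subspace_scale)
  ultimately show "dfun M H p (a *\<^sub>R v + b *\<^sub>R w) = a * dfun M H p v + b * dfun M H p w"
    unfolding dfun_def by (simp only: if_True plus_fun_apply) (simp add: scaleR_fun_def)
qed (simp add: dfun_def)

text \<open>A smooth section is locally a combination of a frame of \<open>E\<close>, so it takes
  values in the fibres of \<open>E\<close>, and so does the span of such sections.\<close>

lemma subbundle_mem:
  assumes E: "framed M E" and D: "smooth_subbundle M E k D" and p: "p \<in> points M"
  shows "D p \<subseteq> fib E p" "subspace (D p)"
proof -
  obtain U s where U: "openin (mtop M) U" "p \<in> U" "\<forall>i<k. smooth_section M E U (s i)"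
    "\<forall>q\<in>U. basis_of k (\<lambda>i. s i q) (D q)"
    using D p unfolding smooth_subbundle_def by blast
  have B: "basis_of k (\<lambda>i. s i p) (D p)" using U(2,4) by blast
  show "subspace (D p)" by (rule basis_of_subspace[OF B])
  obtain V b where V: "(V, b) \<in> frames E" "p \<in> V" using framed_cover[OF E p] by blast
  have "s i p \<in> fib E p" if "i < k" for i
  proof -
    have "smooth_section M E U (s i)" using U(3) that by blast
    then obtain c where "\<forall>q\<in>U \<inter> V. s i q = (\<Sum>i<rk E. c i q *\<^sub>R b i q)"
      using V(1) unfolding smooth_section_def by blast
    then have "s i p = (\<Sum>i<rk E. c i p *\<^sub>R b i p)" using U(2) V(2) by blast
    then show ?thesis using basis_of_comb[OF framedD(2)[OF E V]] by simp
  qed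
  then show "D p \<subseteq> fib E p"
    using B unfolding basis_of_iff
    by (auto intro!: subspace_sum[OF framed_subspace[OF E p]] subspace_scale[OF framed_subspace[OF E p]])
qed

context
  fixes M1 :: "'m manifold" and M2 :: "'n manifold"
  assumes M1: "atlas M1" and M2: "atlas M2"
begin

text \<open>A tangent vector of the product is the sum of the included projections, and
  \<open>split_cotangent\<close> is precomposition with the inclusions. The pairing of the product
  is therefore the sum of the pairings of the factors.\<close>

lemma covector_split:
  assumes p: "p \<in> points M1" and q: "q \<in> points M2"
    and v: "v \<in> tangent_at (prod_manifold M1 M2) (p, q)"
    and a: "\<alpha> \<in> dual_space (tangent_at (prod_manifold M1 M2) (p, q))"
  shows "\<alpha> v = fst (split_cotangent M1 M2 (p, q) \<alpha>) (push M1 p fst v) + snd (split_cotangent M1 M2 (p, q) \<alpha>) (push M2 q snd v)"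
proof -
  note pt = push_tangent[OF M1 M2 p q]
  note m = pt(3)[OF v] pt(4)[OF v]
  have lin: "\<alpha> (1 *\<^sub>R u + 1 *\<^sub>R w) = 1 * \<alpha> u + 1 * \<alpha> w"
    if "u \<in> tangent_at (prod_manifold M1 M2) (p, q)" "w \<in> tangent_at (prod_manifold M1 M2) (p, q)" for u w
    using a that unfolding dual_space_def by blast
  have "\<alpha> v = \<alpha> (push (prod_manifold M1 M2) (p, q) (\<lambda>p'. (p', q)) (push M1 p fst v) +
      push (prod_manifold M1 M2) (p, q) (\<lambda>q'. (p, q')) (push M2 q snd v))"
    unfolding pt(5)[OF v] ..
  also have "\<dots> = \<alpha> (push (prod_manifold M1 M2) (p, q) (\<lambda>p'. (p', q)) (push M1 p fst v)) +
      \<alpha> (push (prod_manifold M1 M2) (p, q) (\<lambda>q'. (p, q')) (push M2 q snd v))"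
    using lin[OF pt(1)[OF m(1)] pt(2)[OF m(2)]] by simp
  also have "\<dots> = fst (split_cotangent M1 M2 (p, q) \<alpha>) (push M1 p fst v) + snd (split_cotangent M1 M2 (p, q) \<alpha>) (push M2 q snd v)"
    using m by (simp add: split_cotangent_def)
  finally show ?thesis .
qed

text \<open>Adding the isotropy relations of \<open>D1\<close> and \<open>D2\<close> gives the form
  of the composite plus the terms at the eliminated port; these terms are the form of
  \<open>Dint\<close> and vanish.\<close>

lemma interconnection_isotropic:
  assumes p: "p \<in> points M1" and q: "q \<in> points M2"
    and D1: "\<And>\<xi> \<xi>'. \<xi> \<in> D1 p ==> \<xi>' \<in> D1 p ==> sym_form (system_pair M1 Er1 Ei1 Ee1) \<xi> \<xi>' = 0"
    and D2: "\<And>\<xi> \<xi>'. \<xi> \<in> D2 q ==> \<xi>' \<in> D2 q ==> sym_form (system_pair M2 Er2 Ei2 Ee2) \<xi> \<xi>' = 0"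
    and Dint: "\<And>\<xi> \<xi>'. \<xi> \<in> Dint (p, q) ==> \<xi>' \<in> Dint (p, q) ==> sym_form (with_dual Ee1 \<times>\<^sub>d with_dual Ee2) \<xi> \<xi>' = 0"
    and x: "\<xi> \<in> dirac_interconnection M1 M2 Dint D1 D2 (p, q)" "\<xi>' \<in> dirac_interconnection M1 M2 Dint D1 D2 (p, q)"
  shows "sym_form (composite_pair M1 Er1 Ei1 M2 Er2 Ei2) \<xi> \<xi>' = 0"
proof -
  let ?T = "tangent_at (prod_manifold M1 M2) (p, q)"
  have ex: "\<exists>v f1 f2 \<eta>1 \<eta>2 \<alpha> e1 e2 u1 u2 \<zeta>1 \<zeta>2 w1 w2.
      \<xi> = ((v, (f1, f2), (\<eta>1, \<eta>2)), (\<alpha>, (e1, e2), (u1, u2))) \<and> v \<in> ?T \<and> \<alpha> \<in> dual_space ?T \<and>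
      ((\<zeta>1, \<zeta>2), (w1, w2)) \<in> Dint (p, q) \<and>
      ((push M1 p fst v, f1, \<eta>1, \<zeta>1), (fst (split_cotangent M1 M2 (p, q) \<alpha>), e1, u1, w1)) \<in> D1 p \<and>
      ((push M2 q snd v, f2, \<eta>2, \<zeta>2), (snd (split_cotangent M1 M2 (p, q) \<alpha>), e2, u2, w2)) \<in> D2 q"
    if "\<xi> \<in> dirac_interconnection M1 M2 Dint D1 D2 (p, q)" for \<xi>
  proof -
    from that obtain v f1 f2 \<eta>1 \<eta>2 \<alpha> e1 e2 u1 u2 v1 v2 \<alpha>1 \<alpha>2 \<zeta>1 \<zeta>2 w1 w2 where *:
      "\<xi> = ((v, (f1, f2), (\<eta>1, \<eta>2)), (\<alpha>, (e1, e2), (u1, u2)))"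
      "v \<in> ?T" "\<alpha> \<in> dual_space ?T"
      "(v1, v2) = split_tangent M1 M2 (p, q) v" "(\<alpha>1, \<alpha>2) = split_cotangent M1 M2 (p, q) \<alpha>"
      "((\<zeta>1, \<zeta>2), (w1, w2)) \<in> Dint (p, q)"
      "((v1, f1, \<eta>1, \<zeta>1), (\<alpha>1, e1, u1, w1)) \<in> D1 p"
      "((v2, f2, \<eta>2, \<zeta>2), (\<alpha>2, e2, u2, w2)) \<in> D2 q"
      unfolding dirac_interconnection_def by auto
    have "v1 = push M1 p fst v" "v2 = push M2 q snd v" using *(4) by (simp_all add: split_tangent_def)
    moreover have "\<alpha>1 = fst (split_cotangent M1 M2 (p, q) \<alpha>)" "\<alpha>2 = snd (split_cotangent M1 M2 (p, q) \<alpha>)"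
      unfolding *(5)[symmetric] by simp_all
    ultimately show ?thesis using * by blast
  qed
  from ex[OF x(1)] obtain v f1 f2 \<eta>1 \<eta>2 \<alpha> e1 e2 u1 u2 \<zeta>1 \<zeta>2 w1 w2 where a:
      "\<xi> = ((v, (f1, f2), (\<eta>1, \<eta>2)), (\<alpha>, (e1, e2), (u1, u2)))" "v \<in> ?T" "\<alpha> \<in> dual_space ?T"
      "((\<zeta>1, \<zeta>2), (w1, w2)) \<in> Dint (p, q)"
      "((push M1 p fst v, f1, \<eta>1, \<zeta>1), (fst (split_cotangent M1 M2 (p, q) \<alpha>), e1, u1, w1)) \<in> D1 p"
      "((push M2 q snd v, f2, \<eta>2, \<zeta>2), (snd (split_cotangent M1 M2 (p, q) \<alpha>), e2, u2, w2)) \<in> D2 q"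
    by blast
  from ex[OF x(2)] obtain v' f1' f2' \<eta>1' \<eta>2' \<alpha>' e1' e2' u1' u2' \<zeta>1' \<zeta>2' w1' w2' where b:
      "\<xi>' = ((v', (f1', f2'), (\<eta>1', \<eta>2')), (\<alpha>', (e1', e2'), (u1', u2')))" "v' \<in> ?T" "\<alpha>' \<in> dual_space ?T"
      "((\<zeta>1', \<zeta>2'), (w1', w2')) \<in> Dint (p, q)"
      "((push M1 p fst v', f1', \<eta>1', \<zeta>1'), (fst (split_cotangent M1 M2 (p, q) \<alpha>'), e1', u1', w1')) \<in> D1 p"
      "((push M2 q snd v', f2', \<eta>2', \<zeta>2'), (snd (split_cotangent M1 M2 (p, q) \<alpha>'), e2', u2', w2')) \<in> D2 q"
    by blast
  show ?thesis
    using D1[OF a(5) b(5)] D2[OF a(6) b(6)] Dint[OF a(4) b(4)]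
    unfolding a(1) b(1)
    by (simp add: sym_form_apply covector_split[OF p q a(2) b(3)] covector_split[OF p q b(2) a(3)])
qed

end

section \<open>The differential of a sum of Hamiltonians\<close>

lemma smooth_near_add_const:
  assumes M: "atlas M" and "smooth_near M p h"
  shows "smooth_near M p (\<lambda>x. h x + c)"
proof -
  obtain U where U: "openin (mtop M) U" "p \<in> U" "smooth_fun M U h" using assms unfolding smooth_near_def by blast
  show ?thesis unfolding smooth_near_def
    using smooth_fun_add[OF M U(1,3) smooth_fun_const] U(1,2) by blast
qed

text \<open>A slice of the total Hamiltonian is one Hamiltonian plus a constant, namely the value of
  the other at the fixed point.\<close>

lemma tangent_add_const:
  assumes M: "atlas M" and v: "v \<in> tangent_at M p" and p: "p \<in> points M" and h: "smooth_near M p h"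
  shows "v (\<lambda>x. h x + c) = v h"
proof -
  obtain U \<phi> where ch: "(U, \<phi>) \<in> charts M" "p \<in> U" using atlas_cover[OF M p] by blast
  obtain a where a: "v = (\<Sum>i<mdim M. a i *\<^sub>R coord_deriv M (U, \<phi>) i p)"
    using coords_sum[OF coord_basis[OF M ch] v, symmetric] by blast
  have "coord_deriv M (U, \<phi>) i p (\<lambda>x. h x + c) = coord_deriv M (U, \<phi>) i p h" if i: "i < mdim M" for i
  proof -
    note d = smooth_near_coord_line[OF M ch i h]
    have "((\<lambda>s. h (inv_into U \<phi> ((\<phi> p)(i := s))) + c) has_real_derivative coord_deriv M (U, \<phi>) i p h + 0) (at (\<phi> p i))"
      by (rule DERIV_add[OF d DERIV_const])
    moreover have "((\<lambda>s. h (inv_into U \<phi> ((\<phi> p)(i := s))) + c) has_real_derivative coord_deriv M (U, \<phi>) i p (\<lambda>x. h x + c)) (at (\<phi> p i))"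
      using smooth_near_coord_line[OF M ch i smooth_near_add_const[OF M h]] .
    ultimately show ?thesis using DERIV_unique by fastforce
  qed
  then show ?thesis unfolding a by (simp add: sum_fun_apply scaleR_fun_def)
qed

lemma smooth_fun_near: "smooth_fun M (points M) h ==> p \<in> points M ==> smooth_near M p h"
  unfolding smooth_near_def using openin_topspace by blast

lemma split_cotangent_dfun:
  assumes M1: "atlas M1" and M2: "atlas M2"
    and H1: "smooth_fun M1 (points M1) H1" and H2: "smooth_fun M2 (points M2) H2"
    and p: "p \<in> points M1" and q: "q \<in> points M2"
  shows "split_cotangent M1 M2 (p, q) (dfun (prod_manifold M1 M2) (\<lambda>(x1, x2). H1 x1 + H2 x2) (p, q)) =
    (dfun M1 H1 p, dfun M2 H2 q)"
proof -
  let ?P = "prod_manifold M1 M2"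
  let ?H = "\<lambda>(x1, x2). H1 x1 + H2 x2"
  have op: "openin (mtop ?P) (points M1 \<times> points M2)" by (simp add: openin_prod_Times_iff)
  have "smooth_fun ?P (points M1 \<times> points M2) (\<lambda>x. H1 (fst x) + H2 (snd x))"
    by (rule smooth_fun_add[OF atlas_prod[OF M1 M2] op smooth_fun_fst[OF M1 M2 _ _ H1] smooth_fun_snd[OF M1 M2 _ _ H2]]) auto
  then have H: "smooth_near ?P (p, q) ?H"
    unfolding smooth_near_def using op p q by (intro exI[of _ "points M1 \<times> points M2"]) (simp add: case_prod_unfold)
  note pt = push_tangent[OF M1 M2 p q]
  have "dfun ?P ?H (p, q) (push ?P (p, q) (\<lambda>p'. (p', q)) v) = v H1" if v: "v \<in> tangent_at M1 p" for v
    using tangent_add_const[OF M1 v p smooth_fun_near[OF H1 p], of "H2 q"] pt(1)[OF v] H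
    by (simp add: dfun_def push_def o_def)
  moreover have "dfun ?P ?H (p, q) (push ?P (p, q) (\<lambda>q'. (p, q')) w) = w H2" if w: "w \<in> tangent_at M2 q" for w
    using tangent_add_const[OF M2 w q smooth_fun_near[OF H2 q], of "H1 p"] pt(2)[OF w] H
    by (simp add: dfun_def push_def o_def add.commute)
  ultimately show ?thesis by (auto simp: split_cotangent_def dfun_def fun_eq_iff)
qed


section \<open>Classical behaviours\<close>

lemma coords_in_cong:
  assumes "local_class I Q" and xx: "\<And>t. t \<in> I ==> x t = x' t" and vv: "\<And>t. t \<in> I ==> v t = v' t"
    and c: "coords_in Q I E x v"
  shows "coords_in Q I E x' v'"
proof (rule coords_inI)
  interpret local_class I Q by fact
  show "v' t \<in> fib E (x' t)" if "t \<in> I" for t using coords_inD(1)[OF c that] xx[OF that] vv[OF that] by simp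
  fix U b i assume fr: "(U, b) \<in> frames E" "i < rk E"
  have eq: "{t \<in> I. x' t \<in> U} = {t \<in> I. x t \<in> U}" using xx by auto
  show "Q {t \<in> I. x' t \<in> U} (\<lambda>t. frame_coords E b (x' t) (v' t) i)"
    unfolding eq by (rule cong[OF _ coords_inD(2)[OF c fr]]) (use xx vv in auto)
qed

lemma C1_curve_cong:
  assumes "\<And>t. t \<in> {t0..t1} ==> x t = x' t"
  shows "C1_curve M t0 t1 x ==> C1_curve M t0 t1 x'"
  unfolding C1_curve_def
proof (elim exE conjE)
  fix a b \<gamma> assume "a < t0" "t1 < b" "curve_on {a<..<b} M \<gamma>"
    "\<forall>(U, \<phi>) \<in> charts M. \<forall>i<mdim M. (\<lambda>t. \<phi> (\<gamma> t) i) C1_differentiable_on {t \<in> {a<..<b}. \<gamma> t \<in> U}"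
    "\<forall>t\<in>{t0..t1}. \<gamma> t = x t"
  moreover have "\<forall>t\<in>{t0..t1}. \<gamma> t = x' t" using calculation(5) assms by simp
  ultimately show "\<exists>a b \<gamma>. a < t0 \<and> t1 < b \<and> curve_on {a<..<b} M \<gamma> \<and>
        (\<forall>(U, \<phi>) \<in> charts M. \<forall>i<mdim M.
           (\<lambda>t. \<phi> (\<gamma> t) i) C1_differentiable_on {t \<in> {a<..<b}. \<gamma> t \<in> U}) \<and>
        (\<forall>t\<in>{t0..t1}. \<gamma> t = x' t)" by blast
qed

lemma vector_derivative_cong_within:
  assumes "\<And>s. s \<in> S ==> f s = g s" "t \<in> S"
  shows "vector_derivative f (at t within S) = vector_derivative g (at t within S)"
proof -
  have "(f has_vector_derivative D) (at t within S) \<longleftrightarrow> (g has_vector_derivative D) (at t within S)" for D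
    using has_vector_derivative_transform[OF assms(2), of f g D] has_vector_derivative_transform[OF assms(2), of g f D] assms(1)
    by auto
  then show ?thesis unfolding vector_derivative_def by simp
qed

lemma velocity_cong:
  assumes "\<And>t. t \<in> {t0..t1} ==> x t = x' t" "t \<in> {t0..t1}"
  shows "velocity M t0 t1 x t = velocity M t0 t1 x' t"
proof
  fix h
  show "velocity M t0 t1 x t h = velocity M t0 t1 x' t h"
    unfolding velocity_def using assms
    by (auto intro!: vector_derivative_cong_within)
qed

text \<open>The restriction to the interval disappears on the right-hand side: continuity, C1
  regularity and velocity depend only on values in the interval.\<close>

lemma classical_behaviour_iff:
  assumes SB: "framed M (signal_bundle Er Ep)"
  shows "(\<lambda>t\<in>{t0..t1}. (x t, f t, y t, e t, u t)) \<in> classical_behaviour M Er Ep D R H t0 t1 \<longleftrightarrow>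
    curve_on {t0..t1} M x \<and>
    coords_in continuous_on {t0..t1} (signal_bundle Er Ep) x (\<lambda>t. (f t, y t, e t, u t)) \<and>
    C1_curve M t0 t1 x \<and>
    (\<forall>t\<in>{t0..t1}. ((velocity M t0 t1 x t, f t, - y t), (dfun M H (x t), e t, u t)) \<in> D (x t) \<and> (f t, e t) \<in> R (x t))"
proof -
  let ?I = "{t0..t1}"
  let ?\<xi> = "\<lambda>t\<in>?I. (x t, f t, y t, e t, u t)"
  have 1: "continuous_map (top_of_set ?I) (total_top M (signal_bundle Er Ep)) ?\<xi> \<longleftrightarrow>
    curve_on ?I M x \<and>
    coords_in continuous_on ?I (signal_bundle Er Ep) x (\<lambda>t. (f t, y t, e t, u t))"
    unfolding curve_continuous_iff[OF SB, symmetric]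
    by (intro iffI; rule continuous_map_eq; assumption?) auto
  have 2: "C1_curve M t0 t1 (fst \<circ> ?\<xi>) \<longleftrightarrow> C1_curve M t0 t1 x"
    using C1_curve_cong[of t0 t1 x "fst \<circ> ?\<xi>" M] C1_curve_cong[of t0 t1 "fst \<circ> ?\<xi>" x M] by auto
  have 3: "velocity M t0 t1 (fst \<circ> ?\<xi>) t = velocity M t0 t1 x t" if "t \<in> ?I" for t
    by (rule velocity_cong[OF _ that]) simp
  show ?thesis unfolding classical_behaviour_def using 1 2 3 by auto
qed

lemma C1_curve_prod:
  assumes x: "C1_curve M t0 t1 x" and y: "C1_curve N t0 t1 y"
  shows "C1_curve (prod_manifold M N) t0 t1 (\<lambda>t. (x t, y t))"
proof -
  obtain a b \<gamma> where g: "a < t0" "t1 < b" "curve_on {a<..<b} M \<gamma>"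
    "\<forall>(U, \<phi>) \<in> charts M. \<forall>i<mdim M. (\<lambda>t. \<phi> (\<gamma> t) i) C1_differentiable_on {t \<in> {a<..<b}. \<gamma> t \<in> U}"
    "\<forall>t\<in>{t0..t1}. \<gamma> t = x t"
    using x unfolding C1_curve_def by blast
  obtain a' b' \<gamma>' where g': "a' < t0" "t1 < b'" "curve_on {a'<..<b'} N \<gamma>'"
    "\<forall>(U, \<phi>) \<in> charts N. \<forall>i<mdim N. (\<lambda>t. \<phi> (\<gamma>' t) i) C1_differentiable_on {t \<in> {a'<..<b'}. \<gamma>' t \<in> U}"
    "\<forall>t\<in>{t0..t1}. \<gamma>' t = y t"
    using y unfolding C1_curve_def by blast
  \<comment> \<open>The two extensions live on different open intervals; their intersection still
    contains the compact one.\<close>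
  let ?A = "max a a'" and ?B = "min b b'"
  have sub: "{?A<..<?B} \<subseteq> {a<..<b}" "{?A<..<?B} \<subseteq> {a'<..<b'}" by auto
  have c: "curve_on {?A<..<?B} (prod_manifold M N) (\<lambda>t. (\<gamma> t, \<gamma>' t))"
    using continuous_map_from_subtopology_mono[OF g(3) sub(1)] continuous_map_from_subtopology_mono[OF g'(3) sub(2)]
    by (simp add: continuous_map_pairwise o_def)
  have d: "case X of (W, \<kappa>) => \<forall>i<mdim (prod_manifold M N).
      (\<lambda>t. \<kappa> (\<gamma> t, \<gamma>' t) i) C1_differentiable_on {t \<in> {?A<..<?B}. (\<gamma> t, \<gamma>' t) \<in> W}"
    if X: "X \<in> charts (prod_manifold M N)" for X
  proof -
    obtain U \<phi> V \<psi> where ch: "(U, \<phi>) \<in> charts M" "(V, \<psi>) \<in> charts N"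
      and eq: "X = (U \<times> V, \<lambda>(p, q) i. if i < mdim M then \<phi> p i else \<psi> q (i - mdim M))"
      by (rule prod_manifold_chart[OF X])
    have "(\<lambda>t. if i < mdim M then \<phi> (\<gamma> t) i else \<psi> (\<gamma>' t) (i - mdim M)) C1_differentiable_on
        {t \<in> {?A<..<?B}. (\<gamma> t, \<gamma>' t) \<in> U \<times> V}" if i: "i < mdim M + mdim N" for i
    proof (cases "i < mdim M")
      case True
      have "(\<lambda>t. \<phi> (\<gamma> t) i) C1_differentiable_on {t \<in> {a<..<b}. \<gamma> t \<in> U}" using g(4) ch(1) True by blast
      then have "(\<lambda>t. \<phi> (\<gamma> t) i) C1_differentiable_on {t \<in> {?A<..<?B}. (\<gamma> t, \<gamma>' t) \<in> U \<times> V}"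
        by (rule C1_differentiable_on_subset) auto
      then show ?thesis using True by simp
    next
      case False
      then have "i - mdim M < mdim N" using i by simp
      then have "(\<lambda>t. \<psi> (\<gamma>' t) (i - mdim M)) C1_differentiable_on {t \<in> {a'<..<b'}. \<gamma>' t \<in> V}" using g'(4) ch(2) by blast
      then have "(\<lambda>t. \<psi> (\<gamma>' t) (i - mdim M)) C1_differentiable_on {t \<in> {?A<..<?B}. (\<gamma> t, \<gamma>' t) \<in> U \<times> V}"
        by (rule C1_differentiable_on_subset) auto
      then show ?thesis using False by simp
    qed
    then show ?thesis unfolding eq by simp
  qed
  have e: "\<forall>t\<in>{t0..t1}. (\<gamma> t, \<gamma>' t) = (x t, y t)" using g(5) g'(5) by simp
  have "?A < t0" "t1 < ?B" using g g' by auto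
  then show ?thesis unfolding C1_curve_def using c d e
    by (intro exI[of _ ?A] exI[of _ ?B] exI[of _ "\<lambda>t. (\<gamma> t, \<gamma>' t)"] conjI ballI) auto
qed

text \<open>A function that is smooth near a point of one factor stays smooth near the pair, and
  along the pair of curves it has the same derivative.\<close>

lemma velocity_prod:
  assumes M: "atlas M" and N: "atlas N" and p: "x t \<in> points M" and q: "y t \<in> points N"
  shows "push M (x t) fst (velocity (prod_manifold M N) t0 t1 (\<lambda>t. (x t, y t)) t) = velocity M t0 t1 x t"
    and "push N (y t) snd (velocity (prod_manifold M N) t0 t1 (\<lambda>t. (x t, y t)) t) = velocity N t0 t1 y t"
proof -
  show "push M (x t) fst (velocity (prod_manifold M N) t0 t1 (\<lambda>t. (x t, y t)) t) = velocity M t0 t1 x t"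
  proof
    fix h
    show "push M (x t) fst (velocity (prod_manifold M N) t0 t1 (\<lambda>t. (x t, y t)) t) h = velocity M t0 t1 x t h"
      using smooth_near_fst[OF M N _ q, of "x t" h] by (simp add: push_def velocity_def o_def)
  qed
  show "push N (y t) snd (velocity (prod_manifold M N) t0 t1 (\<lambda>t. (x t, y t)) t) = velocity N t0 t1 y t"
  proof
    fix h
    show "push N (y t) snd (velocity (prod_manifold M N) t0 t1 (\<lambda>t. (x t, y t)) t) h = velocity N t0 t1 y t h"
      using smooth_near_snd[OF M N _ p, of "y t" h] by (simp add: push_def velocity_def o_def)
  qed
qed

text \<open>The fibrewise step common to both regimes: the signals at the shared port are the
  witnesses hidden in the composite, and \<open>split_cotangent\<close> takes the total differential
  to the two differentials.\<close>

lemma interconnectionI: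
  assumes M1: "atlas M1" and M2: "atlas M2"
    and H1: "smooth_fun M1 (points M1) H1" and H2: "smooth_fun M2 (points M2) H2"
    and p: "p \<in> points M1" and q: "q \<in> points M2"
    and v: "v \<in> tangent_at (prod_manifold M1 M2) (p, q)"
    and vv: "push M1 p fst v = v1" "push M2 q snd v = v2"
    and Dint: "((\<zeta>1, \<zeta>2), (w1, w2)) \<in> Dint (p, q)"
    and D1: "((v1, f1, \<eta>1, \<zeta>1), (dfun M1 H1 p, e1, u1, w1)) \<in> D1 p"
    and D2: "((v2, f2, \<eta>2, \<zeta>2), (dfun M2 H2 q, e2, u2, w2)) \<in> D2 q"
  shows "((v, (f1, f2), (\<eta>1, \<eta>2)), (dfun (prod_manifold M1 M2) (\<lambda>(x1, x2). H1 x1 + H2 x2) (p, q), (e1, e2), (u1, u2)))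
    \<in> dirac_interconnection M1 M2 Dint D1 D2 (p, q)"
proof -
  have 1: "dfun (prod_manifold M1 M2) (\<lambda>(x1, x2). H1 x1 + H2 x2) (p, q) \<in> dual_space (tangent_at (prod_manifold M1 M2) (p, q))"
    by (rule dfun_in_dual[OF atlas_prod[OF M1 M2]]) (use p q in simp)
  have 2: "(v1, v2) = split_tangent M1 M2 (p, q) v" using vv by (simp add: split_tangent_def)
  note 3 = split_cotangent_dfun[OF M1 M2 H1 H2 p q, symmetric]
  show ?thesis
    unfolding dirac_interconnection_def prod.case with_dual_sel dual_bundle_sel
    by (rule CollectI, intro exI conjI) (rule refl v 1 2 3 Dint D1 D2)+
qed

lemma interconnectedE:
  assumes "\<xi> \<in> behaviour_interconnection Dint B1 B2 t0 t1"
  obtains x1 x2 f1 f2 y1 y2 e1 e2 u1 u2 y1' y2' u1' u2' where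
    "\<xi> = (\<lambda>t\<in>{t0..t1}. ((x1 t, x2 t), (f1 t, f2 t), (y1 t, y2 t), (e1 t, e2 t), (u1 t, u2 t)))"
    "\<And>t. t \<in> {t0..t1} ==> ((y1' t, y2' t), (u1' t, u2' t)) \<in> Dint (x1 t, x2 t)"
    "(\<lambda>t\<in>{t0..t1}. (x1 t, f1 t, (y1 t, - y1' t), e1 t, (u1 t, u1' t))) \<in> B1"
    "(\<lambda>t\<in>{t0..t1}. (x2 t, f2 t, (y2 t, - y2' t), e2 t, (u2 t, u2' t))) \<in> B2"
proof -
  obtain y1' y2' u1' u2' where *: "\<xi> \<in> extensional {t0..t1}"
    "\<forall>t\<in>{t0..t1}. ((y1' t, y2' t), (u1' t, u2' t)) \<in> Dint (fst (\<xi> t))"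
    "(\<lambda>t\<in>{t0..t1}. case \<xi> t of ((x1, x2), (f1, f2), (y1, y2), (e1, e2), (u1, u2)) =>
          (x1, f1, (y1, - y1' t), e1, (u1, u1' t))) \<in> B1"
    "(\<lambda>t\<in>{t0..t1}. case \<xi> t of ((x1, x2), (f1, f2), (y1, y2), (e1, e2), (u1, u2)) =>
          (x2, f2, (y2, - y2' t), e2, (u2, u2' t))) \<in> B2"
    using assms unfolding behaviour_interconnection_def by blast
  show ?thesis
  proof (rule that[of "\<lambda>t. fst (fst (\<xi> t))" "\<lambda>t. snd (fst (\<xi> t))"
        "\<lambda>t. fst (fst (snd (\<xi> t)))" "\<lambda>t. snd (fst (snd (\<xi> t)))"
        "\<lambda>t. fst (fst (snd (snd (\<xi> t))))" "\<lambda>t. snd (fst (snd (snd (\<xi> t))))"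
        "\<lambda>t. fst (fst (snd (snd (snd (\<xi> t)))))" "\<lambda>t. snd (fst (snd (snd (snd (\<xi> t)))))"
        "\<lambda>t. fst (snd (snd (snd (snd (\<xi> t)))))" "\<lambda>t. snd (snd (snd (snd (snd (\<xi> t)))))" y1' y2' u1' u2'])
    show "\<xi> = (\<lambda>t\<in>{t0..t1}. ((fst (fst (\<xi> t)), snd (fst (\<xi> t))), (fst (fst (snd (\<xi> t))), snd (fst (snd (\<xi> t)))),
       (fst (fst (snd (snd (\<xi> t)))), snd (fst (snd (snd (\<xi> t))))),
       (fst (fst (snd (snd (snd (\<xi> t))))), snd (fst (snd (snd (snd (\<xi> t)))))),
       (fst (snd (snd (snd (snd (\<xi> t))))), snd (snd (snd (snd (snd (\<xi> t))))))))"
      using extensional_restrict[OF *(1)] by simp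
  qed (use * in \<open>simp_all add: case_prod_unfold\<close>)
qed

text \<open>For an arbitrary local class, so that it yields continuity in the classical and
  integrability in the weak regime. The summands are taken apart, the signals at the shared port
  dropped, and the rest regrouped.\<close>

lemma signal_coords_prod:
  assumes Q: "local_class {t0..t1} Q"
    and E: "framed M1 Er1" "framed M1 Ei1" "framed M1 Ee1" "framed M2 Er2" "framed M2 Ei2" "framed M2 Ee2"
    and x: "curve_on {t0..t1} M1 x1" "curve_on {t0..t1} M2 x2"
    and c1: "coords_in Q {t0..t1} (system_signals Er1 Ei1 Ee1) x1
        (\<lambda>t. (f1 t, (y1 t, y1' t), e1 t, (u1 t, u1' t)))"
    and c2: "coords_in Q {t0..t1} (system_signals Er2 Ei2 Ee2) x2
        (\<lambda>t. (f2 t, (y2 t, y2' t), e2 t, (u2 t, u2' t)))"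
  shows "coords_in Q {t0..t1} (composite_signals Er1 Ei1 Er2 Ei2)
    (\<lambda>t. (x1 t, x2 t)) (\<lambda>t. ((f1 t, f2 t), (y1 t, y2 t), (e1 t, e2 t), (u1 t, u2 t)))"
proof -
  interpret local_class "{t0..t1}" Q by fact
  note fr = framed_dsum framed_dual E
  have 1: "coords_in Q {t0..t1} Er1 x1 f1 \<and> coords_in Q {t0..t1} Ei1 x1 y1 \<and>
      coords_in Q {t0..t1} (dual_bundle Er1) x1 e1 \<and> coords_in Q {t0..t1} (dual_bundle Ei1) x1 u1"
    using c1 by (simp add: coords_in_dsum[OF _ _ x(1)] fr)
  have 2: "coords_in Q {t0..t1} Er2 x2 f2 \<and> coords_in Q {t0..t1} Ei2 x2 y2 \<and>
      coords_in Q {t0..t1} (dual_bundle Er2) x2 e2 \<and> coords_in Q {t0..t1} (dual_bundle Ei2) x2 u2"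
    using c2 by (simp add: coords_in_dsum[OF _ _ x(2)] fr)
  have xp: "curve_on {t0..t1} (prod_manifold M1 M2) (\<lambda>t. (x1 t, x2 t))"
    using x by (simp add: continuous_map_pairwise o_def)
  note pr = coords_in_prod[OF _ _ x]
  note pfr = framed_prod[where M=M1 and N=M2]
  show ?thesis
    unfolding dsum_pair_sel prod_pair_sel with_dual_sel
    using 1 2 by (simp add: coords_in_dsum[OF _ _ xp] pfr framed_dsum framed_dual E pr)
qed

lemma classical_inclusion:
  assumes S1: "ph_system M1 Er1 Ei1 Ee1 D1 R1 H1" and S2: "ph_system M2 Er2 Ei2 Ee2 D2 R2 H2" and t01: "t0 < t1"
  shows "interconnected_behaviours Classical M1 Er1 Ei1 Ee1 D1 R1 H1 M2 Er2 Ei2 Ee2 D2 R2 H2 Dint t0 t1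
        \<subseteq> behaviour_of_interconnection Classical M1 Er1 Ei1 D1 R1 H1 M2 Er2 Ei2 D2 R2 H2 Dint t0 t1"
proof
  fix \<xi> assume "\<xi> \<in> interconnected_behaviours Classical M1 Er1 Ei1 Ee1 D1 R1 H1 M2 Er2 Ei2 Ee2 D2 R2 H2 Dint t0 t1"
  then have x: "\<xi> \<in> behaviour_interconnection Dint
       (classical_behaviour M1 (with_dual Er1) (with_dual Ei1 \<oplus>\<^sub>d with_dual Ee1) D1 R1 H1 t0 t1)
       (classical_behaviour M2 (with_dual Er2) (with_dual Ei2 \<oplus>\<^sub>d with_dual Ee2) D2 R2 H2 t0 t1) t0 t1"
    by (simp add: interconnected_behaviours_def behaviour_def)
  have M1: "atlas M1" and M2: "atlas M2" using S1 S2 smooth_manifold_atlas unfolding ph_system_def by blast+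
  have E: "framed M1 Er1" "framed M1 Ei1" "framed M1 Ee1" "framed M2 Er2" "framed M2 Ei2" "framed M2 Ee2"
    using S1 S2 vector_bundle_framed[OF M1] vector_bundle_framed[OF M2] unfolding ph_system_def by blast+
  have H: "smooth_fun M1 (points M1) H1" "smooth_fun M2 (points M2) H2" using S1 S2 unfolding ph_system_def by blast+
  have SB1: "framed M1 (system_signals Er1 Ei1 Ee1)"
    and SB2: "framed M2 (system_signals Er2 Ei2 Ee2)"
    and SB: "framed (prod_manifold M1 M2) (composite_signals Er1 Ei1 Er2 Ei2)"
    by (simp_all add: framed_dsum framed_dual framed_prod E)
  obtain x1 x2 f1 f2 y1 y2 e1 e2 u1 u2 y1' y2' u1' u2' where
    xi: "\<xi> = (\<lambda>t\<in>{t0..t1}. ((x1 t, x2 t), (f1 t, f2 t), (y1 t, y2 t), (e1 t, e2 t), (u1 t, u2 t)))"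
    and Dt: "\<And>t. t \<in> {t0..t1} ==> ((y1' t, y2' t), (u1' t, u2' t)) \<in> Dint (x1 t, x2 t)"
    and B1: "(\<lambda>t\<in>{t0..t1}. (x1 t, f1 t, (y1 t, - y1' t), e1 t, (u1 t, u1' t))) \<in>
      classical_behaviour M1 (with_dual Er1) (with_dual Ei1 \<oplus>\<^sub>d with_dual Ee1) D1 R1 H1 t0 t1"
    and B2: "(\<lambda>t\<in>{t0..t1}. (x2 t, f2 t, (y2 t, - y2' t), e2 t, (u2 t, u2' t))) \<in>
      classical_behaviour M2 (with_dual Er2) (with_dual Ei2 \<oplus>\<^sub>d with_dual Ee2) D2 R2 H2 t0 t1"
    by (rule interconnectedE[OF x]) (rule that)
  note b1 = B1[unfolded classical_behaviour_iff[OF SB1]] and b2 = B2[unfolded classical_behaviour_iff[OF SB2]]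
  have c1: "curve_on {t0..t1} M1 x1" and c2: "curve_on {t0..t1} M2 x2"
    using b1 b2 by auto
  have C: "C1_curve (prod_manifold M1 M2) t0 t1 (\<lambda>t. (x1 t, x2 t))"
    using b1 b2 by (intro C1_curve_prod) auto
  have "\<xi> \<in> classical_behaviour (prod_manifold M1 M2)
       (with_dual Er1 \<times>\<^sub>d with_dual Er2) (with_dual Ei1 \<times>\<^sub>d with_dual Ei2)
       (dirac_interconnection M1 M2 Dint D1 D2) (box_sum R1 R2) (\<lambda>(x1, x2). H1 x1 + H2 x2) t0 t1"
    unfolding xi classical_behaviour_iff[OF SB]
  proof (intro conjI ballI)
    show "curve_on {t0..t1} (prod_manifold M1 M2) (\<lambda>t. (x1 t, x2 t))"
      using c1 c2 by (simp add: continuous_map_pairwise o_def)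
    show "coords_in continuous_on {t0..t1} (composite_signals Er1 Ei1 Er2 Ei2)
        (\<lambda>t. (x1 t, x2 t)) (\<lambda>t. ((f1 t, f2 t), (y1 t, y2 t), (e1 t, e2 t), (u1 t, u2 t)))"
      by (rule signal_coords_prod[OF continuous_class.local_class_axioms E c1 c2
          conjunct1[OF conjunct2[OF b1]] conjunct1[OF conjunct2[OF b2]]])
    show "C1_curve (prod_manifold M1 M2) t0 t1 (\<lambda>t. (x1 t, x2 t))" by (rule C)
    fix t assume t: "t \<in> {t0..t1}"
    have p: "x1 t \<in> points M1" and q: "x2 t \<in> points M2" using curve_in_points[OF c1 t] curve_in_points[OF c2 t] .
    have pq: "(x1 t, x2 t) \<in> points (prod_manifold M1 M2)" using p q by simp
    \<comment> \<open>The composite structure demands a genuine tangent vector; its components alone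
      would not exclude a functional that is none.\<close>
    have V: "velocity (prod_manifold M1 M2) t0 t1 (\<lambda>t. (x1 t, x2 t)) t \<in> tangent_at (prod_manifold M1 M2) (x1 t, x2 t)"
    proof -
      obtain U \<phi> where ch: "(U, \<phi>) \<in> charts (prod_manifold M1 M2)" "(x1 t, x2 t) \<in> U"
        using atlas_cover[OF atlas_prod[OF M1 M2] pq] by blast
      show ?thesis unfolding velocity_in_tangent[OF atlas_prod[OF M1 M2] C t t01 ch]
        by (rule basis_of_comb[OF coord_basis[OF atlas_prod[OF M1 M2] ch]])
    qed
    \<comment> \<open>The output of the part at the shared port is \<open>- y1'\<close>, and its
      flow slot carries another minus sign; what remains is \<open>y1'\<close>, the flow that enters
      \<open>Dint\<close>.\<close>
    have d1: "((velocity M1 t0 t1 x1 t, f1 t, - y1 t, y1' t), (dfun M1 H1 (x1 t), e1 t, u1 t, u1' t)) \<in> D1 (x1 t)"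
      "(f1 t, e1 t) \<in> R1 (x1 t)" using b1 t by auto
    have d2: "((velocity M2 t0 t1 x2 t, f2 t, - y2 t, y2' t), (dfun M2 H2 (x2 t), e2 t, u2 t, u2' t)) \<in> D2 (x2 t)"
      "(f2 t, e2 t) \<in> R2 (x2 t)" using b2 t by auto
    show "((velocity (prod_manifold M1 M2) t0 t1 (\<lambda>t. (x1 t, x2 t)) t, (f1 t, f2 t), - (y1 t, y2 t)),
        (dfun (prod_manifold M1 M2) (\<lambda>(x1, x2). H1 x1 + H2 x2) (x1 t, x2 t), (e1 t, e2 t), (u1 t, u2 t)))
        \<in> dirac_interconnection M1 M2 Dint D1 D2 (x1 t, x2 t)"
      using interconnectionI[where Dint=Dint and ?D1.0=D1 and ?D2.0=D2, OF M1 M2 H p q V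
          velocity_prod[where x=x1 and y=x2 and t=t and ?t0.0=t0 and ?t1.0=t1, OF M1 M2 p q] Dt[OF t] d1(1) d2(1)] by simp
    show "((f1 t, f2 t), (e1 t, e2 t)) \<in> box_sum R1 R2 (x1 t, x2 t)"
      using d1(2) d2(2) by (simp add: box_sum_def)
  qed
  then show "\<xi> \<in> behaviour_of_interconnection Classical M1 Er1 Ei1 D1 R1 H1 M2 Er2 Ei2 D2 R2 H2 Dint t0 t1"
    by (simp add: behaviour_of_interconnection_def behaviour_def)
qed

section \<open>From the weak to the pointwise relation\<close>

text \<open>Around each point the bundle and its model of the dual have dual frames over a common
  domain, and the pairing is bilinear on fibres. This covers both the single bundle that carries the
  resistive relation and the direct sum that carries the Dirac structure.\<close>

definition dual_framed :: "'m manifold => ('m, 'v::real_vector, 'w::real_vector) dual_pair => bool" where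
  "dual_framed M P \<longleftrightarrow>
     framed M (primal P) \<and> framed M (codual P) \<and> rk (codual P) = rk (primal P) \<and>
     (\<forall>p\<in>points M.
        (\<exists>U b c. (U, b) \<in> frames (primal P) \<and> (U, c) \<in> frames (codual P) \<and> p \<in> U \<and>
          (\<forall>q\<in>U. \<forall>i<rk (primal P). \<forall>j<rk (primal P). pairing P (c i q) (b j q) = (if i = j then 1 else 0))) \<and>
        (\<forall>e\<in>fib (codual P) p. \<forall>f\<in>fib (primal P) p. \<forall>f'\<in>fib (primal P) p. \<forall>a b.
          pairing P e (a *\<^sub>R f + b *\<^sub>R f') = a * pairing P e f + b * pairing P e f') \<and>
        (\<forall>f\<in>fib (primal P) p. \<forall>e\<in>fib (codual P) p. \<forall>e'\<in>fib (codual P) p. \<forall>a b.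
          pairing P (a *\<^sub>R e + b *\<^sub>R e') f = a * pairing P e f + b * pairing P e' f))"

lemma dual_framedD:
  assumes "dual_framed M P"
  shows "framed M (primal P)" "framed M (codual P)" "rk (codual P) = rk (primal P)"
    "p \<in> points M ==> \<exists>U b c. (U, b) \<in> frames (primal P) \<and> (U, c) \<in> frames (codual P) \<and> p \<in> U \<and>
          (\<forall>q\<in>U. \<forall>i<rk (primal P). \<forall>j<rk (primal P). pairing P (c i q) (b j q) = (if i = j then 1 else 0))"
    "p \<in> points M ==> e \<in> fib (codual P) p ==> f \<in> fib (primal P) p ==> f' \<in> fib (primal P) p ==>
      pairing P e (a *\<^sub>R f + b *\<^sub>R f') = a * pairing P e f + b * pairing P e f'"
    "p \<in> points M ==> f \<in> fib (primal P) p ==> e \<in> fib (codual P) p ==> e' \<in> fib (codual P) p ==>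
      pairing P (a *\<^sub>R e + b *\<^sub>R e') f = a * pairing P e f + b * pairing P e' f"
  using assms unfolding dual_framed_def by simp_all

lemma dual_spaceI:
  assumes "\<And>v w a b. v \<in> V ==> w \<in> V ==> a *\<^sub>R v + b *\<^sub>R w \<in> V ==> e (a *\<^sub>R v + b *\<^sub>R w) = a * e v + b * e w"
    and V: "subspace V"
  shows "(\<lambda>v. if v \<in> V then e v else 0) \<in> dual_space V"
  unfolding dual_space_def
proof (intro CollectI conjI ballI allI impI)
  fix v w a b assume *: "v \<in> V" "w \<in> V"
  have m: "a *\<^sub>R v + b *\<^sub>R w \<in> V" using V * by (intro subspace_add subspace_scale)
  show "(if a *\<^sub>R v + b *\<^sub>R w \<in> V then e (a *\<^sub>R v + b *\<^sub>R w) else 0) = a * (if v \<in> V then e v else 0) + b * (if w \<in> V then e w else 0)"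
    using assms(1)[OF * m] m * by simp
qed simp

lemma dual_framed_with_dual:
  assumes E: "framed M E"
  shows "dual_framed M (with_dual E)"
  unfolding dual_framed_def with_dual_sel
proof (intro conjI ballI allI)
  show "framed M E" "framed M (dual_bundle E)" "rk (dual_bundle E) = rk E" using E framed_dual by auto
  fix p assume p: "p \<in> points M"
  obtain U b where fr: "(U, b) \<in> frames E" "p \<in> U" using framed_cover[OF E p] by blast
  let ?c = "\<lambda>i p v. representation ((\<lambda>j. b j p) ` {..<rk E}) v (b i p)"
  have "(U, ?c) \<in> frames (dual_bundle E)" using fr(1) by (auto simp: dual_bundle_def)
  moreover have "?c i q (b j q) = (if i = j then 1 else 0)" if "q \<in> U" "i < rk E" "j < rk E" for q i j
    using coords_basis[OF framedD(2)[OF E fr(1) that(1)] that(3), of i] that(2) by (simp add: coords_def)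
  ultimately show "\<exists>U b c. (U, b) \<in> frames E \<and> (U, c) \<in> frames (dual_bundle E) \<and> p \<in> U \<and>
      (\<forall>q\<in>U. \<forall>i<rk E. \<forall>j<rk E. c i q (b j q) = (if i = j then 1 else 0))"
    using fr by (intro exI[of _ U] exI[of _ b] exI[of _ ?c]) simp
  show "e (a *\<^sub>R f + b *\<^sub>R f') = a * e f + b * e f'"
    if "e \<in> fib (dual_bundle E) p" "f \<in> fib E p" "f' \<in> fib E p" for e f f' a b
    using that unfolding dual_bundle_sel dual_space_def by blast
  show "(a *\<^sub>R e + b *\<^sub>R e') f = a * e f + b * e' f" for e e' f a b by (simp add: scaleR_fun_def)
qed

lemma dual_framed_dsum:
  assumes P: "dual_framed M P" and Q: "dual_framed M Q"
  shows "dual_framed M (P \<oplus>\<^sub>d Q)"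
  unfolding dual_framed_def dsum_pair_sel
proof (intro conjI ballI allI)
  show "framed M (primal P \<oplus>\<^sub>b primal Q)" "framed M (codual P \<oplus>\<^sub>b codual Q)"
    "rk (codual P \<oplus>\<^sub>b codual Q) = rk (primal P \<oplus>\<^sub>b primal Q)"
    using dual_framedD(1,2,3)[OF P] dual_framedD(1,2,3)[OF Q] by (simp_all add: framed_dsum)
  fix p assume p: "p \<in> points M"
  let ?n = "rk (primal P)" and ?k = "rk (primal Q)"
  obtain U b c where U: "(U, b) \<in> frames (primal P)" "(U, c) \<in> frames (codual P)" "p \<in> U"
    "\<forall>q\<in>U. \<forall>i<?n. \<forall>j<?n. pairing P (c i q) (b j q) = (if i = j then 1 else 0)"
    using dual_framedD(4)[OF P p] by blast
  obtain V b' c' where V: "(V, b') \<in> frames (primal Q)" "(V, c') \<in> frames (codual Q)" "p \<in> V"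
    "\<forall>q\<in>V. \<forall>i<?k. \<forall>j<?k. pairing Q (c' i q) (b' j q) = (if i = j then 1 else 0)"
    using dual_framedD(4)[OF Q p] by blast
  have rk: "rk (codual P) = ?n" "rk (codual Q) = ?k" using dual_framedD(3) P Q by auto
  have z: "pairing R 0 f = 0" "pairing R e 0 = 0"
    if R: "dual_framed M R" and q: "q \<in> points M" and "f \<in> fib (primal R) q" "e \<in> fib (codual R) q" for q e f
      and R :: "('a, 'x::real_vector, 'y::real_vector) dual_pair"
    using dual_framedD(6)[OF R q that(3,4,4), of 0 0] dual_framedD(5)[OF R q that(4,3,3), of 0 0]
    by simp_all
  let ?B = "\<lambda>i p. if i < ?n then (b i p, 0) else (0, b' (i - ?n) p)"
  let ?C = "\<lambda>i p. if i < ?n then (c i p, 0) else (0, c' (i - ?n) p)"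
  have fB: "(U \<inter> V, ?B) \<in> frames (primal P \<oplus>\<^sub>b primal Q)" by (rule dsum_frameI[OF U(1) V(1)])
  have fC: "(U \<inter> V, ?C) \<in> frames (codual P \<oplus>\<^sub>b codual Q)" using dsum_frameI[OF U(2) V(2)] unfolding rk .
  have "pairing (P \<oplus>\<^sub>d Q) (?C i q) (?B j q) = (if i = j then 1 else 0)"
    if q: "q \<in> U \<inter> V" and ij: "i < ?n + ?k" "j < ?n + ?k" for q i j
  proof -
    have qM: "q \<in> points M" using q framed_subset[OF dual_framedD(1)[OF P] U(1)] by blast
    note zP = subspace_0[OF framed_subspace[OF dual_framedD(1)[OF P] qM]] subspace_0[OF framed_subspace[OF dual_framedD(2)[OF P] qM]]
    note zQ = subspace_0[OF framed_subspace[OF dual_framedD(1)[OF Q] qM]] subspace_0[OF framed_subspace[OF dual_framedD(2)[OF Q] qM]]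
    have mb: "b i q \<in> fib (primal P) q" "c i q \<in> fib (codual P) q" if "i < ?n" for i
      using basis_of_mem[OF framedD(2)[OF dual_framedD(1)[OF P] U(1)]] basis_of_mem[OF framedD(2)[OF dual_framedD(2)[OF P] U(2)]]
        q that rk by auto
    have mb': "b' i q \<in> fib (primal Q) q" "c' i q \<in> fib (codual Q) q" if "i < ?k" for i
      using basis_of_mem[OF framedD(2)[OF dual_framedD(1)[OF Q] V(1)]] basis_of_mem[OF framedD(2)[OF dual_framedD(2)[OF Q] V(2)]]
        q that rk by auto
    note z0 = z(1)[OF P qM zP] z(1)[OF Q qM zQ]
    show ?thesis
    proof (cases "i < ?n"; cases "j < ?n")
      assume "i < ?n" "j < ?n"
      then show ?thesis using U(4) q z0 by simp
    next
      assume *: "i < ?n" "\<not> j < ?n"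
      then have j: "j - ?n < ?k" using ij by simp
      show ?thesis using * z(2)[OF P qM zP(1) mb(2)[OF *(1)]] z(1)[OF Q qM mb'(1)[OF j] zQ(2)] by simp
    next
      assume *: "\<not> i < ?n" "j < ?n"
      then have i: "i - ?n < ?k" using ij by simp
      show ?thesis using * z(1)[OF P qM mb(1)[OF *(2)] zP(2)] z(2)[OF Q qM zQ(1) mb'(2)[OF i]] by simp
    next
      assume *: "\<not> i < ?n" "\<not> j < ?n"
      then have "i - ?n < ?k" "j - ?n < ?k" "(i - ?n = j - ?n) = (i = j)" using ij by auto
      then show ?thesis using * V(4) q z0 by simp
    qed
  qed
  then show "\<exists>U b c. (U, b) \<in> frames (primal P \<oplus>\<^sub>b primal Q) \<and> (U, c) \<in> frames (codual P \<oplus>\<^sub>b codual Q) \<and> p \<in> U \<and>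
      (\<forall>q\<in>U. \<forall>i<rk (primal P \<oplus>\<^sub>b primal Q). \<forall>j<rk (primal P \<oplus>\<^sub>b primal Q).
         pairing (P \<oplus>\<^sub>d Q) (c i q) (b j q) = (if i = j then 1 else 0))"
    using fB fC U(3) V(3) by (intro exI[of _ "U \<inter> V"] exI[of _ ?B] exI[of _ ?C]) simp
  show "pairing (P \<oplus>\<^sub>d Q) e (r *\<^sub>R v + s *\<^sub>R w) = r * pairing (P \<oplus>\<^sub>d Q) e v + s * pairing (P \<oplus>\<^sub>d Q) e w"
    if "e \<in> fib (codual P \<oplus>\<^sub>b codual Q) p" "v \<in> fib (primal P \<oplus>\<^sub>b primal Q) p" "w \<in> fib (primal P \<oplus>\<^sub>b primal Q) p" for e v w r s
    using that by (cases e; cases v; cases w) (simp add: dual_framedD(5)[OF P p] dual_framedD(5)[OF Q p] algebra_simps)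
  show "pairing (P \<oplus>\<^sub>d Q) (r *\<^sub>R v + s *\<^sub>R w) f = r * pairing (P \<oplus>\<^sub>d Q) v f + s * pairing (P \<oplus>\<^sub>d Q) w f"
    if "f \<in> fib (primal P \<oplus>\<^sub>b primal Q) p" "v \<in> fib (codual P \<oplus>\<^sub>b codual Q) p" "w \<in> fib (codual P \<oplus>\<^sub>b codual Q) p" for f v w r s
    using that by (cases f; cases v; cases w) (simp add: dual_framedD(6)[OF P p] dual_framedD(6)[OF Q p] algebra_simps)
qed

text \<open>In dual frames the pairing is the dot product of coordinate vectors.\<close>

lemma pairing_coords:
  assumes P: "dual_framed M P" and p: "p \<in> points M"
    and b: "basis_of n b (fib (primal P) p)" and c: "basis_of n c (fib (codual P) p)"
    and d: "\<And>i j. i < n ==> j < n ==> pairing P (c i) (b j) = (if i = j then 1 else 0)"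
  shows "pairing P (\<Sum>i<n. a' i *\<^sub>R c i) (\<Sum>i<n. a i *\<^sub>R b i) = (\<Sum>i<n. a' i * a i)"
proof -
  let ?e = "\<Sum>i<n. a' i *\<^sub>R c i"
  have e: "?e \<in> fib (codual P) p" by (rule basis_of_comb[OF c])
  have f: "(\<Sum>i<n. a i *\<^sub>R b i) \<in> fib (primal P) p" by (rule basis_of_comb[OF b])
  have "(\<lambda>f. if f \<in> fib (primal P) p then pairing P ?e f else 0) \<in> dual_space (fib (primal P) p)"
    by (intro dual_spaceI dual_framedD(5)[OF P p e] basis_of_subspace[OF b])
  from dual_space_sum[where b=b and c=a and A="{..<n}", OF this basis_of_subspace[OF b]]
  have "pairing P ?e (\<Sum>i<n. a i *\<^sub>R b i) = (\<Sum>i<n. a i * pairing P ?e (b i))"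
    using basis_of_mem[OF b] f by simp
  also have "\<dots> = (\<Sum>i<n. a' i * a i)"
  proof (rule sum.cong[OF refl])
    fix j assume "j \<in> {..<n}"
    then have j: "j < n" by simp
    have "(\<lambda>e. if e \<in> fib (codual P) p then pairing P e (b j) else 0) \<in> dual_space (fib (codual P) p)"
      by (intro dual_spaceI dual_framedD(6)[OF P p basis_of_mem[OF b j]] basis_of_subspace[OF c])
    from dual_space_sum[where b=c and c=a' and A="{..<n}", OF this basis_of_subspace[OF c]]
    have "pairing P ?e (b j) = (\<Sum>i<n. a' i * pairing P (c i) (b j))"
      using basis_of_mem[OF c] e by simp
    also have "\<dots> = a' j" by (rule sum_times_delta[OF j]) (rule d[OF _ j])
    finally show "a j * pairing P ?e (b j) = a' j * a j" by simp
  qed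
  finally show ?thesis .
qed

text \<open>A section of a subbundle exists only near a point. A cut-off whose support lies where
  the curve runs inside \<open>U\<close> makes it a test section on the whole interval, extended by
  0.\<close>

lemma bump_section_continuous:
  fixes I :: "real set" and \<eta> :: "real => real"
  assumes M: "atlas M" and E: "framed M E" and x: "curve_on I M x"
    and U: "openin (mtop M) U" and s: "smooth_section M E U s"
    and \<eta>: "continuous_on UNIV \<eta>" "\<And>t. t \<notin> {c..d} ==> \<eta> t = 0" and sub: "\<And>t. t \<in> I ==> t \<in> {c..d} ==> x t \<in> U"
  shows "continuous_map (top_of_set I) (total_top M E) (\<lambda>t. (x t, if x t \<in> U then \<eta> t *\<^sub>R s (x t) else 0))"
proof (rule iffD2[OF curve_continuous_iff[OF E]], intro conjI)
  show "curve_on I M x" by (rule x)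
  let ?\<sigma> = "\<lambda>t. if x t \<in> U then \<eta> t *\<^sub>R s (x t) else 0"
  have zero: "?\<sigma> t = 0" if "t \<notin> {c..d}" for t using \<eta>(2)[OF that] by simp
  have sm: "\<exists>a. (\<forall>i<rk E. smooth_fun M (U \<inter> V) (a i)) \<and> (\<forall>p\<in>U \<inter> V. s p = (\<Sum>i<rk E. a i p *\<^sub>R b i p))"
    if "(V, b) \<in> frames E" for V b
    using bspec[OF s[unfolded smooth_section_def] that] by simp
  have mem: "?\<sigma> t \<in> fib E (x t)" if t: "t \<in> I" for t
  proof -
    have p: "x t \<in> points M" by (rule curve_in_points[OF x t])
    obtain V b where fr: "(V, b) \<in> frames E" "x t \<in> V" using framed_cover[OF E p] by blast
    note B = framedD(2)[OF E fr]
    show ?thesis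
    proof (cases "x t \<in> U")
      case True
      obtain a where "\<forall>p\<in>U \<inter> V. s p = (\<Sum>i<rk E. a i p *\<^sub>R b i p)" using sm[OF fr(1)] by blast
      then have "s (x t) = (\<Sum>i<rk E. a i (x t) *\<^sub>R b i (x t))" using True fr(2) by blast
      then show ?thesis using True basis_of_comb[OF B] subspace_scale[OF basis_of_subspace[OF B]] by simp
    qed (simp add: subspace_0[OF basis_of_subspace[OF B]])
  qed
  show "coords_in continuous_on I E x ?\<sigma>"
  proof (rule coords_inI)
    fix V b i assume fr: "(V, b) \<in> frames E" and i: "i < rk E"
    note B = framedD(2)[OF E fr]
    let ?S = "{t \<in> I. x t \<in> V}"
    have opS: "openin (top_of_set I) ?S" by (rule openin_curve_preimage[OF x framedD(1)[OF E fr]])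
    obtain a where a: "\<forall>i<rk E. smooth_fun M (U \<inter> V) (a i)" "\<forall>p\<in>U \<inter> V. s p = (\<Sum>i<rk E. a i p *\<^sub>R b i p)"
      using sm[OF fr] by blast
    show "continuous_on ?S (\<lambda>t. frame_coords E b (x t) (?\<sigma> t) i)"
    proof (rule continuous_class.loc[OF opS])
      fix t assume t: "t \<in> ?S"
      show "\<exists>T. openin (top_of_set I) T \<and> t \<in> T \<and> T \<subseteq> ?S \<and>
          continuous_on T (\<lambda>t. frame_coords E b (x t) (?\<sigma> t) i)"
      proof (cases "x t \<in> U")
        case True
        let ?T = "{t \<in> I. x t \<in> U \<inter> V}"
        have opUV: "openin (mtop M) (U \<inter> V)" using U framedD(1)[OF E fr] by (rule openin_Int)
        have "continuous_map (mtop_on M (U \<inter> V)) euclideanreal (a i)"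
          using atlas_smooth_continuous[OF M] opUV a(1) i unfolding smooth_implies_continuous_def by blast
        then have "continuous_on ?T (\<lambda>t. a i (x t))" by (rule continuous_on_curve[OF x])
        then have "continuous_on ?T (\<lambda>t. \<eta> t * a i (x t))"
          by (intro continuous_on_mult continuous_on_subset[OF \<eta>(1)]) auto
        moreover have "\<eta> t * a i (x t) = frame_coords E b (x t) (?\<sigma> t) i" if "t \<in> ?T" for t
        proof -
          have m: "x t \<in> U" "x t \<in> V" using that by auto
          have "s (x t) = (\<Sum>i<rk E. a i (x t) *\<^sub>R b i (x t))" using a(2) m by blast
          then have "?\<sigma> t = (\<Sum>i<rk E. (\<eta> t * a i (x t)) *\<^sub>R b i (x t))" using m by (simp add: scaleR_sum_right)
          then show ?thesis using coords_unique[OF B[OF m(2)], of "\<lambda>i. \<eta> t * a i (x t)" i] i by simp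
        qed
        ultimately have "continuous_on ?T (\<lambda>t. frame_coords E b (x t) (?\<sigma> t) i)"
          by (rule continuous_class.cong[rotated])
        then show ?thesis using t True openin_curve_preimage[OF x opUV] by (intro exI[of _ ?T]) auto
      next
        case False
        \<comment> \<open>A time at which the curve is outside \<open>U\<close> lies off the closed
          interval \<open>{c..d}\<close>, so the section is 0 at all times nearby, also at those
          where the curve is back in \<open>U\<close>.\<close>
        let ?T = "?S \<inter> - {c..d}"
        have "t \<notin> {c..d}" using False sub t by blast
        have "openin (top_of_set I) ?T" by (rule openin_Int_open[OF opS open_Compl[OF closed_atLeastAtMost]])
        moreover have "continuous_on ?T (\<lambda>t. frame_coords E b (x t) (?\<sigma> t) i)"
        proof (rule continuous_class.cong[of _ "\<lambda>_. 0"])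
          fix t assume "t \<in> ?T"
          then have m: "x t \<in> V" "t \<notin> {c..d}" by auto
          show "0 = frame_coords E b (x t) (?\<sigma> t) i" unfolding zero[OF m(2)] coords_zero[OF B[OF m(1)]] ..
        qed simp
        ultimately show ?thesis using t \<open>t \<notin> {c..d}\<close> by (intro exI[of _ ?T]) auto
      qed
    qed
  qed (rule mem)
qed

section \<open>Isotropic subbundles of half rank, for the symmetric and the alternating form at
  once\<close>

context
  fixes M :: "'m manifold" and P :: "('m, 'v::real_vector, 'w::real_vector) dual_pair"
    and form :: "('m, 'v, 'w) dual_pair => 'v \<times> 'w => 'v \<times> 'w => real" and s :: real and D
  assumes M: "atlas M" and P: "dual_framed M P"
    and form: "\<And>f e f' e'. form P (f, e) (f', e') = pairing P e' f + s * pairing P e f'" and s: "s \<noteq> 0"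
    and D: "smooth_subbundle M (doubled P) (rk (primal P)) D"
    and iso: "\<And>p \<xi> \<xi>'. p \<in> points M ==> \<xi> \<in> D p ==> \<xi>' \<in> D p ==> form P \<xi> \<xi>' = 0"
begin

lemma framed_doubled: "framed M (doubled P)"
  by (rule framed_dsum[OF dual_framedD(1,2)[OF P]])

lemma form_linear:
  assumes p: "p \<in> points M" and "u \<in> fib (doubled P) p" "v \<in> fib (doubled P) p" "w \<in> fib (doubled P) p"
  shows "form P (a *\<^sub>R u + b *\<^sub>R v) w = a * form P u w + b * form P v w"
    and "form P w (a *\<^sub>R u + b *\<^sub>R v) = a * form P w u + b * form P w v"
proof -
  obtain u1 u2 v1 v2 w1 w2 where d: "u = (u1, u2)" "v = (v1, v2)" "w = (w1, w2)" by (cases u, cases v, cases w)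
  have m: "u1 \<in> fib (primal P) p" "v1 \<in> fib (primal P) p" "w1 \<in> fib (primal P) p"
    "u2 \<in> fib (codual P) p" "v2 \<in> fib (codual P) p" "w2 \<in> fib (codual P) p" using assms unfolding d by auto
  note l = dual_framedD(5,6)[OF P p]
  show "form P (a *\<^sub>R u + b *\<^sub>R v) w = a * form P u w + b * form P v w"
    using l(1)[OF m(6,1,2), of a b] l(2)[OF m(3,4,5), of a b] unfolding d by (simp add: form algebra_simps)
  show "form P w (a *\<^sub>R u + b *\<^sub>R v) = a * form P w u + b * form P w v"
    using l(1)[OF m(6,1,2), of a b] l(2)[OF m(3,4,5), of a b] unfolding d by (simp add: form algebra_simps)
qed

lemma form_dual:
  assumes p: "p \<in> points M" and w: "w \<in> fib (doubled P) p"
  shows "(\<lambda>v. if v \<in> fib (doubled P) p then form P v w else 0) \<in> dual_space (fib (doubled P) p)"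
    and "(\<lambda>v. if v \<in> fib (doubled P) p then form P w v else 0) \<in> dual_space (fib (doubled P) p)"
  using form_linear[OF p _ _ w] framed_subspace[OF framed_doubled p] by (auto intro!: dual_spaceI)

text \<open>The form is nondegenerate: in dual frames it is a sum of products of coordinates, and
  pairing with one frame vector isolates one coordinate, up to the factor \<open>s\<close>. Here
  \<open>s\<close> is 1 for Dirac structures and -1 for Lagrangian subbundles. Half the dimension
  then means maximal isotropic.\<close>

lemma form_maximal:
  assumes p: "p \<in> points M" and x: "\<xi> \<in> fib (doubled P) p" "\<And>\<xi>'. \<xi>' \<in> D p ==> form P \<xi> \<xi>' = 0"
  shows "\<xi> \<in> D p"
proof -
  let ?n = "rk (primal P)"
  obtain U b c where U: "(U, b) \<in> frames (primal P)" "(U, c) \<in> frames (codual P)" "p \<in> U"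
    "\<forall>q\<in>U. \<forall>i<?n. \<forall>j<?n. pairing P (c i q) (b j q) = (if i = j then 1 else 0)"
    using dual_framedD(4)[OF P p] by blast
  have B: "basis_of ?n (\<lambda>i. b i p) (fib (primal P) p)" by (rule framedD(2)[OF dual_framedD(1)[OF P] U(1,3)])
  have C: "basis_of ?n (\<lambda>i. c i p) (fib (codual P) p)"
    using framedD(2)[OF dual_framedD(2)[OF P] U(2,3)] unfolding dual_framedD(3)[OF P] .
  have pc: "pairing P (\<Sum>i<?n. a' i *\<^sub>R c i p) (\<Sum>i<?n. a i *\<^sub>R b i p) = (\<Sum>i<?n. a' i * a i)" for a a'
    by (rule pairing_coords[OF P p B C]) (use U in blast)
  have V: "basis_of (?n + ?n) (\<lambda>i. if i < ?n then (b i p, 0) else (0, c (i - ?n) p)) (fib (doubled P) p)"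
    using basis_of_append[OF B C] by simp
  obtain W t where W: "p \<in> W" "\<forall>q\<in>W. basis_of ?n (\<lambda>i. t i q) (D q)"
    using D p unfolding smooth_subbundle_def by blast
  have Db: "basis_of ?n (\<lambda>i. t i p) (D p)" using W by blast
  have nondeg: "v = 0" if v: "v \<in> fib (doubled P) p" "\<forall>w\<in>fib (doubled P) p. form P v w = 0" for v
  proof -
    obtain v1 v2 where v12: "v = (v1, v2)" by (cases v)
    let ?a = "coords ?n (\<lambda>i. b i p) v1" and ?a' = "coords ?n (\<lambda>i. c i p) v2"
    have e: "(\<Sum>i<?n. ?a i *\<^sub>R b i p) = v1" "(\<Sum>i<?n. ?a' i *\<^sub>R c i p) = v2"
      using v(1) v12 coords_sum[OF B] coords_sum[OF C] by auto
    have "?a j = 0 \<and> ?a' j = 0" if j: "j < ?n" for j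
    proof
      have ev: "form P v (\<Sum>i<?n. d i *\<^sub>R b i p, \<Sum>i<?n. d' i *\<^sub>R c i p) = (\<Sum>i<?n. d' i * ?a i) + s * (\<Sum>i<?n. ?a' i * d i)" for d d'
        using pc[of d' ?a] pc[of ?a' d] unfolding e v12 form by simp
      have z: "form P v (\<Sum>i<?n. d i *\<^sub>R b i p, \<Sum>i<?n. d' i *\<^sub>R c i p) = 0" for d d'
        using v(2) basis_of_comb[OF B, of d] basis_of_comb[OF C, of d'] by simp
      have "(\<Sum>i<?n. ?a i * (if i = j then 1 else 0)) = ?a j" by (rule sum_times_delta[OF j]) simp
      then show "?a j = 0"
        using ev[of "\<lambda>_. 0" "\<lambda>i. if i = j then 1 else 0"] z[of "\<lambda>_. 0" "\<lambda>i. if i = j then 1 else 0"]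
        by (simp add: mult.commute)
      have "(\<Sum>i<?n. ?a' i * (if i = j then 1 else 0)) = ?a' j" by (rule sum_times_delta[OF j]) simp
      then show "?a' j = 0"
        using ev[of "\<lambda>i. if i = j then 1 else 0" "\<lambda>_. 0"] z[of "\<lambda>i. if i = j then 1 else 0" "\<lambda>_. 0"] s by simp
    qed
    then have "v1 = 0" "v2 = 0" using e by auto
    then show "v = 0" by (simp add: v12 zero_prod_def)
  qed
  show ?thesis
    by (rule half_dim_isotropic_maximal[OF V Db subbundle_mem(1)[OF framed_doubled D p] form_dual(1)[OF p] form_dual(2)[OF p]
      nondeg iso[OF p] x])
qed

text \<open>Near a given time the subbundle is spanned by smooth sections \<open>se k\<close>.
  Testing with a cut-off multiple of \<open>se k\<close> gives vanishing integrals of the cut-off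
  times the function \<open>h k\<close>, the form of \<open>\<xi>\<close> with \<open>se k\<close>;
  so each \<open>h k\<close> vanishes almost everywhere. Where all of them vanish,
  \<open>\<xi>\<close> is orthogonal to the fibre and belongs to it by maximality.\<close>

lemma weakly_in_pointwise:
  assumes x: "curve_on {t0..t1} M x"
    and \<xi>: "coords_in loc_integrable {t0..t1} (doubled P) x \<xi>"
    and weak: "weakly_in M P form D t0 t1 x \<xi>"
  shows "negligible {t \<in> {t0..t1}. \<xi> t \<notin> D (x t)}"
proof -
  let ?I = "{t0..t1}" and ?n = "rk (primal P)"
  let ?N = "{t \<in> {t0<..<t1}. \<xi> t \<notin> D (x t)}"
  note DP = framed_doubled
  have local: "\<exists>d>0. negligible {r \<in> {t - d<..<t + d}. r \<in> {t0<..<t1} \<and> \<xi> r \<notin> D (x r)}" if t: "t \<in> {t0<..<t1}" for t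
  proof -
    have tI: "t \<in> ?I" using t by auto
    have p: "x t \<in> points M" by (rule curve_in_points[OF x tI])
    obtain U se where U: "openin (mtop M) U" "x t \<in> U" "\<forall>i<?n. smooth_section M (doubled P) U (se i)"
      "\<forall>q\<in>U. basis_of ?n (\<lambda>i. se i q) (D q)"
      using D p unfolding smooth_subbundle_def by blast
    obtain V b c where V: "(V, b) \<in> frames (primal P)" "(V, c) \<in> frames (codual P)" "x t \<in> V"
      "\<forall>q\<in>V. \<forall>i<?n. \<forall>j<?n. pairing P (c i q) (b j q) = (if i = j then 1 else 0)"
      using dual_framedD(4)[OF P p] by blast
    have B: "basis_of ?n (\<lambda>i. b i q) (fib (primal P) q)" if "q \<in> V" for q by (rule framedD(2)[OF dual_framedD(1)[OF P] V(1) that])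
    have C: "basis_of ?n (\<lambda>i. c i q) (fib (codual P) q)" if "q \<in> V" for q
      using framedD(2)[OF dual_framedD(2)[OF P] V(2) that] unfolding dual_framedD(3)[OF P] .
    have opV: "openin (mtop M) V" by (rule framedD(1)[OF dual_framedD(1)[OF P] V(1)])
    let ?B = "\<lambda>i q. if i < ?n then (b i q, 0) else (0, c (i - ?n) q)"
    have fr: "(V, ?B) \<in> frames (doubled P)" using dsum_frameI[OF V(1,2)] by simp
    have rk: "rk (doubled P) = ?n + ?n" using dual_framedD(3)[OF P] by simp
    have "\<forall>k\<in>{..<?n}. \<exists>a. (\<forall>i<?n + ?n. smooth_fun M (U \<inter> V) (a i)) \<and> (\<forall>q\<in>U \<inter> V. se k q = (\<Sum>i<?n + ?n. a i q *\<^sub>R ?B i q))"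
    proof
      fix k assume "k \<in> {..<?n}"
      then have "smooth_section M (doubled P) U (se k)" using U(3) by blast
      from bspec[OF this[unfolded smooth_section_def] fr, unfolded prod.case]
      show "\<exists>a. (\<forall>i<?n + ?n. smooth_fun M (U \<inter> V) (a i)) \<and> (\<forall>q\<in>U \<inter> V. se k q = (\<Sum>i<?n + ?n. a i q *\<^sub>R ?B i q))"
        unfolding rk .
    qed
    from bchoice[OF this] obtain \<alpha> where \<alpha>: "\<forall>k\<in>{..<?n}. (\<forall>i<?n + ?n. smooth_fun M (U \<inter> V) (\<alpha> k i)) \<and>
      (\<forall>q\<in>U \<inter> V. se k q = (\<Sum>i<?n + ?n. \<alpha> k i q *\<^sub>R ?B i q))" ..
    have opUV: "openin (mtop M) (U \<inter> V)" using U(1) opV by (rule openin_Int)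
    let ?S = "{r \<in> ?I. x r \<in> U \<inter> V}"
    have opS: "openin (top_of_set ?I) ?S" by (rule openin_curve_preimage[OF x opUV])
    have opSV: "openin (top_of_set ?I) {r \<in> ?I. x r \<in> V}" by (rule openin_curve_preimage[OF x opV])
    have tS: "t \<in> ?S" using tI U(2) V(3) by blast
    obtain d0 where d0: "d0 > 0" "?I \<inter> cball t d0 \<subseteq> ?S"
      by (rule openin_interval_cball[OF opS tS]) (rule that)
    \<comment> \<open>The halves keep the closed interval around \<open>t\<close> strictly inside
      the open one, as the compact support of test sections requires.\<close>
    define d where "d = min d0 (min ((t - t0) / 2) ((t1 - t) / 2))"
    have d: "d > 0" "{t - d..t + d} \<subseteq> {t0<..<t1}"
    proof -
      show "d > 0" using d0(1) t by (simp add: d_def)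
      have "d \<le> (t - t0) / 2" "d \<le> (t1 - t) / 2" unfolding d_def by linarith+
      moreover have "t0 < t" "t < t1" using t by auto
      ultimately have "t0 < t - d \<and> t + d < t1" by (auto simp: field_simps)
      then show "{t - d..t + d} \<subseteq> {t0<..<t1}" by auto
    qed
    have JS: "{t - d..t + d} \<subseteq> ?S"
    proof
      fix r assume r: "r \<in> {t - d..t + d}"
      have "d \<le> d0" by (simp add: d_def)
      then have "r \<in> cball t d0" using r by (auto simp: dist_real_def)
      moreover have "r \<in> ?I" using r d(2) by (auto simp: subset_iff)
      ultimately show "r \<in> ?S" using d0(2) by blast
    qed
    define a where "a i r = coords (?n + ?n) (\<lambda>j. ?B j (x r)) (\<xi> r) i" for i r
    \<comment> \<open>The form of \<open>\<xi>\<close> with the k-th section, written in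
      coordinates: continuous coefficients along the curve times locally integrable coordinates of
      \<open>\<xi>\<close>.\<close>
    define h where "h k r = (\<Sum>i<?n. \<alpha> k (?n + i) (x r) * a i r + (s * \<alpha> k i (x r)) * a (?n + i) r)" for k r
    have h: "form P (\<xi> r) (se k (x r)) = h k r" if r: "r \<in> ?S" and k: "k < ?n" for r k
    proof -
      have q: "x r \<in> V" "x r \<in> U" "x r \<in> points M" using r framed_subset[OF dual_framedD(1)[OF P] V(1)] by auto
      have BB: "basis_of (?n + ?n) (\<lambda>i. ?B i (x r)) (fib (doubled P) (x r))"
        using framedD(2)[OF DP fr q(1)] unfolding rk .
      have "(\<Sum>i<?n + ?n. a i r *\<^sub>R ?B i (x r)) = \<xi> r"
        unfolding a_def by (rule coords_sum[OF BB coords_inD(1)[OF \<xi>]]) (use r in blast)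
      then have e1: "\<xi> r = (\<Sum>i<?n. a i r *\<^sub>R b i (x r), \<Sum>i<?n. a (?n + i) r *\<^sub>R c i (x r))"
        unfolding sum_append_frame[of "\<lambda>i. a i r" _ "\<lambda>i. b i (x r)" "\<lambda>i. c i (x r)"] by simp
      have "se k (x r) = (\<Sum>i<?n + ?n. \<alpha> k i (x r) *\<^sub>R ?B i (x r))" using \<alpha> k q by blast
      then have e2: "se k (x r) = (\<Sum>i<?n. \<alpha> k i (x r) *\<^sub>R b i (x r), \<Sum>i<?n. \<alpha> k (?n + i) (x r) *\<^sub>R c i (x r))"
        unfolding sum_append_frame[of "\<lambda>i. \<alpha> k i (x r)" _ "\<lambda>i. b i (x r)" "\<lambda>i. c i (x r)"] by simp
      have pc: "pairing P (\<Sum>i<?n. v' i *\<^sub>R c i (x r)) (\<Sum>i<?n. v i *\<^sub>R b i (x r)) = (\<Sum>i<?n. v' i * v i)" for v v'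
        by (rule pairing_coords[OF P q(3) B[OF q(1)] C[OF q(1)]]) (use V(4) q(1) in blast)
      show ?thesis unfolding e1 e2 form pc h_def
        by (simp add: sum.distrib sum_distrib_left mult_ac)
    qed
    have ai: "loc_integrable ?S (a i)" if "i < ?n + ?n" for i
    proof -
      have "loc_integrable {r \<in> ?I. x r \<in> V} (a i)"
        using coords_inD(2)[OF \<xi> fr] that unfolding rk a_def by blast
      then show ?thesis by (rule loc_integrable_class.mono[OF _ opSV opS]) blast
    qed
    have \<alpha>c: "continuous_on ?S (\<lambda>r. \<alpha> k i (x r))" if "k < ?n" "i < ?n + ?n" for k i
    proof -
      have "smooth_fun M (U \<inter> V) (\<alpha> k i)" using \<alpha> that by blast
      then have "continuous_map (mtop_on M (U \<inter> V)) euclideanreal (\<alpha> k i)"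
        using atlas_smooth_continuous[OF M] opUV unfolding smooth_implies_continuous_def by blast
      from continuous_on_curve[OF x this] show ?thesis by simp
    qed
    have hi: "loc_integrable ?S (h k)" if k: "k < ?n" for k
    proof -
      have A: "loc_integrable ?S (\<lambda>r. \<Sum>i<?n. \<alpha> k (?n + i) (x r) * a i r)"
      proof (rule loc_integrable_sum[OF opS])
        fix i assume "i \<in> {..<?n}"
        then have i: "i < ?n + ?n" "?n + i < ?n + ?n" by auto
        show "loc_integrable ?S (\<lambda>r. \<alpha> k (?n + i) (x r) * a i r)"
          by (rule loc_integrable_mult[OF opS ai[OF i(1)] \<alpha>c[OF k i(2)]])
      qed simp
      have A': "loc_integrable ?S (\<lambda>r. \<Sum>i<?n. (s * \<alpha> k i (x r)) * a (?n + i) r)"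
      proof (rule loc_integrable_sum[OF opS])
        fix i assume "i \<in> {..<?n}"
        then have i: "i < ?n + ?n" "?n + i < ?n + ?n" by auto
        show "loc_integrable ?S (\<lambda>r. (s * \<alpha> k i (x r)) * a (?n + i) r)"
          by (rule loc_integrable_mult[OF opS ai[OF i(2)] continuous_on_mult[OF continuous_on_const \<alpha>c[OF k i(1)]]])
      qed simp
      \<comment> \<open>A sum of two functions, phrased as a sum over the truth values to fit
        \<open>loc_integrable_sum\<close>.\<close>
      have "loc_integrable ?S (\<lambda>r. \<Sum>j\<in>{False, True}. if j then (\<Sum>i<?n. \<alpha> k (?n + i) (x r) * a i r)
          else (\<Sum>i<?n. (s * \<alpha> k i (x r)) * a (?n + i) r))"
      proof (rule loc_integrable_sum[OF opS])
        fix j :: bool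
        show "loc_integrable ?S (\<lambda>r. if j then (\<Sum>i<?n. \<alpha> k (?n + i) (x r) * a i r)
          else (\<Sum>i<?n. (s * \<alpha> k i (x r)) * a (?n + i) r))"
          by (cases j) (simp_all only: if_True if_False A A')
      qed simp
      then show ?thesis by (rule loc_integrable_class.cong[rotated]) (simp add: h_def sum.distrib)
    qed
    have null: "negligible {r \<in> {t - d<..<t + d}. h k r \<noteq> 0}" if k: "k < ?n" for k
    proof (rule negligible_if_test_integrals_zero)
      show "set_integrable lebesgue {t - d..t + d} (h k)"
        by (rule loc_integrable_compact[OF openin_interval_lebesgue[OF opS] hi[OF k] _ JS]) simp
      fix \<eta> :: "real => real" and l u
      assume \<eta>: "continuous_on UNIV \<eta>" "t - d < l" "u < t + d" "\<And>r. r \<notin> {l..u} ==> \<eta> r = 0"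
      let ?\<sigma> = "\<lambda>r. if x r \<in> U then \<eta> r *\<^sub>R se k (x r) else 0"
      have luS: "r \<in> ?S" if "r \<in> {l..u}" for r
      proof -
        have "r \<in> {t - d..t + d}" using that \<eta>(2,3) by auto
        then show ?thesis using JS by blast
      qed
      have s1: "\<forall>r\<in>?I. ?\<sigma> r \<in> D (x r)"
      proof
        fix r assume r: "r \<in> ?I"
        have q: "x r \<in> points M" by (rule curve_in_points[OF x r])
        have sp: "subspace (D (x r))" by (rule subbundle_mem(2)[OF DP D q])
        show "?\<sigma> r \<in> D (x r)"
        proof (cases "x r \<in> U")
          case True
          then have "basis_of ?n (\<lambda>i. se i (x r)) (D (x r))" using U(4) by blast
          then show ?thesis using True basis_of_mem[of ?n "\<lambda>i. se i (x r)" "D (x r)" k] k subspace_scale[OF sp] by simp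
        qed (simp add: subspace_0[OF sp])
      qed
      have s2: "continuous_map (top_of_set ?I) (total_top M (doubled P)) (\<lambda>r. (x r, ?\<sigma> r))"
      proof (rule bump_section_continuous[OF M DP x U(1) _ \<eta>(1,4)])
        show "smooth_section M (doubled P) U (se k)" using U(3) k by blast
        show "x r \<in> U" if "r \<in> {l..u}" for r using luS[OF that] by blast
      qed
      have s3: "\<exists>a b. t0 < a \<and> b < t1 \<and> (\<forall>r\<in>?I. r \<notin> {a..b} \<longrightarrow> ?\<sigma> r = 0)"
      proof (intro exI conjI ballI impI)
        have "t - d \<in> {t - d..t + d}" "t + d \<in> {t - d..t + d}" using d(1) by auto
        then have "t - d \<in> {t0<..<t1}" "t + d \<in> {t0<..<t1}" using d(2) by blast+
        then show "t0 < l" "u < t1" using \<eta>(2,3) by auto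
        show "?\<sigma> r = 0" if "r \<notin> {l..u}" for r using \<eta>(4)[OF that] by simp
      qed
      have "(LINT r|lebesgue_on ?I. form P (\<xi> r) (?\<sigma> r)) = 0"
        by (rule mp[OF spec[OF weak[unfolded weakly_in_def], of ?\<sigma>] conjI[OF s1 conjI[OF s2 s3]]])
      moreover have "(LINT r|lebesgue_on ?I. form P (\<xi> r) (?\<sigma> r)) = (LINT r:?I|lebesgue. form P (\<xi> r) (?\<sigma> r))"
        unfolding set_lebesgue_integral_def by (rule integral_restrict_space) simp
      moreover have "(LINT r:?I|lebesgue. form P (\<xi> r) (?\<sigma> r)) = (LINT r:{t - d..t + d}|lebesgue. \<eta> r * h k r)"
        unfolding set_lebesgue_integral_def
      proof (rule Bochner_Integration.integral_cong[OF refl])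
        fix r
        show "indicator ?I r *\<^sub>R form P (\<xi> r) (?\<sigma> r) = indicator {t - d..t + d} r *\<^sub>R (\<eta> r * h k r)"
        proof (cases "r \<in> {t - d..t + d}")
          case True
          then have r: "r \<in> ?S" using JS by blast
          then have q: "x r \<in> points M" "x r \<in> U" "r \<in> ?I" using curve_in_points[OF x] by auto
          have m1: "\<xi> r \<in> fib (doubled P) (x r)" by (rule coords_inD(1)[OF \<xi> q(3)])
          have "basis_of ?n (\<lambda>i. se i (x r)) (D (x r))" using U(4) q(2) by blast
          then have "se k (x r) \<in> D (x r)" using basis_of_mem k by fastforce
          then have m2: "se k (x r) \<in> fib (doubled P) (x r)" using subbundle_mem(1)[OF DP D q(1)] by blast
          have "form P (\<xi> r) (\<eta> r *\<^sub>R se k (x r) + 0 *\<^sub>R se k (x r)) = \<eta> r * form P (\<xi> r) (se k (x r)) + 0 * form P (\<xi> r) (se k (x r))"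
            by (rule form_linear(2)[OF q(1) m2 m2 m1])
          then have "form P (\<xi> r) (?\<sigma> r) = \<eta> r * h k r" using q(2) h[OF r k] by simp
          then show ?thesis using True q(3) by simp
        next
          case False
          then have z: "\<eta> r = 0" using \<eta>(2,3) \<eta>(4)[of r] by auto
          show ?thesis
          proof (cases "r \<in> ?I")
            case True
            have q: "x r \<in> points M" by (rule curve_in_points[OF x True])
            have m1: "\<xi> r \<in> fib (doubled P) (x r)" by (rule coords_inD(1)[OF \<xi> True])
            have "form P (\<xi> r) (0 *\<^sub>R \<xi> r + 0 *\<^sub>R \<xi> r) = 0 * form P (\<xi> r) (\<xi> r) + 0 * form P (\<xi> r) (\<xi> r)"
              by (rule form_linear(2)[OF q m1 m1 m1])
            then show ?thesis using False z by simp
          qed (use False in simp)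
        qed
      qed
      ultimately show "(LINT r:{t - d..t + d}|lebesgue. \<eta> r * h k r) = 0" by simp
    qed
    have "negligible (\<Union>k\<in>{..<?n}. {r \<in> {t - d<..<t + d}. h k r \<noteq> 0})"
      by (rule negligible_Union) (use null in auto)
    moreover have "{r \<in> {t - d<..<t + d}. r \<in> {t0<..<t1} \<and> \<xi> r \<notin> D (x r)} \<subseteq> (\<Union>k\<in>{..<?n}. {r \<in> {t - d<..<t + d}. h k r \<noteq> 0})"
    proof (rule subsetI, rule ccontr)
      fix r assume r: "r \<in> {r \<in> {t - d<..<t + d}. r \<in> {t0<..<t1} \<and> \<xi> r \<notin> D (x r)}"
        and "r \<notin> (\<Union>k\<in>{..<?n}. {r \<in> {t - d<..<t + d}. h k r \<noteq> 0})"
      then have hz: "h k r = 0" if "k < ?n" for k using that by auto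
      have "r \<in> {t - d..t + d}" using r by auto
      then have rS: "r \<in> ?S" using JS by blast
      then have q: "x r \<in> points M" "x r \<in> U" "r \<in> ?I" using curve_in_points[OF x] by auto
      have m1: "\<xi> r \<in> fib (doubled P) (x r)" by (rule coords_inD(1)[OF \<xi> q(3)])
      have Db: "basis_of ?n (\<lambda>i. se i (x r)) (D (x r))" using U(4) q(2) by blast
      have m2: "se k (x r) \<in> fib (doubled P) (x r)" if "k < ?n" for k
        using basis_of_mem[OF Db that] subbundle_mem(1)[OF DP D q(1)] by blast
      have "\<xi> r \<in> D (x r)"
      proof (rule form_maximal[OF q(1) m1])
        fix \<xi>' assume \<xi>': "\<xi>' \<in> D (x r)"
        let ?c = "coords ?n (\<lambda>i. se i (x r)) \<xi>'"
        have e: "(\<Sum>i<?n. ?c i *\<^sub>R se i (x r)) = \<xi>'" by (rule coords_sum[OF Db \<xi>'])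
        have "(\<Sum>i<?n. ?c i *\<^sub>R se i (x r)) \<in> fib (doubled P) (x r)" unfolding e using \<xi>' subbundle_mem(1)[OF DP D q(1)] by blast
        then have "form P (\<xi> r) (\<Sum>i<?n. ?c i *\<^sub>R se i (x r)) = (\<Sum>i<?n. ?c i * form P (\<xi> r) (se i (x r)))"
          using dual_space_sum[where A="{..<?n}" and b="\<lambda>i. se i (x r)" and c="?c",
              OF form_dual(2)[OF q(1) m1] framed_subspace[OF DP q(1)]] m2 by simp
        also have "\<dots> = 0" using h[OF rS] hz by simp
        finally show "form P (\<xi> r) \<xi>' = 0" unfolding e .
      qed
      then show False using r by blast
    qed
    ultimately have "negligible {r \<in> {t - d<..<t + d}. r \<in> {t0<..<t1} \<and> \<xi> r \<notin> D (x r)}" by (rule negligible_subset)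
    then show ?thesis using d(1) by blast
  qed
  \<comment> \<open>Negligibility is a local property, so small neighbourhoods of the single times
    suffice.\<close>
  have "negligible ?N"
  proof (subst locally_negligible_alt, rule ballI)
    fix t assume t: "t \<in> ?N"
    then obtain d where d: "d > 0" "negligible {r \<in> {t - d<..<t + d}. r \<in> {t0<..<t1} \<and> \<xi> r \<notin> D (x r)}" using local by blast
    have eq: "{r \<in> {t - d<..<t + d}. r \<in> {t0<..<t1} \<and> \<xi> r \<notin> D (x r)} = ?N \<inter> {t - d<..<t + d}" by blast
    show "\<exists>U. openin (top_of_set ?N) U \<and> t \<in> U \<and> negligible U"
      using d t unfolding eq by (intro exI[of _ "?N \<inter> {t - d<..<t + d}"] conjI openin_open_Int) auto
  qed
  \<comment> \<open>Test sections vanish near the end points, so nothing is known there; two points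
    do no harm.\<close>
  then have "negligible (?N \<union> {t0, t1})" by (rule negligible_Un) simp
  then show ?thesis by (rule negligible_subset) (auto simp: less_le)
qed

end

section \<open>Weak behaviours\<close>

lemma loc_integrable_uminus:
  assumes "openin (top_of_set {t0..t1}) S" "loc_integrable S f"
  shows "loc_integrable S (\<lambda>t. - f t)"
  using loc_integrable_mult[OF assms continuous_on_const[of S "-1"]] by simp

lemma coords_in_uminus:
  assumes E: "framed M E" and x: "curve_on {t0..t1} M x"
    and c: "coords_in loc_integrable {t0..t1} E x v"
  shows "coords_in loc_integrable {t0..t1} E x (\<lambda>t. - v t)"
proof (rule coords_inI)
  show "- v t \<in> fib E (x t)" if t: "t \<in> {t0..t1}" for t
    using subspace_neg[OF framed_subspace[OF E curve_in_points[OF x t]] coords_inD(1)[OF c t]] .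
  fix U b i assume fr: "(U, b) \<in> frames E" "i < rk E"
  show "loc_integrable {t \<in> {t0..t1}. x t \<in> U} (\<lambda>t. frame_coords E b (x t) (- v t) i)"
  proof (rule loc_integrable_class.cong[OF _ loc_integrable_uminus[OF openin_curve_preimage[OF x framedD(1)[OF E fr(1)]] coords_inD(2)[OF c fr]]])
    fix t assume "t \<in> {t \<in> {t0..t1}. x t \<in> U}"
    then show "- frame_coords E b (x t) (v t) i = frame_coords E b (x t) (- v t) i"
      using coords_uminus[OF framedD(2)[OF E fr(1)] coords_inD(1)[OF c]] by simp
  qed
qed

text \<open>The coordinates of the differential in the dual coordinate frame are the partial
  derivatives of \<open>H\<close> in the chart; along the curve they are continuous, hence locally
  integrable.\<close>

lemma coords_in_dfun:
  assumes M: "atlas M" and x: "curve_on {t0..t1} M x" and H: "smooth_fun M (points M) H"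
  shows "coords_in loc_integrable {t0..t1} (dual_bundle (tangent_bundle M)) x (\<lambda>t. dfun M H (x t))"
proof (rule coords_inI)
  note TM = framed_tangent[OF M]
  show "dfun M H (x t) \<in> fib (dual_bundle (tangent_bundle M)) (x t)" if t: "t \<in> {t0..t1}" for t
    using dfun_in_dual[OF M curve_in_points[OF x t]] by simp
  fix U d i assume fr': "(U, d) \<in> frames (dual_bundle (tangent_bundle M))" and "i < rk (dual_bundle (tangent_bundle M))"
  then have i: "i < mdim M" by simp
  obtain b where d: "d = (\<lambda>i p v. representation ((\<lambda>j. b j p) ` {..<rk (tangent_bundle M)}) v (b i p))"
    and fr: "(U, b) \<in> frames (tangent_bundle M)" using fr' unfolding dual_bundle_def by auto
  then obtain \<phi> where ch: "(U, \<phi>) \<in> charts M" and b: "b = coord_deriv M (U, \<phi>)" by auto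
  let ?S = "{t \<in> {t0..t1}. x t \<in> U}"
  have opS: "openin (top_of_set {t0..t1}) ?S" by (rule openin_curve_preimage[OF x atlasD(1)[OF M ch]])
  let ?f = "\<lambda>z. H (inv_into U \<phi> z)"
  show "loc_integrable ?S (\<lambda>t. frame_coords (dual_bundle (tangent_bundle M)) d (x t) (dfun M H (x t)) i)"
  proof (rule loc_integrable_class.cong[OF _ loc_integrable_continuous[OF opS]])
    have sub: "points M \<inter> U = U" using openin_subset[OF atlasD(1)[OF M ch]] by blast
    have "Ck (Suc 0) (mdim M) (\<phi> ` U) ?f" using smooth_funD[OF H ch, of "Suc 0"] unfolding sub .
    then have c: "continuous_map (subtopology (model M) (\<phi> ` U)) euclideanreal (partial i ?f)" using i by simp
    have "continuous_map (mtop_on M U) (subtopology (model M) (\<phi> ` U)) \<phi>"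
      by (rule continuous_map_into_subtopology[OF chart_continuous[OF M ch]]) auto
    from continuous_on_curve[OF x continuous_map_compose[OF this c]]
    show "continuous_on ?S (\<lambda>t. partial i ?f (\<phi> (x t)))" by (simp add: o_def)
    fix t assume "t \<in> ?S"
    then have t: "t \<in> {t0..t1}" "x t \<in> U" by auto
    have p: "x t \<in> points M" by (rule curve_in_points[OF x t(1)])
    have "frame_coords (dual_bundle (tangent_bundle M)) d (x t) (dfun M H (x t)) i = dfun M H (x t) (b i (x t))"
      using dual_frame_coords[OF TM fr t(2) dfun_in_dual[OF M p]] i unfolding d by simp
    also have "\<dots> = partial i ?f (\<phi> (x t))"
      using basis_of_mem[OF coord_basis[OF M ch t(2)] i] smooth_fun_near[OF H p]
      by (simp add: dfun_def b coord_deriv_apply)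
    finally show "partial i ?f (\<phi> (x t)) = frame_coords (dual_bundle (tangent_bundle M)) d (x t) (dfun M H (x t)) i" ..
  qed
qed

section \<open>Test functions and weak derivatives on open subsets\<close>

lemma test_function_deriv_zero:
  assumes "test_function S \<eta>"
  obtains K where "compact K" "K \<subseteq> S" "\<And>t. t \<notin> K ==> \<eta> t = 0" "\<And>t. t \<notin> K ==> deriv \<eta> t = 0"
proof -
  obtain K where K: "compact K" "K \<subseteq> S" "\<forall>t. t \<notin> K \<longrightarrow> \<eta> t = 0" using assms unfolding test_function_def by blast
  have "deriv \<eta> t = 0" if t: "t \<notin> K" for t
  proof -
    have "open (- K)" using compact_imp_closed[OF K(1)] by (rule open_Compl)
    then have "\<forall>\<^sub>F s in nhds t. s \<in> - K" using t by (intro eventually_nhds_in_open) auto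
    then have "\<forall>\<^sub>F s in nhds t. \<eta> s = 0" by (rule eventually_mono) (use K(3) in auto)
    then have "deriv \<eta> t = deriv (\<lambda>_. 0) t" by (rule deriv_cong_ev) simp
    then show ?thesis by simp
  qed
  then show ?thesis using that K by blast
qed

lemma test_function_mono: "test_function S \<eta> ==> S \<subseteq> T ==> test_function T \<eta>"
  unfolding test_function_def by (meson order_trans)

text \<open>A test function on the smaller set is one on the larger set, and it and its derivative
  vanish off a compact part of the smaller set. All integrals therefore agree, and values outside
  the smaller set may be changed at will.\<close>

lemma weak_derivative_on_mono:
  assumes w: "weak_derivative_on S u v" and sub: "S' \<subseteq> S" and eq: "\<And>t. t \<in> S' ==> u' t = u t \<and> v' t = v t"
  shows "weak_derivative_on S' u' v'"
  unfolding weak_derivative_on_def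
proof (intro conjI allI impI)
  fix K :: "real set" assume K: "compact K \<and> K \<subseteq> S'"
  then have "set_integrable lebesgue K u \<and> set_integrable lebesgue K v"
    using w sub unfolding weak_derivative_on_def by blast
  moreover have "set_integrable lebesgue K u' \<longleftrightarrow> set_integrable lebesgue K u"
    "set_integrable lebesgue K v' \<longleftrightarrow> set_integrable lebesgue K v"
    unfolding set_integrable_def by (intro Bochner_Integration.integrable_cong refl; use K eq in \<open>auto simp: indicator_def subset_iff\<close>)+
  ultimately show "set_integrable lebesgue K u'" "set_integrable lebesgue K v'" by simp_all
next
  fix \<eta> assume t: "test_function S' \<eta>"
  obtain K where K: "compact K" "K \<subseteq> S'" "\<And>t. t \<notin> K ==> \<eta> t = 0" "\<And>t. t \<notin> K ==> deriv \<eta> t = 0"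
    by (rule test_function_deriv_zero[OF t]) (rule that)
  have "(LINT t:S|lebesgue. u t * deriv \<eta> t) = - (LINT t:S|lebesgue. v t * \<eta> t)"
    using w test_function_mono[OF t sub] unfolding weak_derivative_on_def by blast
  moreover have "(LINT t:S'|lebesgue. u' t * deriv \<eta> t) = (LINT t:S|lebesgue. u t * deriv \<eta> t)"
    unfolding set_lebesgue_integral_def
  proof (rule Bochner_Integration.integral_cong[OF refl])
    fix t
    show "indicator S' t *\<^sub>R (u' t * deriv \<eta> t) = indicator S t *\<^sub>R (u t * deriv \<eta> t)"
      using K(2) K(4)[of t] sub eq[of t] by (cases "t \<in> K") (auto simp: indicator_def)
  qed
  moreover have "(LINT t:S'|lebesgue. v' t * \<eta> t) = (LINT t:S|lebesgue. v t * \<eta> t)"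
    unfolding set_lebesgue_integral_def
  proof (rule Bochner_Integration.integral_cong[OF refl])
    fix t
    show "indicator S' t *\<^sub>R (v' t * \<eta> t) = indicator S t *\<^sub>R (v t * \<eta> t)"
      using K(2) K(3)[of t] sub eq[of t] by (cases "t \<in> K") (auto simp: indicator_def)
  qed
  ultimately show "(LINT t:S'|lebesgue. u' t * deriv \<eta> t) = - (LINT t:S'|lebesgue. v' t * \<eta> t)" by simp
qed

text \<open>The converse passage: isotropy makes the integrand vanish off the null set, whatever the
  test section.\<close>

lemma weakly_in_if_pointwise:
  fixes t0 t1 :: real
  assumes iso: "\<And>t \<zeta> \<zeta>'. t \<in> {t0..t1} ==> \<zeta> \<in> D (x t) ==> \<zeta>' \<in> D (x t) ==> form P \<zeta> \<zeta>' = 0"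
    and null: "negligible N" and mem: "\<And>t. t \<in> {t0..t1} ==> t \<notin> N ==> \<xi> t \<in> D (x t)"
  shows "weakly_in M P form D t0 t1 x \<xi>"
  unfolding weakly_in_def
proof (intro allI impI, elim conjE)
  fix \<sigma> assume \<sigma>: "\<forall>t\<in>{t0..t1}. \<sigma> t \<in> D (x t)"
  show "(LINT t|lebesgue_on {t0..t1}. form P (\<xi> t) (\<sigma> t)) = 0"
  proof (rule integral_eq_zero_AE)
    have N: "N \<in> null_sets lebesgue" using null by (simp add: negligible_iff_null_sets)
    have "AE t in lebesgue. t \<notin> N" by (rule AE_not_in[OF N])
    then have "AE t in lebesgue. t \<in> {t0..t1} \<longrightarrow> form P (\<xi> t) (\<sigma> t) = 0"
      by (rule AE_mp) (intro AE_I2 impI, use iso mem \<sigma> in blast)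
    then show "AE t in lebesgue_on {t0..t1}. form P (\<xi> t) (\<sigma> t) = 0"
      by (simp add: AE_restrict_space_iff)
  qed
qed

text \<open>A weak trajectory in the form in which two of them can be combined: regularity in
  coordinates, existence of metrics, a weak derivative \<open>X\<close>, and both relations at every
  time outside one null set \<open>N\<close>.\<close>

definition weak_solution where
  "weak_solution M Er Ei Ee D R H t0 t1 x f yi ye e ui ue X N \<longleftrightarrow>
     curve_on {t0..t1} M x \<and>
     coords_in loc_integrable {t0..t1} (system_signals Er Ei Ee) x (\<lambda>t. (f t, (yi t, ye t), e t, (ui t, ue t))) \<and>
     (\<exists>g. bundle_metric M (system_signals Er Ei Ee) g) \<and>
     coords_in loc_integrable {t0..t1} (tangent_bundle M) x X \<and>
     (\<exists>g. bundle_metric M (tangent_bundle M) g) \<and>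
     weak_derivative M t0 t1 x X \<and> negligible N \<and>
     (\<forall>t\<in>{t0..t1}. t \<notin> N \<longrightarrow>
        ((X t, f t, - yi t, - ye t), (dfun M H (x t), e t, ui t, ue t)) \<in> D (x t) \<and> (f t, e t) \<in> R (x t))"

lemma weak_solutionD:
  assumes "weak_solution M Er Ei Ee D R H t0 t1 x f yi ye e ui ue X N"
  shows "curve_on {t0..t1} M x"
    "coords_in loc_integrable {t0..t1} (system_signals Er Ei Ee) x (\<lambda>t. (f t, (yi t, ye t), e t, (ui t, ue t)))"
    "\<exists>g. bundle_metric M (system_signals Er Ei Ee) g"
    "coords_in loc_integrable {t0..t1} (tangent_bundle M) x X"
    "\<exists>g. bundle_metric M (tangent_bundle M) g"
    "weak_derivative M t0 t1 x X" "negligible N"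
    "\<And>t. t \<in> {t0..t1} ==> t \<notin> N ==>
      ((X t, f t, - yi t, - ye t), (dfun M H (x t), e t, ui t, ue t)) \<in> D (x t) \<and> (f t, e t) \<in> R (x t)"
  using assms unfolding weak_solution_def by blast+

text \<open>Both relations are instances of \<open>weakly_in_pointwise\<close>, with sign 1 and -1.
  What remains is that the combined curve of velocity, signals and differential has locally
  integrable coordinates, and this splits over the summands.\<close>

lemma weak_behaviour_pointwise:
  assumes S: "ph_system M Er Ei Ee D R H"
    and \<xi>: "\<xi> \<in> weak_behaviour M (with_dual Er) (with_dual Ei \<oplus>\<^sub>d with_dual Ee) D R H t0 t1"
    and eq: "\<And>t. t \<in> {t0..t1} ==> \<xi> t = (x t, f t, (yi t, ye t), e t, (ui t, ue t))"
  shows "\<exists>X N. weak_solution M Er Ei Ee D R H t0 t1 x f yi ye e ui ue X N"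
proof -
  let ?I = "{t0..t1}"
  let ?SB = "system_signals Er Ei Ee"
  let ?P = "system_pair M Er Ei Ee"
  have M: "atlas M" using S smooth_manifold_atlas unfolding ph_system_def by blast
  have E: "framed M Er" "framed M Ei" "framed M Ee" using S vector_bundle_framed[OF M] unfolding ph_system_def by blast+
  have D: "dirac_structure M ?P D" and R: "lagrangian_subbundle M (with_dual Er) R" and H: "smooth_fun M (points M) H"
    using S unfolding ph_system_def by blast+
  have SB: "framed M ?SB" by (simp add: framed_dsum framed_dual E)
  note TM = framed_tangent[OF M]
  note sc = atlas_smooth_continuous[OF M]
  note lc = loc_integrable_class.local_class_axioms[of t0 t1]
  obtain X where L: "\<xi> \<in> L1c M ?SB t0 t1" and LX: "(\<lambda>t. (fst (\<xi> t), X t)) \<in> L1c M (tangent_bundle M) t0 t1"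
    and wd: "weak_derivative M t0 t1 (fst \<circ> \<xi>) X"
    and wD: "weakly_in M ?P sym_form D t0 t1 (fst \<circ> \<xi>)
          (\<lambda>t. case \<xi> t of (x, f, y, e, u) => ((X t, f, - y), (dfun M H x, e, u)))"
    and wR: "weakly_in M (with_dual Er) alt_form R t0 t1 (fst \<circ> \<xi>) (\<lambda>t. case \<xi> t of (x, f, y, e, u) => (f, e))"
    using \<xi> unfolding weak_behaviour_def by blast
  have x0: "curve_on ?I M (\<lambda>t. fst (\<xi> t))"
    and c0: "coords_in loc_integrable ?I ?SB (\<lambda>t. fst (\<xi> t)) (\<lambda>t. snd (\<xi> t))"
    and g0: "\<exists>g. bundle_metric M ?SB g"
    using L L1c_iff[OF SB sc, of "\<lambda>t. fst (\<xi> t)" "\<lambda>t. snd (\<xi> t)" t0 t1] by simp_all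
  have cX0: "coords_in loc_integrable ?I (tangent_bundle M) (\<lambda>t. fst (\<xi> t)) X"
    and gX: "\<exists>g. bundle_metric M (tangent_bundle M) g"
    using LX L1c_iff[OF TM sc, of "\<lambda>t. fst (\<xi> t)" X t0 t1] by simp_all
  have x: "curve_on ?I M x" by (rule continuous_map_eq[OF x0]) (use eq in simp)
  have c: "coords_in loc_integrable ?I ?SB x (\<lambda>t. (f t, (yi t, ye t), e t, (ui t, ue t)))"
    by (rule coords_in_cong[OF lc _ _ c0]) (simp_all add: eq)
  have cX: "coords_in loc_integrable ?I (tangent_bundle M) x X"
    by (rule coords_in_cong[OF lc _ _ cX0]) (simp_all add: eq)
  have parts: "coords_in loc_integrable ?I Er x f" "coords_in loc_integrable ?I Ei x yi" "coords_in loc_integrable ?I Ee x ye"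
    "coords_in loc_integrable ?I (dual_bundle Er) x e" "coords_in loc_integrable ?I (dual_bundle Ei) x ui"
    "coords_in loc_integrable ?I (dual_bundle Ee) x ue"
    using c by (simp_all add: loc_integrable_class.coords_in_dsum[OF _ _ x] framed_dsum framed_dual E)
  have cP: "coords_in loc_integrable ?I (doubled ?P) x (\<lambda>t. ((X t, f t, - yi t, - ye t), (dfun M H (x t), e t, ui t, ue t)))"
    by (simp add: loc_integrable_class.coords_in_dsum[OF _ _ x] framed_dsum framed_dual E TM parts cX
        coords_in_uminus[OF _ x] coords_in_dfun[OF M x H])
  have cR: "coords_in loc_integrable ?I (doubled (with_dual Er)) x (\<lambda>t. (f t, e t))"
    by (simp add: loc_integrable_class.coords_in_dsum[OF _ _ x] framed_dual E parts)
  have cP0: "coords_in loc_integrable ?I (doubled ?P) (fst \<circ> \<xi>) (\<lambda>t. case \<xi> t of (x, f, y, e, u) => ((X t, f, - y), (dfun M H x, e, u)))"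
    by (rule coords_in_cong[OF lc _ _ cP]) (simp_all add: eq)
  have cR0: "coords_in loc_integrable ?I (doubled (with_dual Er)) (fst \<circ> \<xi>) (\<lambda>t. case \<xi> t of (x, f, y, e, u) => (f, e))"
    by (rule coords_in_cong[OF lc _ _ cR]) (simp_all add: eq)
  have x0': "curve_on ?I M (fst \<circ> \<xi>)" using x0 by (simp add: o_def)
  have dP: "dual_framed M ?P" and dR: "dual_framed M (with_dual Er)"
    by (simp_all add: dual_framed_dsum dual_framed_with_dual E TM)
  have ND: "negligible {t \<in> ?I. (case \<xi> t of (x, f, y, e, u) => ((X t, f, - y), (dfun M H x, e, u))) \<notin> D ((fst \<circ> \<xi>) t)}"
  proof (rule weakly_in_pointwise[OF M dP _ _ _ _ x0' cP0 wD, where s=1])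
    show "sym_form ?P (f, e) (f', e') = pairing ?P e' f + 1 * pairing ?P e f'" for f e f' e' by (simp add: sym_form_apply)
    show "smooth_subbundle M (doubled ?P) (rk (primal ?P)) D" using D unfolding dirac_structure_def by blast
    show "sym_form ?P \<zeta> \<zeta>' = 0" if "p \<in> points M" "\<zeta> \<in> D p" "\<zeta>' \<in> D p" for p \<zeta> \<zeta>'
      using D that unfolding dirac_structure_def by blast
  qed simp
  have NR: "negligible {t \<in> ?I. (case \<xi> t of (x, f, y, e, u) => (f, e)) \<notin> R ((fst \<circ> \<xi>) t)}"
  proof (rule weakly_in_pointwise[OF M dR _ _ _ _ x0' cR0 wR, where s="-1"])
    show "alt_form (with_dual Er) (f, e) (f', e') = pairing (with_dual Er) e' f + (- 1) * pairing (with_dual Er) e f'" for f e f' e'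
      by (simp add: alt_form_apply)
    show "smooth_subbundle M (doubled (with_dual Er)) (rk (primal (with_dual Er))) R" using R unfolding lagrangian_subbundle_def by blast
    show "alt_form (with_dual Er) \<zeta> \<zeta>' = 0" if "p \<in> points M" "\<zeta> \<in> R p" "\<zeta>' \<in> R p" for p \<zeta> \<zeta>'
      using R that unfolding lagrangian_subbundle_def by blast
  qed simp
  let ?N = "{t \<in> ?I. (case \<xi> t of (x, f, y, e, u) => ((X t, f, - y), (dfun M H x, e, u))) \<notin> D ((fst \<circ> \<xi>) t)} \<union>
      {t \<in> ?I. (case \<xi> t of (x, f, y, e, u) => (f, e)) \<notin> R ((fst \<circ> \<xi>) t)}"
  show ?thesis
    unfolding weak_solution_def
  proof (rule exI[of _ X], rule exI[of _ "?N"], intro conjI x c g0 cX gX)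
    show "weak_derivative M t0 t1 x X"
      unfolding weak_derivative_def
    proof
      fix A assume A: "A \<in> charts M"
      obtain U \<phi> where U: "A = (U, \<phi>)" by (cases A)
      have "weak_derivative_on {t \<in> {t0<..<t1}. (fst \<circ> \<xi>) t \<in> U} (\<lambda>t. \<phi> ((fst \<circ> \<xi>) t) i) (\<lambda>t. X t (\<lambda>p. \<phi> p i))"
        if "i < mdim M" for i
        using bspec[OF wd[unfolded weak_derivative_def] A] that unfolding U by simp
      then have "weak_derivative_on {t \<in> {t0<..<t1}. x t \<in> U} (\<lambda>t. \<phi> (x t) i) (\<lambda>t. X t (\<lambda>p. \<phi> p i))" if "i < mdim M" for i
        by (rule weak_derivative_on_mono[of _ _ _ "{t \<in> {t0<..<t1}. x t \<in> U}"]) (use eq that in auto)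
      then show "case A of (U, \<phi>) => \<forall>i<mdim M. weak_derivative_on {t \<in> {t0<..<t1}. x t \<in> U} (\<lambda>t. \<phi> (x t) i) (\<lambda>t. X t (\<lambda>p. \<phi> p i))"
        unfolding U by simp
    qed
    show "negligible ?N"
      using ND NR by (rule negligible_Un)
  qed (auto simp: eq)
qed

section \<open>Weak regularity on a product\<close>

lemma coords_in_tangent_prod:
  assumes M: "atlas M" and N: "atlas N"
    and x: "curve_on {t0..t1} M x" and y: "curve_on {t0..t1} N y"
    and X: "coords_in loc_integrable {t0..t1} (tangent_bundle M) x X"
    and Y: "coords_in loc_integrable {t0..t1} (tangent_bundle N) y Y"
    and Z: "\<And>t. t \<in> {t0..t1} ==> Z t \<in> tangent_at (prod_manifold M N) (x t, y t)"
    and ZX: "\<And>t. t \<in> {t0..t1} ==> push M (x t) fst (Z t) = X t" and ZY: "\<And>t. t \<in> {t0..t1} ==> push N (y t) snd (Z t) = Y t"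
  shows "coords_in loc_integrable {t0..t1} (tangent_bundle (prod_manifold M N)) (\<lambda>t. (x t, y t)) Z"
proof -
  note T = framed_tangent[OF M] framed_tangent[OF N] and P = atlas_prod[OF M N]
  note lc = loc_integrable_class.local_class_axioms[of t0 t1]
  have c: "coords_in loc_integrable {t0..t1} (tangent_bundle M \<times>\<^sub>b tangent_bundle N) (\<lambda>t. (x t, y t))
      (\<lambda>t. split_tangent M N (x t, y t) (Z t))"
    by (rule coords_in_cong[OF lc _ _ loc_integrable_class.coords_in_prod[OF T x y X Y]]) (simp_all add: split_tangent_def ZX ZY)
  show ?thesis
    by (rule coords_in_pullback[where x="\<lambda>t. (x t, y t)" and v=Z and T="split_tangent M N",
          OF lc framed_tangent[OF P] framed_prod[OF T] frame_preserving_split[OF M N] _ c]) (rule Z)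
qed

text \<open>Each coordinate function of a product chart depends on one factor, so \<open>Z\<close>
  acts on it through a projection. The domain of a product chart only shrinks the set of times,
  which \<open>weak_derivative_on_mono\<close> allows.\<close>

lemma weak_derivative_prod:
  assumes M: "atlas M" and N: "atlas N" and X: "weak_derivative M t0 t1 x X" and Y: "weak_derivative N t0 t1 y Y"
    and ZX: "\<And>t. t \<in> {t0..t1} ==> push M (x t) fst (Z t) = X t" and ZY: "\<And>t. t \<in> {t0..t1} ==> push N (y t) snd (Z t) = Y t"
    and z: "\<And>t. t \<in> {t0..t1} ==> z t = (x t, y t)"
  shows "weak_derivative (prod_manifold M N) t0 t1 z Z"
  unfolding weak_derivative_def
proof
  have X': "weak_derivative_on {t \<in> {t0<..<t1}. x t \<in> U} (\<lambda>t. \<phi> (x t) i) (\<lambda>t. X t (\<lambda>p. \<phi> p i))"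
    if "(U, \<phi>) \<in> charts M" "i < mdim M" for U \<phi> i using X that unfolding weak_derivative_def by blast
  have Y': "weak_derivative_on {t \<in> {t0<..<t1}. y t \<in> U} (\<lambda>t. \<phi> (y t) i) (\<lambda>t. Y t (\<lambda>p. \<phi> p i))"
    if "(U, \<phi>) \<in> charts N" "i < mdim N" for U \<phi> i using Y that unfolding weak_derivative_def by blast
  fix A assume A: "A \<in> charts (prod_manifold M N)"
  obtain U \<phi> V \<psi> where ch: "(U, \<phi>) \<in> charts M" "(V, \<psi>) \<in> charts N"
    and eq: "A = (U \<times> V, \<lambda>(p, q) i. if i < mdim M then \<phi> p i else \<psi> q (i - mdim M))"
    by (rule prod_manifold_chart[OF A])
  let ?\<kappa> = "\<lambda>(p, q) i. if i < mdim M then \<phi> p i else \<psi> q (i - mdim M)"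
  have "weak_derivative_on {t \<in> {t0<..<t1}. z t \<in> U \<times> V} (\<lambda>t. ?\<kappa> (z t) i) (\<lambda>t. Z t (\<lambda>p. ?\<kappa> p i))"
    if i: "i < mdim M + mdim N" for i
  proof (cases "i < mdim M")
    case True
    show ?thesis
    proof (rule weak_derivative_on_mono[OF X'[OF ch(1) True]])
      show "{t \<in> {t0<..<t1}. z t \<in> U \<times> V} \<subseteq> {t \<in> {t0<..<t1}. x t \<in> U}" using z by auto
      fix t assume "t \<in> {t \<in> {t0<..<t1}. z t \<in> U \<times> V}"
      then have t: "t \<in> {t0..t1}" "x t \<in> U" using z by auto
      have "X t (\<lambda>p. \<phi> p i) = push M (x t) fst (Z t) (\<lambda>p. \<phi> p i)" using ZX[OF t(1)] by simp
      also have "\<dots> = Z t (\<lambda>p. ?\<kappa> p i)"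
        using smooth_near_chart[OF M ch(1) t(2) True] True by (simp add: push_def o_def case_prod_unfold)
      finally show "?\<kappa> (z t) i = \<phi> (x t) i \<and> Z t (\<lambda>p. ?\<kappa> p i) = X t (\<lambda>p. \<phi> p i)" using True z[OF t(1)] by simp
    qed
  next
    case False
    then have i': "i - mdim M < mdim N" using i by simp
    show ?thesis
    proof (rule weak_derivative_on_mono[OF Y'[OF ch(2) i']])
      show "{t \<in> {t0<..<t1}. z t \<in> U \<times> V} \<subseteq> {t \<in> {t0<..<t1}. y t \<in> V}" using z by auto
      fix t assume "t \<in> {t \<in> {t0<..<t1}. z t \<in> U \<times> V}"
      then have t: "t \<in> {t0..t1}" "y t \<in> V" using z by auto
      have "Y t (\<lambda>p. \<psi> p (i - mdim M)) = push N (y t) snd (Z t) (\<lambda>p. \<psi> p (i - mdim M))" using ZY[OF t(1)] by simp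
      also have "\<dots> = Z t (\<lambda>p. ?\<kappa> p i)"
        using smooth_near_chart[OF N ch(2) t(2) i'] False by (simp add: push_def o_def case_prod_unfold)
      finally show "?\<kappa> (z t) i = \<psi> (y t) (i - mdim M) \<and> Z t (\<lambda>p. ?\<kappa> p i) = Y t (\<lambda>p. \<psi> p (i - mdim M))" using False z[OF t(1)] by simp
    qed
  qed
  then show "case A of (U, \<phi>) => \<forall>i<mdim (prod_manifold M N). weak_derivative_on {t \<in> {t0<..<t1}. z t \<in> U} (\<lambda>t. \<phi> (z t) i) (\<lambda>t. Z t (\<lambda>p. \<phi> p i))"
    unfolding eq prod.case[of _ "U \<times> V"] prod_manifold_sel by blast
qed

lemma signal_metric_components:
  assumes M: "atlas M" and E: "framed M Er" "framed M Ei" "framed M Ee"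
    and g: "bundle_metric M (system_signals Er Ei Ee) g"
  shows "(\<exists>g. bundle_metric M Er g) \<and> (\<exists>g. bundle_metric M Ei g) \<and>
      (\<exists>g. bundle_metric M (dual_bundle Er) g) \<and> (\<exists>g. bundle_metric M (dual_bundle Ei) g)"
proof -
  note g' = g[unfolded dsum_pair_sel with_dual_sel]
  note f1 = framed_dsum[OF E(2,3)] and f2 = framed_dual[OF E(1)] and f3 = framed_dsum[OF framed_dual[OF E(2)] framed_dual[OF E(3)]]
  note r1 = bundle_metric_snd[OF M E(1) framed_dsum[OF f1 framed_dsum[OF f2 f3]] g']
  note r2 = bundle_metric_snd[OF M f1 framed_dsum[OF f2 f3] r1]
  note r3 = bundle_metric_snd[OF M f2 f3 r2]
  show ?thesis
    using bundle_metric_fst[OF M E(1) framed_dsum[OF f1 framed_dsum[OF f2 f3]] g']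
      bundle_metric_fst[OF M E(2,3) bundle_metric_fst[OF M f1 framed_dsum[OF f2 f3] r1]]
      bundle_metric_fst[OF M f2 f3 r2]
      bundle_metric_fst[OF M framed_dual[OF E(2)] framed_dual[OF E(3)] r3] by blast
qed

text \<open>The composite groups the bundles in another order and lacks the eliminated ports. The
  given metrics are therefore restricted to the single summands and recombined by products and
  orthogonal sums.\<close>

lemma signal_metric_prod:
  assumes M1: "atlas M1" and M2: "atlas M2"
    and E: "framed M1 Er1" "framed M1 Ei1" "framed M1 Ee1" "framed M2 Er2" "framed M2 Ei2" "framed M2 Ee2"
    and g1: "bundle_metric M1 (system_signals Er1 Ei1 Ee1) g1"
    and g2: "bundle_metric M2 (system_signals Er2 Ei2 Ee2) g2"
  shows "\<exists>g. bundle_metric (prod_manifold M1 M2) (composite_signals Er1 Ei1 Er2 Ei2) g"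
proof -
  from signal_metric_components[OF M1 E(1-3) g1] obtain a1 b1 c1 d1 where a: "bundle_metric M1 Er1 a1" "bundle_metric M1 Ei1 b1"
    "bundle_metric M1 (dual_bundle Er1) c1" "bundle_metric M1 (dual_bundle Ei1) d1" by blast
  from signal_metric_components[OF M2 E(4-6) g2] obtain a2 b2 c2 d2 where b: "bundle_metric M2 Er2 a2" "bundle_metric M2 Ei2 b2"
    "bundle_metric M2 (dual_bundle Er2) c2" "bundle_metric M2 (dual_bundle Ei2) d2" by blast
  note m = bundle_metric_prod[OF M1 M2]
  note P = atlas_prod[OF M1 M2]
  note fE = framed_prod[OF E(1,4)] framed_prod[OF E(2,5)] framed_prod[OF framed_dual[OF E(1)] framed_dual[OF E(4)]]
    framed_prod[OF framed_dual[OF E(2)] framed_dual[OF E(5)]]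
  note k1 = m[OF E(1,4) a(1) b(1)] and k2 = m[OF E(2,5) a(2) b(2)]
    and k3 = m[OF framed_dual[OF E(1)] framed_dual[OF E(4)] a(3) b(3)]
    and k4 = m[OF framed_dual[OF E(2)] framed_dual[OF E(5)] a(4) b(4)]
  note n3 = bundle_metric_dsum[OF P fE(3,4) k3 k4]
  note n2 = bundle_metric_dsum[OF P fE(2) framed_dsum[OF fE(3,4)] k2 n3]
  note n1 = bundle_metric_dsum[OF P fE(1) framed_dsum[OF fE(2) framed_dsum[OF fE(3,4)]] k1 n2]
  show ?thesis unfolding dsum_pair_sel prod_pair_sel with_dual_sel by (rule exI, rule n1)
qed

text \<open>Each part is lowered to its pointwise relation outside a null set, the fibres are
  interconnected there, and isotropy of the composite relation leads back to the weak sense.\<close>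

lemma weak_inclusion:
  assumes S1: "ph_system M1 Er1 Ei1 Ee1 D1 R1 H1" and S2: "ph_system M2 Er2 Ei2 Ee2 D2 R2 H2"
    and Di: "dirac_structure (prod_manifold M1 M2) (with_dual Ee1 \<times>\<^sub>d with_dual Ee2) Dint"
  shows "interconnected_behaviours Weak M1 Er1 Ei1 Ee1 D1 R1 H1 M2 Er2 Ei2 Ee2 D2 R2 H2 Dint t0 t1
        \<subseteq> behaviour_of_interconnection Weak M1 Er1 Ei1 D1 R1 H1 M2 Er2 Ei2 D2 R2 H2 Dint t0 t1"
proof
  let ?I = "{t0..t1}" and ?P = "prod_manifold M1 M2"
  fix \<xi> assume "\<xi> \<in> interconnected_behaviours Weak M1 Er1 Ei1 Ee1 D1 R1 H1 M2 Er2 Ei2 Ee2 D2 R2 H2 Dint t0 t1"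
  then have x: "\<xi> \<in> behaviour_interconnection Dint
       (weak_behaviour M1 (with_dual Er1) (with_dual Ei1 \<oplus>\<^sub>d with_dual Ee1) D1 R1 H1 t0 t1)
       (weak_behaviour M2 (with_dual Er2) (with_dual Ei2 \<oplus>\<^sub>d with_dual Ee2) D2 R2 H2 t0 t1) t0 t1"
    by (simp add: interconnected_behaviours_def behaviour_def)
  have M1: "atlas M1" and M2: "atlas M2" using S1 S2 smooth_manifold_atlas unfolding ph_system_def by blast+
  have E: "framed M1 Er1" "framed M1 Ei1" "framed M1 Ee1" "framed M2 Er2" "framed M2 Ei2" "framed M2 Ee2"
    using S1 S2 vector_bundle_framed[OF M1] vector_bundle_framed[OF M2] unfolding ph_system_def by blast+
  have H: "smooth_fun M1 (points M1) H1" "smooth_fun M2 (points M2) H2" using S1 S2 unfolding ph_system_def by blast+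
  let ?SB = "composite_signals Er1 Ei1 Er2 Ei2"
  have SB: "framed ?P ?SB" by (simp_all add: framed_dsum framed_dual framed_prod E)
  note PM = atlas_prod[OF M1 M2]
  note lc = loc_integrable_class.local_class_axioms[of t0 t1]
  obtain x1 x2 f1 f2 y1 y2 e1 e2 u1 u2 y1' y2' u1' u2' where
    xi: "\<xi> = (\<lambda>t\<in>?I. ((x1 t, x2 t), (f1 t, f2 t), (y1 t, y2 t), (e1 t, e2 t), (u1 t, u2 t)))"
    and Dt: "\<And>t. t \<in> ?I ==> ((y1' t, y2' t), (u1' t, u2' t)) \<in> Dint (x1 t, x2 t)"
    and B1: "(\<lambda>t\<in>?I. (x1 t, f1 t, (y1 t, - y1' t), e1 t, (u1 t, u1' t))) \<in>
      weak_behaviour M1 (with_dual Er1) (with_dual Ei1 \<oplus>\<^sub>d with_dual Ee1) D1 R1 H1 t0 t1"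
    and B2: "(\<lambda>t\<in>?I. (x2 t, f2 t, (y2 t, - y2' t), e2 t, (u2 t, u2' t))) \<in>
      weak_behaviour M2 (with_dual Er2) (with_dual Ei2 \<oplus>\<^sub>d with_dual Ee2) D2 R2 H2 t0 t1"
    by (rule interconnectedE[OF x]) (rule that)
  obtain X1 N1 where "weak_solution M1 Er1 Ei1 Ee1 D1 R1 H1 t0 t1 x1 f1 y1 (\<lambda>t. - y1' t) e1 u1 u1' X1 N1"
    using weak_behaviour_pointwise[OF S1 B1, of x1 f1 y1 "\<lambda>t. - y1' t" e1 u1 u1'] by auto
  note b1 = weak_solutionD[OF this]
  obtain X2 N2 where "weak_solution M2 Er2 Ei2 Ee2 D2 R2 H2 t0 t1 x2 f2 y2 (\<lambda>t. - y2' t) e2 u2 u2' X2 N2"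
    using weak_behaviour_pointwise[OF S2 B2, of x2 f2 y2 "\<lambda>t. - y2' t" e2 u2 u2'] by auto
  note b2 = weak_solutionD[OF this]
  \<comment> \<open>The tangent vector of the product whose two projections are the weak derivatives
    of the parts.\<close>
  define Z where "Z t = push ?P (x1 t, x2 t) (\<lambda>p'. (p', x2 t)) (X1 t) + push ?P (x1 t, x2 t) (\<lambda>q'. (x1 t, q')) (X2 t)" for t
  have pq: "x1 t \<in> points M1" "x2 t \<in> points M2" if "t \<in> ?I" for t
    using curve_in_points[OF b1(1) that] curve_in_points[OF b2(1) that] .
  have XX: "X1 t \<in> tangent_at M1 (x1 t)" "X2 t \<in> tangent_at M2 (x2 t)" if "t \<in> ?I" for t
    using coords_inD(1)[OF b1(4) that] coords_inD(1)[OF b2(4) that] .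
  have Z1: "push M1 (x1 t) fst (Z t) = X1 t" and Z2: "push M2 (x2 t) snd (Z t) = X2 t"
    and ZT: "Z t \<in> tangent_at ?P (x1 t, x2 t)" if t: "t \<in> ?I" for t
  proof -
    note pt = push_tangent[OF M1 M2 pq[OF t]]
    show "push M1 (x1 t) fst (Z t) = X1 t" unfolding Z_def by (rule pt(6)[OF XX[OF t]])
    show "push M2 (x2 t) snd (Z t) = X2 t" unfolding Z_def by (rule pt(7)[OF XX[OF t]])
    have "(x1 t, x2 t) \<in> points ?P" using pq[OF t] by simp
    then show "Z t \<in> tangent_at ?P (x1 t, x2 t)"
      unfolding Z_def by (intro subspace_add framed_subspace[OF framed_tangent[OF PM]] pt(1)[OF XX(1)[OF t]] pt(2)[OF XX(2)[OF t]])
  qed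
  have xp: "curve_on ?I ?P (\<lambda>t. (x1 t, x2 t))"
    using b1(1) b2(1) by (simp add: continuous_map_pairwise o_def)
  have fx: "fst (\<xi> t) = (x1 t, x2 t)" if "t \<in> ?I" for t using that by (simp add: xi)
  have xp': "curve_on ?I ?P (\<lambda>t. fst (\<xi> t))"
    by (rule continuous_map_eq[OF xp]) (use fx in simp)
  have csig: "coords_in loc_integrable ?I ?SB (\<lambda>t. fst (\<xi> t)) (\<lambda>t. snd (\<xi> t))"
    by (rule coords_in_cong[OF lc _ _ signal_coords_prod[OF lc E b1(1) b2(1) b1(2) b2(2)]]) (simp_all add: xi)
  have cZ: "coords_in loc_integrable ?I (tangent_bundle ?P) (\<lambda>t. fst (\<xi> t)) Z"
    by (rule coords_in_cong[OF lc _ _ coords_in_tangent_prod[OF M1 M2 b1(1) b2(1) b1(4) b2(4) ZT Z1 Z2]]) (simp_all add: fx)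
  have gsig: "\<exists>g. bundle_metric ?P ?SB g" using b1(3) b2(3) signal_metric_prod[OF M1 M2 E] by blast
  have gZ: "\<exists>g. bundle_metric ?P (tangent_bundle ?P) g" using b1(5) b2(5) bundle_metric_tangent_prod[OF M1 M2] by blast
  have L: "(\<lambda>t. (fst (\<xi> t), snd (\<xi> t))) \<in> L1c ?P ?SB t0 t1"
    unfolding L1c_iff[OF SB atlas_smooth_continuous[OF PM]] using xp' csig gsig by blast
  have LZ: "(\<lambda>t. (fst (\<xi> t), Z t)) \<in> L1c ?P (tangent_bundle ?P) t0 t1"
    unfolding L1c_iff[OF framed_tangent[OF PM] atlas_smooth_continuous[OF PM]] using xp' cZ gZ by blast
  have wd: "weak_derivative ?P t0 t1 (fst \<circ> \<xi>) Z"
    by (rule weak_derivative_prod[OF M1 M2 b1(6) b2(6)]) (simp_all add: Z1 Z2 fx)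
  have iso1: "\<And>t \<zeta> \<zeta>'. t \<in> ?I ==> \<zeta> \<in> D1 (x1 t) ==> \<zeta>' \<in> D1 (x1 t) ==> sym_form (system_pair M1 Er1 Ei1 Ee1) \<zeta> \<zeta>' = 0"
    using S1 pq(1) unfolding ph_system_def dirac_structure_def by blast
  have iso2: "\<And>t \<zeta> \<zeta>'. t \<in> ?I ==> \<zeta> \<in> D2 (x2 t) ==> \<zeta>' \<in> D2 (x2 t) ==> sym_form (system_pair M2 Er2 Ei2 Ee2) \<zeta> \<zeta>' = 0"
    using S2 pq(2) unfolding ph_system_def dirac_structure_def by blast
  have isoi: "sym_form (with_dual Ee1 \<times>\<^sub>d with_dual Ee2) \<zeta> \<zeta>' = 0"
    if "t \<in> ?I" "\<zeta> \<in> Dint (x1 t, x2 t)" "\<zeta>' \<in> Dint (x1 t, x2 t)" for t \<zeta> \<zeta>'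
  proof -
    have "(x1 t, x2 t) \<in> points ?P" using pq[OF that(1)] by simp
    then show ?thesis using Di that(2,3) unfolding dirac_structure_def by blast
  qed
  have isoR: "alt_form (with_dual Er1) \<zeta> \<zeta>' = 0" if "t \<in> ?I" "\<zeta> \<in> R1 (x1 t)" "\<zeta>' \<in> R1 (x1 t)" for t \<zeta> \<zeta>'
    using S1 pq(1)[OF that(1)] that(2,3) unfolding ph_system_def lagrangian_subbundle_def by blast
  have isoR': "alt_form (with_dual Er2) \<zeta> \<zeta>' = 0" if "t \<in> ?I" "\<zeta> \<in> R2 (x2 t)" "\<zeta>' \<in> R2 (x2 t)" for t \<zeta> \<zeta>'
    using S2 pq(2)[OF that(1)] that(2,3) unfolding ph_system_def lagrangian_subbundle_def by blast
  have n12: "negligible (N1 \<union> N2)" using b1(7) b2(7) by (rule negligible_Un)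
  have wD: "weakly_in ?P (composite_pair M1 Er1 Ei1 M2 Er2 Ei2) sym_form
      (dirac_interconnection M1 M2 Dint D1 D2) t0 t1 (fst \<circ> \<xi>)
      (\<lambda>t. case \<xi> t of (x, f, y, e, u) => ((Z t, f, - y), (dfun ?P (\<lambda>(x1, x2). H1 x1 + H2 x2) x, e, u)))"
  proof (rule weakly_in_if_pointwise[OF _ n12])
    fix t \<zeta> \<zeta>' assume t: "t \<in> ?I" and z: "\<zeta> \<in> dirac_interconnection M1 M2 Dint D1 D2 ((fst \<circ> \<xi>) t)"
      "\<zeta>' \<in> dirac_interconnection M1 M2 Dint D1 D2 ((fst \<circ> \<xi>) t)"
    show "sym_form (composite_pair M1 Er1 Ei1 M2 Er2 Ei2) \<zeta> \<zeta>' = 0"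
      by (rule interconnection_isotropic[OF M1 M2 pq[OF t] iso1[OF t] iso2[OF t] isoi[OF t]])
        (use z fx[OF t] in simp_all)
  next
    fix t assume t: "t \<in> ?I" "t \<notin> N1 \<union> N2"
    have d1: "((X1 t, f1 t, - y1 t, y1' t), (dfun M1 H1 (x1 t), e1 t, u1 t, u1' t)) \<in> D1 (x1 t)" using b1(8)[OF t(1)] t(2) by simp
    have d2: "((X2 t, f2 t, - y2 t, y2' t), (dfun M2 H2 (x2 t), e2 t, u2 t, u2' t)) \<in> D2 (x2 t)" using b2(8)[OF t(1)] t(2) by simp
    have "((Z t, (f1 t, f2 t), (- y1 t, - y2 t)), (dfun ?P (\<lambda>(x1, x2). H1 x1 + H2 x2) (x1 t, x2 t), (e1 t, e2 t), (u1 t, u2 t)))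
       \<in> dirac_interconnection M1 M2 Dint D1 D2 (x1 t, x2 t)"
      by (rule interconnectionI[where Dint=Dint and ?D1.0=D1 and ?D2.0=D2, OF M1 M2 H pq[OF t(1)] ZT[OF t(1)] Z1[OF t(1)] Z2[OF t(1)] Dt[OF t(1)] d1 d2])
    then show "(case \<xi> t of (x, f, y, e, u) => ((Z t, f, - y), (dfun ?P (\<lambda>(x1, x2). H1 x1 + H2 x2) x, e, u)))
       \<in> dirac_interconnection M1 M2 Dint D1 D2 ((fst \<circ> \<xi>) t)" using t(1) by (simp add: xi)
  qed
  have wR: "weakly_in ?P (with_dual Er1 \<times>\<^sub>d with_dual Er2) alt_form (box_sum R1 R2) t0 t1 (fst \<circ> \<xi>)
      (\<lambda>t. case \<xi> t of (x, f, y, e, u) => (f, e))"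
  proof (rule weakly_in_if_pointwise[OF _ n12])
    fix t \<zeta> \<zeta>' assume t: "t \<in> ?I" and z: "\<zeta> \<in> box_sum R1 R2 ((fst \<circ> \<xi>) t)" "\<zeta>' \<in> box_sum R1 R2 ((fst \<circ> \<xi>) t)"
    then obtain a1 a2 b1 b2 a1' a2' b1' b2' where "\<zeta> = ((a1, a2), (b1, b2))" "(a1, b1) \<in> R1 (x1 t)" "(a2, b2) \<in> R2 (x2 t)"
      "\<zeta>' = ((a1', a2'), (b1', b2'))" "(a1', b1') \<in> R1 (x1 t)" "(a2', b2') \<in> R2 (x2 t)"
      using fx[OF t] unfolding box_sum_def by auto
    then show "alt_form (with_dual Er1 \<times>\<^sub>d with_dual Er2) \<zeta> \<zeta>' = 0"
      using isoR[OF t, of "(a1, b1)" "(a1', b1')"] isoR'[OF t, of "(a2, b2)" "(a2', b2')"] by (simp add: alt_form_apply)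
  next
    fix t assume t: "t \<in> ?I" "t \<notin> N1 \<union> N2"
    then show "(case \<xi> t of (x, f, y, e, u) => (f, e)) \<in> box_sum R1 R2 ((fst \<circ> \<xi>) t)"
      using b1(8)[OF t(1)] b2(8)[OF t(1)] by (simp add: xi box_sum_def)
  qed
  have ext: "\<xi> \<in> extensional ?I" unfolding xi by simp
  show "\<xi> \<in> behaviour_of_interconnection Weak M1 Er1 Ei1 D1 R1 H1 M2 Er2 Ei2 D2 R2 H2 Dint t0 t1"
    unfolding behaviour_of_interconnection_def behaviour_def regime.case weak_behaviour_def
    by (intro CollectI conjI ext exI[of _ Z] LZ wd wD wR) (use L in simp)
qed

theorem inclusion:
  assumes "ph_system M1 Er1 Ei1 Ee1 D1 R1 H1" "ph_system M2 Er2 Ei2 Ee2 D2 R2 H2"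
    "dirac_structure (prod_manifold M1 M2) (with_dual Ee1 \<times>\<^sub>d with_dual Ee2) Dint" "t0 < t1"
  shows "interconnected_behaviours \<tau> M1 Er1 Ei1 Ee1 D1 R1 H1 M2 Er2 Ei2 Ee2 D2 R2 H2 Dint t0 t1
        \<subseteq> behaviour_of_interconnection \<tau> M1 Er1 Ei1 D1 R1 H1 M2 Er2 Ei2 D2 R2 H2 Dint t0 t1"
  using classical_inclusion[OF assms(1,2,4)] weak_inclusion[OF assms(1-3)] by (cases \<tau>) simp_all

section \<open>Globally framed bundles\<close>

text \<open>Parallelisable in a strict sense: one global frame is the only frame, so smoothness of
  sections and metrics is checked in that frame alone.\<close>

definition parallel :: "'m manifold => ('m, 'v::real_vector) vbundle => bool" where
  "parallel M E \<longleftrightarrow> framed M E \<and> (\<exists>b. frames E = {(points M, b)})"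

lemma parallelD:
  assumes "parallel M E"
  obtains b where "framed M E" "frames E = {(points M, b)}" "\<And>p. p \<in> points M ==> basis_of (rk E) (\<lambda>i. b i p) (fib E p)"
proof -
  obtain b where b: "frames E = {(points M, b)}" and E: "framed M E" using assms unfolding parallel_def by blast
  show ?thesis by (rule that[OF E b]) (rule framedD(2)[OF E, of "points M" b], simp_all add: b)
qed

lemma parallel_dsum:
  assumes "parallel M E" "parallel M F"
  shows "parallel M (E \<oplus>\<^sub>b F)"
proof -
  obtain b where b: "frames E = {(points M, b)}" and E: "framed M E" using assms(1) unfolding parallel_def by blast
  obtain c where c: "frames F = {(points M, c)}" and F: "framed M F" using assms(2) unfolding parallel_def by blast
  have "frames (E \<oplus>\<^sub>b F) = {(points M, sum_frame E b c)}"
    by (auto simp: dsum_bundle_def b c)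
  then show ?thesis unfolding parallel_def using framed_dsum[OF E F] by blast
qed

lemma parallel_prod:
  assumes "parallel M E" "parallel N F"
  shows "parallel (prod_manifold M N) (E \<times>\<^sub>b F)"
proof -
  obtain b where b: "frames E = {(points M, b)}" and E: "framed M E" using assms(1) unfolding parallel_def by blast
  obtain c where c: "frames F = {(points N, c)}" and F: "framed N F" using assms(2) unfolding parallel_def by blast
  have "frames (E \<times>\<^sub>b F) = {(points M \<times> points N, prod_frame E b c)}"
    by (auto simp: prod_bundle_def b c)
  then show ?thesis unfolding parallel_def using framed_prod[OF E F] by simp
qed

lemma parallel_dual:
  assumes "parallel M E"
  shows "parallel M (dual_bundle E)"
proof -
  obtain b where b: "frames E = {(points M, b)}" and E: "framed M E" using assms(1) unfolding parallel_def by blast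
  have "frames (dual_bundle E) = {(points M, \<lambda>i p v. representation ((\<lambda>j. b j p) ` {..<rk E}) v (b i p))}"
    by (auto simp: dual_bundle_def b)
  then show ?thesis unfolding parallel_def using framed_dual[OF E] by blast
qed

lemma parallel_tangent:
  assumes M: "atlas M" and "charts M = {(points M, \<phi>)}"
  shows "parallel M (tangent_bundle M)"
  unfolding parallel_def using framed_tangent[OF M] assms(2) by simp

lemma smooth_section_comb:
  assumes "frames E = {(points M, b)}" "\<And>i. i < rk E ==> smooth_fun M (points M) (f i)"
  shows "smooth_section M E (points M) (\<lambda>p. \<Sum>i<rk E. f i p *\<^sub>R b i p)"
  unfolding smooth_section_def assms(1) using assms(2) by auto

lemma smooth_section_frame:
  assumes b: "frames E = {(points M, b)}" and i: "i < rk E"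
  shows "smooth_section M E (points M) (b i)"
proof -
  have "(\<Sum>j<rk E. (if j = i then 1 else 0) *\<^sub>R b j p) = b i p" for p
    using i by (simp add: if_distrib[of "\<lambda>r. r *\<^sub>R _"] cong: if_cong)
  then have "b i = (\<lambda>p. \<Sum>j<rk E. (if j = i then 1 else 0) *\<^sub>R b j p)" by simp
  then show ?thesis
    using smooth_section_comb[of E M b "\<lambda>j _. if j = i then 1 else 0", OF b smooth_fun_const] by simp
qed

lemma smooth_section_zero: "smooth_section M E U (\<lambda>_. 0)"
  unfolding smooth_section_def by (auto intro!: exI[of _ "\<lambda>_ _. 0"] smooth_fun_const)

lemma smooth_section_dsum:
  assumes v: "smooth_section M E U v" and w: "smooth_section M F U w"
  shows "smooth_section M (E \<oplus>\<^sub>b F) U (\<lambda>p. (v p, w p))"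
  unfolding smooth_section_def
proof
  fix X assume "X \<in> frames (E \<oplus>\<^sub>b F)"
  then obtain V b W c where fr: "(V, b) \<in> frames E" "(W, c) \<in> frames F"
    and X: "X = (V \<inter> W, sum_frame E b c)"
    unfolding dsum_bundle_def by auto
  obtain \<alpha> where \<alpha>: "\<forall>i<rk E. smooth_fun M (U \<inter> V) (\<alpha> i)" "\<forall>p \<in> U \<inter> V. v p = (\<Sum>i<rk E. \<alpha> i p *\<^sub>R b i p)"
    using bspec[OF v[unfolded smooth_section_def] fr(1)] by auto
  obtain \<beta> where \<beta>: "\<forall>i<rk F. smooth_fun M (U \<inter> W) (\<beta> i)" "\<forall>p \<in> U \<inter> W. w p = (\<Sum>i<rk F. \<beta> i p *\<^sub>R c i p)"
    using bspec[OF w[unfolded smooth_section_def] fr(2)] by auto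
  define \<gamma> where "\<gamma> i = (if i < rk E then \<alpha> i else \<beta> (i - rk E))" for i
  have s: "smooth_fun M (U \<inter> (V \<inter> W)) (\<gamma> i)" if i: "i < rk (E \<oplus>\<^sub>b F)" for i
  proof (cases "i < rk E")
    case True
    then show ?thesis unfolding \<gamma>_def using \<alpha>(1) by (simp add: smooth_fun_subset[of M "U \<inter> V" _ "U \<inter> (V \<inter> W)"] le_infI2)
  next
    case False
    then have "i - rk E < rk F" using i by simp
    then show ?thesis unfolding \<gamma>_def using False \<beta>(1) by (auto intro: smooth_fun_subset)
  qed
  have "(v p, w p) = (\<Sum>i<rk (E \<oplus>\<^sub>b F). \<gamma> i p *\<^sub>R (if i < rk E then (b i p, 0) else (0, c (i - rk E) p)))"
    if "p \<in> U \<inter> (V \<inter> W)" for p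
    unfolding dsum_bundle_sel sum_append_frame[of "\<lambda>i. \<gamma> i p" _ "\<lambda>i. b i p" "\<lambda>i. c i p"]
    using that \<alpha>(2) \<beta>(2) by (auto simp: \<gamma>_def intro!: sum.cong)
  with s show "case X of (V, b) => \<exists>c. (\<forall>i<rk (E \<oplus>\<^sub>b F). smooth_fun M (U \<inter> V) (c i)) \<and>
        (\<forall>p \<in> U \<inter> V. (v p, w p) = (\<Sum>i<rk (E \<oplus>\<^sub>b F). c i p *\<^sub>R b i p))"
    unfolding X prod.case by (intro exI[of _ \<gamma>] conjI allI ballI impI)
qed

text \<open>The first summand, embedded with second component 0, is spanned by the global frame. The
  flat Dirac structure, the resistive relations, the interconnection constraint and the composite
  are all of this kind.\<close>

lemma parallel_subbundle:
  fixes F :: "('m, 'c::real_vector) vbundle"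
  assumes E: "parallel M E"
  shows "smooth_subbundle M (E \<oplus>\<^sub>b F) (rk E) (\<lambda>p. fib E p \<times> {0})"
proof (rule parallelD[OF E])
  fix b assume b: "frames E = {(points M, b)}" "\<And>p. p \<in> points M ==> basis_of (rk E) (\<lambda>i. b i p) (fib E p)"
  have sec: "smooth_section M (E \<oplus>\<^sub>b F) (points M) (\<lambda>p. (b i p, 0))" if "i < rk E" for i
    by (rule smooth_section_dsum[OF smooth_section_frame[OF b(1) that] smooth_section_zero])
  have bas: "basis_of (rk E) (\<lambda>i. (b i p, 0::'c)) (fib E p \<times> {0})" if "p \<in> points M" for p
  proof -
    have "basis_of 0 (\<lambda>_. 0) {0::'c}" by (simp add: basis_of_def independent_empty)
    from basis_of_append[OF b(2)[OF that] this] have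
      1: "basis_of (rk E) (\<lambda>i. if i < rk E then (b i p, 0::'c) else (0, 0)) (fib E p \<times> {0})" by simp
    show ?thesis by (rule iffD1[OF basis_of_cong 1]) simp
  qed
  show ?thesis unfolding smooth_subbundle_def
    by (intro ballI exI[of _ "points M"] exI[of _ "\<lambda>i p. (b i p, 0)"] conjI allI impI openin_topspace sec bas)
qed

text \<open>The metric that makes the global frame orthonormal; its Gram matrix is constant.\<close>

lemma parallel_metric:
  assumes M: "atlas M" and E: "parallel M E"
  shows "\<exists>g. bundle_metric M E g"
proof (rule parallelD[OF E])
  fix b assume b: "frames E = {(points M, b)}" "\<And>p. p \<in> points M ==> basis_of (rk E) (\<lambda>i. b i p) (fib E p)"
  let ?c = "\<lambda>p v. frame_coords E b p v"
  let ?g = "\<lambda>p u v. \<Sum>i<rk E. ?c p u i * ?c p v i"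
  have "bundle_metric M E ?g"
  proof (rule bundle_metricI)
    fix p assume p: "p \<in> points M"
    show "inner_on (fib E p) (?g p)"
      unfolding inner_on_def
    proof (intro ballI conjI allI impI)
      fix u v assume u: "u \<in> fib E p" and v: "v \<in> fib E p"
      show "?g p u v = ?g p v u" by (simp add: mult.commute)
      show "?g p u u > 0" if "u \<noteq> 0"
      proof -
        have "\<exists>i<rk E. ?c p u i \<noteq> 0" using that coords_sum[OF b(2)[OF p] u] by (metis (mono_tags, lifting) lessThan_iff scale_zero_left sum.neutral)
        then obtain i where "i < rk E" "?c p u i \<noteq> 0" by blast
        then show ?thesis by (intro sum_pos2[of _ i]) (auto simp: zero_less_mult_iff not_less_iff_gr_or_eq)
      qed
      fix w r s assume w: "w \<in> fib E p"
      show "?g p (r *\<^sub>R u + s *\<^sub>R v) w = r * ?g p u w + s * ?g p v w"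
        by (simp add: coords_linear[OF b(2)[OF p] u v] sum_distrib_left sum.distrib[symmetric] algebra_simps)
    qed
  next
    fix U b' i j assume "(U, b') \<in> frames E" and ij: "i < rk E" "j < rk E"
    then have U: "U = points M" "b' = b" by (simp_all add: b(1))
    show "smooth_fun M U (\<lambda>p. ?g p (b' i p) (b' j p))" unfolding U
    proof (rule smooth_fun_cong[OF M openin_topspace])
      show "(if i = j then 1 else 0) = ?g p (b i p) (b j p)" if "p \<in> points M" for p
      proof -
        have "?g p (b i p) (b j p) = (\<Sum>k<rk E. if k = i then if i = j then 1 else 0 else 0)"
          by (rule sum.cong) (auto simp: coords_basis[OF b(2)[OF that]] ij)
        then show ?thesis using ij by simp
      qed
    qed (rule smooth_fun_const)
  qed
  then show ?thesis by blast
qed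

section \<open>The real line\<close>

definition line_chart :: "real => nat => real" where
  "line_chart x = (\<lambda>i. if i = 0 then x else 0)"

definition line :: "real manifold" where
  "line = \<lparr> mtop = euclideanreal, mdim = 1, charts = {(UNIV, line_chart)} \<rparr>"

lemma line_sel [simp]:
  "mtop line = euclideanreal" "mdim line = 1" "charts line = {(UNIV, line_chart)}"
  by (simp_all add: line_def)

lemma line_chart_0 [simp]: "line_chart x 0 = x"
  by (simp add: line_chart_def)

lemma inv_line_chart [simp]: "inv_into UNIV line_chart (line_chart x) = x"
  by (rule inv_f_f) (metis injI line_chart_0)

lemma range_line_chart: "range line_chart = topspace (Euclidean_space 1)"
proof -
  have "z = line_chart (z 0)" if "\<forall>i\<ge>1. z i = 0" for z
    using that by (auto simp: line_chart_def fun_eq_iff)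
  then show ?thesis by (auto simp: topspace_Euclidean_space line_chart_def image_iff)
qed

text \<open>Polynomials of degree at most 2 are closed under differentiation, so the induction runs
  over all coefficients at once. Degree 2 is what the efforts of \<open>twist_vec\<close>
  require.\<close>

lemma Ck_quadratic: "Ck k 1 W (\<lambda>z. a + b * z 0 + c * (z 0)\<^sup>2)"
proof (induction k arbitrary: a b c)
  case 0
  have "continuous_map (subtopology (Euclidean_space 1) W) euclideanreal (\<lambda>z. z 0)"
    by (rule continuous_map_from_subtopology) (rule continuous_map_coord_compose[OF continuous_map_id[unfolded id_def]])
  then show ?case
    by (simp, intro continuous_map_add continuous_map_real_mult continuous_map_real_pow) simp_all
next
  case (Suc k)
  have d: "((\<lambda>s. a + b * (z(0 := s)) 0 + c * ((z(0 := s)) 0)\<^sup>2) has_real_derivative b + (2 * c) * z 0 + 0 * (z 0)\<^sup>2) (at (z 0))" for z :: "nat => real"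
    by (auto intro!: derivative_eq_intros)
  \<comment> \<open>The summand with coefficient 0 brings the derivative into the shape of the
    induction hypothesis.\<close>
  then have p: "partial 0 (\<lambda>z. a + b * z 0 + c * (z 0)\<^sup>2) = (\<lambda>z. b + (2 * c) * z 0 + 0 * (z 0)\<^sup>2)"
    unfolding partial_def by (intro ext DERIV_imp_deriv)
  have fd: "(\<lambda>s. a + b * (z(0 := s)) 0 + c * ((z(0 := s)) 0)\<^sup>2) field_differentiable at (z 0)" for z :: "nat => real"
    using d by (auto simp: field_differentiable_def)
  have c0: "Ck 0 1 W (\<lambda>z. a + b * z 0 + c * (z 0)\<^sup>2)"
  proof -
    have "continuous_map (subtopology (Euclidean_space 1) W) euclideanreal (\<lambda>z. z 0)"
      by (rule continuous_map_from_subtopology) (rule continuous_map_coord_compose[OF continuous_map_id[unfolded id_def]])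
    then show ?thesis
      by (simp, intro continuous_map_add continuous_map_real_mult continuous_map_real_pow) simp_all
  qed
  show ?case unfolding Ck.simps(2)
  proof (intro conjI allI impI)
    fix i :: nat assume "i < 1"
    then have i: "i = 0" by simp
    show "\<forall>z\<in>W. (\<lambda>s. a + b * (z(i := s)) 0 + c * ((z(i := s)) 0)\<^sup>2) field_differentiable at (z i)" unfolding i using fd by blast
    show "Ck k 1 W (partial i (\<lambda>z. a + b * z 0 + c * (z 0)\<^sup>2))" unfolding i p by (rule Suc.IH)
  qed (use c0 in simp)
qed

lemma smooth_fun_quadratic: "smooth_fun line U (\<lambda>x. a + b * x + c * x\<^sup>2)"
proof (rule smooth_fun_subset[OF smooth_funI])
  fix V \<phi> k assume "(V, \<phi>) \<in> charts line"
  then have V: "V = UNIV" "\<phi> = line_chart" by simp_all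
  have "Ck k 1 (topspace (Euclidean_space 1)) (\<lambda>z. a + b * inv_into UNIV line_chart z + c * (inv_into UNIV line_chart z)\<^sup>2)"
  proof (rule Ck_cong[OF openin_topspace _ Ck_quadratic])
    fix z assume "z \<in> topspace (Euclidean_space 1)"
    then obtain x where "z = line_chart x" unfolding range_line_chart[symmetric] by blast
    then show "a + b * z 0 + c * (z 0)\<^sup>2 = a + b * inv_into UNIV line_chart z + c * (inv_into UNIV line_chart z)\<^sup>2" by simp
  qed
  then show "Ck k (mdim line) (\<phi> ` (UNIV \<inter> V)) (\<lambda>z. a + b * inv_into V \<phi> z + c * (inv_into V \<phi> z)\<^sup>2)"
    by (simp add: V range_line_chart)
qed simp

lemma smooth_manifold_line: "smooth_manifold line"
proof -
  obtain B :: "real set set" where B: "countable B" "\<And>C. C \<in> B ==> open C" "\<And>S. open S ==> \<exists>U. U \<subseteq> B \<and> S = \<Union>U"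
    by (rule univ_second_countable) (rule that)
  have sc: "second_countable euclideanreal"
    unfolding second_countable_def
  proof (intro exI[of _ B] conjI ballI allI impI)
    fix U and x :: real assume "openin euclideanreal U \<and> x \<in> U"
    then show "\<exists>V\<in>B. x \<in> V \<and> V \<subseteq> U" using B(3)[of U] by auto
  qed (use B in auto)
  have c: "continuous_map euclideanreal (Euclidean_space 1) line_chart"
    by (rule continuous_map_into_Euclidean) (auto simp: line_chart_def)
  have "homeomorphic_maps euclideanreal (Euclidean_space 1) line_chart (\<lambda>z. z 0)"
    unfolding homeomorphic_maps_def
  proof (intro conjI ballI)
    show "continuous_map (Euclidean_space 1) euclideanreal (\<lambda>z. z 0)"
      by (rule continuous_map_coord_compose[OF continuous_map_id[unfolded id_def]])
    show "line_chart (z 0) = z" if "z \<in> topspace (Euclidean_space 1)" for z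
      using that unfolding range_line_chart[symmetric] by auto
  qed (use c in simp_all)
  then have "homeomorphic_map euclideanreal (Euclidean_space 1) line_chart" unfolding homeomorphic_map_maps by blast
  moreover have "smooth_fun line UNIV (\<lambda>p. line_chart p 0)" using smooth_fun_quadratic[of UNIV 0 1 0] by simp
  ultimately show ?thesis
    unfolding smooth_manifold_def by (simp add: sc Hausdorff_space_euclidean range_line_chart)
qed

lemma atlas_line: "atlas line"
  by (rule smooth_manifold_atlas[OF smooth_manifold_line])

section \<open>Trivial bundles over the line\<close>

definition unit_vec :: "nat => nat => real" where
  "unit_vec i = (\<lambda>j. if j = i then 1 else 0)"

definition triv :: "nat => (real, nat => real) vbundle" where
  "triv n = \<lparr> fib = (\<lambda>_. {z. \<forall>i\<ge>n. z i = 0}), rk = n, frames = {(UNIV, \<lambda>i _. unit_vec i)} \<rparr>"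

lemma triv_sel [simp]:
  "fib (triv n) x = {z. \<forall>i\<ge>n. z i = 0}" "rk (triv n) = n" "frames (triv n) = {(UNIV, \<lambda>i _. unit_vec i)}"
  by (simp_all add: triv_def)

lemma sum_unit_vec: "(\<Sum>i<n. c i *\<^sub>R unit_vec i) = (\<lambda>j. if j < n then c j else 0)"
proof
  fix j
  have "(\<Sum>i<n. c i *\<^sub>R unit_vec i) j = (\<Sum>i<n. if i = j then c i else 0)"
    unfolding sum_fun_apply by (rule sum.cong) (auto simp: unit_vec_def scaleR_fun_def)
  then show "(\<Sum>i<n. c i *\<^sub>R unit_vec i) j = (if j < n then c j else 0)" by simp
qed

lemma basis_triv: "basis_of n unit_vec {z. \<forall>i\<ge>n. z i = 0}"
  unfolding basis_of_iff sum_unit_vec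
proof (intro conjI allI impI)
  have "z = (\<lambda>j. if j < n then z j else 0)" if "\<forall>i\<ge>n. z i = 0" for z :: "nat => real" using that by (auto simp: fun_eq_iff)
  then show "{z. \<forall>i\<ge>n. z i = 0} = range (\<lambda>c j. if j < n then c j else (0::real))" by auto
next
  fix c :: "nat => real" and i assume "(\<lambda>j. if j < n then c j else 0) = 0" "i < n"
  from fun_cong[OF this(1), of i] this(2) show "c i = 0" by simp
qed

lemma coords_triv:
  assumes "\<forall>i\<ge>n. z i = 0"
  shows "coords n unit_vec z i = z i"
proof -
  have "z = (\<Sum>i<n. z i *\<^sub>R unit_vec i)" unfolding sum_unit_vec using assms by (auto simp: fun_eq_iff)
  then have "coords n unit_vec z i = coords n unit_vec (\<Sum>i<n. z i *\<^sub>R unit_vec i) i" by simp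
  also have "\<dots> = z i" unfolding coords_unique[OF basis_triv] using assms by simp
  finally show ?thesis .
qed

lemma vector_bundle_triv: "vector_bundle line (triv n)"
proof -
  have "smooth_section line (triv n) UNIV (\<lambda>_. unit_vec i)" if "i < n" for i
    using smooth_section_frame[of "triv n" line "\<lambda>i _. unit_vec i" i] that by simp
  then show ?thesis unfolding vector_bundle_def by (simp add: basis_triv)
qed

lemma parallel_triv: "parallel line (triv n)"
  unfolding parallel_def using vector_bundle_framed[OF atlas_line vector_bundle_triv] by simp

section \<open>Two systems whose interconnection forgets a singular signal\<close>

abbreviation flow_line where
  "flow_line \<equiv> flow_pair line (with_dual (triv 0)) (with_dual (triv 1) \<oplus>\<^sub>d with_dual (triv 2))"

abbreviation partial_x :: "real => real tvec" where
  "partial_x \<equiv> coord_deriv line (UNIV, line_chart) 0"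

definition covec :: "nat => nat => (nat => real) => real" where
  "covec n i = (\<lambda>v. coords n unit_vec v i)"

lemma covec_apply: "\<forall>i\<ge>n. v i = 0 ==> covec n i v = v i"
  by (simp add: covec_def coords_triv)

lemma tangent_line: "tangent_at line x = range (\<lambda>r. r *\<^sub>R partial_x x)"
  using tangent_fib[OF atlas_line, of UNIV line_chart x] by (simp add: span_singleton lessThan_Suc)

lemma partial_x_coord: "partial_x x (\<lambda>p. line_chart p 0) = 1"
  using coord_deriv_coord[OF atlas_line, of UNIV line_chart x 0 0] by simp

lemma parallel_line_tangent: "parallel line (tangent_bundle line)"
  by (rule parallel_tangent[OF atlas_line]) simp

text \<open>On the space of the four parameters, \<open>a 2\<close> and \<open>a 3\<close> are the flows at the port that is
  interconnected. The effort there vanishes iff \<open>x * a 3 = a 1\<close> and \<open>a 2 = 0\<close> (for \<open>x \<noteq> 0\<close>), so the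
  composite forgets \<open>a 3 = a 1 / x\<close>, which is singular at \<open>x = 0\<close>. The second unknown \<open>a 2\<close>
  and the powers of \<open>x\<close> make the composite smooth.\<close>

definition twist_vec :: "real => (nat => real) => _" where
  "twist_vec x a = ((a 0 *\<^sub>R partial_x x, 0 :: nat => real, a 1 *\<^sub>R unit_vec 0, a 2 *\<^sub>R unit_vec 0 + a 3 *\<^sub>R unit_vec 1),
     (0 :: real tvec => real, 0 :: (nat => real) => real, (a 2 * x) *\<^sub>R covec 1 0,
      (a 3 * x\<^sup>2 - a 1 * x) *\<^sub>R covec 2 0 + (- (a 2 * x\<^sup>2)) *\<^sub>R covec 2 1))"

definition twist where
  "twist x = range (twist_vec x)"

lemma sum_lessThan_4: "(\<Sum>i<4. f i) = f 0 + f 1 + f 2 + f (3::nat)"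
  by (simp add: eval_nat_numeral add.assoc)

lemma twist_vec_sum: "(\<Sum>i<4. c i *\<^sub>R twist_vec x (unit_vec i)) = twist_vec x c"
  unfolding sum_lessThan_4 twist_vec_def unit_vec_def
  by (simp add: scaleR_add_left scaleR_diff_left)

text \<open>The structure is a graph over the flows: the parameters are recovered from the flow
  components, so the rank is 4 at every \<open>x\<close>, also at 0.\<close>

lemma twist_basis: "basis_of 4 (\<lambda>i. twist_vec x (unit_vec i)) (twist x)"
  unfolding basis_of_iff twist_vec_sum twist_def
proof (intro conjI refl allI impI)
  fix c and i :: nat assume 0: "twist_vec x c = 0" and i: "i < 4"
  have "c 0 *\<^sub>R partial_x x = 0" and z: "c 1 *\<^sub>R unit_vec 0 = 0" "c 2 *\<^sub>R unit_vec 0 + c 3 *\<^sub>R unit_vec 1 = 0"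
    using 0 by (simp_all add: twist_vec_def zero_prod_def)
  from fun_cong[OF this(1), of "\<lambda>p. line_chart p 0"] have "c 0 = 0" by (simp only: scaleR_fun_def partial_x_coord) simp
  moreover from fun_cong[OF z(1), of 0] have "c 1 = 0" by (simp add: scaleR_fun_def unit_vec_def)
  moreover from fun_cong[OF z(2), of 0] have "c 2 = 0" by (simp add: scaleR_fun_def unit_vec_def)
  moreover from fun_cong[OF z(2), of 1] have "c 3 = 0" by (simp add: scaleR_fun_def unit_vec_def)
  moreover have "i = 0 \<or> i = 1 \<or> i = 2 \<or> i = 3" using i by linarith
  ultimately show "c i = 0" by auto
qed

lemma smooth_section_triv:
  assumes "\<And>i. i < n ==> smooth_fun line UNIV (f i)"
  shows "smooth_section line (triv n) UNIV (\<lambda>p. \<Sum>i<n. f i p *\<^sub>R unit_vec i)"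
  using smooth_section_comb[of "triv n" line "\<lambda>i _. unit_vec i" f] assms by simp

lemma smooth_section_dual_triv:
  assumes "\<And>i. i < n ==> smooth_fun line UNIV (f i)"
  shows "smooth_section line (dual_bundle (triv n)) UNIV (\<lambda>p. \<Sum>i<n. f i p *\<^sub>R covec n i)"
proof -
  let ?b = "\<lambda>i (_::real) v. representation ((\<lambda>j. unit_vec j) ` {..<n}) v (unit_vec i)"
  have fr: "frames (dual_bundle (triv n)) = {(points line, ?b)}" by (simp add: dual_bundle_def)
  have "(\<Sum>i<n. f i p *\<^sub>R ?b i p) = (\<Sum>i<n. f i p *\<^sub>R covec n i)" for p
    by (rule sum.cong) (simp_all add: covec_def coords_def)
  then show ?thesis using smooth_section_comb[OF fr, of f] assms by simp
qed

lemma quadratics_smooth: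
  "smooth_fun line U (\<lambda>_. a)" "smooth_fun line U (\<lambda>x. a * x)" "smooth_fun line U (\<lambda>x. - (a * x\<^sup>2))"
  "smooth_fun line U (\<lambda>x. a * x\<^sup>2 - b * x)"
  using smooth_fun_quadratic[of U a 0 0] smooth_fun_quadratic[of U 0 a 0] smooth_fun_quadratic[of U 0 0 "- a"]
    smooth_fun_quadratic[of U 0 "- b" a] by (simp_all add: algebra_simps)

lemma twist_section: "smooth_section line (doubled flow_line) UNIV (\<lambda>x. twist_vec x a)"
proof -
  have fr: "frames (tangent_bundle line) = {(points line, coord_deriv line (UNIV, line_chart))}" by simp
  have t: "smooth_section line (tangent_bundle line) UNIV (\<lambda>x. a 0 *\<^sub>R partial_x x)"
    using smooth_section_comb[OF fr, of "\<lambda>_ _. a 0"] smooth_fun_const[of line UNIV "a 0"] by simp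
  have e: "smooth_section line (triv 1) UNIV (\<lambda>x. a 1 *\<^sub>R unit_vec 0)"
    using smooth_section_triv[of 1 "\<lambda>_ _. a 1"] smooth_fun_const[of line UNIV "a 1"] by simp
  have "smooth_section line (triv 2) UNIV (\<lambda>p. \<Sum>i<2. (if i = 0 then a 2 else a 3) *\<^sub>R unit_vec i)"
    by (rule smooth_section_triv) (rule smooth_fun_const)
  then have z: "smooth_section line (triv 2) UNIV (\<lambda>x. a 2 *\<^sub>R unit_vec 0 + a 3 *\<^sub>R unit_vec 1)"
    by (simp add: eval_nat_numeral)
  have u: "smooth_section line (dual_bundle (triv 1)) UNIV (\<lambda>x. (a 2 * x) *\<^sub>R covec 1 0)"
    using smooth_section_dual_triv[of 1 "\<lambda>_ x. a 2 * x"] quadratics_smooth(2)[of UNIV "a 2"] by simp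
  have "smooth_section line (dual_bundle (triv 2)) UNIV
      (\<lambda>x. \<Sum>i<2. (if i = 0 then a 3 * x\<^sup>2 - a 1 * x else - (a 2 * x\<^sup>2)) *\<^sub>R covec 2 i)"
  proof (rule smooth_section_dual_triv)
    show "smooth_fun line UNIV (\<lambda>x. if i = 0 then a 3 * x\<^sup>2 - a 1 * x else - (a 2 * x\<^sup>2))" for i :: nat
      by (cases "i = 0") (simp_all add: quadratics_smooth)
  qed
  then have w: "smooth_section line (dual_bundle (triv 2)) UNIV
      (\<lambda>x. (a 3 * x\<^sup>2 - a 1 * x) *\<^sub>R covec 2 0 + (- (a 2 * x\<^sup>2)) *\<^sub>R covec 2 1)"
    by (simp add: eval_nat_numeral)
  show ?thesis unfolding twist_vec_def dsum_pair_sel with_dual_sel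
    by (intro smooth_section_dsum t e z u w smooth_section_zero)
qed

text \<open>Isotropy is skew-symmetry of the map from flows to efforts: the entry \<open>x\<close>
  couples \<open>a 1\<close> with \<open>a 2\<close>, the entry \<open>x\<^sup>2\<close> couples
  \<open>a 2\<close> with \<open>a 3\<close>, and each occurs with both signs.\<close>

lemma dirac_twist: "dirac_structure line flow_line twist"
  unfolding dirac_structure_def
proof (intro conjI ballI)
  have 4: "rk (primal flow_line) = 4" by simp
  show "smooth_subbundle line (doubled flow_line) (rk (primal flow_line)) twist"
    unfolding smooth_subbundle_def 4
    by (intro ballI exI[of _ UNIV] exI[of _ "\<lambda>i x. twist_vec x (unit_vec i)"] conjI allI impI
        twist_section twist_basis) simp_all
next
  fix x \<xi> \<xi>' assume "\<xi> \<in> twist x" "\<xi>' \<in> twist x"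
  then obtain a b where ab: "\<xi> = twist_vec x a" "\<xi>' = twist_vec x b" unfolding twist_def by auto
  have c: "covec 1 0 (r *\<^sub>R unit_vec 0) = r" "covec 2 0 (r *\<^sub>R unit_vec 0 + s *\<^sub>R unit_vec 1) = r"
    "covec 2 1 (r *\<^sub>R unit_vec 0 + s *\<^sub>R unit_vec 1) = s" for r s
    by (simp_all add: covec_apply unit_vec_def scaleR_fun_def)
  show "sym_form flow_line \<xi> \<xi>' = 0"
    unfolding ab twist_vec_def sym_form_apply dsum_pair_sel with_dual_sel
    by (simp only: plus_fun_apply scaleR_fun_def[of _ "covec _ _"] zero_fun_apply c real_scaleR_def) (simp add: algebra_simps)
qed

text \<open>All flows are free and all efforts are 0. This companion has the same composite as
  \<open>twist\<close>, and its own behaviour has no difficulty with the singular curve.\<close>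

definition flat where
  "flat x = fib (primal flow_line) x \<times>
    {0 :: (real tvec => real) \<times> ((nat => real) => real) \<times> ((nat => real) => real) \<times> ((nat => real) => real)}"

lemma parallel_flow: "parallel line (primal flow_line)"
  by (simp add: parallel_dsum parallel_triv parallel_line_tangent)

lemma dirac_flat: "dirac_structure line flow_line flat"
  unfolding dirac_structure_def flat_def
proof (intro conjI ballI)
  show "smooth_subbundle line (doubled flow_line) (rk (primal flow_line)) (\<lambda>x. fib (primal flow_line) x \<times> {0})"
    by (rule parallel_subbundle[OF parallel_flow])
qed (auto simp: sym_form_def zero_prod_def dsum_pair_def with_dual_def)

abbreviation zero_port where
  "zero_port x \<equiv> fib (triv 0) x \<times> {0 :: (nat => real) => real}"

text \<open>The constraint that cuts the wires: effort 0 at both ports, flows arbitrary and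
  unrelated.\<close>

abbreviation cut where
  "cut p \<equiv> fib (triv 2 \<times>\<^sub>b triv 2) p \<times> {0 :: ((nat => real) => real) \<times> ((nat => real) => real)}"

lemma lagrangian_zero: "lagrangian_subbundle line (with_dual (triv 0)) zero_port" "nonnegative line (with_dual (triv 0)) zero_port"
  using parallel_subbundle[OF parallel_triv[of 0], of "dual_bundle (triv 0)"]
  by (auto simp: lagrangian_subbundle_def nonnegative_def sym_form_def alt_form_def with_dual_def)

lemma ph_system_line:
  assumes "dirac_structure line flow_line D"
  shows "ph_system line (triv 0) (triv 1) (triv 2) D zero_port (\<lambda>_. 0)"
  unfolding ph_system_def
  by (intro conjI smooth_manifold_line vector_bundle_triv assms lagrangian_zero smooth_fun_const)

lemma dirac_cut: "dirac_structure (prod_manifold line line) (with_dual (triv 2) \<times>\<^sub>d with_dual (triv 2)) cut"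
  unfolding dirac_structure_def
proof (intro conjI ballI)
  show "smooth_subbundle (prod_manifold line line) (doubled (with_dual (triv 2) \<times>\<^sub>d with_dual (triv 2)))
      (rk (primal (with_dual (triv 2) \<times>\<^sub>d with_dual (triv 2)))) (\<lambda>p. cut p)"
    unfolding prod_pair_sel with_dual_sel by (rule parallel_subbundle[OF parallel_prod[OF parallel_triv parallel_triv]])
qed (auto simp: sym_form_def zero_prod_def prod_pair_def with_dual_def)


text \<open>If effort 0 at the port forces the other efforts to vanish and leaves the other flows
  free, the composite retains nothing of \<open>D\<close>: its fibre consists of all flows together
  with effort 0. Both \<open>twist\<close> and \<open>flat\<close> have this property.\<close>

lemma interconnection_forgets:
  assumes D1: "\<And>x v f \<eta> \<zeta> \<alpha> e u. ((v, f, \<eta>, \<zeta>), (\<alpha>, e, u, 0)) \<in> D x ==>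
      f \<in> fib (triv 0) x \<and> \<eta> \<in> fib (triv 1) x \<and> \<alpha> = 0 \<and> e = 0 \<and> u = 0"
    and D2: "\<And>x v \<eta>. v \<in> tangent_at line x ==> \<eta> \<in> fib (triv 1) x ==>
      \<exists>\<zeta>\<in>fib (triv 2) x. ((v, 0, \<eta>, \<zeta>), 0) \<in> D x"
  shows "dirac_interconnection line line cut D D p =
    fib (tangent_bundle (prod_manifold line line) \<oplus>\<^sub>b (triv 0 \<times>\<^sub>b triv 0) \<oplus>\<^sub>b (triv 1 \<times>\<^sub>b triv 1)) p \<times> {0}"
    (is "?L = ?R")
proof -
  obtain x1 x2 where p: "p = (x1, x2)" by (cases p)
  have q: "x1 \<in> points line" "x2 \<in> points line" by simp_all
  let ?T = "tangent_at (prod_manifold line line) (x1, x2)"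
  show ?thesis
  proof (intro equalityI subsetI)
    fix \<xi> assume "\<xi> \<in> ?L"
    then obtain v f1 f2 \<eta>1 \<eta>2 \<alpha> e1 e2 u1 u2 v1 v2 \<alpha>1 \<alpha>2 \<zeta>1 \<zeta>2 where
      \<xi>: "\<xi> = ((v, (f1, f2), (\<eta>1, \<eta>2)), (\<alpha>, (e1, e2), (u1, u2)))"
      and v: "v \<in> ?T" and a: "\<alpha> \<in> dual_space ?T"
      and s: "(\<alpha>1, \<alpha>2) = split_cotangent line line (x1, x2) \<alpha>"
      and d: "((v1, f1, \<eta>1, \<zeta>1), (\<alpha>1, e1, u1, 0)) \<in> D x1" "((v2, f2, \<eta>2, \<zeta>2), (\<alpha>2, e2, u2, 0)) \<in> D x2"
      unfolding p dirac_interconnection_def by (auto simp: zero_prod_def)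
    note c = D1[OF d(1)] D1[OF d(2)]
    \<comment> \<open>Both components of the covector vanish, and \<open>covector_split\<close>
      expresses its values on tangent vectors through them.\<close>
    have "\<alpha> = 0"
    proof
      fix w show "\<alpha> w = 0 w"
      proof (cases "w \<in> ?T")
        case True
        show ?thesis using covector_split[OF atlas_line atlas_line q True a] c unfolding s[symmetric] by simp
      qed (use a in \<open>simp add: dual_space_def\<close>)
    qed
    then show "\<xi> \<in> ?R" using v c by (simp add: \<xi> p zero_prod_def)
  next
    fix \<xi> assume "\<xi> \<in> ?R"
    moreover obtain v f1 f2 \<eta>1 \<eta>2 \<epsilon> where "\<xi> = ((v, (f1, f2), (\<eta>1, \<eta>2)), \<epsilon>)" by (metis surj_pair)
    ultimately have \<xi>: "\<xi> = ((v, (f1, f2), (\<eta>1, \<eta>2)), 0)" and v: "v \<in> ?T"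
      and f: "f1 = 0" "f2 = 0" and \<eta>: "\<eta>1 \<in> fib (triv 1) x1" "\<eta>2 \<in> fib (triv 1) x2"
      by (simp_all add: p fun_eq_iff)
    note pt = push_tangent[OF atlas_line atlas_line q]
    obtain \<zeta>1 where z1: "\<zeta>1 \<in> fib (triv 2) x1" "((push line x1 fst v, 0, \<eta>1, \<zeta>1), 0) \<in> D x1" using D2[OF pt(3)[OF v] \<eta>(1)] by blast
    obtain \<zeta>2 where z2: "\<zeta>2 \<in> fib (triv 2) x2" "((push line x2 snd v, 0, \<eta>2, \<zeta>2), 0) \<in> D x2" using D2[OF pt(4)[OF v] \<eta>(2)] by blast
    have "split_cotangent line line (x1, x2) 0 = (0, 0)" by (auto simp: split_cotangent_def fun_eq_iff)
    moreover have "(0 :: (real \<times> real) tvec => real) \<in> dual_space ?T" by (simp add: dual_space_def)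
    moreover have "((\<zeta>1, \<zeta>2), (0, 0)) \<in> cut (x1, x2)" using z1(1) z2(1) by (simp add: zero_prod_def)
    ultimately show "\<xi> \<in> ?L" using v z1(2) z2(2) unfolding p \<xi> f dirac_interconnection_def prod.case with_dual_sel dual_bundle_sel zero_prod_def
      by (intro CollectI exI conjI) (rule refl | assumption | simp add: split_tangent_def)+
  qed
qed

lemma twist_forgets:
  "dirac_interconnection line line cut twist twist =
    (\<lambda>p. fib (tangent_bundle (prod_manifold line line) \<oplus>\<^sub>b (triv 0 \<times>\<^sub>b triv 0) \<oplus>\<^sub>b (triv 1 \<times>\<^sub>b triv 1)) p \<times> {0})"
proof (rule ext, rule interconnection_forgets)
  fix x v f \<eta> \<zeta> \<alpha> e u assume "((v, f, \<eta>, \<zeta>), (\<alpha>, e, u, 0)) \<in> twist x"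
  then obtain a where "((v, f, \<eta>, \<zeta>), (\<alpha>, e, u, 0)) = twist_vec x a" unfolding twist_def by blast
  note P = this[unfolded twist_vec_def prod.inject]
  have a: "\<alpha> = 0" "e = 0" "f = 0" "\<eta> = a 1 *\<^sub>R unit_vec 0" "u = (a 2 * x) *\<^sub>R covec 1 0"
    "0 = (a 3 * x\<^sup>2 - a 1 * x) *\<^sub>R covec 2 0 + (- (a 2 * x\<^sup>2)) *\<^sub>R covec 2 1"
    using P by blast+
  have "covec 2 0 (unit_vec 1) = 0" "covec 2 1 (unit_vec 1) = 1" by (simp_all add: covec_apply unit_vec_def)
  \<comment> \<open>The weaker product \<open>a 2 * x\<close> is what the external effort contains,
    so the conclusion also holds at \<open>x = 0\<close>, where \<open>a 2\<close> is
    arbitrary.\<close>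
  then have "a 2 * x\<^sup>2 = 0" using fun_cong[OF a(6), of "unit_vec 1"] by (simp add: scaleR_fun_def)
  then have "(a 2 * x) *\<^sub>R covec 1 0 = 0" by (auto simp: power2_eq_square)
  then show "f \<in> fib (triv 0) x \<and> \<eta> \<in> fib (triv 1) x \<and> \<alpha> = 0 \<and> e = 0 \<and> u = 0"
    unfolding a(1-5) by (simp add: scaleR_fun_def unit_vec_def)
next
  fix x v \<eta> assume "v \<in> tangent_at line x" and \<eta>: "\<eta> \<in> fib (triv 1) x"
  then obtain r where v: "v = r *\<^sub>R partial_x x" unfolding tangent_line by blast
  have \<eta>: "\<eta> = \<eta> 0 *\<^sub>R unit_vec 0" using \<eta> by (auto simp: fun_eq_iff scaleR_fun_def unit_vec_def)
  \<comment> \<open>Solves the port condition with \<open>a 2 = 0\<close> and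
    \<open>a 3 = a 1 / x\<close>. At \<open>x = 0\<close> the quotient is 0 by convention, and all
    efforts vanish there anyway because each of them has a factor \<open>x\<close>.\<close>
  let ?a = "\<lambda>i::nat. if i = 0 then r else if i = 1 then \<eta> 0 else if i = 3 then \<eta> 0 / x else 0"
  have "twist_vec x ?a = ((v, 0, \<eta>, (\<eta> 0 / x) *\<^sub>R unit_vec 1), 0)"
    unfolding twist_vec_def v by (simp add: zero_prod_def power2_eq_square \<eta>[symmetric])
  then have "((v, 0, \<eta>, (\<eta> 0 / x) *\<^sub>R unit_vec 1), 0) \<in> twist x" unfolding twist_def by (metis rangeI)
  moreover have "(\<eta> 0 / x) *\<^sub>R unit_vec 1 \<in> fib (triv 2) x" by (simp add: scaleR_fun_def unit_vec_def)
  ultimately show "\<exists>\<zeta>\<in>fib (triv 2) x. ((v, 0, \<eta>, \<zeta>), 0) \<in> twist x" by blast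
qed

lemma flat_forgets:
  "dirac_interconnection line line cut flat flat =
    (\<lambda>p. fib (tangent_bundle (prod_manifold line line) \<oplus>\<^sub>b (triv 0 \<times>\<^sub>b triv 0) \<oplus>\<^sub>b (triv 1 \<times>\<^sub>b triv 1)) p \<times> {0})"
  by (rule ext, rule interconnection_forgets) (auto simp: flat_def zero_prod_def intro!: exI[of _ 0])

lemma atlas_plane: "atlas (prod_manifold line line)"
  by (rule atlas_prod[OF atlas_line atlas_line])

text \<open>The composite is the whole flow bundle with effort 0, a subbundle with a global frame,
  although the forgotten flow is singular.\<close>

lemma admissible_twist: "admissible line (triv 0) (triv 1) line (triv 0) (triv 1) twist twist cut"
proof -
  have "charts (prod_manifold line line) = {(points (prod_manifold line line), \<lambda>(p, q) i. if i < mdim line then line_chart p i else line_chart q (i - mdim line))}"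
    by (auto simp: prod_manifold_def)
  note T = parallel_tangent[OF atlas_plane this]
  have "parallel (prod_manifold line line) (tangent_bundle (prod_manifold line line) \<oplus>\<^sub>b (triv 0 \<times>\<^sub>b triv 0) \<oplus>\<^sub>b (triv 1 \<times>\<^sub>b triv 1))"
    by (intro parallel_dsum T parallel_prod parallel_triv)
  from parallel_subbundle[OF this] show ?thesis
    unfolding admissible_def twist_forgets dsum_pair_sel prod_pair_sel with_dual_sel by (rule exI)
qed

section \<open>A signal of the composite that does not come from the parts\<close>

lemma coords_in_zero:
  assumes E: "framed M E" and x: "curve_on I M x"
  shows "coords_in continuous_on I E x (\<lambda>_. 0)"
proof (rule coords_inI)
  show "0 \<in> fib E (x t)" if "t \<in> I" for t
    by (rule subspace_0[OF framed_subspace[OF E curve_in_points[OF x that]]])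
  fix U b i assume "(U, b) \<in> frames E"
  then show "continuous_on {t \<in> I. x t \<in> U} (\<lambda>t. frame_coords E b (x t) 0 i)"
    by (intro continuous_on_eq[OF continuous_on_const[of _ 0]]) (simp add: coords_zero[OF framedD(2)[OF E]])
qed

lemma coords_in_integrable:
  assumes E: "framed M E" and x: "curve_on {t0..t1} M x"
    and v: "coords_in continuous_on {t0..t1} E x v"
  shows "coords_in loc_integrable {t0..t1} E x v"
  by (intro coords_inI coords_inD(1)[OF v]
      loc_integrable_continuous[OF openin_curve_preimage[OF x framedD(1)[OF E]] coords_inD(2)[OF v]])

lemma set_integrable_compact_continuous:
  fixes f :: "real => real"
  assumes "compact K" "K \<subseteq> {a..b}" "continuous_on {a..b} f"
  shows "set_integrable lebesgue K f"
proof -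
  have o: "openin (top_of_set {a..b}) {a..b}" by simp
  show ?thesis
    by (rule loc_integrable_compact[OF openin_interval_lebesgue[OF o] loc_integrable_continuous[OF o assms(3)] assms(1,2)])
qed

text \<open>Integration by parts: the integral of the derivative of \<open>t * \<eta> t\<close> over
  the unit interval is its boundary term, which vanishes because \<open>\<eta>\<close> is 0 at
  1.\<close>

lemma weak_derivative_ident: "weak_derivative_on {0<..<1} (\<lambda>t. t) (\<lambda>_. 1)"
  unfolding weak_derivative_on_def
proof (intro conjI allI impI)
  fix K :: "real set" assume "compact K \<and> K \<subseteq> {0<..<1}"
  then have K: "compact K" "K \<subseteq> {0..1}" by (auto simp: subset_iff)
  show "set_integrable lebesgue K (\<lambda>t. t)" "set_integrable lebesgue K (\<lambda>_. 1 :: real)"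
    by (rule set_integrable_compact_continuous[OF K]; simp)+
next
  fix \<eta> assume \<eta>: "test_function {0<..<1} \<eta>"
  then obtain K where K: "K \<subseteq> {0<..<1}" "\<And>t. t \<notin> K ==> \<eta> t = 0"
    unfolding test_function_def by blast
  have d: "(\<eta> has_real_derivative deriv \<eta> t) (at t)" "(deriv \<eta>) field_differentiable at t" for t
  proof -
    have *: "(deriv ^^ k) \<eta> field_differentiable at t" for k using \<eta> unfolding test_function_def by blast
    show "(\<eta> has_real_derivative deriv \<eta> t) (at t)" using *[of 0] by (simp add: field_differentiable_derivI)
    show "(deriv \<eta>) field_differentiable at t" using *[of 1] by simp
  qed
  have c: "continuous_on {0..1} \<eta>" "continuous_on {0..1} (deriv \<eta>)"
    by (auto intro!: continuous_at_imp_continuous_on field_differentiable_imp_continuous_at d(2) DERIV_isCont[OF d(1)])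
  have "((\<lambda>t. t * deriv \<eta> t + \<eta> t) has_integral (1 * \<eta> 1 - 0 * \<eta> 0)) {0..1}"
  proof (rule fundamental_theorem_of_calculus)
    fix t :: real
    have "((\<lambda>t. t * \<eta> t) has_real_derivative t * deriv \<eta> t + \<eta> t) (at t)"
      by (auto intro!: derivative_eq_intros d(1))
    then show "((\<lambda>t. t * \<eta> t) has_vector_derivative t * deriv \<eta> t + \<eta> t) (at t within {0..1})"
      by (simp add: has_real_derivative_iff_has_vector_derivative has_vector_derivative_at_within)
  qed simp
  moreover have "\<eta> 1 = 0" by (rule K(2)) (use K(1) in auto)
  ultimately have 1: "integral {0..1} (\<lambda>t. t * deriv \<eta> t + \<eta> t) = 0" by (simp add: integral_unique)
  have "integral {0..1} (\<lambda>t. t * deriv \<eta> t + \<eta> t) = integral {0..1} (\<lambda>t. t * deriv \<eta> t) + integral {0..1} \<eta>"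
    by (rule integral_add) (auto intro!: integrable_continuous_interval continuous_intros c)
  with 1 have 2: "integral {0..1} (\<lambda>t. t * deriv \<eta> t) = - integral {0..1} \<eta>" by simp
  have lint: "(LINT t:{0<..<1}|lebesgue. f t) = integral {0..1} f" if f: "continuous_on {0..1} f" for f :: "real => real"
  proof -
    have "f absolutely_integrable_on {0<..<1}"
      by (rule set_integrable_subset[OF set_integrable_compact_continuous[OF _ order_refl f]]) auto
    from set_lebesgue_integral_eq_integral(2)[OF this] show ?thesis by (simp add: integral_open_interval_real)
  qed
  show "(LINT t:{0<..<1}|lebesgue. t * deriv \<eta> t) = - (LINT t:{0<..<1}|lebesgue. 1 * \<eta> t)"
    using 2 c by (simp add: lint continuous_intros)
qed

abbreviation line_behaviour where
  "line_behaviour \<tau> D \<equiv> behaviour \<tau> line (with_dual (triv 0)) (with_dual (triv 1) \<oplus>\<^sub>d with_dual (triv 2)) D zero_port (\<lambda>_. 0) 0 1"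

abbreviation line_signals where
  "line_signals \<equiv> signal_bundle (with_dual (triv 0)) (with_dual (triv 1) \<oplus>\<^sub>d with_dual (triv 2))"

lemma parallel_line_signals: "parallel line line_signals"
  by (simp add: parallel_dsum parallel_dual parallel_triv)

lemma framed_line_signals: "framed line line_signals"
  using parallel_line_signals unfolding parallel_def by blast

lemma dfun_line_zero: "dfun line (\<lambda>_. 0) x = 0"
  unfolding dfun_def tangent_line by (auto simp: fun_eq_iff scaleR_fun_def coord_deriv_apply)

text \<open>With efforts 0 and flows free, every relation holds at each time, so the identity curve
  with a constant output is a classical and a weak trajectory.\<close>

lemma flat_curve: "(\<lambda>t\<in>{0..1}. (t, 0, (unit_vec 0, 0), 0, (0, 0))) \<in> line_behaviour \<tau> flat"
proof -
  let ?I = "{0..1::real}" and ?v = "(0 :: nat => real, (unit_vec 0, 0 :: nat => real), 0 :: (nat => real) => real, (0 :: (nat => real) => real, 0 :: (nat => real) => real))"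
  have x: "curve_on ?I line (\<lambda>t. t)" by (simp add: continuous_on_id)
  note F = conjunct1[OF iffD1[OF parallel_def parallel_triv]]
  note Z = coords_in_zero[OF _ x]
  have u: "coords_in continuous_on ?I (triv 1) (\<lambda>t. t) (\<lambda>_. unit_vec 0)"
    unfolding coords_in_def by (simp add: unit_vec_def continuous_on_const)
  have sig: "coords_in continuous_on ?I line_signals (\<lambda>t. t) (\<lambda>_. ?v)"
    unfolding dsum_pair_sel with_dual_sel
    by (intro iffD2[OF continuous_class.coords_in_dsum[OF _ _ x]] conjI framed_dsum framed_dual F u Z)
  have rel: "((v, 0, - (unit_vec 0, 0)), (dfun line (\<lambda>_. 0) t, 0, (0, 0))) \<in> flat t" if "v \<in> tangent_at line t" for v t
    using that by (simp add: flat_def dfun_line_zero zero_prod_def unit_vec_def)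
  have R: "(0, 0) \<in> zero_port t" for t by simp
  have C: "C1_curve line 0 1 (\<lambda>t. t)"
    unfolding C1_curve_def by (intro exI[of _ "-1"] exI[of _ 2] exI[of _ "\<lambda>t. t"]) (simp add: continuous_on_id)
  show ?thesis
  proof (cases \<tau>)
    case Classical
    have "velocity line 0 1 (\<lambda>t. t) t \<in> tangent_at line t" if "t \<in> ?I" for t
      unfolding tangent_line by (subst velocity_in_tangent[OF atlas_line C that, of UNIV line_chart]) auto
    then show ?thesis
      unfolding Classical behaviour_def regime.case classical_behaviour_iff[OF framed_line_signals]
      using x sig C rel R by blast
  next
    case Weak
    let ?\<xi> = "\<lambda>t\<in>?I. (t, ?v)"
    have T: "partial_x t \<in> tangent_at line t" for t
      unfolding tangent_line by (rule range_eqI[of _ _ 1]) simp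
    have fx: "fst (?\<xi> t) = t" if "t \<in> ?I" for t using that by simp
    have x': "curve_on ?I line (\<lambda>t. fst (?\<xi> t))"
      by (rule continuous_map_eq[OF x]) (use fx in simp)
    note lc = loc_integrable_class.local_class_axioms[of 0 1]
    have s': "coords_in loc_integrable ?I line_signals (\<lambda>t. fst (?\<xi> t)) (\<lambda>t. snd (?\<xi> t))"
      by (rule coords_in_cong[OF lc _ _ coords_in_integrable[OF framed_line_signals x sig]]) simp_all
    have "coords_in continuous_on ?I (tangent_bundle line) (\<lambda>t. t) partial_x"
      unfolding coords_in_def
      using tangent_coords[OF atlas_line, of UNIV line_chart, OF _ _ T] by (simp add: T partial_x_coord[simplified] continuous_on_const)
    from coords_in_integrable[OF framed_tangent[OF atlas_line] x this]
    have X': "coords_in loc_integrable ?I (tangent_bundle line) (\<lambda>t. fst (?\<xi> t)) partial_x"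
      by (rule coords_in_cong[OF lc, rotated 2]) simp_all
    have L: "(\<lambda>t. (fst (?\<xi> t), snd (?\<xi> t))) \<in> L1c line line_signals 0 1"
      unfolding L1c_iff[OF framed_line_signals atlas_smooth_continuous[OF atlas_line]]
      using x' s' parallel_metric[OF atlas_line parallel_line_signals] by blast
    have LX: "(\<lambda>t. (fst (?\<xi> t), partial_x t)) \<in> L1c line (tangent_bundle line) 0 1"
      unfolding L1c_iff[OF framed_tangent[OF atlas_line] atlas_smooth_continuous[OF atlas_line]]
      using x' X' parallel_metric[OF atlas_line parallel_line_tangent] by blast
    have wd: "weak_derivative line 0 1 (fst \<circ> ?\<xi>) partial_x"
    proof -
      have w: "weak_derivative_on {t \<in> {0<..<1}. (fst \<circ> ?\<xi>) t \<in> UNIV} (\<lambda>t. line_chart ((fst \<circ> ?\<xi>) t) 0) (\<lambda>t. partial_x t (\<lambda>p. line_chart p 0))"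
        by (rule weak_derivative_on_mono[OF weak_derivative_ident]) (auto simp: partial_x_coord[simplified])
      have "\<forall>i<mdim line. weak_derivative_on {t \<in> {0<..<1}. (fst \<circ> ?\<xi>) t \<in> UNIV} (\<lambda>t. line_chart ((fst \<circ> ?\<xi>) t) i) (\<lambda>t. partial_x t (\<lambda>p. line_chart p i))"
      proof (intro allI impI)
        fix i assume "i < mdim line"
        then have "i = 0" by simp
        with w show "weak_derivative_on {t \<in> {0<..<1}. (fst \<circ> ?\<xi>) t \<in> UNIV} (\<lambda>t. line_chart ((fst \<circ> ?\<xi>) t) i) (\<lambda>t. partial_x t (\<lambda>p. line_chart p i))" by blast
      qed
      then show ?thesis unfolding weak_derivative_def line_sel(3) by blast
    qed
    have wD: "weakly_in line flow_line sym_form flat 0 1 (fst \<circ> ?\<xi>)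
        (\<lambda>t. case ?\<xi> t of (x, f, y, e, u) => ((partial_x t, f, - y), (dfun line (\<lambda>_. 0) x, e, u)))"
      by (rule weakly_in_if_pointwise[OF _ negligible_empty])
        (use dirac_flat rel[OF T] in \<open>auto simp: dirac_structure_def\<close>)
    have wR: "weakly_in line (with_dual (triv 0)) alt_form zero_port 0 1 (fst \<circ> ?\<xi>) (\<lambda>t. case ?\<xi> t of (x, f, y, e, u) => (f, e))"
      by (rule weakly_in_if_pointwise[OF _ negligible_empty])
        (use lagrangian_zero R in \<open>auto simp: lagrangian_subbundle_def\<close>)
    have L': "?\<xi> \<in> L1c line line_signals 0 1" using L unfolding prod.collapse .
    have ext: "?\<xi> \<in> extensional ?I" by simp
    then show ?thesis unfolding Weak behaviour_def regime.case weak_behaviour_def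
      by (intro CollectI conjI exI[of _ partial_x] ext L' LX wd wD wR)
  qed
qed

lemma inverse_not_loc_integrable:
  assumes g: "loc_integrable {0..1} g" and N: "negligible N" and eq: "\<And>t. t \<in> {0<..1} ==> t \<notin> N ==> g t = 1 / t"
  shows False
proof -
  have "set_integrable lebesgue {0..1} g"
    by (rule loc_integrable_compact[OF openin_interval_lebesgue[of 0 1] g]) simp_all
  then have a: "(\<lambda>t. \<bar>g t\<bar>) integrable_on {0..1}" unfolding absolutely_integrable_on_def by simp
  let ?C = "integral {0..1} (\<lambda>t. \<bar>g t\<bar>)"
  \<comment> \<open>Chosen so that 1/t has integral \<open>\<bar>?C\<bar> + 1\<close> over
    \<open>{e..1}\<close>, more than the total mass of \<open>g\<close>.\<close>
  define e where "e = exp (- (\<bar>?C\<bar> + 1))"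
  have e: "0 < e" "e \<le> 1" by (simp_all add: e_def)
  have "((\<lambda>t. 1 / t) has_integral (ln 1 - ln e)) {e..1}"
  proof (rule fundamental_theorem_of_calculus[OF e(2)])
    fix t assume "t \<in> {e..1}"
    then have "t > 0" using e(1) by simp
    then show "(ln has_vector_derivative 1 / t) (at t within {e..1})"
      by (simp add: has_real_derivative_iff_has_vector_derivative[symmetric] has_field_derivative_at_within[OF DERIV_ln_divide])
  qed
  then have "((\<lambda>t. \<bar>g t\<bar>) has_integral (ln 1 - ln e)) {e..1}"
    by (rule has_integral_spike[OF N, rotated]) (use eq e(1) in auto)
  then have i: "(\<lambda>t. \<bar>g t\<bar>) integrable_on {e..1}" "integral {e..1} (\<lambda>t. \<bar>g t\<bar>) = \<bar>?C\<bar> + 1"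
    by (auto simp: integral_unique e_def)
  have "integral {e..1} (\<lambda>t. \<bar>g t\<bar>) \<le> ?C"
    by (rule integral_subset_le[OF _ i(1) a]) (use e in auto)
  then show False using i(2) by linarith
qed

text \<open>What both regimes have in common: integrable signals and the pointwise relation outside
  a null set, which is empty in the classical case. The contradiction is derived from this
  alone.\<close>

lemma twist_signals:
  assumes B: "(\<lambda>t\<in>{0..1}. (x t, f t, (y t, y' t), e t, (u t, u' t))) \<in> line_behaviour \<tau> twist"
  obtains X N where "curve_on {0..1} line x"
    "coords_in loc_integrable {0..1} line_signals x (\<lambda>t. (f t, (y t, y' t), e t, (u t, u' t)))" "negligible N"
    "\<And>t. t \<in> {0..1} ==> t \<notin> N ==> ((X t, f t, - y t, - y' t), (dfun line (\<lambda>_. 0) (x t), e t, u t, u' t)) \<in> twist (x t)"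
proof (cases \<tau>)
  case Classical
  note * = B[unfolded Classical behaviour_def regime.case classical_behaviour_iff[OF framed_line_signals]]
  note x = conjunct1[OF *] and c = conjunct1[OF conjunct2[OF *]]
  show ?thesis
    by (rule that[OF x coords_in_integrable[OF framed_line_signals x c] negligible_empty, of "velocity line 0 1 x"])
      (use conjunct2[OF conjunct2[OF conjunct2[OF *]]] in \<open>unfold uminus_Pair, blast\<close>)
next
  case Weak
  obtain X N where "weak_solution line (triv 0) (triv 1) (triv 2) twist zero_port (\<lambda>_. 0) 0 1 x f y y' e u u' X N"
    using weak_behaviour_pointwise[OF ph_system_line[OF dirac_twist] B[unfolded Weak behaviour_def regime.case], of x f y y' e u u']
    by auto
  note w = weak_solutionD[OF this]
  show ?thesis by (rule that[OF w(1,2,7)]) (use w(8) in blast)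
qed

text \<open>Both parts run along x(t) = t with the constant output \<open>unit_vec 0\<close>. The
  curve itself is smooth; only the port flow that the parts would need is singular, at t =
  0.\<close>

definition singular_curve where
  "singular_curve = (\<lambda>t\<in>{0..1::real}. ((t, t), (0 :: nat => real, 0 :: nat => real), (unit_vec 0, unit_vec 0),
     (0 :: (nat => real) => real, 0 :: (nat => real) => real), (0 :: (nat => real) => real, 0 :: (nat => real) => real)))"

abbreviation parts where
  "parts \<tau> D \<equiv> interconnected_behaviours \<tau> line (triv 0) (triv 1) (triv 2) D zero_port (\<lambda>_. 0)
     line (triv 0) (triv 1) (triv 2) D zero_port (\<lambda>_. 0) cut 0 1"

abbreviation composite where
  "composite \<tau> D \<equiv> behaviour_of_interconnection \<tau> line (triv 0) (triv 1) D zero_port (\<lambda>_. 0)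
     line (triv 0) (triv 1) D zero_port (\<lambda>_. 0) cut 0 1"

text \<open>Decomposed for \<open>flat\<close> with all signals at the shared port equal to 0, the
  curve enters the composite of \<open>flat\<close> by the inclusion, and this composite is that of
  \<open>twist\<close>.\<close>

lemma singular_curve_in_composite: "singular_curve \<in> composite \<tau> twist"
proof -
  have "(\<lambda>t\<in>{0..1}. case singular_curve t of ((x1, x2), (f1, f2), (y1, y2), (e1, e2), (u1, u2)) =>
      (x1, f1, (y1, - 0), e1, (u1, 0))) \<in> line_behaviour \<tau> flat"
    and "(\<lambda>t\<in>{0..1}. case singular_curve t of ((x1, x2), (f1, f2), (y1, y2), (e1, e2), (u1, u2)) =>
      (x2, f2, (y2, - 0), e2, (u2, 0))) \<in> line_behaviour \<tau> flat"
    using flat_curve[of \<tau>] by (simp_all add: singular_curve_def cong: restrict_cong)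
  then have "singular_curve \<in> parts \<tau> flat"
    unfolding interconnected_behaviours_def behaviour_interconnection_def
    by (intro CollectI conjI exI[of _ "\<lambda>_. 0"]) (auto simp: singular_curve_def zero_prod_def)
  then have "singular_curve \<in> composite \<tau> flat"
    using inclusion[OF ph_system_line[OF dirac_flat] ph_system_line[OF dirac_flat] dirac_cut, of 0 1 \<tau>] by auto
  then show ?thesis unfolding behaviour_of_interconnection_def twist_forgets flat_forgets .
qed

text \<open>Effort 0 at the shared port and external flow -1 leave \<open>twist\<close> no choice
  for the second component of the port flow: it is -1/t for almost every t > 0, whereas the signals
  of a part are locally integrable on the closed interval.\<close>

lemma singular_curve_not_in_parts: "singular_curve \<notin> parts \<tau> twist"
proof
  assume "singular_curve \<in> parts \<tau> twist"
  then have B: "singular_curve \<in> behaviour_interconnection cut (line_behaviour \<tau> twist) (line_behaviour \<tau> twist) 0 1"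
    by (simp add: interconnected_behaviours_def)
  obtain x1 x2 f1 f2 y1 y2 e1 e2 u1 u2 y1' y2' u1' u2' where
    xi: "singular_curve = (\<lambda>t\<in>{0..1}. ((x1 t, x2 t), (f1 t, f2 t), (y1 t, y2 t), (e1 t, e2 t), (u1 t, u2 t)))"
    and c: "\<And>t. t \<in> {0..1} ==> ((y1' t, y2' t), (u1' t, u2' t)) \<in> cut (x1 t, x2 t)"
    and B1: "(\<lambda>t\<in>{0..1}. (x1 t, f1 t, (y1 t, - y1' t), e1 t, (u1 t, u1' t))) \<in> line_behaviour \<tau> twist"
    by (rule interconnectedE[OF B]) (rule that)
  have sel: "x1 t = t" "y1 t = unit_vec 0" if "t \<in> {0..1}" for t
    using fun_cong[OF xi, of t] that by (simp_all add: singular_curve_def)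
  have cut: "\<forall>i\<ge>2. y1' t i = 0" "u1' t = 0" if "t \<in> {0..1}" for t
    using c[OF that] by (simp_all add: zero_prod_def)
  obtain X N where x: "curve_on {0..1} line x1"
    and s: "coords_in loc_integrable {0..1} line_signals x1 (\<lambda>t. (f1 t, (y1 t, - y1' t), e1 t, (u1 t, u1' t)))"
    and N: "negligible N"
    and r: "\<And>t. t \<in> {0..1} ==> t \<notin> N ==>
      ((X t, f1 t, - y1 t, - (- y1' t)), (dfun line (\<lambda>_. 0) (x1 t), e1 t, u1 t, u1' t)) \<in> twist (x1 t)"
    by (rule twist_signals[OF B1]) (rule that)
  note F = conjunct1[OF iffD1[OF parallel_def parallel_triv]]
  note D = loc_integrable_class.coords_in_dsum[OF _ _ x]
  have "coords_in loc_integrable {0..1} (triv 1 \<oplus>\<^sub>b triv 2) x1 (\<lambda>t. (y1 t, - y1' t))"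
    using s unfolding dsum_pair_sel with_dual_sel by (simp add: D F framed_dsum framed_dual)
  then have "coords_in loc_integrable {0..1} (triv 2) x1 (\<lambda>t. - y1' t)" by (simp add: D F)
  \<comment> \<open>Index 1 is the component of the port flow that carries
    \<open>a 3\<close>.\<close>
  from coords_inD(2)[OF this, of UNIV "\<lambda>i _. unit_vec i" 1]
  have "loc_integrable {t \<in> {0..1}. x1 t \<in> UNIV} (\<lambda>t. coords 2 unit_vec (- y1' t) 1)" by simp
  moreover have "{t \<in> {0..1}. x1 t \<in> UNIV} = {0..1}" by auto
  ultimately have "loc_integrable {0..1} (\<lambda>t. coords 2 unit_vec (- y1' t) 1)" by metis
  then have "loc_integrable {0..1} (\<lambda>t. - y1' t 1)"
    by (rule loc_integrable_class.cong[rotated]) (use cut(1) in \<open>simp add: coords_triv\<close>)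
  then show False
  proof (rule inverse_not_loc_integrable[OF _ N])
    fix t :: real assume t: "t \<in> {0<..1}" "t \<notin> N"
    then have I: "t \<in> {0..1}" by simp
    obtain a where "((X t, f1 t, - y1 t, - (- y1' t)), (dfun line (\<lambda>_. 0) (x1 t), e1 t, u1 t, u1' t)) = twist_vec t a"
      using r[OF I t(2)] unfolding twist_def sel(1)[OF I] by blast
    note P = this[unfolded twist_vec_def prod.inject sel(2)[OF I] cut(2)[OF I]]
    have a: "- unit_vec 0 = a 1 *\<^sub>R unit_vec 0" "- (- y1' t) = a 2 *\<^sub>R unit_vec 0 + a 3 *\<^sub>R unit_vec 1"
      "0 = (a 3 * t\<^sup>2 - a 1 * t) *\<^sub>R covec 2 0 + (- (a 2 * t\<^sup>2)) *\<^sub>R covec 2 1"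
      using P by blast+
    have 1: "a 1 = -1" using fun_cong[OF a(1), of 0] by (simp add: scaleR_fun_def unit_vec_def)
    have 3: "y1' t 1 = a 3" using fun_cong[OF a(2), of 1] by (simp add: scaleR_fun_def unit_vec_def)
    have "covec 2 0 (unit_vec 0) = 1" "covec 2 1 (unit_vec 0) = 0" by (simp_all add: covec_apply unit_vec_def)
    \<comment> \<open>The first component of the port effort, which vanishes by the constraint;
      evaluating at \<open>unit_vec 0\<close> isolates it.\<close>
    then have "a 3 * t\<^sup>2 - a 1 * t = 0" using fun_cong[OF a(3), of "unit_vec 0"] by (simp add: scaleR_fun_def)
    then have "(a 3 * t + 1) * t = 0" unfolding 1 by (simp add: power2_eq_square algebra_simps)
    then have "a 3 * t + 1 = 0" using t(1) by simp
    then have "- a 3 * t = 1" by simp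
    then show "- y1' t 1 = 1 / t" using t(1) unfolding 3 by (simp add: eq_divide_eq)
  qed
qed

theorem proposition4p7:
  "(\<forall>(M1 :: 'm1 manifold) (Er1 :: ('m1, 'r1::real_vector) vbundle)
     (Epi1 :: ('m1, 'i1::real_vector) vbundle) (Epe1 :: ('m1, 'e1::real_vector) vbundle) D1 R1 H1
     (M2 :: 'm2 manifold) (Er2 :: ('m2, 'r2::real_vector) vbundle)
     (Epi2 :: ('m2, 'i2::real_vector) vbundle) (Epe2 :: ('m2, 'e2::real_vector) vbundle) D2 R2 H2
     Dint \<tau> t0 t1.
      ph_system M1 Er1 Epi1 Epe1 D1 R1 H1 \<and>
      ph_system M2 Er2 Epi2 Epe2 D2 R2 H2 \<and>
      dirac_structure (prod_manifold M1 M2) (with_dual Epe1 \<times>\<^sub>d with_dual Epe2) Dint \<and>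
      admissible M1 Er1 Epi1 M2 Er2 Epi2 D1 D2 Dint \<and>
      t0 < t1 \<longrightarrow>
      interconnected_behaviours \<tau> M1 Er1 Epi1 Epe1 D1 R1 H1 M2 Er2 Epi2 Epe2 D2 R2 H2 Dint t0 t1
        \<subseteq> behaviour_of_interconnection \<tau> M1 Er1 Epi1 D1 R1 H1 M2 Er2 Epi2 D2 R2 H2 Dint t0 t1) \<and>
   (\<forall>\<tau>. \<exists>(M1 :: real manifold) (Er1 :: (real, nat \<Rightarrow> real) vbundle)
     (Epi1 :: (real, nat \<Rightarrow> real) vbundle) (Epe1 :: (real, nat \<Rightarrow> real) vbundle) D1 R1 H1
     (M2 :: real manifold) (Er2 :: (real, nat \<Rightarrow> real) vbundle)
     (Epi2 :: (real, nat \<Rightarrow> real) vbundle) (Epe2 :: (real, nat \<Rightarrow> real) vbundle) D2 R2 H2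
     Dint t0 t1.
      ph_system M1 Er1 Epi1 Epe1 D1 R1 H1 \<and>
      ph_system M2 Er2 Epi2 Epe2 D2 R2 H2 \<and>
      dirac_structure (prod_manifold M1 M2) (with_dual Epe1 \<times>\<^sub>d with_dual Epe2) Dint \<and>
      admissible M1 Er1 Epi1 M2 Er2 Epi2 D1 D2 Dint \<and>
      t0 < t1 \<and>
      interconnected_behaviours \<tau> M1 Er1 Epi1 Epe1 D1 R1 H1 M2 Er2 Epi2 Epe2 D2 R2 H2 Dint t0 t1
        \<subset> behaviour_of_interconnection \<tau> M1 Er1 Epi1 D1 R1 H1 M2 Er2 Epi2 D2 R2 H2 Dint t0 t1)"
proof (rule conjI, goal_cases)
  case 1
  show ?case by (intro allI impI, elim conjE) (rule inclusion)
next
  case 2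
  note S = ph_system_line[OF dirac_twist]
  have "parts \<tau> twist \<subset> composite \<tau> twist" for \<tau>
    using inclusion[OF S S dirac_cut zero_less_one] singular_curve_in_composite singular_curve_not_in_parts by blast
  then show ?case
    using S dirac_cut admissible_twist zero_less_one by (intro allI exI conjI) assumption+
qed

end
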